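(* Assume that $\int_{\mathbb R}\sigma^2\,\nu(d\sigma)<\infty$ and that the function $t\mapsto\|S(t)Q^{1/2}\|_{(HS)}$ belongs to $L^2([0,T],dt)$. Let $\varphi\in C^2_b(H)$ be such that for each $x\in H$ the derivative $D^2\varphi(x)$ is an element of $L_{(HS)}(H)$ and the mapping $H\ni x\mapsto D^2\varphi(x)\in L_{(HS)}(H)$ is uniformly continuous on any bounded subset of $H$. Let $T\ge 1$ and let $(X_t)_{t\in[0,T]}$ be the $H$-valued (mild, equivalently weak) solution of $$dX_t+AX_t\,dt=Q^{1/2}\,dZ_t,\qquad X_0=x_0\in H,\quad t\in[0,T].$$ For any $N\ge1$ and $h>0$ let $(X_h^n)_{n\in\{0,\dots,N\}}$ be the space-time discretization and $(X_{h,t})_{t\in[0,T]}$ the space discretization of $X$ defined in the context. Then, with $v_h,v,Y_h,\bar Y_h,E,F,G$ as defined in the context, the following error expansions hold: $$\begin{aligned} \mathbb E\varphi(X_h^N)-\mathbb E\varphi(X_{h,T}) &=\Big\{v_h(T,S_{h,\Delta t}^NP_hx_0)-v_h(T,S_h(T)P_hx_0)\Big\}\\ &\quad+\mathbb E\int_0^T\int_{\mathcal O\times\mathbb R}\Big\{v_h\big(T-t,\bar Y_{h,t-}+G(t,\xi,\sigma)\big)-v_h\big(T-t,\bar Y_{h,t-}+F(t,\xi,\sigma)\big)\\ &\qquad\qquad+\big\langle D_xv_h(T-t,\bar Y_{h,t-}),\,F(t,\xi,\sigma)-G(t,\xi,\sigma)\big\rangle_H\Big\}\,dt\,d\xi\,\nu(d\sigma),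 \end{aligned}$$ $$\begin{aligned} \mathbb E\varphi(X_{h,T})-\mathbb E\varphi(X_T) &=\Big\{v(T,S_h(T)P_hx_0)-v(T,S(T)x_0)\Big\}\\ &\quad+\mathbb E\int_0^T\int_{\mathcal O\times\mathbb R}\Big\{v\big(T-t,Y_{h,t-}+F(t,\xi,\sigma)\big)-v\big(T-t,Y_{h,t-}+E(t,\xi,\sigma)\big)\\ &\qquad\qquad+\big\langle D_xv(T-t,Y_{h,t-}),\,E(t,\xi,\sigma)-F(t,\xi,\sigma)\big\rangle_H\Big\}\,dt\,d\xi\,\nu(d\sigma). \end{aligned}$$
   Context: **Spaces and operators.** $\mathcal O\subset\mathbb R^d$ is open and bounded, $H=L^2(\mathcal O)$ with inner product $\langle\cdot,\cdot\rangle_H$ and norm $|\cdot|_H$, $T\in(0,\infty)$. $Q:H\to H$ is a bounded nonnegative definite symmetric operator. $A:D(A)\subset H\to H$ is a (possibly unbounded) strictly positive definite self-adjoint operator whose domain, with the graph norm, is compactly embedded in $H$. $(S(t))_{t\ge0}$ is the $C_0$-semigroup on $H$ generated by $-A$. $L_{(HS)}(H)$ is the space of Hilbert-Schmidt operators on $H$ with norm $\|\cdot\|_{(HS)}$. $C^k_b(H)$ is the space of $k$-times continuously Fréchet-differentiable functions $H\to\mathbb R$ that are bounded together with their derivatives; $D\varphi(x)$ is identified with an element of $H$ (gradient) and $D^2\varphi(x)$ with an element of $L(H)$. **Noise.** $\nu$ is a sigma-finite Lévy measure on $\mathbb R$ (so $\nu(\{0\})=0$), called the jump size intensity. $\pi$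 is a Poisson random measure on $[0,T]\times\mathcal O\times\mathbb R$ with reference (intensity) measure $dt\,d\xi\,\nu(d\sigma)$, defined on a complete filtered probability space $(\Omega,\mathcal A,\mathbb P,(\mathcal F_t)_{t\in[0,T]})$ satisfying the usual hypotheses, such that $\pi([0,t]\times B)$ is $\mathcal F_t$-measurable and $\pi((s,t]\times B)$ is independent of $\mathcal F_s$ for $0\le s<t\le T$ and $B\in\mathcal B(\mathcal O\times\mathbb R)$, and $\pi=\sum_{j\ge1}\delta_{(T_j,\Xi_j,\Sigma_j)}$ for a suitable sequence of random elements of $[0,T]\times\mathcal O\times\mathbb R$. $\hat\pi=\pi-dt\,d\xi\,\nu(d\sigma)$ is the compensated measure; the $\hat\pi$-integral of deterministic $L^2$ integrands is the usual $L^2$-isometric integral. For an orthonormal basis $(e_k)_{k\in\mathbb N}$ of $H$ put $Z^{(k)}_t=\int_0^t\int_{\mathcal O\times\mathbb R}e_k(\xi)\,\sigma\,\hat\pi(ds,d\xi,d\sigma)$. The impulsive cylindrical process on $L^2(\mathcal O)$ with jump size intensity $\nu$ is $Z_t=\sum_kZ^{(k)}_te_k$ (limit in $L^2(\Omega;U)$, where $U\supset H$ is a Hilbert space in which $H$ is densely embedded with Hilbert-Schmidt embedding). For deterministic $\Psi\in L^2([0,T];L_{(HS)}(H))$, $$\int_0^t\Psi(s)\,dZ_s=L^2(\Omega;H)\text{-}\lim_{n\to\infty}\sum_{k=1}^n\int_0^t\Psi(s)e_k\,dZ_s^{(k)}=\int_0^t\int_{\mathcal O\times\mathbb R}\Big(\sum_{k}e_k(\xi)\sigma\Psi(s)e_k\Big)\hat\pi(ds,d\xi,d\sigma).$$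 The mild solution of the equation is $X_t=S(t)x_0+\int_0^tS(t-s)Q^{1/2}\,dZ_s$. **Discretization.** $(V_h)_{h>0}$ is a family of finite dimensional subspaces of $D(A^{1/2})$ (finite element spaces); $P_h:H\to V_h$ is the $\langle\cdot,\cdot\rangle_H$-orthogonal projector; $A_h:V_h\to V_h$ is the positive symmetric operator defined by $\langle A_hu_h,w_h\rangle_H=\langle A^{1/2}u_h,A^{1/2}w_h\rangle_H$ for $u_h,w_h\in V_h$; $(S_h(t))_{t\ge0}$ is the semigroup on $V_h$ generated by $-A_h$. Fix $\theta\in(1/2,1]$. For $N\ge1$ put $\Delta t=T/N$, $t_n=n\Delta t$, $$S_{h,\Delta t}=(I+\theta\Delta tA_h)^{-1}(I-(1-\theta)\Delta tA_h),\qquad T_{h,\Delta t}=(I+\theta\Delta tA_h)^{-1}.$$ The space-time discretization is $$X_h^n=S_{h,\Delta t}^nP_hx_0+\sum_{k=0}^{n-1}S_{h,\Delta t}^{n-k-1}T_{h,\Delta t}P_hQ^{1/2}(Z_{t_{k+1}}-Z_{t_k}),\qquad n\in\{0,\dots,N\},$$ where $P_hQ^{1/2}(Z_{t_{k+1}}-Z_{t_k})=L^2(\Omega;H)\text{-}\lim_{M\to\infty}\sum_{j=1}^M(Z^{(j)}_{t_{k+1}}-Z^{(j)}_{t_k})P_hQ^{1/2}e_j$. The space discretization is $$X_{h,t}=S_h(t)P_hx_0+\int_0^tS_h(t-s)P_hQ^{1/2}\,dZ_s,\qquad t\in[0,T].$$ **Auxiliary objects.** Let $\Phi(s)=S_h(T-s)P_hQ^{1/2}$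 and $\Gamma(s)=\sum_{k=0}^{N-1}S_{h,\Delta t}^{N-k-1}T_{h,\Delta t}\mathbf 1_{(t_k,t_{k+1}]}(s)P_hQ^{1/2}$. Define the (càdlàg) processes $$Y_{h,t}=S_h(T)P_hx_0+\int_0^t\Phi(s)\,dZ_s,\qquad \bar Y_{h,t}=S_{h,\Delta t}^NP_hx_0+\int_0^t\Gamma(s)\,dZ_s,$$ with left limits $Y_{h,t-}$, $\bar Y_{h,t-}$; the $H$-valued mappings on $[0,T]\times\mathcal O\times\mathbb R$ $$E(s,\xi,\sigma)=\sum_{k}e_k(\xi)\sigma S(T-s)Q^{1/2}e_k,\quad F(s,\xi,\sigma)=\sum_ke_k(\xi)\sigma\Phi(s)e_k,\quad G(s,\xi,\sigma)=\sum_ke_k(\xi)\sigma\Gamma(s)e_k,$$ where the sums are limits in $L^2([0,T]\times\mathcal O\times\mathbb R,ds\,d\xi\,\nu(d\sigma);H)$; and the functions on $[0,T]\times H$ $$v_h(t,x)=\mathbb E\varphi\Big(x+\int_{T-t}^TS_h(T-r)P_hQ^{1/2}\,dZ_r\Big),\qquad v(t,x)=\mathbb E\varphi\Big(x+\int_{T-t}^TS(T-r)Q^{1/2}\,dZ_r\Big).$$ $D_x$ denotes the Fréchet derivative (gradient) in $x\in H$. *)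

theory Defs
  imports "HOL-Probability.Probability"
begin

section \<open>The Hilbert space $L^2(\mathcal O)$ and its operators\<close>

text \<open>
  The Hilbert space \<open>L\<^sup>2(\<O>)\<close> depends on the set \<open>\<O>\<close>, so it cannot be a type of its own. It is
  rendered as a Hilbert space type \<open>'h\<close> together with a map \<open>rep\<close> that picks, for every element of
  \<open>'h\<close>, a representative function on \<open>\<O>\<close>, and that identifies \<open>'h\<close> isometrically with the whole
  space of square integrable functions on \<open>\<O>\<close> modulo equality almost everywhere.
  The class constraints \<open>banach\<close> and \<open>second_countable_topology\<close> hold in every such space.
\<close>

definition is_L2 :: "'d::euclidean_space set \<Rightarrow> ('h::real_inner \<Rightarrow> 'd \<Rightarrow> real) \<Rightarrow> bool" where
  "is_L2 \<O> rep \<longleftrightarrow>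
     (let lam = restrict_space lborel \<O> in
       (\<forall>x. rep x \<in> borel_measurable lam \<and> integrable lam (\<lambda>\<xi>. (rep x \<xi>)\<^sup>2)) \<and>
       (\<forall>x y. AE \<xi> in lam. rep (x + y) \<xi> = rep x \<xi> + rep y \<xi>) \<and>
       (\<forall>c x. AE \<xi> in lam. rep (c *\<^sub>R x) \<xi> = c * rep x \<xi>) \<and>
       (\<forall>x y. inner x y = (LINT \<xi>|lam. rep x \<xi> * rep y \<xi>)) \<and>
       (\<forall>f. f \<in> borel_measurable lam \<and> integrable lam (\<lambda>\<xi>. (f \<xi>)\<^sup>2) \<longrightarrow>
            (\<exists>x. AE \<xi> in lam. rep x \<xi> = f \<xi>)))"

definition orthonormal_basis :: "(nat \<Rightarrow> 'h::real_inner) \<Rightarrow> bool" where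
  "orthonormal_basis e \<longleftrightarrow>
     (\<forall>i j. inner (e i) (e j) = (if i = j then 1 else 0)) \<and> closure (span (range e)) = UNIV"

text \<open>Neither notion below depends on the orthonormal basis \<open>e\<close>.\<close>

definition hilbert_schmidt :: "(nat \<Rightarrow> 'h::real_inner) \<Rightarrow> ('h \<Rightarrow> 'h) \<Rightarrow> bool" where
  "hilbert_schmidt e K \<longleftrightarrow> bounded_linear K \<and> summable (\<lambda>k. (norm (K (e k)))\<^sup>2)"

definition hs_norm :: "(nat \<Rightarrow> 'h::real_inner) \<Rightarrow> ('h \<Rightarrow> 'h) \<Rightarrow> real" where
  "hs_norm e K = sqrt (\<Sum>k. (norm (K (e k)))\<^sup>2)"

definition nonneg_symmetric :: "('h::real_inner \<Rightarrow> 'h) \<Rightarrow> bool" where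
  "nonneg_symmetric Q \<longleftrightarrow> bounded_linear Q \<and>
     (\<forall>x y. inner (Q x) y = inner x (Q y)) \<and> (\<forall>x. 0 \<le> inner (Q x) x)"

text \<open>An unbounded operator is a pair of a domain \<open>D\<close> and a function whose values outside \<open>D\<close> are
  irrelevant. The last conjunct says that the graph of the operator is the graph of its adjoint.\<close>

definition self_adjoint :: "'h::real_inner set \<Rightarrow> ('h \<Rightarrow> 'h) \<Rightarrow> bool" where
  "self_adjoint D A \<longleftrightarrow> subspace D \<and> closure D = UNIV \<and>
     (\<forall>x\<in>D. \<forall>y\<in>D. A (x + y) = A x + A y) \<and> (\<forall>c. \<forall>x\<in>D. A (c *\<^sub>R x) = c *\<^sub>R A x) \<and>
     (\<forall>y z. (\<forall>x\<in>D. inner (A x) y = inner x z) \<longleftrightarrow> y \<in> D \<and> z = A y)"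

definition strictly_positive :: "'h::real_inner set \<Rightarrow> ('h \<Rightarrow> 'h) \<Rightarrow> bool" where
  "strictly_positive D A \<longleftrightarrow> (\<forall>x\<in>D. x \<noteq> 0 \<longrightarrow> 0 < inner (A x) x)"

text \<open>Sets bounded in the graph norm are relatively compact.\<close>

definition compactly_embedded_domain :: "'h::real_inner set \<Rightarrow> ('h \<Rightarrow> 'h) \<Rightarrow> bool" where
  "compactly_embedded_domain D A \<longleftrightarrow>
     (\<forall>B\<subseteq>D. bounded B \<and> bounded (A ` B) \<longrightarrow> compact (closure B))"

text \<open>\<open>(D', R)\<close> is the nonnegative self-adjoint square root of \<open>(D, A)\<close>.\<close>

definition is_sqrt_operator ::
  "'h::real_inner set \<Rightarrow> ('h \<Rightarrow> 'h) \<Rightarrow> 'h set \<Rightarrow> ('h \<Rightarrow> 'h) \<Rightarrow> bool" where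
  "is_sqrt_operator D A D' R \<longleftrightarrow> self_adjoint D' R \<and> (\<forall>x\<in>D'. 0 \<le> inner (R x) x) \<and>
     D = {x \<in> D'. R x \<in> D'} \<and> (\<forall>x\<in>D. R (R x) = A x)"

text \<open>\<open>S\<close> is a strongly continuous semigroup of bounded operators on the closed subspace \<open>V\<close>, and
  its infinitesimal generator is the operator \<open>B\<close> with domain \<open>D \<subseteq> V\<close>.\<close>

definition C0_semigroup_on :: "'h::real_normed_vector set \<Rightarrow> (real \<Rightarrow> 'h \<Rightarrow> 'h) \<Rightarrow> bool" where
  "C0_semigroup_on V S \<longleftrightarrow>
     (\<forall>t\<ge>0. S t ` V \<subseteq> V \<and>
        (\<forall>x\<in>V. \<forall>y\<in>V. S t (x + y) = S t x + S t y) \<and> (\<forall>c. \<forall>x\<in>V. S t (c *\<^sub>R x) = c *\<^sub>R S t x) \<and>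
        (\<exists>C. \<forall>x\<in>V. norm (S t x) \<le> C * norm x)) \<and>
     (\<forall>x\<in>V. S 0 x = x) \<and>
     (\<forall>s\<ge>0. \<forall>t\<ge>0. \<forall>x\<in>V. S (s + t) x = S s (S t x)) \<and>
     (\<forall>x\<in>V. ((\<lambda>t. S t x) \<longlongrightarrow> x) (at_right 0))"

definition generates_on ::
  "'h::real_normed_vector set \<Rightarrow> 'h set \<Rightarrow> ('h \<Rightarrow> 'h) \<Rightarrow> (real \<Rightarrow> 'h \<Rightarrow> 'h) \<Rightarrow> bool" where
  "generates_on V D B S \<longleftrightarrow> C0_semigroup_on V S \<and> D \<subseteq> V \<and>
     (\<forall>x\<in>V. \<forall>y. ((\<lambda>t. (S t x - x) /\<^sub>R t) \<longlongrightarrow> y) (at_right 0) \<longleftrightarrow> x \<in> D \<and> y = B x)"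

section \<open>Functions of class $C^2_b$\<close>

definition grad :: "('h::real_inner \<Rightarrow> real) \<Rightarrow> 'h \<Rightarrow> 'h" where
  "grad f x = (THE g. GDERIV f x :> g)"

definition hess :: "('h::real_inner \<Rightarrow> real) \<Rightarrow> 'h \<Rightarrow> 'h \<Rightarrow> 'h" where
  "hess f x = frechet_derivative (grad f) (at x)"

definition C2_b :: "('h::real_inner \<Rightarrow> real) \<Rightarrow> bool" where
  "C2_b f \<longleftrightarrow>
     (\<forall>x. GDERIV f x :> grad f x) \<and> (\<forall>x. grad f differentiable (at x)) \<and>
     continuous_on UNIV (\<lambda>x. Blinfun (hess f x)) \<and>
     bounded (range f) \<and> bounded (range (grad f)) \<and> bounded (range (\<lambda>x. Blinfun (hess f x)))"

section \<open>Limits in $L^2$\<close>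

definition L2_tendsto ::
  "'a measure \<Rightarrow> (nat \<Rightarrow> 'a \<Rightarrow> 'b::{banach,second_countable_topology}) \<Rightarrow> ('a \<Rightarrow> 'b) \<Rightarrow> bool" where
  "L2_tendsto M Xn X \<longleftrightarrow>
     (\<forall>n. Xn n \<in> borel_measurable M) \<and> X \<in> borel_measurable M \<and>
     (\<lambda>n. \<integral>\<^sup>+\<omega>. ennreal ((norm (Xn n \<omega> - X \<omega>))\<^sup>2) \<partial>M) \<longlonglongrightarrow> 0"

text \<open>A representative of the limit; it is determined up to a null set.\<close>

definition L2_lim ::
  "'a measure \<Rightarrow> (nat \<Rightarrow> 'a \<Rightarrow> 'b::{banach,second_countable_topology}) \<Rightarrow> 'a \<Rightarrow> 'b" where
  "L2_lim M Xn = (SOME X. L2_tendsto M Xn X)"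

section \<open>The Poisson random measure and the impulsive cylindrical process\<close>

definition levy_measure :: "real measure \<Rightarrow> bool" where
  "levy_measure \<nu> \<longleftrightarrow> sets \<nu> = sets borel \<and> emeasure \<nu> {0} = 0 \<and>
     (\<integral>\<^sup>+\<sigma>. ennreal (min 1 (\<sigma>\<^sup>2)) \<partial>\<nu>) < \<infinity>"

definition usual_filtration :: "'w measure \<Rightarrow> real \<Rightarrow> (real \<Rightarrow> 'w measure) \<Rightarrow> bool" where
  "usual_filtration M T F \<longleftrightarrow>
     prob_space M \<and> complete_measure M \<and>
     (\<forall>t\<in>{0..T}. subalgebra M (F t)) \<and>
     (\<forall>s t. 0 \<le> s \<and> s \<le> t \<and> t \<le> T \<longrightarrow> sets (F s) \<subseteq> sets (F t)) \<and>
     null_sets M \<subseteq> sets (F 0) \<and>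
     (\<forall>t\<in>{0..<T}. sets (F t) = (\<Inter>s\<in>{t<..T}. sets (F s)))"

definition intensity :: "real \<Rightarrow> 'd::euclidean_space set \<Rightarrow> real measure \<Rightarrow> (real \<times> 'd \<times> real) measure" where
  "intensity T \<O> \<nu> = restrict_space lborel {0..T} \<Otimes>\<^sub>M (restrict_space lborel \<O> \<Otimes>\<^sub>M \<nu>)"

definition poisson_random_measure ::
  "'w measure \<Rightarrow> 'z measure \<Rightarrow> ('w \<Rightarrow> 'z measure) \<Rightarrow> bool" where
  "poisson_random_measure M \<mu> \<pi> \<longleftrightarrow>
     (\<forall>\<omega>\<in>space M. space (\<pi> \<omega>) = space \<mu> \<and> sets (\<pi> \<omega>) = sets \<mu>) \<and>
     (\<forall>B\<in>sets \<mu>. (\<lambda>\<omega>. emeasure (\<pi> \<omega>) B) \<in> borel_measurable M) \<and>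
     (\<forall>B\<in>sets \<mu>. emeasure \<mu> B < \<infinity> \<longrightarrow>
        (\<forall>n::nat. measure M {\<omega>\<in>space M. emeasure (\<pi> \<omega>) B = of_nat n}
           = measure \<mu> B ^ n / fact n * exp (- measure \<mu> B))) \<and>
     (\<forall>B\<in>sets \<mu>. emeasure \<mu> B = \<infinity> \<longrightarrow> (AE \<omega> in M. emeasure (\<pi> \<omega>) B = \<infinity>)) \<and>
     (\<forall>B :: nat \<Rightarrow> 'z set. range B \<subseteq> sets \<mu> \<and> disjoint_family B \<longrightarrow>
        prob_space.indep_vars M (\<lambda>_. borel) (\<lambda>i \<omega>. emeasure (\<pi> \<omega>) (B i)) UNIV)"

text \<open>The number of points \<open>\<kappa> \<omega>\<close> may be finite: this is the case almost surely whenever \<open>\<mu>\<close> is a finite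
  measure.\<close>

definition sum_of_point_masses ::
  "'w measure \<Rightarrow> 'z measure \<Rightarrow> ('w \<Rightarrow> 'z measure) \<Rightarrow> bool" where
  "sum_of_point_masses M \<mu> \<pi> \<longleftrightarrow>
     (\<exists>p :: nat \<Rightarrow> 'w \<Rightarrow> 'z. \<exists>\<kappa> :: 'w \<Rightarrow> enat.
        (\<forall>j. p j \<in> measurable M \<mu>) \<and> \<kappa> \<in> measurable M (count_space UNIV) \<and>
        (AE \<omega> in M. \<forall>B\<in>sets \<mu>.
           emeasure (\<pi> \<omega>) B = (\<Sum>j. if enat j < \<kappa> \<omega> then indicator B (p j \<omega>) else 0)))"

definition adapted_independent_increments ::
  "'w measure \<Rightarrow> real \<Rightarrow> (real \<Rightarrow> 'w measure) \<Rightarrow> 'y measure \<Rightarrow> ('w \<Rightarrow> (real \<times> 'y) measure) \<Rightarrow> bool" where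
  "adapted_independent_increments M T F mark \<pi> \<longleftrightarrow>
     (\<forall>B\<in>sets mark. \<forall>t\<in>{0..T}. (\<lambda>\<omega>. emeasure (\<pi> \<omega>) ({0..t} \<times> B)) \<in> borel_measurable (F t)) \<and>
     (\<forall>B\<in>sets mark. \<forall>s t. 0 \<le> s \<and> s < t \<and> t \<le> T \<longrightarrow>
        prob_space.indep_set M (sets (F s))
          (sets (vimage_algebra (space M) (\<lambda>\<omega>. emeasure (\<pi> \<omega>) ({s<..t} \<times> B)) borel)))"

text \<open>Integral of a deterministic square integrable function against \<open>\<pi> - \<mu>\<close>: for a simple function
  supported by a set of finite intensity it is the obvious finite sum, and it is extended as an
  isometry from \<open>L\<^sup>2(\<mu>)\<close> to \<open>L\<^sup>2(M)\<close>, hence determined up to a null set.\<close>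

definition comp_integral ::
  "'w measure \<Rightarrow> 'z measure \<Rightarrow> ('w \<Rightarrow> 'z measure) \<Rightarrow>
     ('z \<Rightarrow> 'b::{banach,second_countable_topology}) \<Rightarrow> 'w \<Rightarrow> 'b" where
  "comp_integral M \<mu> \<pi> f = (SOME X. \<exists>g. (\<forall>n. Bochner_Integration.simple_bochner_integrable \<mu> (g n)) \<and>
      L2_tendsto \<mu> g f \<and>
      L2_tendsto M (\<lambda>n \<omega>. Bochner_Integration.simple_bochner_integral (\<pi> \<omega>) (g n) - Bochner_Integration.simple_bochner_integral \<mu> (g n)) X)"

definition coord_process ::
  "'w measure \<Rightarrow> (real \<times> 'd \<times> real) measure \<Rightarrow> ('w \<Rightarrow> (real \<times> 'd \<times> real) measure) \<Rightarrow>
     ('h \<Rightarrow> 'd \<Rightarrow> real) \<Rightarrow> (nat \<Rightarrow> 'h) \<Rightarrow> nat \<Rightarrow> real \<Rightarrow> 'w \<Rightarrow> real" where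
  "coord_process M \<mu> \<pi> rep e k t =
     comp_integral M \<mu> \<pi> (\<lambda>(s, \<xi>, \<sigma>). indicator {0..t} s * (rep (e k) \<xi> * \<sigma>))"

section \<open>Stochastic integrals of deterministic integrands\<close>

text \<open>A list of triples \<open>(c, d, x)\<close> encodes the step function \<open>\<Sum> 1\<^bsub>(c,d]\<^esub> x\<close>.\<close>

definition step_fun :: "(real \<times> real \<times> 'h::real_vector) list \<Rightarrow> real \<Rightarrow> 'h" where
  "step_fun xs s = (\<Sum>(c, d, x)\<leftarrow>xs. indicator {c<..d} s *\<^sub>R x)"

definition step_integral ::
  "(real \<Rightarrow> 'w \<Rightarrow> real) \<Rightarrow> (real \<times> real \<times> 'h::real_vector) list \<Rightarrow> 'w \<Rightarrow> 'h" where
  "step_integral Z xs \<omega> = (\<Sum>(c, d, x)\<leftarrow>xs. (Z d \<omega> - Z c \<omega>) *\<^sub>R x)"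

text \<open>The integral \<open>\<integral>\<^bsub>(a,b]\<^esub> f(s) dZ\<^sub>s\<close> for a real process \<open>Z\<close>, as the \<open>L\<^sup>2\<close>-limit of integrals of step functions.\<close>

definition process_integral ::
  "'w measure \<Rightarrow> (real \<Rightarrow> 'w \<Rightarrow> real) \<Rightarrow> real \<Rightarrow> real \<Rightarrow>
     (real \<Rightarrow> 'h::{banach,second_countable_topology}) \<Rightarrow> 'w \<Rightarrow> 'h" where
  "process_integral M Z a b f = (SOME X. \<exists>xs.
      (\<forall>n. \<forall>(c, d, x)\<in>set (xs n). a \<le> c \<and> c \<le> d \<and> d \<le> b) \<and>
      L2_tendsto (restrict_space lborel {a..b}) (\<lambda>n. step_fun (xs n)) f \<and>
      L2_tendsto M (\<lambda>n. step_integral Z (xs n)) X)"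

text \<open>The integral \<open>\<integral>\<^bsub>(a,b]\<^esub> \<Psi>(s) dZ\<^sub>s\<close> of an operator valued \<open>\<Psi>\<close>; here \<open>Z k\<close> is the \<open>k\<close>-th coordinate of
  the cylindrical process with respect to \<open>e\<close>.\<close>

definition stoch_integral ::
  "'w measure \<Rightarrow> (nat \<Rightarrow> real \<Rightarrow> 'w \<Rightarrow> real) \<Rightarrow> (nat \<Rightarrow> 'h) \<Rightarrow> real \<Rightarrow> real \<Rightarrow>
     (real \<Rightarrow> 'h \<Rightarrow> 'h::{banach,second_countable_topology}) \<Rightarrow> 'w \<Rightarrow> 'h" where
  "stoch_integral M Z e a b \<Psi> =
     L2_lim M (\<lambda>n \<omega>. \<Sum>k<n. process_integral M (Z k) a b (\<lambda>s. \<Psi> s (e k)) \<omega>)"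

text \<open>For \<open>\<Psi>\<close> square integrable, the jump of \<open>\<integral>\<Psi>(s)dZ\<^sub>s\<close> caused by an atom \<open>(s, \<xi>, \<sigma>)\<close>.\<close>

definition jump_kernel ::
  "(real \<times> 'd \<times> real) measure \<Rightarrow> ('h \<Rightarrow> 'd \<Rightarrow> real) \<Rightarrow> (nat \<Rightarrow> 'h) \<Rightarrow>
     (real \<Rightarrow> 'h \<Rightarrow> 'h::{banach,second_countable_topology}) \<Rightarrow> real \<times> 'd \<times> real \<Rightarrow> 'h" where
  "jump_kernel \<mu> rep e \<Psi> =
     L2_lim \<mu> (\<lambda>n (s, \<xi>, \<sigma>). \<Sum>k<n. (rep (e k) \<xi> * \<sigma>) *\<^sub>R \<Psi> s (e k))"

definition cadlag_version ::
  "'w measure \<Rightarrow> real \<Rightarrow> (real \<Rightarrow> 'w \<Rightarrow> 'h::topological_space) \<Rightarrow> (real \<Rightarrow> 'w \<Rightarrow> 'h) \<Rightarrow> bool" where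
  "cadlag_version M T X Y \<longleftrightarrow>
     (\<forall>t\<in>{0..T}. AE \<omega> in M. Y t \<omega> = X t \<omega>) \<and>
     (AE \<omega> in M.
        (\<forall>t\<in>{0..<T}. ((\<lambda>s. Y s \<omega>) \<longlongrightarrow> Y t \<omega>) (at_right t)) \<and>
        (\<forall>t\<in>{0<..T}. \<exists>l. ((\<lambda>s. Y s \<omega>) \<longlongrightarrow> l) (at_left t)))"

definition left_limit :: "(real \<Rightarrow> 'w \<Rightarrow> 'h::t2_space) \<Rightarrow> real \<Rightarrow> 'w \<Rightarrow> 'h" where
  "left_limit Y t \<omega> = (if t \<le> 0 then Y 0 \<omega> else Lim (at_left t) (\<lambda>s. Y s \<omega>))"

section \<open>The equation and its discretizations\<close>

text \<open>In this section \<open>R\<close> stands for \<open>Q\<^bsup>1/2\<^esup>\<close>.\<close>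

definition mild_solution ::
  "'w measure \<Rightarrow> (nat \<Rightarrow> real \<Rightarrow> 'w \<Rightarrow> real) \<Rightarrow> (nat \<Rightarrow> 'h) \<Rightarrow> real \<Rightarrow> (real \<Rightarrow> 'h \<Rightarrow> 'h) \<Rightarrow>
     ('h \<Rightarrow> 'h) \<Rightarrow> 'h::{banach,second_countable_topology} \<Rightarrow> (real \<Rightarrow> 'w \<Rightarrow> 'h) \<Rightarrow> bool" where
  "mild_solution M Z e T S R x0 X \<longleftrightarrow>
     (\<forall>t\<in>{0..T}. AE \<omega> in M.
        X t \<omega> = S t x0 + stoch_integral M Z e 0 t (\<lambda>s x. S (t - s) (R x)) \<omega>)"

definition finite_dim_subspace :: "'h::real_vector set \<Rightarrow> bool" where
  "finite_dim_subspace V \<longleftrightarrow> (\<exists>B. finite B \<and> V = span B)"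

definition orth_proj :: "'h::real_inner set \<Rightarrow> 'h \<Rightarrow> 'h" where
  "orth_proj V x = (THE v. v \<in> V \<and> (\<forall>w\<in>V. inner (x - v) w = 0))"

text \<open>With \<open>A12\<close> the square root of \<open>A\<close>, this is \<open>A\<^sub>h\<close>.\<close>

definition discrete_op :: "('h::real_inner \<Rightarrow> 'h) \<Rightarrow> 'h set \<Rightarrow> 'h \<Rightarrow> 'h" where
  "discrete_op A12 V u = (THE y. y \<in> V \<and> (\<forall>w\<in>V. inner y w = inner (A12 u) (A12 w)))"

definition theta_T :: "('h::real_vector \<Rightarrow> 'h) \<Rightarrow> 'h set \<Rightarrow> real \<Rightarrow> real \<Rightarrow> 'h \<Rightarrow> 'h" where
  "theta_T Ah V \<theta> \<Delta>t = inv_into V (\<lambda>u. u + (\<theta> * \<Delta>t) *\<^sub>R Ah u)"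

definition theta_S :: "('h::real_vector \<Rightarrow> 'h) \<Rightarrow> 'h set \<Rightarrow> real \<Rightarrow> real \<Rightarrow> 'h \<Rightarrow> 'h" where
  "theta_S Ah V \<theta> \<Delta>t u = theta_T Ah V \<theta> \<Delta>t (u - ((1 - \<theta>) * \<Delta>t) *\<^sub>R Ah u)"

definition full_discretization ::
  "'w measure \<Rightarrow> (nat \<Rightarrow> real \<Rightarrow> 'w \<Rightarrow> real) \<Rightarrow> (nat \<Rightarrow> 'h) \<Rightarrow> real \<Rightarrow> ('h \<Rightarrow> 'h) \<Rightarrow> ('h \<Rightarrow> 'h) \<Rightarrow>
     ('h \<Rightarrow> 'h) \<Rightarrow> ('h \<Rightarrow> 'h) \<Rightarrow> 'h::{banach,second_countable_topology} \<Rightarrow> nat \<Rightarrow> 'w \<Rightarrow> 'h" where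
  "full_discretization M Z e \<Delta>t Sd Td P R x0 n \<omega> =
     (Sd ^^ n) (P x0) +
     (\<Sum>k<n. (Sd ^^ (n - k - 1)) (Td
        (L2_lim M (\<lambda>m \<omega>. \<Sum>j<m. (Z j (real (k + 1) * \<Delta>t) \<omega> - Z j (real k * \<Delta>t) \<omega>) *\<^sub>R P (R (e j))) \<omega>)))"

definition space_discretization ::
  "'w measure \<Rightarrow> (nat \<Rightarrow> real \<Rightarrow> 'w \<Rightarrow> real) \<Rightarrow> (nat \<Rightarrow> 'h) \<Rightarrow> (real \<Rightarrow> 'h \<Rightarrow> 'h) \<Rightarrow>
     ('h \<Rightarrow> 'h) \<Rightarrow> ('h \<Rightarrow> 'h) \<Rightarrow> 'h::{banach,second_countable_topology} \<Rightarrow> real \<Rightarrow> 'w \<Rightarrow> 'h" where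
  "space_discretization M Z e Sh P R x0 t \<omega> =
     Sh t (P x0) + stoch_integral M Z e 0 t (\<lambda>s x. Sh (t - s) (P (R x))) \<omega>"

text \<open>The function \<open>(t, x) \<mapsto> E \<phi>(x + \<integral>\<^bsub>(T-t,T]\<^esub> \<Psi>(r) dZ\<^sub>r)\<close>.\<close>

definition value_fun ::
  "'w measure \<Rightarrow> (nat \<Rightarrow> real \<Rightarrow> 'w \<Rightarrow> real) \<Rightarrow> (nat \<Rightarrow> 'h) \<Rightarrow> real \<Rightarrow> ('h \<Rightarrow> real) \<Rightarrow>
     (real \<Rightarrow> 'h \<Rightarrow> 'h) \<Rightarrow> real \<Rightarrow> 'h::{banach,second_countable_topology} \<Rightarrow> real" where
  "value_fun M Z e T \<phi> \<Psi> t x = (LINT \<omega>|M. \<phi> (x + stoch_integral M Z e (T - t) T \<Psi> \<omega>))"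

end

theory Submission
  imports Defs
begin

text \<open>
  Both expansions are instances of one identity. For deterministic square integrable jump fields
  \<open>F\<close> and \<open>G\<close> let \<open>J t\<close> be the compensated integral of \<open>F\<close> over \<open>(t, T]\<close> and \<open>Y t\<close> that of \<open>G\<close> over
  \<open>(0, t]\<close>, started at \<open>x\<close>. With \<open>v t y = E \<phi> (y + J t)\<close>, the independence of \<open>Y t\<close> and \<open>J t\<close> turns
  \<open>E \<phi> (Y T) - v 0 x\<close> into the total change of \<open>E \<phi> (Y t + J t)\<close> over \<open>[0, T]\<close>, that is, of the
  expectation of \<open>\<phi>\<close> at a single compensated integral whose integrand switches from \<open>F\<close> to \<open>G\<close>.

  Instead of Ito's formula this change is computed by telescoping over a partition of \<open>[0, T]\<close>. Adding
  an independent compensated integral \<open>X\<close> of \<open>f\<close> to \<open>W\<close> changes \<open>E \<phi>\<close> by \<open>E (\<phi> (W + X) - \<phi> W - D W \<bullet> X)\<close>,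
  because \<open>X\<close> is centred. If \<open>f\<close> is bounded with small support, then up to a second order error there
  is at most one jump, and this equals the integral of \<open>E (\<phi> (W + f z) - \<phi> W - D W \<bullet> f z)\<close> against the
  intensity measure. The second order remainder is Lipschitz on \<open>L\<^sup>2\<close>-balls, so approximation by simple
  functions covers all square integrable \<open>f\<close>. Refining the partition, \<open>W\<close> converges to \<open>Y t + J t\<close>, and
  conditioning on \<open>Y t\<close> produces \<open>v\<close> and its gradient.
\<close>

section \<open>Square integrable functions\<close>

text \<open>Every integral in the definitions is a Hilbert choice, known only up to a null set and
  separately for each time. The obstacle is to handle them without chasing choices: all are
  described by one relation, \<open>comp_lim f X\<close>, which is linear, closed under mean square
  limits and fixes \<open>X\<close> almost surely. Coordinate processes, stochastic integrals and
  the noise increments of the scheme then differ only in their jump field \<open>f\<close>.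

  The integrand of the theorem is \<open>rho w G - rho w F\<close> for the Taylor remainder
  \<open>rho\<close> of the value function: the values at \<open>w\<close> cancel and the gradient
  terms merge. Each remainder is quadratic in the jump, hence integrable even if the intensity is
  infinite.

  Quadratic growth also controls the telescoping: the energies of the slabs add up to the total
  energy, whatever their number, and the multiple jump errors add up to squared slab intensities,
  which vanish because time has no atoms.

  Left limits involve uncountably many times, so they are replaced by a jointly measurable version
  built from countably many, and completeness of \<open>M\<close> transfers measurability
  back.\<close>

definition sq_norm :: "'a measure \<Rightarrow> ('a \<Rightarrow> 'b::real_normed_vector) \<Rightarrow> ennreal" where
  "sq_norm M f = (\<integral>\<^sup>+x. ennreal ((norm (f x))\<^sup>2) \<partial>M)"

definition sq_integrable ::
  "'a measure \<Rightarrow> ('a \<Rightarrow> 'b::{banach,second_countable_topology}) \<Rightarrow> bool" where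
  "sq_integrable M f \<longleftrightarrow> f \<in> borel_measurable M \<and> sq_norm M f < \<infinity>"

lemma sq_integrableD [dest]:
  "sq_integrable M f \<Longrightarrow> f \<in> borel_measurable M"
  "sq_integrable M f \<Longrightarrow> sq_norm M f < \<infinity>"
  by (simp_all add: sq_integrable_def)

lemma sq_integrable_iff_integrable:
  assumes "f \<in> borel_measurable M"
  shows "sq_integrable M f \<longleftrightarrow> integrable M (\<lambda>x. (norm (f x))\<^sup>2)"
  using assms by (simp add: sq_integrable_def sq_norm_def integrable_iff_bounded)

lemma sq_integrable_integrable:
  "sq_integrable M f \<Longrightarrow> integrable M (\<lambda>x. (norm (f x))\<^sup>2)"
  using sq_integrable_iff_integrable by blast

lemma sq_norm_eq_integral:
  assumes "sq_integrable M f"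
  shows "sq_norm M f = ennreal (LINT x|M. (norm (f x))\<^sup>2)"
  unfolding sq_norm_def
  by (intro nn_integral_eq_integral sq_integrable_integrable assms) auto

lemma norm_add_sq_le:
  fixes a b :: "'b::real_normed_vector"
  shows "(norm (a + b))\<^sup>2 \<le> 2 * (norm a)\<^sup>2 + 2 * (norm b)\<^sup>2"
proof -
  have "(norm (a + b))\<^sup>2 \<le> (norm a + norm b)\<^sup>2"
    by (intro power_mono norm_triangle_ineq) auto
  also have "\<dots> \<le> 2 * (norm a)\<^sup>2 + 2 * (norm b)\<^sup>2"
    using sum_squares_bound[of "norm a" "norm b"] by (simp add: power2_sum)
  finally show ?thesis .
qed

lemma sq_norm_mono:
  assumes "AE x in M. norm (f x) \<le> norm (g x)"
  shows "sq_norm M f \<le> sq_norm M g"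
  unfolding sq_norm_def using assms
  by (intro nn_integral_mono_AE) (auto elim!: eventually_mono intro!: ennreal_leI power_mono)

lemma sq_norm_cong_AE:
  assumes "AE x in M. f x = g x"
  shows "sq_norm M f = sq_norm M g"
  unfolding sq_norm_def using assms by (intro nn_integral_cong_AE) auto

lemma sq_norm_cmult:
  "f \<in> borel_measurable M \<Longrightarrow> sq_norm M (\<lambda>x. c *\<^sub>R f x) = ennreal (c\<^sup>2) * sq_norm M f"
  unfolding sq_norm_def
  by (subst nn_integral_cmult[symmetric]) (auto simp: power_mult_distrib ennreal_mult)

lemma sq_norm_minus [simp]: "sq_norm M (\<lambda>x. - f x) = sq_norm M f"
  by (simp add: sq_norm_def)

lemma sq_norm_commute: "sq_norm M (\<lambda>x. f x - g x) = sq_norm M (\<lambda>x. g x - f x)"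
  by (simp add: sq_norm_def norm_minus_commute)

lemma sq_norm_zero [simp]: "sq_norm M (\<lambda>x. 0) = 0"
  by (simp add: sq_norm_def)

text \<open>The factor 2 replaces Minkowski's inequality: no square roots of extended numbers occur,
  and convergence to 0 does not depend on constants.\<close>

lemma sq_norm_add:
  fixes f g :: "'a \<Rightarrow> 'b::{banach,second_countable_topology}"
  assumes [measurable]: "f \<in> borel_measurable M" "g \<in> borel_measurable M"
  shows "sq_norm M (\<lambda>x. f x + g x) \<le> 2 * sq_norm M f + 2 * sq_norm M g"
proof -
  have "sq_norm M (\<lambda>x. f x + g x)
      \<le> (\<integral>\<^sup>+x. 2 * ennreal ((norm (f x))\<^sup>2) + 2 * ennreal ((norm (g x))\<^sup>2) \<partial>M)"
    unfolding sq_norm_def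
  proof (intro nn_integral_mono)
    fix x
    have "ennreal ((norm (f x + g x))\<^sup>2) \<le> ennreal (2 * (norm (f x))\<^sup>2 + 2 * (norm (g x))\<^sup>2)"
      by (intro ennreal_leI norm_add_sq_le)
    also have "\<dots> = 2 * ennreal ((norm (f x))\<^sup>2) + 2 * ennreal ((norm (g x))\<^sup>2)"
      by (simp add: ennreal_plus ennreal_mult)
    finally show "ennreal ((norm (f x + g x))\<^sup>2) \<le> \<dots>" .
  qed
  also have "\<dots> = 2 * sq_norm M f + 2 * sq_norm M g"
    by (simp add: sq_norm_def nn_integral_add nn_integral_cmult)
  finally show ?thesis .
qed

lemma sq_norm_diff:
  fixes f g :: "'a \<Rightarrow> 'b::{banach,second_countable_topology}"
  assumes "f \<in> borel_measurable M" "g \<in> borel_measurable M"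
  shows "sq_norm M (\<lambda>x. f x - g x) \<le> 2 * sq_norm M f + 2 * sq_norm M g"
  using sq_norm_add[of f M "\<lambda>x. - g x"] assms by simp

lemma sq_norm_diff_triangle:
  fixes f g :: "'a \<Rightarrow> 'b::{banach,second_countable_topology}"
  assumes [measurable]: "f \<in> borel_measurable M" "g \<in> borel_measurable M" "k \<in> borel_measurable M"
  shows "sq_norm M (\<lambda>x. f x - k x)
    \<le> 2 * sq_norm M (\<lambda>x. f x - g x) + 2 * sq_norm M (\<lambda>x. g x - k x)"
  using sq_norm_add[of "\<lambda>x. f x - g x" M "\<lambda>x. g x - k x"] by simp

lemma sq_norm_eq_0_iff:
  fixes f :: "'a \<Rightarrow> 'b::{banach,second_countable_topology}"
  assumes [measurable]: "f \<in> borel_measurable M"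
  shows "sq_norm M f = 0 \<longleftrightarrow> (AE x in M. f x = 0)"
  unfolding sq_norm_def by (subst nn_integral_0_iff_AE) auto

lemma ennreal_2_less_top: "x < \<infinity> \<Longrightarrow> y < \<infinity> \<Longrightarrow> 2 * x + 2 * (y::ennreal) < \<infinity>"
  by (simp add: ennreal_mult_less_top)

lemma sq_integrable_add:
  assumes "sq_integrable M f" "sq_integrable M g"
  shows "sq_integrable M (\<lambda>x. f x + g x)"
  using assms sq_norm_add[of f M g] ennreal_2_less_top[of "sq_norm M f" "sq_norm M g"]
  by (auto simp: sq_integrable_def intro: le_less_trans)

lemma sq_integrable_diff:
  assumes "sq_integrable M f" "sq_integrable M g"
  shows "sq_integrable M (\<lambda>x. f x - g x)"
  using assms sq_norm_diff[of f M g] ennreal_2_less_top[of "sq_norm M f" "sq_norm M g"]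
  by (auto simp: sq_integrable_def intro: le_less_trans)

lemma sq_integrable_scaleR:
  "sq_integrable M f \<Longrightarrow> sq_integrable M (\<lambda>x. c *\<^sub>R f x)"
  by (auto simp: sq_integrable_def sq_norm_cmult ennreal_mult_less_top)

lemma sq_integrable_zero [simp]: "sq_integrable M (\<lambda>x. 0)"
  by (simp add: sq_integrable_def)

lemma sq_integrable_mono:
  fixes f :: "'a \<Rightarrow> 'b::{banach,second_countable_topology}"
    and g :: "'a \<Rightarrow> 'c::{banach,second_countable_topology}"
  assumes "sq_integrable M g" "f \<in> borel_measurable M" "AE x in M. norm (f x) \<le> norm (g x)"
  shows "sq_integrable M f"
  using assms sq_norm_mono[of f g M] by (auto simp: sq_integrable_def intro: le_less_trans)

lemma sq_integrable_indicator_scaleR: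
  assumes "sq_integrable M f" "A \<in> sets M"
  shows "sq_integrable M (\<lambda>x. indicator A x *\<^sub>R f x)"
  by (rule sq_integrable_mono[OF assms(1)]) (use assms in \<open>auto split: split_indicator\<close>)

subsection \<open>Convergence in mean square\<close>

lemma L2_tendsto_iff:
  "L2_tendsto M Xn X \<longleftrightarrow> (\<forall>n. Xn n \<in> borel_measurable M) \<and> X \<in> borel_measurable M \<and>
     (\<lambda>n. sq_norm M (\<lambda>x. Xn n x - X x)) \<longlonglongrightarrow> 0"
  by (simp add: L2_tendsto_def sq_norm_def)

lemma L2_tendstoD:
  assumes "L2_tendsto M Xn X"
  shows "Xn n \<in> borel_measurable M" "X \<in> borel_measurable M"
    "(\<lambda>n. sq_norm M (\<lambda>x. Xn n x - X x)) \<longlonglongrightarrow> 0"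
  using assms by (auto simp: L2_tendsto_iff)

lemma ennreal_tendsto_0_le:
  fixes f g :: "nat \<Rightarrow> ennreal"
  assumes "\<And>n. f n \<le> g n" "g \<longlonglongrightarrow> 0"
  shows "f \<longlonglongrightarrow> 0"
  using tendsto_sandwich[of "\<lambda>_. 0" f sequentially g 0] assms by auto

lemma tendsto_0_cmult_ennreal:
  fixes f :: "nat \<Rightarrow> ennreal"
  assumes "f \<longlonglongrightarrow> 0" "c < \<infinity>"
  shows "(\<lambda>n. c * f n) \<longlonglongrightarrow> 0"
  using ennreal_tendsto_cmult[of c f 0 sequentially] assms by auto

lemma tendsto_0_add_ennreal:
  fixes f g :: "nat \<Rightarrow> ennreal"
  assumes "f \<longlonglongrightarrow> 0" "g \<longlonglongrightarrow> 0"
  shows "(\<lambda>n. f n + g n) \<longlonglongrightarrow> 0"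
  using tendsto_add[OF assms] by simp

lemma tendsto_0_combine_ennreal:
  fixes f g :: "nat \<Rightarrow> ennreal"
  assumes "f \<longlonglongrightarrow> 0" "g \<longlonglongrightarrow> 0"
  shows "(\<lambda>n. 2 * f n + 2 * g n) \<longlonglongrightarrow> 0"
  by (intro tendsto_0_add_ennreal tendsto_0_cmult_ennreal assms) auto

lemma const_tendsto_0_ennreal:
  assumes "(\<lambda>n::nat. a::ennreal) \<longlonglongrightarrow> 0"
  shows "a = 0"
  using LIMSEQ_unique[OF assms tendsto_const] by simp

lemma L2_tendsto_unique:
  assumes "L2_tendsto M Xn X" "L2_tendsto M Xn Y"
  shows "AE x in M. X x = Y x"
proof -
  note [measurable] = L2_tendstoD(1,2)[OF assms(1)] L2_tendstoD(1,2)[OF assms(2)]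
  have "(\<lambda>n. sq_norm M (\<lambda>x. X x - Y x)) \<longlonglongrightarrow> 0"
  proof (rule ennreal_tendsto_0_le)
    show "sq_norm M (\<lambda>x. X x - Y x)
      \<le> 2 * sq_norm M (\<lambda>x. Xn n x - X x) + 2 * sq_norm M (\<lambda>x. Xn n x - Y x)" for n
      using sq_norm_diff_triangle[of X M "Xn n" Y] sq_norm_commute[of M X "Xn n"] by simp
  qed (use L2_tendstoD(3)[OF assms(1)] L2_tendstoD(3)[OF assms(2)] in \<open>intro tendsto_0_combine_ennreal\<close>)
  then have "sq_norm M (\<lambda>x. X x - Y x) = 0"
    by (rule const_tendsto_0_ennreal)
  then show ?thesis
    by (subst (asm) sq_norm_eq_0_iff) auto
qed

lemma L2_tendsto_cong_limit:
  assumes "L2_tendsto M Xn X" "AE x in M. X x = Y x" "Y \<in> borel_measurable M"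
  shows "L2_tendsto M Xn Y"
proof -
  have "sq_norm M (\<lambda>x. Xn n x - X x) = sq_norm M (\<lambda>x. Xn n x - Y x)" for n
    using assms(2) by (intro sq_norm_cong_AE) auto
  then show ?thesis using assms by (auto simp: L2_tendsto_iff)
qed

lemma L2_tendsto_cong_AE:
  assumes "L2_tendsto M Xn X" "\<And>n. AE x in M. Xn n x = Yn n x" "\<And>n. Yn n \<in> borel_measurable M"
  shows "L2_tendsto M Yn X"
proof -
  have "sq_norm M (\<lambda>x. Xn n x - X x) = sq_norm M (\<lambda>x. Yn n x - X x)" for n
    using assms(2)[of n] by (intro sq_norm_cong_AE) auto
  then show ?thesis using assms by (auto simp: L2_tendsto_iff)
qed

lemma L2_tendsto_const: "X \<in> borel_measurable M \<Longrightarrow> L2_tendsto M (\<lambda>n. X) X"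
  by (simp add: L2_tendsto_iff)

lemma L2_tendsto_add:
  assumes "L2_tendsto M Xn X" "L2_tendsto M Yn Y"
  shows "L2_tendsto M (\<lambda>n x. Xn n x + Yn n x) (\<lambda>x. X x + Y x)"
proof -
  note [measurable] = L2_tendstoD(1,2)[OF assms(1)] L2_tendstoD(1,2)[OF assms(2)]
  have "(\<lambda>n. sq_norm M (\<lambda>x. (Xn n x + Yn n x) - (X x + Y x))) \<longlonglongrightarrow> 0"
  proof (rule ennreal_tendsto_0_le)
    show "sq_norm M (\<lambda>x. (Xn n x + Yn n x) - (X x + Y x))
      \<le> 2 * sq_norm M (\<lambda>x. Xn n x - X x) + 2 * sq_norm M (\<lambda>x. Yn n x - Y x)" for n
      using sq_norm_add[of "\<lambda>x. Xn n x - X x" M "\<lambda>x. Yn n x - Y x"]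
      by (simp add: algebra_simps)
  qed (use L2_tendstoD(3)[OF assms(1)] L2_tendstoD(3)[OF assms(2)] in \<open>intro tendsto_0_combine_ennreal\<close>)
  then show ?thesis by (auto simp: L2_tendsto_iff)
qed

lemma L2_tendsto_bounded_linear:
  fixes L :: "'b::{banach,second_countable_topology} \<Rightarrow> 'c::{banach,second_countable_topology}"
  assumes L: "bounded_linear L" and X: "L2_tendsto M Xn X"
  shows "L2_tendsto M (\<lambda>n x. L (Xn n x)) (\<lambda>x. L (X x))"
proof -
  note [measurable] = L2_tendstoD(1,2)[OF X]
  have [measurable]: "L \<in> borel_measurable borel"
    using L by (intro borel_measurable_continuous_onI linear_continuous_on)
  obtain K where K: "0 < K" "\<And>x. norm (L x) \<le> norm x * K"
    using bounded_linear.pos_bounded[OF L] by blast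
  have "(\<lambda>n. sq_norm M (\<lambda>x. L (Xn n x) - L (X x))) \<longlonglongrightarrow> 0"
  proof (rule ennreal_tendsto_0_le)
    fix n
    have "sq_norm M (\<lambda>x. L (Xn n x) - L (X x)) \<le> sq_norm M (\<lambda>x. K *\<^sub>R (Xn n x - X x))"
      using K by (intro sq_norm_mono AE_I2)
        (simp add: linear_diff[OF bounded_linear.linear[OF L], symmetric] mult.commute)
    also have "\<dots> = ennreal (K\<^sup>2) * sq_norm M (\<lambda>x. Xn n x - X x)"
      by (rule sq_norm_cmult) auto
    finally show "sq_norm M (\<lambda>x. L (Xn n x) - L (X x)) \<le> \<dots>" .
  qed (intro tendsto_0_cmult_ennreal L2_tendstoD(3) X, simp)
  then show ?thesis by (auto simp: L2_tendsto_iff)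
qed

lemma L2_tendsto_sum:
  assumes "\<And>i. i \<in> I \<Longrightarrow> L2_tendsto M (\<lambda>n. Xn n i) (X i)"
  shows "L2_tendsto M (\<lambda>n x. \<Sum>i\<in>I. Xn n i x) (\<lambda>x. \<Sum>i\<in>I. X i x)"
  using assms
  by (induction I rule: infinite_finite_induct) (auto intro: L2_tendsto_add L2_tendsto_const)

text \<open>The factor 2 is that of \<open>sq_norm_add\<close>; used twice, it produces the constant
  4 of \<open>comp_lim_sq_norm\<close>.\<close>

lemma L2_tendsto_sq_norm_le:
  assumes "L2_tendsto M Xn X" "\<And>n. sq_norm M (Xn n) \<le> c n" "c \<longlonglongrightarrow> C"
  shows "sq_norm M X \<le> 2 * C"
proof -
  note [measurable] = L2_tendstoD(1,2)[OF assms(1)]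
  have "(\<lambda>n. 2 * sq_norm M (\<lambda>x. Xn n x - X x) + 2 * c n) \<longlonglongrightarrow> 2 * 0 + 2 * C"
    by (intro tendsto_add ennreal_tendsto_cmult L2_tendstoD(3)[OF assms(1)] assms(3)) auto
  moreover have "sq_norm M X \<le> 2 * sq_norm M (\<lambda>x. Xn n x - X x) + 2 * c n" for n
  proof -
    have "sq_norm M X \<le> 2 * sq_norm M (\<lambda>x. X x - Xn n x) + 2 * sq_norm M (Xn n)"
      using sq_norm_add[of "\<lambda>x. X x - Xn n x" M "Xn n"] by simp
    then show ?thesis
      using assms(2)[of n] sq_norm_commute[of M X "Xn n"]
      by (simp, meson add_left_mono dual_order.trans mult_left_mono zero_le)
  qed
  ultimately show ?thesis
    using LIMSEQ_le_const[of "\<lambda>n. 2 * sq_norm M (\<lambda>x. Xn n x - X x) + 2 * c n" "2 * C"] by auto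
qed

text \<open>A single index at distance below 1 suffices, since \<open>X\<close> is the difference of
  \<open>Xn n\<close> and \<open>Xn n - X\<close>.\<close>

lemma L2_tendsto_sq_integrable:
  assumes "L2_tendsto M Xn X" "\<And>n. sq_integrable M (Xn n)"
  shows "sq_integrable M X"
proof -
  note [measurable] = L2_tendstoD(1,2)[OF assms(1)]
  have "eventually (\<lambda>n. sq_norm M (\<lambda>x. Xn n x - X x) < 1) sequentially"
    using L2_tendstoD(3)[OF assms(1)] by (rule order_tendstoD) simp
  then obtain n where "sq_norm M (\<lambda>x. Xn n x - X x) < 1"
    by (auto simp: eventually_sequentially)
  then have "sq_integrable M (\<lambda>x. Xn n x - X x)"
    by (auto simp: sq_integrable_def intro: less_trans)
  from sq_integrable_diff[OF assms(2)[of n] this] show ?thesis by simp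
qed

lemma L2_lim_tendsto:
  assumes "L2_tendsto M Xn X"
  shows "L2_tendsto M Xn (L2_lim M Xn)"
  unfolding L2_lim_def using assms by (metis someI)

text \<open>Passing to a subsequence with \<open>\<parallel>X\<^bsub>r (k+1)\<^esub> - X\<^bsub>r k\<^esub>\<parallel>\<^sup>2 \<le> 8\<^sup>-\<^sup>k\<close> forces almost sure convergence,
  and Fatou's lemma upgrades this to convergence in mean square.\<close>

lemma L2_complete:
  fixes Xn :: "nat \<Rightarrow> 'a \<Rightarrow> 'b::{banach,second_countable_topology}"
  assumes meas [measurable]: "\<And>n. Xn n \<in> borel_measurable M"
    and Cauchy: "\<And>\<epsilon>::real. 0 < \<epsilon> \<Longrightarrow> \<exists>N. \<forall>m\<ge>N. \<forall>n\<ge>N. sq_norm M (\<lambda>x. Xn m x - Xn n x) \<le> ennreal \<epsilon>"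
  shows "\<exists>X. L2_tendsto M Xn X"
proof -
  have "\<exists>N. \<forall>k. \<forall>m\<ge>N k. \<forall>n\<ge>N k. sq_norm M (\<lambda>x. Xn m x - Xn n x) \<le> ennreal ((1/8)^k)"
    using Cauchy by (intro choice allI) simp
  then obtain N where N: "\<And>k m n. N k \<le> m \<Longrightarrow> N k \<le> n \<Longrightarrow>
      sq_norm M (\<lambda>x. Xn m x - Xn n x) \<le> ennreal ((1/8)^k)"
    by metis
  \<comment> \<open>Summing makes \<open>r (Suc k)\<close> dominate \<open>N k\<close> as well, so
    that consecutive terms can be compared; the summand \<open>k\<close> drives \<open>r\<close> to
    infinity.\<close>
  define r where "r k = (\<Sum>i\<le>k. N i) + k" for k
  have rN: "N k \<le> r k" for k
    unfolding r_def by (metis atMost_iff finite_atMost le_add1 le_trans member_le_sum order_refl zero_le)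
  have rN': "N k \<le> r (Suc k)" for k
    using rN[of k] by (simp add: r_def)
  have rk: "k \<le> r k" for k by (simp add: r_def)
  define d where "d k x = Xn (r (Suc k)) x - Xn (r k) x" for k x
  have [measurable]: "d k \<in> borel_measurable M" for k unfolding d_def by measurable
  have dk: "sq_norm M (d k) \<le> ennreal ((1/8)^k)" for k
    unfolding d_def using rN rN' by (intro N) auto
  \<comment> \<open>The weight \<open>2^k\<close> still leaves the summable bound
    \<open>4^-k\<close>, and its finiteness almost everywhere forces the differences to decay
    pathwise like \<open>sqrt (1/2) ^ k\<close>.\<close>
  have "(\<integral>\<^sup>+x. (\<Sum>k. ennreal (2^k * (norm (d k x))\<^sup>2)) \<partial>M) = (\<Sum>k. ennreal (2^k) * sq_norm M (d k))"
    unfolding sq_norm_def by (subst nn_integral_suminf) (auto simp: ennreal_mult nn_integral_cmult)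
  also have "\<dots> \<le> (\<Sum>k. ennreal ((1/4)^k))"
  proof (intro suminf_le allI)
    fix k
    have "ennreal (2^k) * sq_norm M (d k) \<le> ennreal (2^k) * ennreal ((1/8)^k)"
      by (intro mult_left_mono dk) auto
    also have "\<dots> = ennreal ((1/4)^k)"
      by (simp add: ennreal_mult[symmetric] power_mult_distrib[symmetric])
    finally show "ennreal (2^k) * sq_norm M (d k) \<le> ennreal ((1/4)^k)" .
  qed auto
  also have "\<dots> < \<infinity>"
    by (subst suminf_ennreal2) (auto intro!: summable_geometric)
  finally have "AE x in M. (\<Sum>k. ennreal (2^k * (norm (d k x))\<^sup>2)) \<noteq> \<infinity>"
    by (intro nn_integral_noteq_infinite) auto
  then have ae: "AE x in M. convergent (\<lambda>k. Xn (r k) x)"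
  proof eventually_elim
    case (elim x)
    then have "summable (\<lambda>k. 2^k * (norm (d k x))\<^sup>2)"
      by (intro summable_suminf_not_top) auto
    then have "(\<lambda>k. 2^k * (norm (d k x))\<^sup>2) \<longlonglongrightarrow> 0"
      by (rule summable_LIMSEQ_zero)
    then have "Bseq (\<lambda>k. 2^k * (norm (d k x))\<^sup>2)"
      by (intro convergent_imp_Bseq convergentI)
    then obtain K where K: "0 < K" "\<And>k. norm (2^k * (norm (d k x))\<^sup>2) \<le> K"
      by (auto simp: Bseq_def)
    have le: "norm (d k x) \<le> sqrt K * sqrt (1/2) ^ k" for k
    proof -
      have "(norm (d k x))\<^sup>2 \<le> K * (1/2)^k"
        using K(2)[of k] by (simp add: field_simps power_divide)
      then have "norm (d k x) \<le> sqrt (K * (1/2)^k)"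
        by (intro real_le_rsqrt)
      then show ?thesis by (simp only: real_sqrt_mult real_sqrt_power)
    qed
    have "summable (\<lambda>k. sqrt K * sqrt (1/2) ^ k)"
      by (intro summable_mult summable_geometric) (simp add: real_sqrt_lt_1_iff)
    then have "summable (\<lambda>k. d k x)"
      by (rule summable_comparison_test'[of _ 0]) (use le in auto)
    then have "convergent (\<lambda>n. (\<Sum>k<n. Xn (r (Suc k)) x - Xn (r k) x))"
      by (simp add: d_def summable_iff_convergent)
    then have "convergent (\<lambda>n. Xn (r n) x - Xn (r 0) x)"
      by (simp add: sum_lessThan_telescope[of "\<lambda>k. Xn (r k) x"])
    then have "convergent (\<lambda>n. Xn (r n) x - Xn (r 0) x + Xn (r 0) x)"
      by (intro convergent_add convergent_const)
    then show ?case by simp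
  qed
  define X where "X x = lim (\<lambda>k. Xn (r k) x)" for x
  have [measurable]: "X \<in> borel_measurable M"
    unfolding X_def by (rule borel_measurable_lim_metric) measurable
  have ae': "AE x in M. (\<lambda>k. Xn (r k) x) \<longlonglongrightarrow> X x"
    using ae by eventually_elim (simp add: X_def convergent_LIMSEQ_iff)
  have "(\<lambda>n. sq_norm M (\<lambda>x. Xn n x - X x)) \<longlonglongrightarrow> 0"
  proof (rule order_tendstoI)
    fix a :: ennreal assume "0 < a"
    then obtain \<epsilon> :: real where \<epsilon>: "0 < \<epsilon>" "ennreal \<epsilon> < a"
      by (metis dense ennreal_0 ennreal_cases ennreal_less_iff less_le_trans linorder_not_less neq_iff top_greatest)
    obtain N0 where N0: "\<And>m n. N0 \<le> m \<Longrightarrow> N0 \<le> n \<Longrightarrow> sq_norm M (\<lambda>x. Xn m x - Xn n x) \<le> ennreal \<epsilon>"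
      using Cauchy[OF \<epsilon>(1)] by blast
    have "sq_norm M (\<lambda>x. Xn n x - X x) \<le> ennreal \<epsilon>" if n: "N0 \<le> n" for n
    proof -
      have "sq_norm M (\<lambda>x. Xn n x - X x)
          = (\<integral>\<^sup>+x. liminf (\<lambda>k. ennreal ((norm (Xn n x - Xn (r k) x))\<^sup>2)) \<partial>M)"
        unfolding sq_norm_def
      proof (intro nn_integral_cong_AE, use ae' in eventually_elim)
        case (elim x)
        then have c: "(\<lambda>k. ennreal ((norm (Xn n x - Xn (r k) x))\<^sup>2)) \<longlonglongrightarrow> ennreal ((norm (Xn n x - X x))\<^sup>2)"
          by (intro tendsto_intros)
        show ?case by (rule lim_imp_Liminf[OF sequentially_bot c, symmetric])
      qed
      also have "\<dots> \<le> liminf (\<lambda>k. sq_norm M (\<lambda>x. Xn n x - Xn (r k) x))"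
        unfolding sq_norm_def by (intro nn_integral_liminf) auto
      also have "\<dots> \<le> ennreal \<epsilon>"
      proof (rule order_trans[OF Liminf_mono])
        show "\<forall>\<^sub>F k in sequentially. sq_norm M (\<lambda>x. Xn n x - Xn (r k) x) \<le> ennreal \<epsilon>"
          using eventually_ge_at_top[of N0] by eventually_elim (use n rk N0 le_trans in blast)
      qed (simp add: Liminf_const)
      finally show ?thesis .
    qed
    then show "\<forall>\<^sub>F n in sequentially. sq_norm M (\<lambda>x. Xn n x - X x) < a"
      using \<epsilon>(2) by (auto simp: eventually_sequentially intro: le_less_trans)
  qed auto
  then show ?thesis by (intro exI[of _ X]) (auto simp: L2_tendsto_iff)
qed

section \<open>Simple integrands and their density\<close>

abbreviation simple_integrable :: "'a measure \<Rightarrow> ('a \<Rightarrow> 'b::real_vector) \<Rightarrow> bool" where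
  "simple_integrable \<equiv> Bochner_Integration.simple_bochner_integrable"

abbreviation simple_integral :: "'a measure \<Rightarrow> ('a \<Rightarrow> 'b::real_vector) \<Rightarrow> 'b" where
  "simple_integral \<equiv> Bochner_Integration.simple_bochner_integral"

lemmas simple_integrable_iff = Bochner_Integration.simple_bochner_integrable.simps
lemmas simple_integrable_compose2 = Bochner_Integration.simple_bochner_integrable_compose2
lemmas simple_integral_def = Bochner_Integration.simple_bochner_integral_def
lemmas simple_integral_add = Bochner_Integration.simple_bochner_integral_add
lemmas simple_integral_linear = Bochner_Integration.simple_bochner_integral_linear
lemmas simple_integral_eq_integral = Bochner_Integration.simple_bochner_integrable_eq_integral

lemma simple_integrable_borel [dest]:
  fixes f :: "'a \<Rightarrow> 'b::{real_normed_vector,second_countable_topology}"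
  shows "simple_integrable M f \<Longrightarrow> f \<in> borel_measurable M"
  by (auto simp: simple_integrable_iff borel_measurable_simple_function)

lemma simple_integrable_compose:
  assumes "simple_integrable M f" "p 0 = 0"
  shows "simple_integrable M (\<lambda>x. p (f x))"
  using simple_integrable_compose2[where p="\<lambda>x y. p x", of M f f] assms by simp

lemma simple_integrable_bounded:
  fixes f :: "'a \<Rightarrow> 'b::real_normed_vector"
  assumes "simple_integrable M f"
  shows "\<exists>c\<ge>0. \<forall>x\<in>space M. norm (f x) \<le> c"
proof -
  have "finite (f ` space M)"
    using assms by (auto simp: simple_integrable_iff simple_function_def)
  then have "bounded (f ` space M)" by (rule finite_imp_bounded)
  then obtain c where "0 < c" "\<forall>y\<in>f ` space M. norm y \<le> c" by (auto simp: bounded_pos)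
  then show ?thesis by (intro exI[of _ c]) auto
qed

lemma simple_integrable_indicator:
  assumes "simple_integrable M f" "A \<in> sets M"
  shows "simple_integrable M (\<lambda>x. indicator A x *\<^sub>R f x)"
proof -
  have "{x \<in> space M. f x \<noteq> 0} \<in> sets M"
    using assms(1) simple_functionD(2)[of M f "- {0}"]
    by (simp add: simple_integrable_iff vimage_def Int_def conj_commute)
  then have "emeasure M {x \<in> space M. indicator A x *\<^sub>R f x \<noteq> 0} \<le> emeasure M {x \<in> space M. f x \<noteq> 0}"
    by (intro emeasure_mono) (auto split: split_indicator_asm)
  moreover have "simple_function M (\<lambda>x. indicator A x *\<^sub>R f x)"
    using assms simple_function_compose2[of M "indicator A :: 'a \<Rightarrow> real" f "\<lambda>a b. a *\<^sub>R b"]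
    by (auto simp: simple_integrable_iff)
  ultimately show ?thesis
    using assms by (auto simp: simple_integrable_iff top_unique)
qed

lemma simple_integrable_sq_integrable:
  fixes f :: "'a \<Rightarrow> 'b::{banach,second_countable_topology}"
  assumes "simple_integrable M f"
  shows "sq_integrable M f"
proof -
  have "simple_integrable M (\<lambda>x. (norm (f x))\<^sup>2)"
    by (rule simple_integrable_compose[OF assms]) simp
  then have "integrable M (\<lambda>x. (norm (f x))\<^sup>2)"
    using Bochner_Integration.has_bochner_integral_simple_bochner_integrable integrable.intros by blast
  then show ?thesis
    using assms by (auto simp: sq_integrable_iff_integrable)
qed

text \<open>The simple approximants stay below \<open>2 * norm f\<close>, so their squares are
  integrable, and a simple function with integrable square has a support of finite measure. The
  error is then dominated by \<open>3 * norm f\<close>.\<close>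

lemma simple_integrable_dense:
  fixes f :: "'a \<Rightarrow> 'b::{banach,second_countable_topology}"
  assumes f: "sq_integrable M f"
  shows "\<exists>g. (\<forall>n. simple_integrable M (g n)) \<and> L2_tendsto M g f"
proof -
  have [measurable]: "f \<in> borel_measurable M" using f by auto
  obtain s where s: "\<And>i. simple_function M (s i)"
    "\<And>x. x \<in> space M \<Longrightarrow> (\<lambda>i. s i x) \<longlonglongrightarrow> f x"
    "\<And>i x. x \<in> space M \<Longrightarrow> norm (s i x) \<le> 2 * norm (f x)"
    using borel_measurable_implies_sequence_metric[of f M 0] by (simp, metis)
  have [measurable]: "s i \<in> borel_measurable M" for i
    by (rule borel_measurable_simple_function[OF s(1)])
  have bound: "sq_norm M (\<lambda>x. K *\<^sub>R f x) < \<infinity>" for K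
    by (rule sq_integrableD(2)[OF sq_integrable_scaleR[OF f]])
  have "simple_integrable M (s i)" for i
  proof -
    have "sq_norm M (s i) \<le> sq_norm M (\<lambda>x. 2 *\<^sub>R f x)"
      using s(3) by (intro sq_norm_mono AE_I2) simp
    then have "sq_norm M (s i) < \<infinity>" using bound[of 2] by (rule le_less_trans)
    then have "emeasure M {x \<in> space M. (norm (s i x))\<^sup>2 \<noteq> 0} \<noteq> \<infinity>"
      unfolding sq_norm_def using s(1)
      using simple_function_finite_support[OF simple_function_compose1[OF s(1)[of i], of "\<lambda>x. ennreal ((norm x)\<^sup>2)"]]
      by simp
    then show ?thesis using s(1) by (simp add: simple_integrable_iff)
  qed
  moreover have "(\<lambda>n. sq_norm M (\<lambda>x. s n x - f x)) \<longlonglongrightarrow> (\<integral>\<^sup>+x. 0 \<partial>M)"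
    unfolding sq_norm_def
  proof (rule nn_integral_dominated_convergence[where w="\<lambda>x. ennreal ((norm (3 *\<^sub>R f x))\<^sup>2)"])
    show "AE x in M. ennreal ((norm (s j x - f x))\<^sup>2) \<le> ennreal ((norm (3 *\<^sub>R f x))\<^sup>2)" for j
    proof (intro AE_I2 ennreal_leI power_mono)
      fix x assume "x \<in> space M"
      then show "norm (s j x - f x) \<le> norm (3 *\<^sub>R f x)"
        using s(3)[of x j] norm_triangle_ineq4[of "s j x" "f x"] by simp
    qed simp
    show "(\<integral>\<^sup>+x. ennreal ((norm (3 *\<^sub>R f x))\<^sup>2) \<partial>M) < \<infinity>"
      using bound[of 3] by (simp add: sq_norm_def)
    show "AE x in M. (\<lambda>i. ennreal ((norm (s i x - f x))\<^sup>2)) \<longlonglongrightarrow> 0"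
    proof (intro AE_I2)
      fix x assume "x \<in> space M"
      then have "(\<lambda>i. ennreal ((norm (s i x - f x))\<^sup>2)) \<longlonglongrightarrow> ennreal ((norm (f x - f x))\<^sup>2)"
        by (intro tendsto_intros s(2))
      then show "(\<lambda>i. ennreal ((norm (s i x - f x))\<^sup>2)) \<longlonglongrightarrow> 0" by simp
    qed
  qed measurable
  ultimately show ?thesis by (auto simp: L2_tendsto_iff)
qed

section \<open>Independence and mean square limits\<close>

text \<open>Random quantities that are specified only almost surely, such as the mild solution or
  the inner integral over left limits, become measurable through completeness.\<close>

lemma measurable_AE_eq_complete:
  assumes "complete_measure M" and g: "g \<in> measurable M N" and ae: "AE x in M. f x = g x"
    and f: "f \<in> space M \<rightarrow> space N"
  shows "f \<in> measurable M N"
proof (rule measurableI)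
  interpret complete_measure M by fact
  fix A assume A: "A \<in> sets N"
  show "f -` A \<inter> space M \<in> sets M"
  proof (rule in_sets_AE[of "g -` A \<inter> space M"])
    show "AE x in M. (x \<in> g -` A \<inter> space M) = (x \<in> f -` A \<inter> space M)"
      using ae by eventually_elim auto
  qed (use g A in \<open>auto intro: measurable_sets\<close>)
qed (use f in auto)

lemma L2_tendsto_Pair:
  fixes X :: "'a \<Rightarrow> 'b::{banach,second_countable_topology}"
    and Y :: "'a \<Rightarrow> 'c::{banach,second_countable_topology}"
  assumes X: "L2_tendsto M Xn X" and Y: "L2_tendsto M Yn Y"
  shows "L2_tendsto M (\<lambda>n x. (Xn n x, Yn n x)) (\<lambda>x. (X x, Y x))"
proof -
  note [measurable] = L2_tendstoD(1,2)[OF X] L2_tendstoD(1,2)[OF Y]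
  have "sq_norm M (\<lambda>x. (Xn n x, Yn n x) - (X x, Y x))
      = sq_norm M (\<lambda>x. Xn n x - X x) + sq_norm M (\<lambda>x. Yn n x - Y x)" for n
    unfolding sq_norm_def norm_Pair diff_Pair
    by (subst nn_integral_add[symmetric]) (auto simp: ennreal_plus)
  then show ?thesis
    using tendsto_0_add_ennreal[OF L2_tendstoD(3)[OF X] L2_tendstoD(3)[OF Y]]
    by (auto simp: L2_tendsto_iff)
qed

context prob_space
begin

lemma sq_integrable_norm_integrable:
  assumes X: "sq_integrable M X"
  shows "integrable M (\<lambda>x. norm (X x))" "(expectation (\<lambda>x. norm (X x)))\<^sup>2 \<le> expectation (\<lambda>x. (norm (X x))\<^sup>2)"
proof -
  have [measurable]: "X \<in> borel_measurable M" using X by auto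
  have 2: "integrable M (\<lambda>x. (norm (X x))\<^sup>2)" by (rule sq_integrable_integrable[OF X])
  show 1: "integrable M (\<lambda>x. norm (X x))"
    by (rule square_integrable_imp_integrable[OF _ 2]) measurable
  show "(expectation (\<lambda>x. norm (X x)))\<^sup>2 \<le> expectation (\<lambda>x. (norm (X x))\<^sup>2)"
    using variance_positive[of "\<lambda>x. norm (X x)"] variance_eq[OF 1 2] by simp
qed

lemma sq_integrable_imp_integrable:
  "sq_integrable M X \<Longrightarrow> integrable M X"
  using sq_integrable_norm_integrable(1)[of X] by (auto simp: integrable_norm_iff)

lemma expectation_norm_le:
  assumes "sq_integrable M X" "sq_norm M X \<le> ennreal c" "0 \<le> c"
  shows "expectation (\<lambda>x. norm (X x)) \<le> sqrt c"
  using sq_integrable_norm_integrable(2)[OF assms(1)] assms sq_norm_eq_integral[OF assms(1)]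
  by (intro real_le_rsqrt) simp

lemma expectation_norm_tendsto_0:
  fixes Xn :: "nat \<Rightarrow> 'a \<Rightarrow> 'b::{banach,second_countable_topology}"
  assumes Xn: "\<And>n. Xn n \<in> borel_measurable M" and lim: "(\<lambda>n. sq_norm M (Xn n)) \<longlonglongrightarrow> 0"
  shows "(\<lambda>n. expectation (\<lambda>x. norm (Xn n x))) \<longlonglongrightarrow> 0"
proof (rule LIMSEQ_I)
  fix r :: real assume r: "0 < r"
  have "eventually (\<lambda>n. sq_norm M (Xn n) < ennreal ((r/2)\<^sup>2)) sequentially"
    using lim by (rule order_tendstoD) (use r in simp)
  then obtain N where N: "\<And>n. N \<le> n \<Longrightarrow> sq_norm M (Xn n) < ennreal ((r/2)\<^sup>2)"
    by (auto simp: eventually_sequentially)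
  have "norm (expectation (\<lambda>x. norm (Xn n x)) - 0) < r" if "N \<le> n" for n
  proof -
    have "sq_integrable M (Xn n)"
      using N[OF that] Xn by (auto simp: sq_integrable_def intro: less_trans)
    then have "expectation (\<lambda>x. norm (Xn n x)) \<le> sqrt ((r/2)\<^sup>2)"
      using N[OF that] r by (intro expectation_norm_le) auto
    also have "\<dots> < r" using r by simp
    finally show ?thesis by simp
  qed
  then show "\<exists>no. \<forall>n\<ge>no. norm (expectation (\<lambda>x. norm (Xn n x)) - 0) < r" by blast
qed

text \<open>Boundedness of \<open>\<psi>\<close> makes the expectations exist although
  \<open>Xn n\<close> need not be integrable; the differences \<open>Xn n - X\<close> are,
  eventually, square integrable.\<close>

lemma expectation_Lipschitz_tendsto:
  fixes \<psi> :: "'b::{banach,second_countable_topology} \<Rightarrow> real"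
  assumes X: "L2_tendsto M Xn X" and \<psi>: "\<And>x y. \<bar>\<psi> x - \<psi> y\<bar> \<le> K * norm (x - y)"
    and bd: "\<And>x. \<bar>\<psi> x\<bar> \<le> B"
  shows "(\<lambda>n. expectation (\<lambda>\<omega>. \<psi> (Xn n \<omega>))) \<longlonglongrightarrow> expectation (\<lambda>\<omega>. \<psi> (X \<omega>))"
proof -
  note [measurable] = L2_tendstoD(1,2)[OF X]
  have K: "0 \<le> \<bar>K\<bar>" by simp
  have \<psi>': "\<bar>\<psi> x - \<psi> y\<bar> \<le> \<bar>K\<bar> * norm (x - y)" for x y
    using \<psi>[of x y] by (meson abs_ge_self mult_right_mono norm_ge_zero order_trans)
  have "\<bar>K\<bar>-lipschitz_on UNIV \<psi>"
    using \<psi>' by (intro lipschitz_onI) (auto simp: dist_norm dist_real_def)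
  then have "continuous_on UNIV \<psi>" by (rule lipschitz_on_continuous_on)
  then have [measurable]: "\<psi> \<in> borel_measurable borel" by (rule borel_measurable_continuous_onI)
  have int: "integrable M (\<lambda>\<omega>. \<psi> (Y \<omega>))" if [measurable]: "Y \<in> borel_measurable M" for Y
    by (rule integrable_const_bound[of _ B]) (use bd in auto)
  have z: "(\<lambda>n. sq_norm M (\<lambda>x. Xn n x - X x)) \<longlonglongrightarrow> 0" by (rule L2_tendstoD(3)[OF X])
  have "(\<lambda>n. expectation (\<lambda>\<omega>. \<psi> (Xn n \<omega>)) - expectation (\<lambda>\<omega>. \<psi> (X \<omega>))) \<longlonglongrightarrow> 0"
  proof (rule Lim_null_comparison)
    have "(\<lambda>n. \<bar>K\<bar> * expectation (\<lambda>x. norm (Xn n x - X x))) \<longlonglongrightarrow> \<bar>K\<bar> * 0"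
      by (intro tendsto_mult tendsto_const expectation_norm_tendsto_0 z) auto
    then show "(\<lambda>n. \<bar>K\<bar> * expectation (\<lambda>x. norm (Xn n x - X x))) \<longlonglongrightarrow> 0" by simp
    have "eventually (\<lambda>n. sq_norm M (\<lambda>x. Xn n x - X x) < 1) sequentially"
      using z by (rule order_tendstoD) simp
    then show "\<forall>\<^sub>F n in sequentially. norm (expectation (\<lambda>\<omega>. \<psi> (Xn n \<omega>)) - expectation (\<lambda>\<omega>. \<psi> (X \<omega>)))
        \<le> \<bar>K\<bar> * expectation (\<lambda>x. norm (Xn n x - X x))"
    proof eventually_elim
      case (elim n)
      then have "sq_integrable M (\<lambda>x. Xn n x - X x)"
        by (auto simp: sq_integrable_def intro: less_trans)
      then have i: "integrable M (\<lambda>x. \<bar>K\<bar> * norm (Xn n x - X x))"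
        by (intro integrable_mult_right sq_integrable_norm_integrable(1))
      have "norm (expectation (\<lambda>\<omega>. \<psi> (Xn n \<omega>)) - expectation (\<lambda>\<omega>. \<psi> (X \<omega>)))
          = norm (expectation (\<lambda>\<omega>. \<psi> (Xn n \<omega>) - \<psi> (X \<omega>)))"
        by (subst Bochner_Integration.integral_diff) (auto intro: int)
      also have "\<dots> \<le> expectation (\<lambda>x. \<bar>K\<bar> * norm (Xn n x - X x))"
        by (rule order_trans[OF integral_norm_bound], rule integral_mono[OF _ i])
          (auto intro!: int \<psi>' Bochner_Integration.integrable_diff)
      finally show ?case by simp
    qed
  qed
  then show ?thesis by (simp add: LIM_zero_iff)
qed

text \<open>Preimages of open sets form a generator that is stable under intersection, so the
  product rule extends to the generated sigma algebras.\<close>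

lemma indep_var_borel_openI:
  fixes X Y :: "'a \<Rightarrow> 'b::{banach,second_countable_topology}"
  assumes [measurable]: "X \<in> borel_measurable M" "Y \<in> borel_measurable M"
    and opens: "\<And>U V. open U \<Longrightarrow> open V \<Longrightarrow>
      prob ((X -` U \<inter> space M) \<inter> (Y -` V \<inter> space M)) = prob (X -` U \<inter> space M) * prob (Y -` V \<inter> space M)"
  shows "indep_var borel X borel Y"
proof -
  have gen: "sigma_sets (space M) {Z -` A \<inter> space M |A. A \<in> sets borel}
      = sigma_sets (space M) {Z -` U \<inter> space M |U. open U}" for Z :: "'a \<Rightarrow> 'b"
  proof -
    have "{Z -` A \<inter> space M |A. A \<in> sets borel} = sigma_sets (space M) {Z -` U \<inter> space M |U. U \<in> {S. open S}}"
      using sigma_sets_vimage_commute[of Z "space M" UNIV "{S. open S}"] by (simp add: borel_def)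
    then have "{Z -` A \<inter> space M |A. A \<in> sets borel} = sigma_sets (space M) {Z -` U \<inter> space M |U. open U}"
      by simp
    moreover have "{Z -` U \<inter> space M |U. open U} \<subseteq> Pow (space M)" by auto
    ultimately show ?thesis by (simp only: sigma_sets_sigma_sets_eq)
  qed
  have stable: "Int_stable {Z -` U \<inter> space M |U. open U}" for Z :: "'a \<Rightarrow> 'b"
  proof (safe intro!: Int_stableI)
    fix U V :: "'b set" assume "open U" "open V"
    then show "\<exists>W. Z -` U \<inter> space M \<inter> (Z -` V \<inter> space M) = Z -` W \<inter> space M \<and> open W"
      by (intro exI[of _ "U \<inter> V"]) auto
  qed
  have "indep_set {X -` U \<inter> space M |U. open U} {Y -` V \<inter> space M |V. open V}"
  proof (rule indep_setI)
    fix a b assume "a \<in> {X -` U \<inter> space M |U. open U}" "b \<in> {Y -` V \<inter> space M |V. open V}"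
    then obtain U V where "open U" "open V" "a = X -` U \<inter> space M" "b = Y -` V \<inter> space M" by blast
    then show "prob (a \<inter> b) = prob a * prob b" using opens by simp
  next
    show "{X -` U \<inter> space M |U. open U} \<subseteq> events"
      using measurable_sets[OF assms(1)] borel_open by blast
    show "{Y -` V \<inter> space M |V. open V} \<subseteq> events"
      using measurable_sets[OF assms(2)] borel_open by blast
  qed
  from indep_set_sigma_sets[OF this stable stable]
  show ?thesis
    unfolding indep_var_eq gen by simp
qed

text \<open>The indicator of an open set is a pointwise limit of Lipschitz functions with values in
  [0, 1]. For these the product rule survives mean square limits, and dominated convergence then
  restores the indicators.\<close>

lemma indep_var_L2_limit:
  fixes X Y :: "'a \<Rightarrow> 'b::{banach,second_countable_topology}"
  assumes indep: "\<And>n. indep_var borel (Xn n) borel (Yn n)"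
    and X: "L2_tendsto M Xn X" and Y: "L2_tendsto M Yn Y"
  shows "indep_var borel X borel Y"
proof (rule indep_var_borel_openI)
  note [measurable] = L2_tendstoD(1,2)[OF X] L2_tendstoD(1,2)[OF Y]
  show "X \<in> borel_measurable M" "Y \<in> borel_measurable M" by measurable
  fix U :: "'b set" and V :: "'b set" assume UV: "open U" "open V"
  have [measurable]: "U \<in> sets borel" "V \<in> sets borel" using UV by auto
  have approx: "\<exists>f. (\<forall>n x y. \<bar>f n x - f n y\<bar> \<le> real n * norm (x - y)) \<and> (\<forall>n x. 0 \<le> f n x \<and> f n x \<le> 1) \<and>
      (\<forall>x. (\<lambda>n. f n x) \<longlonglongrightarrow> indicator W x) \<and> (\<forall>n. f n \<in> borel_measurable borel)"
    if W: "open W" for W :: "'b set"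
  \<comment> \<open>The whole space is separate because \<open>infdist x {}\<close> is 0 by
    convention, so the formula below would give 0 in place of 1.\<close>
  proof (cases "W = UNIV")
    case True then show ?thesis by (intro exI[of _ "\<lambda>_ _. 1::real"]) auto
  next
    case False
    define f where "f n x = min 1 (real n * infdist x (- W))" for n x
    have 1: "\<bar>f n x - f n y\<bar> \<le> real n * norm (x - y)" for n x y
    proof -
      have "\<bar>real n * infdist x (- W) - real n * infdist y (- W)\<bar> \<le> real n * norm (x - y)"
        using mult_left_mono[OF infdist_triangle_abs[of x "- W" y], of "real n"]
        by (simp add: right_diff_distrib[symmetric] abs_mult dist_norm)
      then show ?thesis by (auto simp: f_def min_def)
    qed
    have 2: "(\<lambda>n. f n x) \<longlonglongrightarrow> indicator W x" for x
    proof (cases "x \<in> W")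
      case True
      have "infdist x (- W) \<noteq> 0"
        using in_closed_iff_infdist_zero[of "- W" x] W False True by auto
      then have pos: "0 < infdist x (- W)" using infdist_nonneg[of x "- W"] by simp
      then obtain N where N: "1 < real N * infdist x (- W)"
        using reals_Archimedean3 by blast
      have "f n x = 1" if "N \<le> n" for n
      proof -
        have "real N * infdist x (- W) \<le> real n * infdist x (- W)"
          using that by (intro mult_right_mono) (auto simp: infdist_nonneg)
        then show ?thesis using N by (simp add: f_def)
      qed
      then have "\<forall>\<^sub>F n in sequentially. f n x = 1" by (auto simp: eventually_sequentially)
      then show ?thesis using True by (simp add: tendsto_eventually)
    next
      case x: False
      then have "f n x = 0" for n by (simp add: f_def)
      then show ?thesis using x by simp
    qed
    have 3: "f n \<in> borel_measurable borel" for n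
      unfolding f_def by (intro borel_measurable_continuous_onI continuous_intros)
    show ?thesis
      using 1 2 3 by (intro exI[of _ f]) (auto simp: f_def infdist_nonneg)
  qed
  obtain f where f: "\<And>n x y. \<bar>f n x - f n y\<bar> \<le> real n * norm (x - y)"
    "\<And>n x. 0 \<le> f n x" "\<And>n x. f n x \<le> 1" "\<And>x. (\<lambda>n. f n x) \<longlonglongrightarrow> indicator U x"
    and fm [measurable]: "\<And>n. f n \<in> borel_measurable borel"
    using approx[OF UV(1)] by blast
  obtain g where g: "\<And>n x y. \<bar>g n x - g n y\<bar> \<le> real n * norm (x - y)"
    "\<And>n x. 0 \<le> g n x" "\<And>n x. g n x \<le> 1" "\<And>x. (\<lambda>n. g n x) \<longlonglongrightarrow> indicator V x"
    and gm [measurable]: "\<And>n. g n \<in> borel_measurable borel"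
    using approx[OF UV(2)] by blast
  have *: "expectation (\<lambda>\<omega>. f k (X \<omega>) * g k (Y \<omega>))
      = expectation (\<lambda>\<omega>. f k (X \<omega>)) * expectation (\<lambda>\<omega>. g k (Y \<omega>))" for k
  proof -
    \<comment> \<open>A product of two bounded Lipschitz functions is Lipschitz in the pair, so the
      joint convergence of \<open>(Xn, Yn)\<close> applies to it.\<close>
    define \<psi> where "\<psi> p = f k (fst p) * g k (snd p)" for p
    have "\<bar>\<psi> p - \<psi> q\<bar> \<le> (2 * real k) * norm (p - q)" for p q
    proof -
      have "\<psi> p - \<psi> q = (f k (fst p) - f k (fst q)) * g k (snd p) + f k (fst q) * (g k (snd p) - g k (snd q))"
        by (simp add: \<psi>_def algebra_simps)
      then have "\<bar>\<psi> p - \<psi> q\<bar> \<le> \<bar>f k (fst p) - f k (fst q)\<bar> * \<bar>g k (snd p)\<bar> + \<bar>f k (fst q)\<bar> * \<bar>g k (snd p) - g k (snd q)\<bar>"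
        by (metis abs_mult abs_triangle_ineq)
      also have "\<dots> \<le> \<bar>f k (fst p) - f k (fst q)\<bar> * 1 + 1 * \<bar>g k (snd p) - g k (snd q)\<bar>"
        using f(2,3) g(2,3) by (intro add_mono mult_left_mono mult_right_mono) auto
      also have "\<dots> \<le> real k * norm (fst p - fst q) + real k * norm (snd p - snd q)"
        using f(1)[of k "fst p" "fst q"] g(1)[of k "snd p" "snd q"] by simp
      also have "\<dots> \<le> real k * norm (p - q) + real k * norm (p - q)"
        using norm_fst_le[of "fst (p - q)" "snd (p - q)"] norm_snd_le[of "snd (p - q)" "fst (p - q)"]
        by (intro add_mono mult_left_mono) (auto simp: minus_prod_def)
      finally show ?thesis by simp
    qed
    moreover have "\<bar>\<psi> p\<bar> \<le> 1" for p
      using f(2,3)[of k "fst p"] g(2,3)[of k "snd p"] by (simp add: \<psi>_def abs_mult mult_le_one)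
    ultimately have l1: "(\<lambda>n. expectation (\<lambda>\<omega>. \<psi> (Xn n \<omega>, Yn n \<omega>))) \<longlonglongrightarrow> expectation (\<lambda>\<omega>. \<psi> (X \<omega>, Y \<omega>))"
      by (rule expectation_Lipschitz_tendsto[OF L2_tendsto_Pair[OF X Y]])
    have l2: "expectation (\<lambda>\<omega>. \<psi> (Xn n \<omega>, Yn n \<omega>))
        = expectation (\<lambda>\<omega>. f k (Xn n \<omega>)) * expectation (\<lambda>\<omega>. g k (Yn n \<omega>))" for n
    proof -
      have "indep_var borel (f k \<circ> Xn n) borel (g k \<circ> Yn n)"
        by (rule indep_var_compose[OF indep]) measurable
      moreover have "integrable M (f k \<circ> Xn n)" "integrable M (g k \<circ> Yn n)"
        using f(2,3) g(2,3) by (auto intro!: integrable_const_bound[of _ 1])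
      ultimately show ?thesis
        using indep_var_lebesgue_integral[of "f k \<circ> Xn n" "g k \<circ> Yn n"] by (simp add: \<psi>_def o_def)
    qed
    have l3: "(\<lambda>n. expectation (\<lambda>\<omega>. f k (Xn n \<omega>)) * expectation (\<lambda>\<omega>. g k (Yn n \<omega>)))
        \<longlonglongrightarrow> expectation (\<lambda>\<omega>. f k (X \<omega>)) * expectation (\<lambda>\<omega>. g k (Y \<omega>))"
      using f(1,2,3) g(1,2,3)
      by (intro tendsto_mult expectation_Lipschitz_tendsto[OF X, of _ "real k" 1]
          expectation_Lipschitz_tendsto[OF Y, of _ "real k" 1]) auto
    show ?thesis
      using LIMSEQ_unique[OF l1[unfolded l2] l3] by (simp add: \<psi>_def)
  qed
  have lim1: "(\<lambda>k. expectation (\<lambda>\<omega>. f k (X \<omega>) * g k (Y \<omega>)))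
      \<longlonglongrightarrow> expectation (\<lambda>\<omega>. indicator U (X \<omega>) * indicator V (Y \<omega>))"
    using f(2,3) g(2,3)
    by (intro integral_dominated_convergence[where w="\<lambda>_. 1"])
      (auto intro!: tendsto_mult f(4) g(4) simp: abs_mult mult_le_one)
  have lim2: "(\<lambda>k. expectation (\<lambda>\<omega>. f k (X \<omega>)) * expectation (\<lambda>\<omega>. g k (Y \<omega>)))
      \<longlonglongrightarrow> expectation (\<lambda>\<omega>. indicator U (X \<omega>)) * expectation (\<lambda>\<omega>. indicator V (Y \<omega>))"
    using f(2,3) g(2,3)
    by (intro tendsto_mult integral_dominated_convergence[where w="\<lambda>_. 1"])
      (auto intro!: f(4) g(4))
  have e0: "expectation (\<lambda>\<omega>. indicator U (X \<omega>) * indicator V (Y \<omega>))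
      = expectation (\<lambda>\<omega>. indicator U (X \<omega>)) * expectation (\<lambda>\<omega>. indicator V (Y \<omega>) :: real)"
    by (rule LIMSEQ_unique[OF lim1[unfolded *] lim2])
  have ind: "(expectation (indicator A) :: real) = prob A" if "A \<subseteq> space M" for A
    using that by (simp add: Int_absorb2)
  have e1: "(expectation (\<lambda>\<omega>. indicator U (X \<omega>)) :: real) = prob (X -` U \<inter> space M)"
    by (rule trans[OF Bochner_Integration.integral_cong[OF refl] ind[of "X -` U \<inter> space M"]]) (auto split: split_indicator)
  have e2: "(expectation (\<lambda>\<omega>. indicator V (Y \<omega>)) :: real) = prob (Y -` V \<inter> space M)"
    by (rule trans[OF Bochner_Integration.integral_cong[OF refl] ind[of "Y -` V \<inter> space M"]]) (auto split: split_indicator)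
  have e3: "(expectation (\<lambda>\<omega>. indicator U (X \<omega>) * indicator V (Y \<omega>)) :: real)
      = prob ((X -` U \<inter> space M) \<inter> (Y -` V \<inter> space M))"
    by (rule trans[OF Bochner_Integration.integral_cong[OF refl] ind[of "(X -` U \<inter> space M) \<inter> (Y -` V \<inter> space M)"]]) (auto split: split_indicator)
  show "prob ((X -` U \<inter> space M) \<inter> (Y -` V \<inter> space M))
      = prob (X -` U \<inter> space M) * prob (Y -` V \<inter> space M)"
    by (rule trans[OF e3[symmetric] trans[OF e0 arg_cong2[where f="(*)", OF e1 e2]]])
qed

text \<open>Independence makes the joint law a product measure, and Fubini applies to it. This takes
  the place of conditional expectations given the past.\<close>

lemma indep_var_iterated_expectation:
  fixes X Y :: "'a \<Rightarrow> 'b::{banach,second_countable_topology}"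
    and k :: "'b \<Rightarrow> 'b \<Rightarrow> real"
  assumes indep: "indep_var borel X borel Y"
    and k [measurable]: "case_prod k \<in> borel_measurable (borel \<Otimes>\<^sub>M borel)"
    and int: "integrable M (\<lambda>\<omega>. k (X \<omega>) (Y \<omega>))"
  shows "expectation (\<lambda>\<omega>. k (X \<omega>) (Y \<omega>)) = expectation (\<lambda>\<omega>. expectation (\<lambda>\<omega>'. k (X \<omega>) (Y \<omega>')))"
    and "integrable M (\<lambda>\<omega>. expectation (\<lambda>\<omega>'. k (X \<omega>) (Y \<omega>')))"
proof -
  have [measurable]: "X \<in> borel_measurable M" "Y \<in> borel_measurable M"
    using indep_var_rv1[OF indep] indep_var_rv2[OF indep] by auto
  have eq: "distr M borel X \<Otimes>\<^sub>M distr M borel Y = distr M (borel \<Otimes>\<^sub>M borel) (\<lambda>x. (X x, Y x))"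
    using indep by (simp add: indep_var_distribution_eq)
  interpret X: prob_space "distr M borel X" by (rule prob_space_distr) measurable
  interpret Y: prob_space "distr M borel Y" by (rule prob_space_distr) measurable
  interpret XY: pair_prob_space "distr M borel X" "distr M borel Y" ..
  have i: "integrable (distr M borel X \<Otimes>\<^sub>M distr M borel Y) (case_prod k)"
    unfolding eq by (subst integrable_distr_eq) (use int in auto)
  have inner: "(LINT y|distr M borel Y. k x y) = expectation (\<lambda>\<omega>'. k x (Y \<omega>'))" for x
    by (subst integral_distr) auto
  have m: "(\<lambda>x. expectation (\<lambda>\<omega>'. k x (Y \<omega>'))) \<in> borel_measurable borel"
  proof -
    have "(\<lambda>x. LINT y|distr M borel Y. k x y) \<in> borel_measurable borel"
      by (rule Y.borel_measurable_lebesgue_integral) simp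
    then show ?thesis unfolding inner .
  qed
  have "expectation (\<lambda>\<omega>. k (X \<omega>) (Y \<omega>)) = integral\<^sup>L (distr M borel X \<Otimes>\<^sub>M distr M borel Y) (case_prod k)"
    unfolding eq by (subst integral_distr) auto
  also have "\<dots> = (LINT x|distr M borel X. LINT y|distr M borel Y. k x y)"
    using XY.integral_fst'[OF i] by simp
  also have "\<dots> = expectation (\<lambda>\<omega>. expectation (\<lambda>\<omega>'. k (X \<omega>) (Y \<omega>')))"
    unfolding inner by (rule integral_distr) (use m in auto)
  finally show "expectation (\<lambda>\<omega>. k (X \<omega>) (Y \<omega>)) = expectation (\<lambda>\<omega>. expectation (\<lambda>\<omega>'. k (X \<omega>) (Y \<omega>')))" .
  have "integrable (distr M borel X) (\<lambda>x. LINT y|distr M borel Y. k x y)"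
    using XY.integrable_fst'[OF i] by simp
  then show "integrable M (\<lambda>\<omega>. expectation (\<lambda>\<omega>'. k (X \<omega>) (Y \<omega>')))"
    unfolding inner by (subst (asm) integrable_distr_eq) (use m in auto)
qed

end

section \<open>Integrals against a compensated Poisson random measure\<close>

text \<open>Total mass, mean and second factorial moment of the Poisson law. Each factor in front
  cancels one factor of the factorial and shifts the exponential series by one index.\<close>

lemma poisson_sums:
  fixes a :: real
  shows "(\<lambda>n. a ^ n / fact n * exp (- a)) sums 1"
    and "(\<lambda>n. real n * (a ^ n / fact n * exp (- a))) sums a"
    and "(\<lambda>n. real n * (real n - 1) * (a ^ n / fact n * exp (- a))) sums a\<^sup>2"
proof -
  have "(\<lambda>n. a ^ n /\<^sub>R fact n) sums exp a" by (rule exp_converges)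
  from sums_mult2[OF this, of "exp (- a)"]
  show 0: "(\<lambda>n. a ^ n / fact n * exp (- a)) sums 1"
    by (simp add: exp_minus field_simps)
  have Suc_eq: "real (Suc n) * (a ^ Suc n / fact (Suc n) * exp (- a)) = a * (a ^ n / fact n * exp (- a))" for n
    by (simp add: fact_Suc del: of_nat_Suc)
  have "(\<lambda>n. real (Suc n) * (a ^ Suc n / fact (Suc n) * exp (- a))) sums (a * 1)"
    unfolding Suc_eq by (rule sums_mult[OF 0])
  then show 1: "(\<lambda>n. real n * (a ^ n / fact n * exp (- a))) sums a"
    by (subst (asm) sums_Suc_iff) simp
  have Suc_eq': "real (Suc n) * (real (Suc n) - 1) * (a ^ Suc n / fact (Suc n) * exp (- a))
      = a * (real n * (a ^ n / fact n * exp (- a)))" for n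
  proof -
    have "real (Suc n) * (real (Suc n) - 1) * (a ^ Suc n / fact (Suc n) * exp (- a))
        = real n * (real (Suc n) * (a ^ Suc n / fact (Suc n) * exp (- a)))" by simp
    then show ?thesis unfolding Suc_eq by simp
  qed
  have "(\<lambda>n. real (Suc n) * (real (Suc n) - 1) * (a ^ Suc n / fact (Suc n) * exp (- a))) sums (a * a)"
    unfolding Suc_eq' by (rule sums_mult[OF 1])
  then show "(\<lambda>n. real n * (real n - 1) * (a ^ n / fact n * exp (- a))) sums a\<^sup>2"
    by (subst (asm) sums_Suc_iff) (simp add: power2_eq_square)
qed

locale poisson_measure = prob_space M for M :: "'w measure" +
  fixes \<mu> :: "'z measure" and \<pi> :: "'w \<Rightarrow> 'z measure"
  assumes poisson: "poisson_random_measure M \<mu> \<pi>"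
begin

lemma space_pi [simp]: "\<omega> \<in> space M \<Longrightarrow> space (\<pi> \<omega>) = space \<mu>"
  and sets_pi [simp]: "\<omega> \<in> space M \<Longrightarrow> sets (\<pi> \<omega>) = sets \<mu>"
  and emeasure_pi_measurable [measurable]: "B \<in> sets \<mu> \<Longrightarrow> (\<lambda>\<omega>. emeasure (\<pi> \<omega>) B) \<in> borel_measurable M"
  using poisson by (auto simp: poisson_random_measure_def)

lemma measure_pi_measurable [measurable]:
  "B \<in> sets \<mu> \<Longrightarrow> (\<lambda>\<omega>. measure (\<pi> \<omega>) B) \<in> borel_measurable M"
  unfolding measure_def by measurable

lemma prob_count:
  assumes "B \<in> sets \<mu>" "emeasure \<mu> B < \<infinity>"
  shows "prob {\<omega>\<in>space M. emeasure (\<pi> \<omega>) B = of_nat n} = measure \<mu> B ^ n / fact n * exp (- measure \<mu> B)"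
  using poisson assms unfolding poisson_random_measure_def by blast

text \<open>The Poisson weights already sum to 1, so the value infinity and all non-integers have
  probability 0.\<close>

lemma AE_count:
  assumes B: "B \<in> sets \<mu>" "emeasure \<mu> B < \<infinity>"
  shows "AE \<omega> in M. \<exists>n::nat. emeasure (\<pi> \<omega>) B = of_nat n"
proof -
  note [measurable] = B(1)
  let ?A = "\<lambda>n::nat. {\<omega>\<in>space M. emeasure (\<pi> \<omega>) B = of_nat n}"
  have "disjoint_family ?A" by (auto simp: disjoint_family_on_def)
  then have "(\<lambda>n. prob (?A n)) sums prob (\<Union>n. ?A n)"
    by (intro finite_measure_UNION) auto
  then have "prob (\<Union>n. ?A n) = 1"
    using poisson_sums(1)[of "measure \<mu> B"] prob_count[OF B] by (simp add: sums_unique2)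
  moreover have "(\<Union>n. ?A n) \<in> events" by measurable
  ultimately have "AE \<omega> in M. \<omega> \<in> (\<Union>n. ?A n)"
    using prob_eq_1 by simp
  then show ?thesis by eventually_elim auto
qed

lemma AE_finite_pi:
  assumes "B \<in> sets \<mu>" "emeasure \<mu> B < \<infinity>"
  shows "AE \<omega> in M. emeasure (\<pi> \<omega>) B < \<infinity>"
  using AE_count[OF assms] by eventually_elim (auto simp: of_nat_less_top)

lemma AE_count_real:
  assumes "B \<in> sets \<mu>" "emeasure \<mu> B < \<infinity>"
  shows "AE \<omega> in M. \<exists>n::nat. measure (\<pi> \<omega>) B = real n"
  using AE_count[OF assms] by eventually_elim (auto simp: measure_def)

lemma nn_integral_count:
  assumes B: "B \<in> sets \<mu>" "emeasure \<mu> B < \<infinity>"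
  shows "(\<integral>\<^sup>+\<omega>. f (measure (\<pi> \<omega>) B) \<partial>M)
    = (\<Sum>n. f (real n) * ennreal (measure \<mu> B ^ n / fact n * exp (- measure \<mu> B)))"
proof -
  note [measurable] = B(1)
  let ?A = "\<lambda>n::nat. {\<omega>\<in>space M. emeasure (\<pi> \<omega>) B = of_nat n}"
  have disj: "disjoint_family ?A" by (auto simp: disjoint_family_on_def)
  have "(\<integral>\<^sup>+\<omega>. f (measure (\<pi> \<omega>) B) \<partial>M) = (\<integral>\<^sup>+\<omega>. (\<Sum>n. f (real n) * indicator (?A n) \<omega>) \<partial>M)"
  proof (intro nn_integral_cong_AE)
    show "AE \<omega> in M. f (measure (\<pi> \<omega>) B) = (\<Sum>n. f (real n) * indicator (?A n) \<omega>)"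
      using AE_count[OF B] AE_space
    proof eventually_elim
      case (elim \<omega>)
      then obtain n :: nat where n: "emeasure (\<pi> \<omega>) B = of_nat n" by blast
      then have "\<omega> \<in> ?A n" "measure (\<pi> \<omega>) B = real n" using elim by (auto simp: measure_def)
      then show ?case using suminf_cmult_indicator[OF disj, of \<omega> n "\<lambda>n. f (real n)"] by simp
    qed
  qed
  also have "\<dots> = (\<Sum>n. f (real n) * emeasure M (?A n))"
    by (subst nn_integral_suminf) (auto simp: nn_integral_cmult_indicator)
  also have "\<dots> = (\<Sum>n. f (real n) * ennreal (measure \<mu> B ^ n / fact n * exp (- measure \<mu> B)))"
    using prob_count[OF B] by (simp add: emeasure_eq_measure)
  finally show ?thesis .
qed

text \<open>The factorial moment is the useful second moment: \<open>n * (n - 1)\<close> vanishes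
  for at most one point and is therefore the price of two or more points, with mean quadratic in the
  intensity.\<close>

lemma count_moments:
  assumes B: "B \<in> sets \<mu>" "emeasure \<mu> B < \<infinity>"
  shows "integrable M (\<lambda>\<omega>. measure (\<pi> \<omega>) B)"
    and "expectation (\<lambda>\<omega>. measure (\<pi> \<omega>) B) = measure \<mu> B"
    and "integrable M (\<lambda>\<omega>. measure (\<pi> \<omega>) B * (measure (\<pi> \<omega>) B - 1))"
    and "expectation (\<lambda>\<omega>. measure (\<pi> \<omega>) B * (measure (\<pi> \<omega>) B - 1)) = (measure \<mu> B)\<^sup>2"
proof -
  note [measurable] = B(1)
  have p: "0 \<le> measure \<mu> B ^ n / fact n * exp (- measure \<mu> B)" for n by simp
  let ?p = "\<lambda>n. measure \<mu> B ^ n / fact n * exp (- measure \<mu> B)"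
  have series: "(\<Sum>n. ennreal (c n) * ennreal (?p n)) = ennreal s"
    if "\<And>n. 0 \<le> c n" "(\<lambda>n. c n * ?p n) sums s" for c s
  proof -
    have "(\<Sum>n. ennreal (c n) * ennreal (?p n)) = (\<Sum>n. ennreal (c n * ?p n))"
      by (intro suminf_cong ennreal_mult[symmetric] that(1) p)
    also have "\<dots> = ennreal s"
      by (rule suminf_ennreal_eq[OF _ that(2)]) (intro mult_nonneg_nonneg that(1) p)
    finally show ?thesis .
  qed
  have "(\<integral>\<^sup>+\<omega>. ennreal (measure (\<pi> \<omega>) B) \<partial>M) = ennreal (measure \<mu> B)"
    unfolding nn_integral_count[OF B, of ennreal] by (rule series[OF _ poisson_sums(2)]) simp
  then show "integrable M (\<lambda>\<omega>. measure (\<pi> \<omega>) B)" "expectation (\<lambda>\<omega>. measure (\<pi> \<omega>) B) = measure \<mu> B"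
    using nn_integral_eq_integrable[of "\<lambda>\<omega>. measure (\<pi> \<omega>) B" M "measure \<mu> B"] by auto
  have nn: "0 \<le> real n * (real n - 1)" for n by (cases n) auto
  have "(\<integral>\<^sup>+\<omega>. ennreal (measure (\<pi> \<omega>) B * (measure (\<pi> \<omega>) B - 1)) \<partial>M) = ennreal ((measure \<mu> B)\<^sup>2)"
    unfolding nn_integral_count[OF B, of "\<lambda>x. ennreal (x * (x - 1))"]
    by (rule series[OF nn poisson_sums(3)])
  moreover have "AE \<omega> in M. 0 \<le> measure (\<pi> \<omega>) B * (measure (\<pi> \<omega>) B - 1)"
    using AE_count_real[OF B] by eventually_elim (use nn in auto)
  ultimately show "integrable M (\<lambda>\<omega>. measure (\<pi> \<omega>) B * (measure (\<pi> \<omega>) B - 1))"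
    "expectation (\<lambda>\<omega>. measure (\<pi> \<omega>) B * (measure (\<pi> \<omega>) B - 1)) = (measure \<mu> B)\<^sup>2"
    using nn_integral_eq_integrable[of "\<lambda>\<omega>. measure (\<pi> \<omega>) B * (measure (\<pi> \<omega>) B - 1)" M "(measure \<mu> B)\<^sup>2"]
    by auto
qed

lemma indep_vars_counts:
  assumes "range B \<subseteq> sets \<mu>" "disjoint_family (B :: nat \<Rightarrow> 'z set)"
  shows "indep_vars (\<lambda>_. borel) (\<lambda>i \<omega>. emeasure (\<pi> \<omega>) (B i)) UNIV"
  using poisson assms unfolding poisson_random_measure_def by blast

text \<open>Independence is given for sequences of disjoint sets, so the pair is padded with empty
  sets by \<open>binaryset\<close>.\<close>

lemma indep_counts:
  assumes "B \<in> sets \<mu>" "C \<in> sets \<mu>" "B \<inter> C = {}"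
  shows "indep_var borel (\<lambda>\<omega>. measure (\<pi> \<omega>) B) borel (\<lambda>\<omega>. measure (\<pi> \<omega>) C)"
proof -
  let ?D = "binaryset B C"
  have "range ?D \<subseteq> sets \<mu>" "disjoint_family ?D"
    using assms by (auto simp: range_binaryset_eq disjoint_family_on_def binaryset_def)
  then have "indep_vars (\<lambda>_. borel) (\<lambda>i \<omega>. emeasure (\<pi> \<omega>) (?D i)) UNIV" by (rule indep_vars_counts)
  then have "indep_var
      (PiM {0} (\<lambda>_. borel)) (\<lambda>\<omega>. restrict (\<lambda>i. emeasure (\<pi> \<omega>) (?D i)) {0})
      (PiM {1} (\<lambda>_. borel)) (\<lambda>\<omega>. restrict (\<lambda>i. emeasure (\<pi> \<omega>) (?D i)) {1})"
    by (rule indep_var_restrict) auto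
  from indep_var_compose[OF this, of "\<lambda>f. enn2real (f 0)" borel "\<lambda>f. enn2real (f 1)" borel]
  show ?thesis by (simp add: o_def binaryset_def measure_def)
qed

text \<open>Two level sets of a simple function are equal or disjoint. In the first case this is the
  Poisson variance, rebuilt from the factorial moment; in the second it is independence of centred
  counts.\<close>

lemma count_covariance:
  assumes B: "B \<in> sets \<mu>" "emeasure \<mu> B < \<infinity>" and C: "C \<in> sets \<mu>" "emeasure \<mu> C < \<infinity>"
    and BC: "B = C \<or> B \<inter> C = {}"
  shows "integrable M (\<lambda>\<omega>. (measure (\<pi> \<omega>) B - measure \<mu> B) * (measure (\<pi> \<omega>) C - measure \<mu> C))"
    and "expectation (\<lambda>\<omega>. (measure (\<pi> \<omega>) B - measure \<mu> B) * (measure (\<pi> \<omega>) C - measure \<mu> C))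
      = (if B = C then measure \<mu> B else 0)"
proof -
  note mB = count_moments[OF B] and mC = count_moments[OF C]
  let ?X = "\<lambda>\<omega>. measure (\<pi> \<omega>) B - measure \<mu> B" and ?Y = "\<lambda>\<omega>. measure (\<pi> \<omega>) C - measure \<mu> C"
  have *: "integrable M (\<lambda>\<omega>. ?X \<omega> * ?Y \<omega>) \<and>
      expectation (\<lambda>\<omega>. ?X \<omega> * ?Y \<omega>) = (if B = C then measure \<mu> B else 0)"
  proof (cases "B = C")
    case True
    define P where "P \<omega> = measure (\<pi> \<omega>) B * (measure (\<pi> \<omega>) B - 1)" for \<omega>
    have P: "integrable M P" "expectation P = (measure \<mu> B)\<^sup>2" using mB by (simp_all add: P_def[abs_def])
    have eq: "?X \<omega> * ?Y \<omega> = P \<omega> + (1 - 2 * measure \<mu> B) * measure (\<pi> \<omega>) B + (measure \<mu> B)\<^sup>2" for \<omega>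
      using True by (simp add: P_def algebra_simps power2_eq_square)
    have "integrable M (\<lambda>\<omega>. ?X \<omega> * ?Y \<omega>)"
      unfolding eq by (intro Bochner_Integration.integrable_add integrable_mult_right P mB) simp
    moreover have "expectation (\<lambda>\<omega>. ?X \<omega> * ?Y \<omega>) = (measure \<mu> B)\<^sup>2 + (1 - 2 * measure \<mu> B) * measure \<mu> B + (measure \<mu> B)\<^sup>2"
      unfolding eq using P mB(1,2) by (simp add: prob_space)
    ultimately show ?thesis using True by (simp add: algebra_simps power2_eq_square)
  next
    case False
    then have "B \<inter> C = {}" using BC by auto
    from indep_var_compose[OF indep_counts[OF B(1) C(1) this], of "\<lambda>x. x - measure \<mu> B" borel "\<lambda>x. x - measure \<mu> C" borel]
    have "indep_var borel ?X borel ?Y" by (simp add: o_def)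
    moreover have "integrable M ?X" "integrable M ?Y" using mB mC by auto
    moreover have "expectation ?X = 0" using mB by (simp add: prob_space)
    ultimately show ?thesis
      using indep_var_lebesgue_integral[of ?X ?Y] indep_var_integrable[of ?X ?Y] False by simp
  qed
  then show "integrable M (\<lambda>\<omega>. ?X \<omega> * ?Y \<omega>)"
    "expectation (\<lambda>\<omega>. ?X \<omega> * ?Y \<omega>) = (if B = C then measure \<mu> B else 0)" by auto
qed

subsection \<open>Simple integrands\<close>

text \<open>Restricting to nonzero levels keeps exactly the level sets of finite intensity, so every
  summand is a centred Poisson count with finite moments. The index set does not depend on
  \<open>\<omega>\<close>, which makes measurability immediate.\<close>

definition compensated :: "('z \<Rightarrow> 'b::real_vector) \<Rightarrow> 'w \<Rightarrow> 'b" where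
  "compensated g \<omega> = (\<Sum>y\<in>g ` space \<mu> - {0}.
     (measure (\<pi> \<omega>) {x\<in>space \<mu>. g x = y} - measure \<mu> {x\<in>space \<mu>. g x = y}) *\<^sub>R y)"

lemma simple_levels:
  assumes "simple_integrable \<mu> g"
  shows "finite (g ` space \<mu>)" "{x\<in>space \<mu>. g x = y} \<in> sets \<mu>"
    "y \<noteq> 0 \<Longrightarrow> emeasure \<mu> {x\<in>space \<mu>. g x = y} < \<infinity>"
    "{x\<in>space \<mu>. g x \<noteq> 0} \<in> sets \<mu>" "emeasure \<mu> {x\<in>space \<mu>. g x \<noteq> 0} < \<infinity>"
proof -
  have sf: "simple_function \<mu> g" using assms by (simp add: simple_integrable_iff)
  then show "finite (g ` space \<mu>)" by (simp add: simple_function_def)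
  have meas: "{x\<in>space \<mu>. g x \<in> S} \<in> sets \<mu>" for S
    using simple_functionD(2)[OF sf, of S] by (simp add: vimage_def Int_def conj_commute)
  show l: "{x\<in>space \<mu>. g x = y} \<in> sets \<mu>" using meas[of "{y}"] by simp
  show nz: "{x\<in>space \<mu>. g x \<noteq> 0} \<in> sets \<mu>" using meas[of "- {0}"] by simp
  show fin: "emeasure \<mu> {x\<in>space \<mu>. g x \<noteq> 0} < \<infinity>"
    using assms by (simp add: simple_integrable_iff less_top)
  show "emeasure \<mu> {x\<in>space \<mu>. g x = y} < \<infinity>" if "y \<noteq> 0"
    by (rule le_less_trans[OF emeasure_mono fin]) (use that nz in auto)
qed

lemma simple_integral_nonzero:
  fixes g :: "'x \<Rightarrow> 'b::real_vector"
  assumes "finite (g ` space N)"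
  shows "simple_integral N g = (\<Sum>y\<in>g ` space N - {0}. measure N {x\<in>space N. g x = y} *\<^sub>R y)"
  unfolding simple_integral_def by (rule sum.mono_neutral_right) (use assms in auto)

lemma compensated_eq:
  assumes "\<omega> \<in> space M" "simple_integrable \<mu> g"
  shows "compensated g \<omega> = simple_integral (\<pi> \<omega>) g - simple_integral \<mu> g"
  using assms simple_levels(1)[OF assms(2)]
  by (simp add: simple_integral_nonzero compensated_def scaleR_diff_left sum_subtractf)

lemma compensated_measurable [measurable]:
  fixes g :: "'z \<Rightarrow> 'b::{real_normed_vector,second_countable_topology}"
  assumes "simple_integrable \<mu> g"
  shows "compensated g \<in> borel_measurable M"
  unfolding compensated_def[abs_def] using simple_levels(2)[OF assms] by measurable

lemma AE_simple_integrable_pi: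
  assumes g: "simple_integrable \<mu> g"
  shows "AE \<omega> in M. simple_integrable (\<pi> \<omega>) g"
  using AE_finite_pi[OF simple_levels(4,5)[OF g]] AE_space
proof eventually_elim
  case (elim \<omega>)
  have "simple_function (\<pi> \<omega>) g"
    using g elim simple_function_cong_algebra[of \<mu> "\<pi> \<omega>" g] by (simp add: simple_integrable_iff)
  then show ?case using elim by (simp add: simple_integrable_iff less_top)
qed

lemma simple_integrable_add:
  "simple_integrable \<mu> f \<Longrightarrow> simple_integrable \<mu> g \<Longrightarrow> simple_integrable \<mu> (\<lambda>x. f x + g x)"
  by (rule simple_integrable_compose2[where p="(+)"]) auto

lemma simple_integrable_linear:
  assumes "linear L" "simple_integrable \<mu> g"
  shows "simple_integrable \<mu> (\<lambda>x. L (g x))"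
  by (rule simple_integrable_compose[OF assms(2), of L]) (rule linear_0[OF assms(1)])

lemma compensated_add:
  assumes "simple_integrable \<mu> f" "simple_integrable \<mu> g"
  shows "AE \<omega> in M. compensated (\<lambda>x. f x + g x) \<omega> = compensated f \<omega> + compensated g \<omega>"
  using AE_simple_integrable_pi[OF assms(1)] AE_simple_integrable_pi[OF assms(2)] AE_space
proof eventually_elim
  case (elim \<omega>)
  show ?case
    unfolding compensated_eq[OF elim(3) assms(1)] compensated_eq[OF elim(3) assms(2)]
      compensated_eq[OF elim(3) simple_integrable_add[OF assms]]
      simple_integral_add[OF assms] simple_integral_add[OF elim(1,2)] by simp
qed

lemma compensated_linear:
  assumes "linear L" "simple_integrable \<mu> g"
  shows "AE \<omega> in M. compensated (\<lambda>x. L (g x)) \<omega> = L (compensated g \<omega>)"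
  using AE_simple_integrable_pi[OF assms(2)] AE_space
proof eventually_elim
  case (elim \<omega>)
  show ?case
    unfolding compensated_eq[OF elim(2) assms(2)] compensated_eq[OF elim(2) simple_integrable_linear[OF assms]]
      simple_integral_linear[OF assms] simple_integral_linear[OF assms(1) elim(1)]
    by (rule linear_diff[OF assms(1), symmetric])
qed

text \<open>Expanding the squared norm gives products of centred counts of level sets. Different
  levels are uncorrelated, and on the diagonal the Poisson variance equals the intensity of the
  level.\<close>

lemma compensated_isometry:
  fixes g :: "'z \<Rightarrow> 'b::{real_inner,banach,second_countable_topology}"
  assumes g: "simple_integrable \<mu> g"
  shows "sq_norm M (compensated g) = sq_norm \<mu> g" "expectation (compensated g) = 0"
proof -
  let ?R = "g ` space \<mu> - {0}"
  let ?B = "\<lambda>y. {x\<in>space \<mu>. g x = y}"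
  let ?d = "\<lambda>y \<omega>. measure (\<pi> \<omega>) (?B y) - measure \<mu> (?B y)"
  note lev = simple_levels[OF g]
  have fin: "finite ?R" using lev(1) by simp
  have si: "simple_integrable \<mu> (\<lambda>x. (norm (g x))\<^sup>2)"
    by (rule simple_integrable_compose[OF g]) simp
  have sq: "(norm (compensated g \<omega>))\<^sup>2 = (\<Sum>y\<in>?R. \<Sum>z\<in>?R. (y \<bullet> z) * (?d y \<omega> * ?d z \<omega>))" for \<omega>
    unfolding compensated_def power2_norm_eq_inner inner_sum_left inner_sum_right
    by (intro sum.cong refl) (simp add: inner_commute)
  have cov: "integrable M (\<lambda>\<omega>. ?d y \<omega> * ?d z \<omega>)"
    "expectation (\<lambda>\<omega>. ?d y \<omega> * ?d z \<omega>) = (if y = z then measure \<mu> (?B y) else 0)"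
    if "y \<in> ?R" "z \<in> ?R" for y z
  proof -
    have d: "?B y = ?B z \<or> ?B y \<inter> ?B z = {}" and e: "?B y = ?B z \<longleftrightarrow> y = z"
      using that by auto
    note c = count_covariance[OF lev(2) lev(3) lev(2) lev(3) d]
    show "integrable M (\<lambda>\<omega>. ?d y \<omega> * ?d z \<omega>)" using c(1) that by simp
    show "expectation (\<lambda>\<omega>. ?d y \<omega> * ?d z \<omega>) = (if y = z then measure \<mu> (?B y) else 0)"
      using c(2) that e by simp
  qed
  have int: "integrable M (\<lambda>\<omega>. (norm (compensated g \<omega>))\<^sup>2)"
    unfolding sq by (intro Bochner_Integration.integrable_sum integrable_mult_right cov(1))
  have "expectation (\<lambda>\<omega>. (norm (compensated g \<omega>))\<^sup>2)
      = (\<Sum>y\<in>?R. expectation (\<lambda>\<omega>. \<Sum>z\<in>?R. (y \<bullet> z) * (?d y \<omega> * ?d z \<omega>)))"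
    unfolding sq
    by (rule Bochner_Integration.integral_sum) (intro Bochner_Integration.integrable_sum integrable_mult_right cov(1))
  also have "\<dots> = (\<Sum>y\<in>?R. \<Sum>z\<in>?R. (y \<bullet> z) * expectation (\<lambda>\<omega>. ?d y \<omega> * ?d z \<omega>))"
  proof (rule sum.cong[OF refl])
    fix y assume y: "y \<in> ?R"
    have "expectation (\<lambda>\<omega>. \<Sum>z\<in>?R. (y \<bullet> z) * (?d y \<omega> * ?d z \<omega>))
        = (\<Sum>z\<in>?R. expectation (\<lambda>\<omega>. (y \<bullet> z) * (?d y \<omega> * ?d z \<omega>)))"
      by (rule Bochner_Integration.integral_sum) (intro integrable_mult_right cov(1) y)
    then show "expectation (\<lambda>\<omega>. \<Sum>z\<in>?R. (y \<bullet> z) * (?d y \<omega> * ?d z \<omega>))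
        = (\<Sum>z\<in>?R. (y \<bullet> z) * expectation (\<lambda>\<omega>. ?d y \<omega> * ?d z \<omega>))"
      by (simp only: integral_mult_right_zero)
  qed
  also have "\<dots> = (\<Sum>y\<in>?R. \<Sum>z\<in>?R. if y = z then (y \<bullet> y) * measure \<mu> (?B y) else 0)"
    by (intro sum.cong refl) (auto simp only: cov(2) split: if_splits)
  also have "\<dots> = (\<Sum>y\<in>?R. measure \<mu> (?B y) * (norm y)\<^sup>2)"
    using fin by (intro sum.cong refl) (simp add: power2_norm_eq_inner)
  also have "\<dots> = (\<Sum>y\<in>g ` space \<mu>. measure \<mu> (?B y) *\<^sub>R (norm y)\<^sup>2)"
    using lev(1) by (intro sum.mono_neutral_cong_left) auto
  also have "\<dots> = simple_integral \<mu> (\<lambda>x. (norm (g x))\<^sup>2)"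
    by (rule Bochner_Integration.simple_bochner_integral_partition[OF si, symmetric])
      (use g in \<open>auto simp: simple_integrable_iff\<close>)
  also have "\<dots> = (LINT x|\<mu>. (norm (g x))\<^sup>2)"
    by (rule simple_integral_eq_integral[OF si])
  finally have E: "expectation (\<lambda>\<omega>. (norm (compensated g \<omega>))\<^sup>2) = (LINT x|\<mu>. (norm (g x))\<^sup>2)" .
  have [measurable]: "compensated g \<in> borel_measurable M" using g by measurable
  have "sq_integrable M (compensated g)" using int by (subst sq_integrable_iff_integrable) auto
  then show "sq_norm M (compensated g) = sq_norm \<mu> g"
    using E simple_integrable_sq_integrable[OF g] by (simp add: sq_norm_eq_integral)
  have di: "integrable M (?d y)" if "y \<in> ?R" for y
    using that by (intro Bochner_Integration.integrable_diff count_moments(1) lev(2,3)) auto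
  have "expectation (compensated g) = (\<Sum>y\<in>?R. expectation (\<lambda>\<omega>. ?d y \<omega> *\<^sub>R y))"
    unfolding compensated_def by (intro Bochner_Integration.integral_sum integrable_scaleR_left di)
  also have "\<dots> = (\<Sum>y\<in>?R. expectation (?d y) *\<^sub>R y)"
    by (intro sum.cong refl integral_scaleR_left di)
  also have "\<dots> = 0"
    using count_moments(1,2)[OF lev(2,3)] by (intro sum.neutral ballI) (simp add: prob_space)
  finally show "expectation (compensated g) = 0" .
qed

text \<open>Disjoint supports make the nonzero levels of \<open>f\<close> and \<open>g\<close> one
  disjoint family. Listed in a single sequence \<open>B\<close>, they fill two separate blocks of
  indices, and each integral is a measurable function of the counts in its own block.\<close>

lemma compensated_indep:
  fixes f g :: "'z \<Rightarrow> 'b::{banach,second_countable_topology}"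
  assumes f: "simple_integrable \<mu> f" and g: "simple_integrable \<mu> g"
    and disj: "\<And>x. x \<in> space \<mu> \<Longrightarrow> f x = 0 \<or> g x = 0"
  shows "indep_var borel (compensated f) borel (compensated g)"
proof -
  note lf = simple_levels[OF f] and lg = simple_levels[OF g]
  let ?F = "\<lambda>y. {x\<in>space \<mu>. f x = y}" and ?G = "\<lambda>y. {x\<in>space \<mu>. g x = y}"
  obtain ys where ys: "set ys = f ` space \<mu> - {0}" "distinct ys"
    using finite_distinct_list[of "f ` space \<mu> - {0}"] lf(1) by auto
  obtain zs where zs: "set zs = g ` space \<mu> - {0}" "distinct zs"
    using finite_distinct_list[of "g ` space \<mu> - {0}"] lg(1) by auto
  define p q where "p = length ys" and "q = length zs"
  define B where "B i = (if i < p then ?F (ys ! i) else if i < p + q then ?G (zs ! (i - p)) else {})" for i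
  have B_meas: "range B \<subseteq> sets \<mu>" using lf(2) lg(2) by (auto simp: B_def)
  have ysnz: "ys ! i \<noteq> 0" if "i < p" for i using that ys(1) nth_mem[of i ys] by (auto simp: p_def)
  have zsnz: "zs ! i \<noteq> 0" if "i < q" for i using that zs(1) nth_mem[of i zs] by (auto simp: q_def)
  have "disjoint_family B"
    unfolding disjoint_family_on_def
  proof (intro ballI impI)
    fix i j :: nat assume "i \<noteq> j"
    have False if x: "x \<in> B i" "x \<in> B j" for x
    proof -
      have F: "f x = ys ! k" "f x \<noteq> 0" if "x \<in> B k" "k < p" for k
        using that ysnz by (auto simp: B_def)
      have G: "k < p + q" "g x = zs ! (k - p)" "g x \<noteq> 0" if "x \<in> B k" "\<not> k < p" for k
        using that zsnz[of "k - p"] by (auto simp: B_def split: if_splits)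
      have "x \<in> space \<mu>" using x by (auto simp: B_def split: if_splits)
      then have same: "i < p \<longleftrightarrow> j < p" using F(2) G(3) x disj by blast
      show False
      proof (cases "i < p")
        case True
        then show False
          using F(1)[OF x(1)] F(1)[OF x(2)] same nth_eq_iff_index_eq[OF ys(2), of i j] \<open>i \<noteq> j\<close>
          by (auto simp: p_def)
      next
        case False
        then have "i - p < q" "j - p < q" "i - p \<noteq> j - p"
          using G(1)[OF x(1)] G(1)[OF x(2)] same \<open>i \<noteq> j\<close> by auto
        then show False
          using G(2)[OF x(1)] G(2)[OF x(2)] False same nth_eq_iff_index_eq[OF zs(2), of "i - p" "j - p"]
          by (auto simp: q_def)
      qed
    qed
    then show "B i \<inter> B j = {}" by blast
  qed
  then have "indep_vars (\<lambda>_. borel) (\<lambda>i \<omega>. emeasure (\<pi> \<omega>) (B i)) UNIV"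
    by (rule indep_vars_counts[OF B_meas])
  then have "indep_var
      (PiM {..<p} (\<lambda>_. borel)) (\<lambda>\<omega>. restrict (\<lambda>i. emeasure (\<pi> \<omega>) (B i)) {..<p})
      (PiM {p..<p+q} (\<lambda>_. borel)) (\<lambda>\<omega>. restrict (\<lambda>i. emeasure (\<pi> \<omega>) (B i)) {p..<p+q})"
    by (rule indep_var_restrict) auto
  then have "indep_var
      borel ((\<lambda>h. \<Sum>i<p. (enn2real (h i) - measure \<mu> (?F (ys ! i))) *\<^sub>R (ys ! i)) \<circ> (\<lambda>\<omega>. restrict (\<lambda>i. emeasure (\<pi> \<omega>) (B i)) {..<p}))
      borel ((\<lambda>h. \<Sum>i<q. (enn2real (h (i + p)) - measure \<mu> (?G (zs ! i))) *\<^sub>R (zs ! i)) \<circ> (\<lambda>\<omega>. restrict (\<lambda>i. emeasure (\<pi> \<omega>) (B i)) {p..<p+q}))"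
    by (rule indep_var_compose)
      (auto intro!: borel_measurable_sum borel_measurable_scaleR borel_measurable_diff
          borel_measurable_enn2real measurable_component_singleton)
  moreover have "compensated f = (\<lambda>h. \<Sum>i<p. (enn2real (h i) - measure \<mu> (?F (ys ! i))) *\<^sub>R (ys ! i)) \<circ> (\<lambda>\<omega>. restrict (\<lambda>i. emeasure (\<pi> \<omega>) (B i)) {..<p})"
  proof
    fix \<omega>
    have "compensated f \<omega> = (\<Sum>i<p. (measure (\<pi> \<omega>) (?F (ys ! i)) - measure \<mu> (?F (ys ! i))) *\<^sub>R (ys ! i))"
      unfolding compensated_def ys(1)[symmetric] p_def
      by (rule sum.reindex_bij_betw[OF bij_betw_nth[OF ys(2) refl refl], symmetric])
    also have "\<dots> = ((\<lambda>h. \<Sum>i<p. (enn2real (h i) - measure \<mu> (?F (ys ! i))) *\<^sub>R (ys ! i)) \<circ> (\<lambda>\<omega>. restrict (\<lambda>i. emeasure (\<pi> \<omega>) (B i)) {..<p})) \<omega>"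
      unfolding o_def by (intro sum.cong refl) (simp add: B_def measure_def)
    finally show "compensated f \<omega> = \<dots>" .
  qed
  moreover have "compensated g = (\<lambda>h. \<Sum>i<q. (enn2real (h (i + p)) - measure \<mu> (?G (zs ! i))) *\<^sub>R (zs ! i)) \<circ> (\<lambda>\<omega>. restrict (\<lambda>i. emeasure (\<pi> \<omega>) (B i)) {p..<p+q})"
  proof
    fix \<omega>
    have "compensated g \<omega> = (\<Sum>i<q. (measure (\<pi> \<omega>) (?G (zs ! i)) - measure \<mu> (?G (zs ! i))) *\<^sub>R (zs ! i))"
      unfolding compensated_def zs(1)[symmetric] q_def
      by (rule sum.reindex_bij_betw[OF bij_betw_nth[OF zs(2) refl refl], symmetric])
    also have "\<dots> = ((\<lambda>h. \<Sum>i<q. (enn2real (h (i + p)) - measure \<mu> (?G (zs ! i))) *\<^sub>R (zs ! i)) \<circ> (\<lambda>\<omega>. restrict (\<lambda>i. emeasure (\<pi> \<omega>) (B i)) {p..<p+q})) \<omega>"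
      unfolding o_def by (intro sum.cong refl) (simp add: B_def measure_def)
    finally show "compensated g \<omega> = \<dots>" .
  qed
  ultimately show ?thesis by (simp only:)
qed

end

context poisson_measure
begin

subsection \<open>Square integrable integrands\<close>

text \<open>A relation rather than a function, since the integral is determined only up to a null
  set. Every choice made by a \<open>SOME\<close> in the definitions is later shown to satisfy
  it.\<close>

definition comp_lim ::
  "('z \<Rightarrow> 'b::{real_inner,banach,second_countable_topology}) \<Rightarrow> ('w \<Rightarrow> 'b) \<Rightarrow> bool" where
  "comp_lim f X \<longleftrightarrow> (\<exists>g. (\<forall>n. simple_integrable \<mu> (g n)) \<and> L2_tendsto \<mu> g f \<and>
     L2_tendsto M (\<lambda>n. compensated (g n)) X)"

lemma comp_lim_comp_integral_iff:
  "comp_lim f X \<longleftrightarrow> (\<exists>g. (\<forall>n. simple_integrable \<mu> (g n)) \<and> L2_tendsto \<mu> g f \<and>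
     L2_tendsto M (\<lambda>n \<omega>. simple_integral (\<pi> \<omega>) (g n) - simple_integral \<mu> (g n)) X)"
proof -
  have "L2_tendsto M (\<lambda>n. compensated (g n)) X \<longleftrightarrow>
      L2_tendsto M (\<lambda>n \<omega>. simple_integral (\<pi> \<omega>) (g n) - simple_integral \<mu> (g n)) X"
    if g: "\<And>n. simple_integrable \<mu> (g n)" for g
  proof
    have eq: "AE \<omega> in M. compensated (g n) \<omega> = simple_integral (\<pi> \<omega>) (g n) - simple_integral \<mu> (g n)" for n
      using AE_space by eventually_elim (rule compensated_eq[OF _ g])
    have meas: "(\<lambda>\<omega>. simple_integral (\<pi> \<omega>) (g n) - simple_integral \<mu> (g n)) \<in> borel_measurable M" for n
      using compensated_measurable[OF g[of n]] compensated_eq[OF _ g[of n]]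
      by (simp cong: measurable_cong)
    show "L2_tendsto M (\<lambda>n. compensated (g n)) X \<Longrightarrow>
        L2_tendsto M (\<lambda>n \<omega>. simple_integral (\<pi> \<omega>) (g n) - simple_integral \<mu> (g n)) X"
      by (rule L2_tendsto_cong_AE[OF _ eq meas])
    have eq': "AE \<omega> in M. simple_integral (\<pi> \<omega>) (g n) - simple_integral \<mu> (g n) = compensated (g n) \<omega>" for n
      using eq[of n] by eventually_elim simp
    show "L2_tendsto M (\<lambda>n \<omega>. simple_integral (\<pi> \<omega>) (g n) - simple_integral \<mu> (g n)) X \<Longrightarrow>
        L2_tendsto M (\<lambda>n. compensated (g n)) X"
      by (rule L2_tendsto_cong_AE[OF _ eq' compensated_measurable[OF g]])
  qed
  then show ?thesis unfolding comp_lim_def by blast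
qed

lemma comp_lim_sq_integrable:
  assumes "comp_lim f X"
  shows "sq_integrable \<mu> f" "sq_integrable M X"
proof -
  obtain g where g: "\<And>n. simple_integrable \<mu> (g n)" "L2_tendsto \<mu> g f"
    "L2_tendsto M (\<lambda>n. compensated (g n)) X"
    using assms by (auto simp: comp_lim_def)
  show "sq_integrable \<mu> f"
    by (rule L2_tendsto_sq_integrable[OF g(2) simple_integrable_sq_integrable[OF g(1)]])
  have "sq_integrable M (compensated (g n))" for n
    using compensated_isometry(1)[OF g(1)] compensated_measurable[OF g(1)]
      sq_integrableD(2)[OF simple_integrable_sq_integrable[OF g(1)]]
    by (simp add: sq_integrable_def)
  then show "sq_integrable M X" by (rule L2_tendsto_sq_integrable[OF g(3)])
qed

text \<open>The isometry carries the Cauchy property of simple approximants from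
  \<open>\<mu>\<close> to \<open>M\<close>, where completeness yields a limit.\<close>

lemma comp_lim_exists:
  assumes f: "sq_integrable \<mu> f"
  shows "\<exists>X. comp_lim f X"
proof -
  obtain g where g: "\<And>n. simple_integrable \<mu> (g n)" "L2_tendsto \<mu> g f"
    using simple_integrable_dense[OF f] by blast
  note [measurable] = L2_tendstoD(1,2)[OF g(2)]
  have diff: "sq_norm M (\<lambda>\<omega>. compensated (g m) \<omega> - compensated (g n) \<omega>) = sq_norm \<mu> (\<lambda>x. g m x - g n x)" for m n
  proof -
    have l: "linear (\<lambda>x::'a. - x)" by (rule linear_uminus)
    have neg: "simple_integrable \<mu> (\<lambda>x. - g n x)" by (rule simple_integrable_linear[OF l g(1)])
    have "AE \<omega> in M. compensated (\<lambda>x. g m x + - g n x) \<omega> = compensated (g m) \<omega> - compensated (g n) \<omega>"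
      using compensated_add[OF g(1)[of m] neg] compensated_linear[OF l g(1)[of n]]
      by eventually_elim simp
    then have "sq_norm M (\<lambda>\<omega>. compensated (g m) \<omega> - compensated (g n) \<omega>) = sq_norm M (compensated (\<lambda>x. g m x + - g n x))"
      by (intro sq_norm_cong_AE) auto
    also have "\<dots> = sq_norm \<mu> (\<lambda>x. g m x + - g n x)"
      by (rule compensated_isometry(1)[OF simple_integrable_add[OF g(1) neg]])
    finally show ?thesis by simp
  qed
  have "\<exists>X. L2_tendsto M (\<lambda>n. compensated (g n)) X"
  proof (rule L2_complete)
    fix \<epsilon> :: real assume e: "0 < \<epsilon>"
    then have "eventually (\<lambda>n. sq_norm \<mu> (\<lambda>x. g n x - f x) < ennreal (\<epsilon>/4)) sequentially"
      by (intro order_tendstoD(2)[OF L2_tendstoD(3)[OF g(2)]]) simp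
    then obtain N where N: "\<And>n. N \<le> n \<Longrightarrow> sq_norm \<mu> (\<lambda>x. g n x - f x) < ennreal (\<epsilon>/4)"
      by (auto simp: eventually_sequentially)
    have "sq_norm M (\<lambda>\<omega>. compensated (g m) \<omega> - compensated (g n) \<omega>) \<le> ennreal \<epsilon>" if "N \<le> m" "N \<le> n" for m n
    proof -
      have "sq_norm M (\<lambda>\<omega>. compensated (g m) \<omega> - compensated (g n) \<omega>)
          \<le> 2 * sq_norm \<mu> (\<lambda>x. g m x - f x) + 2 * sq_norm \<mu> (\<lambda>x. f x - g n x)"
        unfolding diff by (rule sq_norm_diff_triangle) auto
      also have "\<dots> \<le> 2 * ennreal (\<epsilon>/4) + 2 * ennreal (\<epsilon>/4)"
        using N[OF that(1)] N[OF that(2)] sq_norm_commute[of \<mu> f "g n"]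
        by (intro add_mono mult_left_mono) auto
      also have "\<dots> = ennreal \<epsilon>"
      proof -
        have "2 * ennreal (\<epsilon>/4) = ennreal (\<epsilon>/2)"
          using e ennreal_mult[of 2 "\<epsilon>/4"] by simp
        then show ?thesis using e by (simp add: ennreal_plus[symmetric] del: ennreal_plus)
      qed
      finally show ?thesis .
    qed
    then show "\<exists>N. \<forall>m\<ge>N. \<forall>n\<ge>N. sq_norm M (\<lambda>\<omega>. compensated (g m) \<omega> - compensated (g n) \<omega>) \<le> ennreal \<epsilon>"
      by blast
  qed (rule compensated_measurable[OF g(1)])
  then show ?thesis using g by (auto simp: comp_lim_def)
qed

lemma comp_lim_add:
  assumes "comp_lim f X" "comp_lim g Y"
  shows "comp_lim (\<lambda>x. f x + g x) (\<lambda>\<omega>. X \<omega> + Y \<omega>)"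
proof -
  obtain a where a: "\<And>n. simple_integrable \<mu> (a n)" "L2_tendsto \<mu> a f"
    "L2_tendsto M (\<lambda>n. compensated (a n)) X"
    using assms(1) by (auto simp: comp_lim_def)
  obtain b where b: "\<And>n. simple_integrable \<mu> (b n)" "L2_tendsto \<mu> b g"
    "L2_tendsto M (\<lambda>n. compensated (b n)) Y"
    using assms(2) by (auto simp: comp_lim_def)
  have ab: "simple_integrable \<mu> (\<lambda>x. a n x + b n x)" for n by (rule simple_integrable_add[OF a(1) b(1)])
  have "AE \<omega> in M. compensated (a n) \<omega> + compensated (b n) \<omega> = compensated (\<lambda>x. a n x + b n x) \<omega>" for n
    using compensated_add[OF a(1)[of n] b(1)[of n]] by eventually_elim simp
  then have "L2_tendsto M (\<lambda>n. compensated (\<lambda>x. a n x + b n x)) (\<lambda>\<omega>. X \<omega> + Y \<omega>)"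
    by (rule L2_tendsto_cong_AE[OF L2_tendsto_add[OF a(3) b(3)] _ compensated_measurable[OF ab]])
  then show ?thesis
    unfolding comp_lim_def using ab L2_tendsto_add[OF a(2) b(2)]
    by (intro exI[of _ "\<lambda>n x. a n x + b n x"]) simp
qed

lemma comp_lim_bounded_linear:
  fixes L :: "'b::{real_inner,banach,second_countable_topology} \<Rightarrow> 'c::{real_inner,banach,second_countable_topology}"
  assumes L: "bounded_linear L" and f: "comp_lim f X"
  shows "comp_lim (\<lambda>x. L (f x)) (\<lambda>\<omega>. L (X \<omega>))"
proof -
  obtain a where a: "\<And>n. simple_integrable \<mu> (a n)" "L2_tendsto \<mu> a f"
    "L2_tendsto M (\<lambda>n. compensated (a n)) X"
    using f by (auto simp: comp_lim_def)
  have l: "linear L" using L by (rule bounded_linear.linear)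
  have La: "simple_integrable \<mu> (\<lambda>x. L (a n x))" for n by (rule simple_integrable_linear[OF l a(1)])
  have "AE \<omega> in M. L (compensated (a n) \<omega>) = compensated (\<lambda>x. L (a n x)) \<omega>" for n
    using compensated_linear[OF l a(1)[of n]] by eventually_elim simp
  then have "L2_tendsto M (\<lambda>n. compensated (\<lambda>x. L (a n x))) (\<lambda>\<omega>. L (X \<omega>))"
    by (rule L2_tendsto_cong_AE[OF L2_tendsto_bounded_linear[OF L a(3)] _ compensated_measurable[OF La]])
  then show ?thesis
    unfolding comp_lim_def using La L2_tendsto_bounded_linear[OF L a(2)]
    by (intro exI[of _ "\<lambda>n x. L (a n x)"]) simp
qed

lemma comp_lim_diff:
  assumes "comp_lim f X" "comp_lim g Y"
  shows "comp_lim (\<lambda>x. f x - g x) (\<lambda>\<omega>. X \<omega> - Y \<omega>)"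
  using comp_lim_add[OF assms(1) comp_lim_bounded_linear[OF bounded_linear_minus[OF bounded_linear_ident] assms(2)]]
  by simp

lemma comp_lim_zero: "comp_lim (\<lambda>x. 0) (\<lambda>\<omega>. 0)"
proof -
  have "sq_integrable \<mu> (\<lambda>x. 0 :: 'a)" by simp
  then obtain X :: "'w \<Rightarrow> 'a" where "comp_lim (\<lambda>x. 0) X" using comp_lim_exists by blast
  from comp_lim_diff[OF this this] show ?thesis by simp
qed

lemma comp_lim_sum:
  assumes "\<And>i. i \<in> I \<Longrightarrow> comp_lim (f i) (X i)"
  shows "comp_lim (\<lambda>x. \<Sum>i\<in>I. f i x) (\<lambda>\<omega>. \<Sum>i\<in>I. X i \<omega>)"
  using assms
  by (induction I rule: infinite_finite_induct) (auto intro: comp_lim_add comp_lim_zero)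

text \<open>Two uses of the factor 2 inequality give the constant 4 in place of the exact isometry.
  Such a continuity bound is what uniqueness, stability and the remainder estimates rest on.\<close>

lemma comp_lim_sq_norm:
  assumes "comp_lim f X"
  shows "sq_norm M X \<le> 4 * sq_norm \<mu> f"
proof -
  obtain g where g: "\<And>n. simple_integrable \<mu> (g n)" "L2_tendsto \<mu> g f"
    "L2_tendsto M (\<lambda>n. compensated (g n)) X"
    using assms by (auto simp: comp_lim_def)
  note [measurable] = L2_tendstoD(1,2)[OF g(2)]
  have "sq_norm M (compensated (g n)) \<le> 2 * sq_norm \<mu> (\<lambda>x. g n x - f x) + 2 * sq_norm \<mu> f" for n
    unfolding compensated_isometry(1)[OF g(1)]
    using sq_norm_add[of "\<lambda>x. g n x - f x" \<mu> f] by simp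
  moreover have "(\<lambda>n. 2 * sq_norm \<mu> (\<lambda>x. g n x - f x) + 2 * sq_norm \<mu> f) \<longlonglongrightarrow> 2 * 0 + 2 * sq_norm \<mu> f"
    by (intro tendsto_add tendsto_const ennreal_tendsto_cmult L2_tendstoD(3)[OF g(2)]) auto
  ultimately have "sq_norm M X \<le> 2 * (2 * 0 + 2 * sq_norm \<mu> f)"
    by (rule L2_tendsto_sq_norm_le[OF g(3)])
  then show ?thesis by (simp add: mult.assoc[symmetric])
qed

lemma comp_lim_unique:
  assumes X: "comp_lim f X" and Y: "comp_lim g Y" and fg: "AE x in \<mu>. f x = g x"
  shows "AE \<omega> in M. X \<omega> = Y \<omega>"
proof -
  note XY = comp_lim_diff[OF X Y]
  have "sq_norm \<mu> (\<lambda>x. f x - g x) = 0"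
    using sq_norm_cong_AE[of "\<lambda>x. f x - g x" "\<lambda>x. 0" \<mu>] fg by auto
  then have "sq_norm M (\<lambda>\<omega>. X \<omega> - Y \<omega>) = 0"
    using comp_lim_sq_norm[OF XY] by simp
  then have "AE \<omega> in M. X \<omega> - Y \<omega> = 0"
    using comp_lim_sq_integrable(2)[OF XY] by (subst (asm) sq_norm_eq_0_iff) auto
  then show ?thesis by eventually_elim simp
qed

lemma comp_lim_cong:
  assumes X: "comp_lim f X"
    and f: "AE x in \<mu>. f x = f' x" "f' \<in> borel_measurable \<mu>"
    and Y: "AE \<omega> in M. X \<omega> = Y \<omega>" "Y \<in> borel_measurable M"
  shows "comp_lim f' Y"
  using X L2_tendsto_cong_limit[OF _ f] L2_tendsto_cong_limit[OF _ Y]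
  unfolding comp_lim_def by blast

lemma comp_lim_L2_tendsto:
  assumes "\<And>n. comp_lim (fn n) (Xn n)" "L2_tendsto \<mu> fn f" "comp_lim f X"
  shows "L2_tendsto M Xn X"
proof -
  have "(\<lambda>n. sq_norm M (\<lambda>\<omega>. Xn n \<omega> - X \<omega>)) \<longlonglongrightarrow> 0"
    by (rule ennreal_tendsto_0_le[OF comp_lim_sq_norm[OF comp_lim_diff[OF assms(1,3)]]
        tendsto_0_cmult_ennreal[OF L2_tendstoD(3)[OF assms(2)]]]) simp
  then show ?thesis
    using comp_lim_sq_integrable(2)[OF assms(1)] comp_lim_sq_integrable(2)[OF assms(3)]
    by (auto simp: L2_tendsto_iff)
qed

text \<open>Identifies a chosen limit from whichever approximating sequence the choice comes
  with.\<close>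

lemma comp_lim_closed:
  assumes "\<And>n. comp_lim (fn n) (Xn n)" "L2_tendsto \<mu> fn f" "L2_tendsto M Xn X"
  shows "comp_lim f X"
proof -
  have "sq_integrable \<mu> f"
    by (rule L2_tendsto_sq_integrable[OF assms(2) comp_lim_sq_integrable(1)[OF assms(1)]])
  then obtain X' where X': "comp_lim f X'" using comp_lim_exists by blast
  have "AE \<omega> in M. X' \<omega> = X \<omega>"
    by (rule L2_tendsto_unique[OF comp_lim_L2_tendsto[OF assms(1,2) X'] assms(3)])
  then show ?thesis
    using L2_tendstoD(2)[OF assms(2)] L2_tendstoD(2)[OF assms(3)]
    by (intro comp_lim_cong[OF X']) auto
qed

lemma comp_lim_simple:
  assumes "simple_integrable \<mu> g"
  shows "comp_lim g (compensated g)"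
proof -
  have "g \<in> borel_measurable \<mu>" using assms by auto
  then show ?thesis
    unfolding comp_lim_def using assms
    by (intro exI[of _ "\<lambda>n. g"]) (auto intro!: L2_tendsto_const compensated_measurable)
qed

lemma comp_lim_comp_integral:
  assumes "sq_integrable \<mu> f"
  shows "comp_lim f (comp_integral M \<mu> \<pi> f)"
proof -
  have "\<exists>X. comp_lim f X" by (rule comp_lim_exists[OF assms])
  then show ?thesis
    unfolding comp_lim_comp_integral_iff comp_integral_def by (rule someI_ex)
qed

lemma comp_lim_expectation:
  assumes "comp_lim f X"
  shows "expectation X = 0"
proof -
  obtain g where g: "\<And>n. simple_integrable \<mu> (g n)" "L2_tendsto \<mu> g f"
    "L2_tendsto M (\<lambda>n. compensated (g n)) X"
    using assms by (auto simp: comp_lim_def)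
  note [measurable] = L2_tendstoD(1,2)[OF g(3)]
  have iX: "integrable M X" by (rule sq_integrable_imp_integrable[OF comp_lim_sq_integrable(2)[OF assms]])
  have ig: "integrable M (compensated (g n))" for n
    by (rule sq_integrable_imp_integrable[OF comp_lim_sq_integrable(2)[OF comp_lim_simple[OF g(1)]]])
  have "(\<lambda>n. expectation (\<lambda>\<omega>. norm (compensated (g n) \<omega> - X \<omega>))) \<longlonglongrightarrow> 0"
    by (rule expectation_norm_tendsto_0[OF _ L2_tendstoD(3)[OF g(3)]]) measurable
  moreover have "norm (expectation X) \<le> expectation (\<lambda>\<omega>. norm (compensated (g n) \<omega> - X \<omega>))" for n
  proof -
    have "norm (expectation (\<lambda>\<omega>. compensated (g n) \<omega> - X \<omega>)) = norm (expectation X)"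
      using compensated_isometry(2)[OF g(1)] by (subst Bochner_Integration.integral_diff[OF ig iX]) simp
    then show ?thesis
      using integral_norm_bound[of M "\<lambda>\<omega>. compensated (g n) \<omega> - X \<omega>"] by simp
  qed
  ultimately have "norm (expectation X) \<le> 0"
    by (intro LIMSEQ_le_const) auto
  then show ?thesis by simp
qed

text \<open>Cutting the simple approximants down to \<open>A\<close> and to its complement does not
  increase their distance to fields supported there. The cut approximants have disjoint supports,
  and independence passes to mean square limits.\<close>

lemma comp_lim_indep:
  assumes X: "comp_lim f X" and Y: "comp_lim g Y" and A: "A \<in> sets \<mu>"
    and f: "\<And>x. x \<in> space \<mu> \<Longrightarrow> x \<notin> A \<Longrightarrow> f x = 0" and g: "\<And>x. x \<in> A \<Longrightarrow> g x = 0"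
  shows "indep_var borel X borel Y"
proof -
  note [measurable] = A
  have approx: "\<exists>a. (\<forall>n. simple_integrable \<mu> (a n)) \<and> (\<forall>n. \<forall>x\<in>space \<mu> - B. a n x = 0) \<and> L2_tendsto M (\<lambda>n. compensated (a n)) X'"
    if X': "comp_lim f' X'" and B: "B \<in> sets \<mu>" and z: "\<And>x. x \<in> space \<mu> \<Longrightarrow> x \<notin> B \<Longrightarrow> f' x = 0" for f' X' B
  proof -
    obtain a where a: "\<And>n. simple_integrable \<mu> (a n)" "L2_tendsto \<mu> a f'"
      using X' by (auto simp: comp_lim_def)
    note [measurable] = L2_tendstoD(1,2)[OF a(2)] B
    define a' where "a' n x = indicator B x *\<^sub>R a n x" for n x
    have a': "simple_integrable \<mu> (a' n)" for n
      unfolding a'_def by (rule simple_integrable_indicator[OF a(1) B])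
    have "(\<lambda>n. sq_norm \<mu> (\<lambda>x. a' n x - f' x)) \<longlonglongrightarrow> 0"
    proof (rule ennreal_tendsto_0_le[OF _ L2_tendstoD(3)[OF a(2)]])
      show "sq_norm \<mu> (\<lambda>x. a' n x - f' x) \<le> sq_norm \<mu> (\<lambda>x. a n x - f' x)" for n
        by (intro sq_norm_mono AE_I2) (auto simp: a'_def z split: split_indicator)
    qed
    then have "L2_tendsto \<mu> a' f'"
      using a' by (auto simp: L2_tendsto_iff)
    from comp_lim_L2_tendsto[OF comp_lim_simple[OF a'] this X']
    show ?thesis using a' by (intro exI[of _ a']) (auto simp: a'_def)
  qed
  obtain a where a: "\<And>n. simple_integrable \<mu> (a n)" "\<And>n x. x \<in> space \<mu> - A \<Longrightarrow> a n x = 0"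
    "L2_tendsto M (\<lambda>n. compensated (a n)) X"
    using approx[OF X A f] by blast
  obtain b where b: "\<And>n. simple_integrable \<mu> (b n)" "\<And>n x. x \<in> space \<mu> - (space \<mu> - A) \<Longrightarrow> b n x = 0"
    "L2_tendsto M (\<lambda>n. compensated (b n)) Y"
  proof -
    have "\<exists>b. (\<forall>n. simple_integrable \<mu> (b n)) \<and> (\<forall>n. \<forall>x\<in>space \<mu> - (space \<mu> - A). b n x = 0)
        \<and> L2_tendsto M (\<lambda>n. compensated (b n)) Y"
      by (rule approx[OF Y]) (use g in auto)
    then show ?thesis using that by blast
  qed
  have "indep_var borel (compensated (a n)) borel (compensated (b n))" for n
    by (rule compensated_indep[OF a(1) b(1)]) (use a(2) b(2) in auto)
  then show ?thesis by (rule indep_var_L2_limit[OF _ a(3) b(3)])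
qed

end

section \<open>Second order remainders\<close>

text \<open>The form in which \<open>C2_b\<close> enters the estimates: \<open>K\<close> is also a
  Lipschitz constant of \<open>\<phi>\<close>, and \<open>C\<close> controls every second order
  remainder.\<close>

locale C11_function =
  fixes \<phi> :: "'h::{real_inner,banach,second_countable_topology} \<Rightarrow> real" and D :: "'h \<Rightarrow> 'h"
    and B K C :: real
  assumes bounded: "\<bar>\<phi> x\<bar> \<le> B" and grad_bounded: "norm (D x) \<le> K"
    and grad_Lipschitz: "norm (D x - D y) \<le> C * norm (x - y)"
    and gderiv: "GDERIV \<phi> x :> D x" and C_nonneg: "0 \<le> C"
begin

lemma K_nonneg: "0 \<le> K"
  using grad_bounded[of 0] norm_ge_zero order_trans by blast

lemma has_derivative_phi: "(\<phi> has_derivative (\<lambda>v. v \<bullet> D x)) (at x within S)"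
  using gderiv[of x] by (auto simp: gderiv_def intro: has_derivative_at_withinI)

lemma Lipschitz: "\<bar>\<phi> x - \<phi> y\<bar> \<le> K * norm (x - y)"
proof -
  have "norm (\<phi> x - \<phi> y) \<le> K * norm (x - y)"
  proof (rule differentiable_bound[of UNIV])
    fix z :: 'h
    show "(\<phi> has_derivative (\<lambda>v. v \<bullet> D z)) (at z within UNIV)" by (rule has_derivative_phi)
    show "onorm (\<lambda>v. v \<bullet> D z) \<le> K"
    proof (rule onorm_bound[OF K_nonneg])
      fix v show "norm (v \<bullet> D z) \<le> K * norm v"
        using Cauchy_Schwarz_ineq2[of v "D z"] mult_left_mono[OF grad_bounded[of z], of "norm v"]
        by (simp add: mult.commute)
    qed
  qed auto
  then show ?thesis by simp
qed

lemma phi_continuous: "continuous_on UNIV \<phi>"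
  using has_derivative_continuous_on[of UNIV \<phi> "\<lambda>x v. v \<bullet> D x"] has_derivative_phi by blast

lemma D_continuous: "continuous_on UNIV D"
proof -
  have "C-lipschitz_on UNIV D"
    using grad_Lipschitz C_nonneg by (intro lipschitz_onI) (auto simp: dist_norm)
  then show ?thesis by (rule lipschitz_on_continuous_on)
qed

lemma phi_measurable [measurable]: "\<phi> \<in> borel_measurable borel"
  by (rule borel_measurable_continuous_onI[OF phi_continuous])

lemma D_measurable [measurable]: "D \<in> borel_measurable borel"
  by (rule borel_measurable_continuous_onI[OF D_continuous])

text \<open>The first order Taylor remainder, which is the contribution of a jump \<open>g\<close>
  from the state \<open>w\<close> to Ito's formula for a compensated jump process.\<close>

definition rho :: "'h \<Rightarrow> 'h \<Rightarrow> real" where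
  "rho w g = \<phi> (w + g) - \<phi> w - D w \<bullet> g"

lemma rho_zero [simp]: "rho w 0 = 0" by (simp add: rho_def)

text \<open>Mean value inequality on a ball around 0 that contains \<open>a\<close> and
  \<open>b\<close>: there the gradient \<open>D (w + g) - D w\<close> of \<open>rho w\<close> is at
  most \<open>C\<close> times the radius.\<close>

lemma rho_diff: "\<bar>rho w a - rho w b\<bar> \<le> C * (norm a + norm b) * norm (a - b)"
proof -
  let ?S = "cball (0::'h) (norm a + norm b)"
  have "norm (rho w a - rho w b) \<le> C * (norm a + norm b) * norm (a - b)"
  proof (rule differentiable_bound[of ?S])
    fix g :: 'h assume g: "g \<in> ?S"
    have "((\<lambda>g. \<phi> (w + g)) has_derivative (\<lambda>v. v \<bullet> D (w + g))) (at g within ?S)"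
      by (rule has_derivative_compose[of "\<lambda>g. w + g" "\<lambda>v. v"])
        (use has_derivative_phi[of "w + g" UNIV] in \<open>auto intro!: derivative_eq_intros\<close>)
    then show "(rho w has_derivative (\<lambda>v. v \<bullet> (D (w + g) - D w))) (at g within ?S)"
      unfolding rho_def[abs_def]
      by (auto intro!: derivative_eq_intros simp: inner_diff_right inner_commute)
    have "norm (D (w + g) - D w) \<le> C * (norm a + norm b)"
      using grad_Lipschitz[of "w + g" w] g mult_left_mono[OF _ C_nonneg, of "norm g" "norm a + norm b"]
      by simp
    then show "onorm (\<lambda>v. v \<bullet> (D (w + g) - D w)) \<le> C * (norm a + norm b)"
    proof (intro onorm_bound)
      fix v assume le: "norm (D (w + g) - D w) \<le> C * (norm a + norm b)"
      show "norm (v \<bullet> (D (w + g) - D w)) \<le> C * (norm a + norm b) * norm v"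
        using Cauchy_Schwarz_ineq2[of v "D (w + g) - D w"] mult_left_mono[OF le, of "norm v"]
        by (simp add: mult.commute)
    qed (use C_nonneg in simp)
  qed (auto simp: norm_minus_commute)
  then show ?thesis by simp
qed

lemma rho_bound: "\<bar>rho w a\<bar> \<le> C * (norm a)\<^sup>2"
  using rho_diff[of w a 0] by (simp add: power2_eq_square mult.assoc)

lemma rho_base: "\<bar>rho w g - rho w' g\<bar> \<le> (2 * K + C * norm g) * norm (w - w')"
proof -
  have "\<bar>D w \<bullet> g - D w' \<bullet> g\<bar> \<le> norm (D w - D w') * norm g"
    using Cauchy_Schwarz_ineq2[of "D w - D w'" g] by (simp add: inner_diff_left)
  also have "\<dots> \<le> C * norm (w - w') * norm g"
    by (intro mult_right_mono grad_Lipschitz) simp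
  finally show ?thesis
    using Lipschitz[of "w + g" "w' + g"] Lipschitz[of w w']
    unfolding rho_def by (simp add: algebra_simps)
qed

lemma rho_measurable [measurable]: "(\<lambda>p. rho (fst p) (snd p)) \<in> borel_measurable (borel \<Otimes>\<^sub>M borel)"
  unfolding rho_def by measurable

lemma rho_measurable_compose [measurable (raw)]:
  assumes [measurable]: "X \<in> borel_measurable N" "Y \<in> borel_measurable N"
  shows "(\<lambda>x. rho (X x) (Y x)) \<in> borel_measurable N"
  unfolding rho_def by measurable

lemma rho_integrable:
  assumes [measurable]: "X \<in> borel_measurable N" and Y: "sq_integrable N Y"
  shows "integrable N (\<lambda>x. rho (X x) (Y x))"
proof (rule Bochner_Integration.integrable_bound)
  show "integrable N (\<lambda>x. C * (norm (Y x))\<^sup>2)"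
    by (intro integrable_mult_right sq_integrable_integrable Y)
  have [measurable]: "Y \<in> borel_measurable N" using Y by auto
  show "(\<lambda>x. rho (X x) (Y x)) \<in> borel_measurable N" by measurable
  show "AE x in N. norm (rho (X x) (Y x)) \<le> norm (C * (norm (Y x))\<^sup>2)"
    using rho_bound C_nonneg by auto
qed

end

locale poisson_C11 = poisson_measure M \<mu> \<pi> + C11_function \<phi> D B K C
  for M :: "'w measure" and \<mu> :: "'z measure" and \<pi> :: "'w \<Rightarrow> 'z measure"
    and \<phi> :: "'h::{real_inner,banach,second_countable_topology} \<Rightarrow> real" and D B K C
begin

subsection \<open>A single small set of jumps\<close>

text \<open>On the event of at most one point in \<open>S\<close> the integrals of \<open>g\<close> and of \<open>rho w \<circ> g\<close> against \<open>\<pi>\<close>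
  see the same single jump; more points have probability of order \<open>(\<mu> S)\<^sup>2\<close>.\<close>

lemma rho_simple_pathwise:
  assumes g: "simple_integrable \<mu> g" and c: "\<And>x. x \<in> space \<mu> \<Longrightarrow> norm (g x) \<le> c"
    and S: "S \<in> sets \<mu>" "emeasure \<mu> S < \<infinity>" and supp: "\<And>x. x \<in> space \<mu> \<Longrightarrow> x \<notin> S \<Longrightarrow> g x = 0"
    and c0: "0 \<le> c"
  shows "AE \<omega> in M. \<bar>rho w (compensated g \<omega>) - simple_integral (\<pi> \<omega>) (\<lambda>x. rho w (g x))\<bar>
    \<le> C * c\<^sup>2 * (2 * (measure \<mu> S)\<^sup>2 + 2 * measure \<mu> S * measure (\<pi> \<omega>) S
        + 5 * (measure (\<pi> \<omega>) S * (measure (\<pi> \<omega>) S - 1)))"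
proof -
  let ?B = "\<lambda>y. {x\<in>space \<mu>. g x = y}" and ?R = "g ` space \<mu> - {0}"
  note lev = simple_levels[OF g]
  have fin: "finite ?R" using lev(1) by simp
  define a where "a = measure \<mu> S"
  have a0: "0 \<le> a" by (simp add: a_def)
  \<comment> \<open>Stated for a general measure because it serves both the compensator, with
    \<open>\<mu>\<close>, and the sums over jumps, with \<open>\<pi> \<omega>\<close>.\<close>
  have norm_int: "norm (simple_integral N f) \<le> d * measure N S"
    if f: "simple_integrable N f" and N: "sets N = sets \<mu>" "emeasure N S < \<infinity>"
      and d: "\<And>x. x \<in> space \<mu> \<Longrightarrow> norm (f x) \<le> d" "\<And>x. x \<in> space \<mu> \<Longrightarrow> x \<notin> S \<Longrightarrow> f x = 0"
    for N and f :: "'z \<Rightarrow> 'b::{banach,second_countable_topology}" and d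
  proof -
    have sp: "space N = space \<mu>" by (rule sets_eq_imp_space_eq[OF N(1)])
    have i: "integrable N f"
      using Bochner_Integration.has_bochner_integral_simple_bochner_integrable[OF f] integrable.intros by blast
    have "norm (simple_integral N f) \<le> (LINT x|N. norm (f x))"
      unfolding simple_integral_eq_integral[OF f] by (rule integral_norm_bound)
    also have "\<dots> \<le> (LINT x|N. d * indicator S x)"
    proof (rule integral_mono)
      show "integrable N (\<lambda>x. d * indicator S x)"
        using N S(1) by (intro integrable_mult_right integrable_real_indicator) auto
      show "norm (f x) \<le> d * indicator S x" if "x \<in> space N" for x
        using that d sp by (auto split: split_indicator)
    qed (use i in simp)
    also have "\<dots> = d * measure N S"
      using N S(1) sets.sets_into_space[OF S(1)] sp by (simp add: Int_absorb2)
    finally show ?thesis .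
  qed
  define m where "m = simple_integral \<mu> g"
  have m: "norm m \<le> c * a"
    unfolding m_def a_def by (rule norm_int[OF g refl S(2) c supp])
  have rg: "simple_integrable \<mu> (\<lambda>x. rho w (g x))" by (rule simple_integrable_compose[OF g]) simp
  have "AE \<omega> in M. \<forall>y\<in>?R. \<exists>n::nat. measure (\<pi> \<omega>) (?B y) = real n"
    using fin by (intro AE_finite_allI AE_count_real lev) auto
  with AE_count_real[OF S] AE_finite_pi[OF S] AE_simple_integrable_pi[OF g] AE_simple_integrable_pi[OF rg] AE_space
  show ?thesis
    unfolding a_def[symmetric]
  proof eventually_elim
    case (elim \<omega>)
    let ?N = "measure (\<pi> \<omega>) S" and ?J = "simple_integral (\<pi> \<omega>) g"
    let ?I = "simple_integral (\<pi> \<omega>) (\<lambda>x. rho w (g x))"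
    obtain n :: nat where n: "?N = real n" using elim by blast
    have sets: "sets (\<pi> \<omega>) = sets \<mu>" and sp: "space (\<pi> \<omega>) = space \<mu>" using elim by simp_all
    have comp: "compensated g \<omega> = ?J - m"
      unfolding m_def by (rule compensated_eq) (use elim g in auto)
    have J: "norm ?J \<le> c * ?N"
      by (rule norm_int[OF _ sets _ c supp]) (use elim in auto)
    have I: "\<bar>?I\<bar> \<le> C * c\<^sup>2 * ?N"
    proof -
      have "norm (rho w (g x)) \<le> C * c\<^sup>2" if "x \<in> space \<mu>" for x
      proof -
        have "(norm (g x))\<^sup>2 \<le> c\<^sup>2" using c[OF that] by (intro power_mono) auto
        then show ?thesis using rho_bound[of w "g x"] mult_left_mono[OF _ C_nonneg] by (simp, meson order_trans)
      qed
      from norm_int[OF _ sets _ this] show ?thesis using elim supp by auto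
    qed
    show ?case
    proof (cases "n \<le> 1")
      case True
      have sum_le: "(\<Sum>y\<in>?R. measure (\<pi> \<omega>) (?B y)) \<le> ?N"
      proof -
        have "emeasure (\<pi> \<omega>) (?B y) \<noteq> \<infinity>" if "y \<in> ?R" for y
        proof -
          have "?B y \<subseteq> S" using that supp by fastforce
          then have "emeasure (\<pi> \<omega>) (?B y) \<le> emeasure (\<pi> \<omega>) S"
            by (intro emeasure_mono) (use S sets in auto)
          then show ?thesis using elim by (auto simp: top_unique)
        qed
        then have "(\<Sum>y\<in>?R. measure (\<pi> \<omega>) (?B y)) = measure (\<pi> \<omega>) (\<Union>y\<in>?R. ?B y)"
          by (intro measure_finite_Union[symmetric] fin) (use lev(2) sets in \<open>auto simp: disjoint_family_on_def\<close>)
        also have "\<dots> \<le> ?N"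
        proof (rule measure_mono_fmeasurable)
          show "(\<Union>y\<in>?R. ?B y) \<subseteq> S" using supp by auto
          show "(\<Union>y\<in>?R. ?B y) \<in> sets (\<pi> \<omega>)" using lev(2) sets fin by (intro sets.finite_UN) auto
          show "S \<in> fmeasurable (\<pi> \<omega>)" using elim sets S by (intro fmeasurableI) auto
        qed
        finally show ?thesis .
      qed
      have ex: "\<exists>y. norm y \<le> c * ?N \<and> ?J = y \<and> ?I = rho w y"
      proof -
        have J_eq: "?J = (\<Sum>y\<in>?R. measure (\<pi> \<omega>) (?B y) *\<^sub>R y)"
          using lev(1) by (subst simple_integral_nonzero) (simp_all add: sp)
        have gs: "simple_function (\<pi> \<omega>) g" using elim by (simp add: simple_integrable_iff)
        have "?I = (\<Sum>y\<in>g ` space (\<pi> \<omega>). measure (\<pi> \<omega>) {x\<in>space (\<pi> \<omega>). g x = y} *\<^sub>R rho w y)"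
          by (rule Bochner_Integration.simple_bochner_integral_partition[OF _ gs]) (use elim in auto)
        also have "\<dots> = (\<Sum>y\<in>?R. measure (\<pi> \<omega>) (?B y) *\<^sub>R rho w y)"
          unfolding sp by (rule sum.mono_neutral_right) (use lev(1) in auto)
        finally have I_eq: "?I = (\<Sum>y\<in>?R. measure (\<pi> \<omega>) (?B y) *\<^sub>R rho w y)" .
        show ?thesis
        proof (cases "\<exists>y\<in>?R. measure (\<pi> \<omega>) (?B y) \<noteq> 0")
          case False
          then show ?thesis
            unfolding J_eq I_eq using c0 by (intro exI[of _ 0]) simp
        next
          case ex: True
          then obtain y where y: "y \<in> ?R" "measure (\<pi> \<omega>) (?B y) \<noteq> 0" by blast
          obtain k :: nat where k: "measure (\<pi> \<omega>) (?B y) = real k" using elim y(1) by blast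
          have split: "(\<Sum>y\<in>?R. measure (\<pi> \<omega>) (?B y)) = measure (\<pi> \<omega>) (?B y) + (\<Sum>z\<in>?R - {y}. measure (\<pi> \<omega>) (?B z))"
            by (rule sum.remove[OF fin y(1)])
          have rest: "0 \<le> (\<Sum>z\<in>?R - {y}. measure (\<pi> \<omega>) (?B z))" by (intro sum_nonneg) simp
          \<comment> \<open>The counts of the levels are integers with sum at most 1, so the level
            found above carries the only point and all other levels are empty.\<close>
          have k1: "k = 1" and N1: "?N = 1" and "(\<Sum>z\<in>?R - {y}. measure (\<pi> \<omega>) (?B z)) = 0"
            using split rest sum_le y(2) n k True by auto
          then have z: "measure (\<pi> \<omega>) (?B z) = 0" if "z \<in> ?R - {y}" for z
            using that fin by (subst (asm) sum_nonneg_eq_0_iff) auto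
          have "?J = y"
            unfolding J_eq sum.remove[OF fin y(1)] using z k k1 by simp
          moreover have "?I = rho w y"
            unfolding I_eq sum.remove[OF fin y(1)] using z k k1 by simp
          moreover have "norm y \<le> c * ?N" using y(1) c N1 by auto
          ultimately show ?thesis by blast
        qed
      qed
      then obtain y where y: "norm y \<le> c * ?N" "?J = y" "?I = rho w y" by blast
      \<comment> \<open>With at most one jump \<open>y\<close>, the compensated integral misses
        \<open>y\<close> only by the compensator \<open>m\<close>, whose norm is at most
        \<open>c * a\<close>.\<close>
      have "\<bar>rho w (y - m) - rho w y\<bar> \<le> C * (norm (y - m) + norm y) * norm m"
        using rho_diff[of w "y - m" y] by simp
      also have "\<dots> \<le> C * ((c * ?N + c * a) + c * ?N) * (c * a)"
        using y(1) m norm_triangle_ineq4[of y m] C_nonneg c0 a0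
        by (intro mult_mono add_mono mult_left_mono mult_nonneg_nonneg add_nonneg_nonneg) auto
      also have "\<dots> = C * c\<^sup>2 * (a\<^sup>2 + 2 * a * ?N)"
        by (simp add: power2_eq_square algebra_simps)
      also have "\<dots> \<le> C * c\<^sup>2 * (2 * a\<^sup>2 + 2 * a * ?N + 5 * (?N * (?N - 1)))"
        using True n C_nonneg by (intro mult_left_mono) (auto simp: le_Suc_eq)
      finally show ?thesis unfolding comp y(2,3) .
    next
      case False
      have N2: "2 \<le> ?N" using False n by simp
      have "\<bar>rho w (?J - m)\<bar> \<le> C * (norm (?J - m))\<^sup>2" by (rule rho_bound)
      also have "\<dots> \<le> C * (c * ?N + c * a)\<^sup>2"
        using J m norm_triangle_ineq4[of ?J m] C_nonneg
        by (intro mult_left_mono power_mono) auto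
      also have "\<dots> \<le> C * (c\<^sup>2 * (2 * ?N\<^sup>2 + 2 * a\<^sup>2))"
      proof (intro mult_left_mono C_nonneg)
        have "(c * ?N + c * a)\<^sup>2 = c\<^sup>2 * (?N + a)\<^sup>2" by (simp add: power2_eq_square algebra_simps)
        also have "\<dots> \<le> c\<^sup>2 * (2 * ?N\<^sup>2 + 2 * a\<^sup>2)"
          using norm_add_sq_le[of ?N a] by (intro mult_left_mono) auto
        finally show "(c * ?N + c * a)\<^sup>2 \<le> c\<^sup>2 * (2 * ?N\<^sup>2 + 2 * a\<^sup>2)" .
      qed
      finally have "\<bar>rho w (?J - m) - ?I\<bar> \<le> C * c\<^sup>2 * (2 * ?N\<^sup>2 + 2 * a\<^sup>2 + ?N)"
        using I by (simp add: algebra_simps)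
      also have "\<dots> \<le> C * c\<^sup>2 * (2 * a\<^sup>2 + 2 * a * ?N + 5 * (?N * (?N - 1)))"
      proof (intro mult_left_mono)
        \<comment> \<open>For at least two points, \<open>2 * ?N^2 + ?N\<close> is at most
          \<open>5 * ?N * (?N - 1)\<close>, with equality at 2; this fixes the constant 5.\<close>
        have "?N \<le> ?N * (?N - 1)" using N2 mult_left_mono[of 1 "?N - 1" ?N] by simp
        then have "2 * ?N\<^sup>2 + ?N \<le> 5 * (?N * (?N - 1))" by (simp add: power2_eq_square algebra_simps)
        moreover have "0 \<le> 2 * a * ?N" using a0 by simp
        ultimately show "2 * ?N\<^sup>2 + 2 * a\<^sup>2 + ?N \<le> 2 * a\<^sup>2 + 2 * a * ?N + 5 * (?N * (?N - 1))" by linarith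
      qed (use C_nonneg in simp)
      finally show ?thesis unfolding comp .
    qed
  qed
qed

end

section \<open>Remainder estimates for square integrable integrands\<close>

context poisson_C11
begin

lemma comp_lim_sq_norm_real:
  assumes "comp_lim f X"
  shows "expectation (\<lambda>\<omega>. (norm (X \<omega>))\<^sup>2) \<le> 4 * (LINT x|\<mu>. (norm (f x))\<^sup>2)"
proof -
  note sq = comp_lim_sq_integrable[OF assms]
  have "ennreal (expectation (\<lambda>\<omega>. (norm (X \<omega>))\<^sup>2)) \<le> ennreal (4 * (LINT x|\<mu>. (norm (f x))\<^sup>2))"
    using comp_lim_sq_norm[OF assms] sq_norm_eq_integral[OF sq(1)] sq_norm_eq_integral[OF sq(2)]
    by (simp add: ennreal_mult)
  then show ?thesis by (subst (asm) ennreal_le_iff) auto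
qed

text \<open>The integral of \<open>rho w \<circ> g\<close> against \<open>\<pi>\<close> has its
  integral against \<open>\<mu>\<close> as mean, so only the pathwise error remains. With
  \<open>a = measure \<mu> S\<close> its bound has mean
  \<open>2 * a^2 + 2 * a * a + 5 * a^2\<close>, whence the 9.\<close>

lemma rho_simple_estimate:
  assumes g: "simple_integrable \<mu> g" and c: "\<And>x. x \<in> space \<mu> \<Longrightarrow> norm (g x) \<le> c" "0 \<le> c"
    and S: "S \<in> sets \<mu>" "emeasure \<mu> S < \<infinity>" and supp: "\<And>x. x \<in> space \<mu> \<Longrightarrow> x \<notin> S \<Longrightarrow> g x = 0"
  shows "\<bar>expectation (\<lambda>\<omega>. rho w (compensated g \<omega>)) - (LINT x|\<mu>. rho w (g x))\<bar>
    \<le> 9 * C * c\<^sup>2 * (measure \<mu> S)\<^sup>2"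
proof -
  define a where "a = measure \<mu> S"
  have rg: "simple_integrable \<mu> (\<lambda>x. rho w (g x))" by (rule simple_integrable_compose[OF g]) simp
  let ?k = "compensated (\<lambda>x. rho w (g x))" and ?m = "LINT x|\<mu>. rho w (g x)"
  have ik: "integrable M ?k"
    by (rule sq_integrable_imp_integrable[OF comp_lim_sq_integrable(2)[OF comp_lim_simple[OF rg]]])
  have ig: "integrable M (\<lambda>\<omega>. rho w (compensated g \<omega>))"
    by (rule rho_integrable[OF _ comp_lim_sq_integrable(2)[OF comp_lim_simple[OF g]]]) simp
  have "expectation (\<lambda>\<omega>. rho w (compensated g \<omega>) - (?k \<omega> + ?m)) = expectation (\<lambda>\<omega>. rho w (compensated g \<omega>)) - ?m"
    using ik ig compensated_isometry(2)[OF rg] by (simp add: prob_space)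
  moreover have "\<bar>expectation (\<lambda>\<omega>. rho w (compensated g \<omega>) - (?k \<omega> + ?m))\<bar> \<le> 9 * C * c\<^sup>2 * a\<^sup>2"
  proof -
    let ?N = "\<lambda>\<omega>. measure (\<pi> \<omega>) S"
    let ?b = "\<lambda>\<omega>. C * c\<^sup>2 * (2 * a\<^sup>2 + 2 * a * ?N \<omega> + 5 * (?N \<omega> * (?N \<omega> - 1)))"
    note mom = count_moments[OF S, folded a_def]
    have pathwise: "AE \<omega> in M. \<bar>rho w (compensated g \<omega>) - simple_integral (\<pi> \<omega>) (\<lambda>x. rho w (g x))\<bar> \<le> ?b \<omega>"
      unfolding a_def by (rule rho_simple_pathwise[OF g _ S _ c(2)]) (use c supp in auto)
    define P where "P \<omega> = ?N \<omega> * (?N \<omega> - 1)" for \<omega>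
    have P: "integrable M P" "expectation P = a\<^sup>2" using mom by (simp_all add: P_def[abs_def])
    have ib: "integrable M ?b"
      unfolding P_def[symmetric] using mom P by simp
    have "\<bar>expectation (\<lambda>\<omega>. rho w (compensated g \<omega>) - (?k \<omega> + ?m))\<bar>
        \<le> expectation (\<lambda>\<omega>. \<bar>rho w (compensated g \<omega>) - (?k \<omega> + ?m)\<bar>)"
      using integral_abs_bound by blast
    also have "\<dots> \<le> expectation ?b"
    proof (rule integral_mono_AE[OF _ ib])
      show "integrable M (\<lambda>\<omega>. \<bar>rho w (compensated g \<omega>) - (?k \<omega> + ?m)\<bar>)" using ik ig by simp
      show "AE \<omega> in M. \<bar>rho w (compensated g \<omega>) - (?k \<omega> + ?m)\<bar> \<le> ?b \<omega>"
        using pathwise AE_space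
      proof eventually_elim
        case (elim \<omega>)
        have "?k \<omega> + ?m = simple_integral (\<pi> \<omega>) (\<lambda>x. rho w (g x))"
          using compensated_eq[OF elim(2) rg] simple_integral_eq_integral[OF rg] by simp
        then show ?case using elim(1) by simp
      qed
    qed
    also have "expectation ?b = C * c\<^sup>2 * (2 * a\<^sup>2 + 2 * a * a + 5 * a\<^sup>2)"
      unfolding P_def[symmetric] using mom P by (simp add: prob_space)
    also have "\<dots> = 9 * C * c\<^sup>2 * a\<^sup>2" by (simp add: power2_eq_square algebra_simps)
    finally show ?thesis .
  qed
  ultimately show ?thesis by (simp add: a_def)
qed

text \<open>\<open>rho_diff\<close> followed by Young's inequality with parameter
  \<open>\<delta>\<close>. A small \<open>\<delta>\<close> tames the energies; afterwards the
  distance of \<open>X\<close> and \<open>Y\<close> is made small relative to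
  \<open>\<delta>\<close>.\<close>

lemma rho_integral_diff:
  assumes X: "sq_integrable N X" and Y: "sq_integrable N Y" and \<delta>: "0 < \<delta>"
  shows "\<bar>(LINT x|N. rho w (X x)) - (LINT x|N. rho w (Y x))\<bar>
    \<le> C * (\<delta> * ((LINT x|N. (norm (X x))\<^sup>2) + (LINT x|N. (norm (Y x))\<^sup>2)) + (LINT x|N. (norm (X x - Y x))\<^sup>2) / \<delta>)"
proof -
  note i = sq_integrable_integrable[OF X] sq_integrable_integrable[OF Y]
    sq_integrable_integrable[OF sq_integrable_diff[OF X Y]]
  have r: "integrable N (\<lambda>x. rho w (X x))" "integrable N (\<lambda>x. rho w (Y x))"
    by (auto intro: rho_integrable X Y)
  let ?b = "\<lambda>x. C * (\<delta> * ((norm (X x))\<^sup>2 + (norm (Y x))\<^sup>2) + (norm (X x - Y x))\<^sup>2 / \<delta>)"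
  have "\<bar>(LINT x|N. rho w (X x)) - (LINT x|N. rho w (Y x))\<bar> = \<bar>LINT x|N. rho w (X x) - rho w (Y x)\<bar>"
    using r by simp
  also have "\<dots> \<le> (LINT x|N. \<bar>rho w (X x) - rho w (Y x)\<bar>)"
    using integral_abs_bound by blast
  also have "\<dots> \<le> (LINT x|N. ?b x)"
  proof (rule integral_mono)
    show "\<bar>rho w (X x) - rho w (Y x)\<bar> \<le> ?b x" for x
    proof -
      let ?p = "norm (X x)" and ?q = "norm (Y x)" and ?r = "norm (X x - Y x)"
      have "(?p + ?q) * ?r \<le> \<delta> * (?p\<^sup>2 + ?q\<^sup>2) + ?r\<^sup>2 / \<delta>"
      proof -
        have "0 \<le> (\<delta> * (?p + ?q) - ?r)\<^sup>2" by simp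
        then have "2 * (\<delta> * ((?p + ?q) * ?r)) \<le> (\<delta> * (?p + ?q))\<^sup>2 + ?r\<^sup>2"
          by (simp add: power2_eq_square algebra_simps)
        also have "\<dots> \<le> \<delta>\<^sup>2 * (2 * ?p\<^sup>2 + 2 * ?q\<^sup>2) + 2 * ?r\<^sup>2"
          using norm_add_sq_le[of ?p ?q] mult_left_mono[of "(?p + ?q)\<^sup>2" "2 * ?p\<^sup>2 + 2 * ?q\<^sup>2" "\<delta>\<^sup>2"]
          by (simp add: power_mult_distrib add_mono)
        finally have "\<delta> * ((?p + ?q) * ?r) \<le> \<delta> * (\<delta> * (?p\<^sup>2 + ?q\<^sup>2) + ?r\<^sup>2 / \<delta>)"
          using \<delta> by (simp add: power2_eq_square algebra_simps)
        then show ?thesis using \<delta> by (simp only: mult_le_cancel_left_pos)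
      qed
      from mult_left_mono[OF this C_nonneg] show ?thesis
        using rho_diff[of w "X x" "Y x"] by (simp only: mult.assoc)
    qed
  qed (use r i in auto)
  also have "\<dots> = C * (\<delta> * ((LINT x|N. (norm (X x))\<^sup>2) + (LINT x|N. (norm (Y x))\<^sup>2)) + (LINT x|N. (norm (X x - Y x))\<^sup>2) / \<delta>)"
    using i by simp
  finally show ?thesis .
qed

text \<open>The comparison of \<open>f\<close> with \<open>g\<close> is made twice, under
  \<open>M\<close> with the factor 4 of \<open>comp_lim_sq_norm_real\<close> and under
  \<open>\<mu>\<close> with factor 1, which adds up to 5. The last term is the error for the simple
  field \<open>g\<close> itself.\<close>

lemma rho_estimate:
  assumes f: "comp_lim f X" and \<delta>: "0 < \<delta>"
    and g: "simple_integrable \<mu> g" and c: "\<And>x. x \<in> space \<mu> \<Longrightarrow> norm (g x) \<le> c" "0 \<le> c"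
    and S: "S \<in> sets \<mu>" "emeasure \<mu> S < \<infinity>" and supp: "\<And>x. x \<in> space \<mu> \<Longrightarrow> x \<notin> S \<Longrightarrow> g x = 0"
  shows "\<bar>expectation (\<lambda>\<omega>. rho w (X \<omega>)) - (LINT x|\<mu>. rho w (f x))\<bar>
    \<le> 5 * C * (\<delta> * ((LINT x|\<mu>. (norm (f x))\<^sup>2) + (LINT x|\<mu>. (norm (g x))\<^sup>2)) + (LINT x|\<mu>. (norm (f x - g x))\<^sup>2) / \<delta>)
      + 9 * C * c\<^sup>2 * (measure \<mu> S)\<^sup>2"
proof -
  note cg = comp_lim_simple[OF g]
  note sf = comp_lim_sq_integrable[OF f] and sg = comp_lim_sq_integrable[OF cg]
  let ?F = "LINT x|\<mu>. (norm (f x))\<^sup>2" and ?G = "LINT x|\<mu>. (norm (g x))\<^sup>2" and ?D = "LINT x|\<mu>. (norm (f x - g x))\<^sup>2"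
  have 1: "\<bar>expectation (\<lambda>\<omega>. rho w (X \<omega>)) - expectation (\<lambda>\<omega>. rho w (compensated g \<omega>))\<bar>
      \<le> 4 * (C * (\<delta> * (?F + ?G) + ?D / \<delta>))"
  proof -
    have "\<bar>expectation (\<lambda>\<omega>. rho w (X \<omega>)) - expectation (\<lambda>\<omega>. rho w (compensated g \<omega>))\<bar>
        \<le> C * (\<delta> * (expectation (\<lambda>\<omega>. (norm (X \<omega>))\<^sup>2) + expectation (\<lambda>\<omega>. (norm (compensated g \<omega>))\<^sup>2))
          + expectation (\<lambda>\<omega>. (norm (X \<omega> - compensated g \<omega>))\<^sup>2) / \<delta>)"
      by (rule rho_integral_diff[OF sf(2) sg(2) \<delta>])
    also have "\<dots> \<le> C * (\<delta> * (4 * ?F + 4 * ?G) + (4 * ?D) / \<delta>)"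
      using \<delta> C_nonneg
      by (intro mult_left_mono add_mono divide_right_mono comp_lim_sq_norm_real f cg comp_lim_diff) auto
    finally show ?thesis by (simp add: algebra_simps)
  qed
  have 2: "\<bar>(LINT x|\<mu>. rho w (f x)) - (LINT x|\<mu>. rho w (g x))\<bar> \<le> C * (\<delta> * (?F + ?G) + ?D / \<delta>)"
    by (rule rho_integral_diff[OF sf(1) sg(1) \<delta>])
  have 3: "\<bar>expectation (\<lambda>\<omega>. rho w (compensated g \<omega>)) - (LINT x|\<mu>. rho w (g x))\<bar> \<le> 9 * C * c\<^sup>2 * (measure \<mu> S)\<^sup>2"
    by (rule rho_simple_estimate[OF g _ c(2) S]) (use c supp in auto)
  have "5 * C * (\<delta> * (?F + ?G) + ?D / \<delta>) = 4 * (C * (\<delta> * (?F + ?G) + ?D / \<delta>)) + C * (\<delta> * (?F + ?G) + ?D / \<delta>)"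
    by simp
  then show ?thesis using 1 2 3 by linarith
qed

end

locale sigma_finite_poisson_C11 = poisson_C11 M \<mu> \<pi> \<phi> D B K C + mu: sigma_finite_measure \<mu>
  for M :: "'w measure" and \<mu> :: "'z measure" and \<pi> :: "'w \<Rightarrow> 'z measure"
    and \<phi> :: "'h::{real_inner,banach,second_countable_topology} \<Rightarrow> real" and D B K C
begin

sublocale M_mu: pair_sigma_finite M \<mu> ..

lemma rho_pair_integrable:
  assumes [measurable]: "W \<in> borel_measurable (M \<Otimes>\<^sub>M \<mu>)" and f: "sq_integrable \<mu> f"
  shows "integrable (M \<Otimes>\<^sub>M \<mu>) (\<lambda>(\<omega>, z). rho (W (\<omega>, z)) (f z))"
proof -
  have [measurable]: "f \<in> borel_measurable \<mu>" using f by auto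
  have sq: "sq_integrable (M \<Otimes>\<^sub>M \<mu>) (\<lambda>p. f (snd p))"
  proof -
    have "sq_norm (M \<Otimes>\<^sub>M \<mu>) (\<lambda>p. f (snd p)) = (\<integral>\<^sup>+\<omega>. \<integral>\<^sup>+z. ennreal ((norm (f z))\<^sup>2) \<partial>\<mu> \<partial>M)"
      unfolding sq_norm_def by (subst mu.nn_integral_fst[symmetric]) auto
    also have "\<dots> = sq_norm \<mu> f" by (simp add: sq_norm_def emeasure_space_1)
    finally show ?thesis using f by (auto simp: sq_integrable_def)
  qed
  have "integrable (M \<Otimes>\<^sub>M \<mu>) (\<lambda>p. rho (W p) (f (snd p)))"
    by (rule rho_integrable[OF assms(1) sq])
  then show ?thesis by (simp add: case_prod_beta')
qed

lemma rho_Fubini: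
  assumes [measurable]: "W \<in> borel_measurable M" and f: "sq_integrable \<mu> f"
  shows "integrable M (\<lambda>\<omega>. LINT z|\<mu>. rho (W \<omega>) (f z))"
    and "expectation (\<lambda>\<omega>. LINT z|\<mu>. rho (W \<omega>) (f z)) = (LINT z|\<mu>. expectation (\<lambda>\<omega>. rho (W \<omega>) (f z)))"
    and "integrable \<mu> (\<lambda>z. expectation (\<lambda>\<omega>. rho (W \<omega>) (f z)))"
proof -
  have i: "integrable (M \<Otimes>\<^sub>M \<mu>) (\<lambda>(\<omega>, z). rho (W \<omega>) (f z))"
    using rho_pair_integrable[of "\<lambda>p. W (fst p)", OF _ f] by simp
  show "integrable M (\<lambda>\<omega>. LINT z|\<mu>. rho (W \<omega>) (f z))" by (rule M_mu.integrable_fst[OF i])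
  show "expectation (\<lambda>\<omega>. LINT z|\<mu>. rho (W \<omega>) (f z)) = (LINT z|\<mu>. expectation (\<lambda>\<omega>. rho (W \<omega>) (f z)))"
    by (rule M_mu.Fubini_integral[OF i, symmetric])
  show "integrable \<mu> (\<lambda>z. expectation (\<lambda>\<omega>. rho (W \<omega>) (f z)))" by (rule M_mu.integrable_snd[OF i])
qed

lemma phi_integrable: "W \<in> borel_measurable M \<Longrightarrow> integrable M (\<lambda>\<omega>. \<phi> (W \<omega>))"
  by (rule integrable_const_bound[of _ B]) (use bounded in auto)

lemma D_integrable: "W \<in> borel_measurable M \<Longrightarrow> integrable M (\<lambda>\<omega>. D (W \<omega>))"
  by (rule integrable_const_bound[of _ K]) (use grad_bounded in auto)

text \<open>The bound \<open>\<beta>\<close> is uniform in the base point, so it survives freezing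
  the independent \<open>W\<close> and averaging over its law.\<close>

lemma increment_estimate:
  assumes f: "comp_lim f X" and W: "indep_var borel W borel X"
    and est: "\<And>w. \<bar>expectation (\<lambda>\<omega>. rho w (X \<omega>)) - (LINT x|\<mu>. rho w (f x))\<bar> \<le> \<beta>"
  shows "\<bar>expectation (\<lambda>\<omega>. \<phi> (W \<omega> + X \<omega>)) - expectation (\<lambda>\<omega>. \<phi> (W \<omega>))
    - (LINT z|\<mu>. expectation (\<lambda>\<omega>. rho (W \<omega>) (f z)))\<bar> \<le> \<beta>"
proof -
  have [measurable]: "W \<in> borel_measurable M" "X \<in> borel_measurable M"
    using indep_var_rv1[OF W] indep_var_rv2[OF W] by auto
  have sX: "sq_integrable M X" and sf: "sq_integrable \<mu> f"
    using comp_lim_sq_integrable[OF f] by auto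
  have iX: "integrable M X" by (rule sq_integrable_imp_integrable[OF sX])
  have iD: "integrable M (\<lambda>\<omega>. D (W \<omega>) \<bullet> X \<omega>)"
  proof (rule Bochner_Integration.integrable_bound)
    show "integrable M (\<lambda>\<omega>. K * norm (X \<omega>))" using iX by simp
    show "AE \<omega> in M. norm (D (W \<omega>) \<bullet> X \<omega>) \<le> norm (K * norm (X \<omega>))"
    proof (intro AE_I2)
      fix \<omega>
      have "\<bar>D (W \<omega>) \<bullet> X \<omega>\<bar> \<le> norm (D (W \<omega>)) * norm (X \<omega>)" by (rule Cauchy_Schwarz_ineq2)
      also have "\<dots> \<le> K * norm (X \<omega>)" by (intro mult_right_mono grad_bounded) simp
      finally show "norm (D (W \<omega>) \<bullet> X \<omega>) \<le> norm (K * norm (X \<omega>))" using K_nonneg by simp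
    qed
  qed measurable
  have "expectation (\<lambda>\<omega>. D (W \<omega>) \<bullet> X \<omega>) = expectation (\<lambda>\<omega>. expectation (\<lambda>\<omega>'. D (W \<omega>) \<bullet> X \<omega>'))"
    by (rule indep_var_iterated_expectation(1)[OF W, of "\<lambda>w x. D w \<bullet> x"]) (use iD in auto)
  also have "\<dots> = 0"
    using comp_lim_expectation[OF f] iX by simp
  finally have D0: "expectation (\<lambda>\<omega>. D (W \<omega>) \<bullet> X \<omega>) = 0" .
  have ir: "integrable M (\<lambda>\<omega>. rho (W \<omega>) (X \<omega>))" by (rule rho_integrable[OF _ sX]) measurable
  have "expectation (\<lambda>\<omega>. rho (W \<omega>) (X \<omega>))
      = expectation (\<lambda>\<omega>. \<phi> (W \<omega> + X \<omega>)) - expectation (\<lambda>\<omega>. \<phi> (W \<omega>))"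
    unfolding rho_def using iD D0 phi_integrable by simp
  moreover have "expectation (\<lambda>\<omega>. rho (W \<omega>) (X \<omega>)) = expectation (\<lambda>\<omega>. expectation (\<lambda>\<omega>'. rho (W \<omega>) (X \<omega>')))"
    and ii: "integrable M (\<lambda>\<omega>. expectation (\<lambda>\<omega>'. rho (W \<omega>) (X \<omega>')))"
    using indep_var_iterated_expectation[OF W, of rho] ir rho_measurable by (auto simp: case_prod_beta')
  moreover have "\<bar>expectation (\<lambda>\<omega>. expectation (\<lambda>\<omega>'. rho (W \<omega>) (X \<omega>'))) - expectation (\<lambda>\<omega>. LINT z|\<mu>. rho (W \<omega>) (f z))\<bar> \<le> \<beta>"
  proof -
    note i2 = rho_Fubini(1)[OF \<open>W \<in> borel_measurable M\<close> sf]
    let ?d = "\<lambda>\<omega>. expectation (\<lambda>\<omega>'. rho (W \<omega>) (X \<omega>')) - (LINT z|\<mu>. rho (W \<omega>) (f z))"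
    have "\<bar>expectation ?d\<bar> \<le> expectation (\<lambda>\<omega>. \<bar>?d \<omega>\<bar>)" using integral_abs_bound by blast
    also have "\<dots> \<le> expectation (\<lambda>\<omega>. \<beta>)"
      by (rule integral_mono) (use ii i2 est in auto)
    finally show ?thesis using ii i2 by (simp add: prob_space)
  qed
  ultimately show ?thesis
    using rho_Fubini(2)[OF \<open>W \<in> borel_measurable M\<close> sf] by simp
qed

end

text \<open>The mark space stays abstract. Absence of atoms in time makes single instants
  negligible, in particular time 0, and makes integrals over shrinking time windows vanish.\<close>

locale time_poisson_C11 = sigma_finite_poisson_C11 M \<mu> \<pi> \<phi> D B K C
  for M :: "'w measure" and \<mu> :: "(real \<times> 'y) measure" and \<pi> :: "'w \<Rightarrow> (real \<times> 'y) measure"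
    and \<phi> :: "'h::{real_inner,banach,second_countable_topology} \<Rightarrow> real" and D B K C +
  fixes T :: real
  assumes T_pos: "0 < T" and time_measurable [measurable]: "fst \<in> borel_measurable \<mu>"
    and time_range: "z \<in> space \<mu> \<Longrightarrow> 0 \<le> fst z \<and> fst z \<le> T"
    and no_atoms: "AE z in \<mu>. fst z \<noteq> t"
begin

subsection \<open>Partitions of the time interval\<close>

abbreviation sq_int :: "(real \<times> 'y \<Rightarrow> 'h) \<Rightarrow> real" where
  "sq_int f \<equiv> LINT z|\<mu>. (norm (f z))\<^sup>2"

text \<open>Counting \<open>Suc n\<close> cells avoids a division by zero at
  \<open>n = 0\<close>.\<close>

definition grid :: "nat \<Rightarrow> nat \<Rightarrow> real" where
  "grid n k = T * real k / real (Suc n)"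

definition slab :: "nat \<Rightarrow> nat \<Rightarrow> (real \<times> 'y) set" where
  "slab n k = {z\<in>space \<mu>. grid n k < fst z \<and> fst z \<le> grid n (Suc k)}"

lemma grid_0 [simp]: "grid n 0 = 0" and grid_end [simp]: "grid n (Suc n) = T"
  by (auto simp: grid_def)

lemma grid_Suc: "grid n (Suc k) = grid n k + T / real (Suc n)"
  unfolding grid_def of_nat_Suc[of k] distrib_left add_divide_distrib by simp

lemma grid_less: "grid n k < grid n (Suc k)"
  using T_pos by (simp add: grid_Suc)

lemma grid_range: "k \<le> Suc n \<Longrightarrow> 0 \<le> grid n k \<and> grid n k \<le> T"
  using T_pos mult_left_mono[of "real k" "real (Suc n)" T]
  by (auto simp: grid_def pos_divide_le_eq simp del: of_nat_Suc)

lemma slab_measurable [measurable]: "slab n k \<in> sets \<mu>"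
  unfolding slab_def by measurable

text \<open>The indicator of a slab is a difference of two consecutive values of
  \<open>of_bool (fst z \<le> grid n k)\<close>, so the sum telescopes. Slabs are open on the left
  and miss time 0.\<close>

lemma sum_indicator_slab:
  assumes "z \<in> space \<mu>"
  shows "(\<Sum>k<Suc n. indicator (slab n k) z) = (if 0 < fst z then 1 else (0::real))"
proof -
  have "(indicator (slab n k) z :: real) = (\<lambda>k. of_bool (fst z \<le> grid n k)) (Suc k) - (\<lambda>k. of_bool (fst z \<le> grid n k)) k" for k
    using assms grid_less[of n k] by (auto simp: slab_def indicator_def of_bool_def)
  then have "(\<Sum>k<Suc n. indicator (slab n k) z) = of_bool (fst z \<le> grid n (Suc n)) - (of_bool (fst z \<le> grid n 0) :: real)"
    by (simp only: sum_lessThan_telescope[of "\<lambda>k. of_bool (fst z \<le> grid n k) :: real"])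
  then show ?thesis using time_range[OF assms] by auto
qed

lemma sum_slab_integral_le:
  fixes f :: "real \<times> 'y \<Rightarrow> real"
  assumes "integrable \<mu> f" "\<And>z. z \<in> space \<mu> \<Longrightarrow> 0 \<le> f z"
  shows "(\<Sum>k<Suc n. LINT z|\<mu>. indicator (slab n k) z * f z) \<le> (LINT z|\<mu>. f z)"
proof -
  have i: "integrable \<mu> (\<lambda>z. indicator (slab n k) z * f z)" for k
    using integrable_mult_indicator[OF slab_measurable assms(1)] by simp
  have "(\<Sum>k<Suc n. LINT z|\<mu>. indicator (slab n k) z * f z) = (LINT z|\<mu>. (\<Sum>k<Suc n. indicator (slab n k) z * f z))"
    by (rule Bochner_Integration.integral_sum[symmetric]) (rule i)
  also have "\<dots> \<le> (LINT z|\<mu>. f z)"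
  proof (rule integral_mono)
    fix z assume z: "z \<in> space \<mu>"
    show "(\<Sum>k<Suc n. indicator (slab n k) z * f z) \<le> f z"
      unfolding sum_distrib_right[symmetric] sum_indicator_slab[OF z] using assms(2)[OF z] by simp
  next
    show "integrable \<mu> (\<lambda>z. \<Sum>k<Suc n. indicator (slab n k) z * f z)"
      by (intro Bochner_Integration.integrable_sum i)
  qed (rule assms(1))
  finally show ?thesis .
qed

text \<open>A neighbourhood that contains the slab through its centre but does not depend on the
  slab index. With the centre fixed it shrinks to a single instant, so dominated convergence
  applies.\<close>

definition window :: "nat \<Rightarrow> real \<Rightarrow> (real \<times> 'y) set" where
  "window n t = {z\<in>space \<mu>. \<bar>fst z - t\<bar> \<le> T / real (Suc n)}"

lemma window_measurable [measurable]: "window n t \<in> sets \<mu>"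
  unfolding window_def by measurable

lemma slab_subset_window: "z \<in> slab n k \<Longrightarrow> slab n k \<subseteq> window n (fst z)"
  by (auto simp: slab_def window_def grid_Suc)

lemma window_tendsto_0:
  fixes f :: "real \<times> 'y \<Rightarrow> real"
  assumes f: "integrable \<mu> f"
  shows "(\<lambda>n. LINT z|\<mu>. indicator (window n t) z * f z) \<longlonglongrightarrow> 0"
proof -
  have [measurable]: "f \<in> borel_measurable \<mu>" using f by auto
  have "(\<lambda>n. LINT z|\<mu>. indicator (window n t) z * f z) \<longlonglongrightarrow> (LINT z|\<mu>. 0)"
  proof (rule integral_dominated_convergence[where w="\<lambda>z. norm (f z)"])
    show "AE z in \<mu>. (\<lambda>n. indicator (window n t) z * f z) \<longlonglongrightarrow> 0"
      using no_atoms[of t]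
    proof eventually_elim
      case (elim z)
      have "(\<lambda>n. T / real (Suc n)) \<longlonglongrightarrow> 0"
        using tendsto_mult[OF tendsto_const[of T] LIMSEQ_inverse_real_of_nat] by (simp add: divide_inverse)
      then have "eventually (\<lambda>n. T / real (Suc n) < \<bar>fst z - t\<bar>) sequentially"
        by (rule order_tendstoD) (use elim in simp)
      then have "eventually (\<lambda>n. indicator (window n t) z * f z = 0) sequentially"
        by eventually_elim (auto simp: window_def)
      then show ?case by (rule tendsto_eventually)
    qed
  qed (use f in \<open>auto split: split_indicator\<close>)
  then show ?thesis by simp
qed

text \<open>The sum of squares is the integral over \<open>S\<close> of the measure of the part of
  \<open>S\<close> in the slab through the current point. This measure tends to 0 pointwise by
  absence of atoms and is dominated by the finite \<open>measure \<mu> S\<close>.\<close>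

lemma sum_slab_squares_tendsto_0:
  assumes S: "S \<in> sets \<mu>" "emeasure \<mu> S < \<infinity>"
  shows "(\<lambda>n. \<Sum>k<Suc n. (measure \<mu> (slab n k \<inter> S))\<^sup>2) \<longlonglongrightarrow> 0"
proof -
  note [measurable] = S(1)
  have fm: "S \<in> fmeasurable \<mu>" using S by (simp add: fmeasurable_def)
  have iS: "integrable \<mu> (indicator A :: _ \<Rightarrow> real)" if "A \<in> sets \<mu>" "A \<subseteq> S" for A
    using that S by (intro integrable_real_indicator) (auto intro: le_less_trans[OF emeasure_mono])
  let ?q = "\<lambda>n z. \<Sum>k<Suc n. measure \<mu> (slab n k \<inter> S) * indicator (slab n k \<inter> S) z"
  have int: "(LINT z|\<mu>. ?q n z) = (\<Sum>k<Suc n. (measure \<mu> (slab n k \<inter> S))\<^sup>2)" for n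
  proof -
    have "(LINT z|\<mu>. ?q n z) = (\<Sum>k<Suc n. LINT z|\<mu>. measure \<mu> (slab n k \<inter> S) * indicator (slab n k \<inter> S) z)"
      by (intro Bochner_Integration.integral_sum integrable_mult_right iS) auto
    also have "\<dots> = (\<Sum>k<Suc n. (measure \<mu> (slab n k \<inter> S))\<^sup>2)"
    proof (intro sum.cong refl)
      fix k
      have "slab n k \<inter> S \<inter> space \<mu> = slab n k \<inter> S" by (auto simp: slab_def)
      then show "(LINT z|\<mu>. measure \<mu> (slab n k \<inter> S) * indicator (slab n k \<inter> S) z) = (measure \<mu> (slab n k \<inter> S))\<^sup>2"
        by (simp add: power2_eq_square)
    qed
    finally show ?thesis .
  qed
  have le: "?q n z \<le> c * indicator S z" and nn: "0 \<le> ?q n z"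
    if z: "z \<in> space \<mu>" and c: "\<And>k. z \<in> slab n k \<Longrightarrow> measure \<mu> (slab n k \<inter> S) \<le> c" "0 \<le> c" for n z c
  proof -
    have "?q n z \<le> (\<Sum>k<Suc n. (c * indicator S z) * indicator (slab n k) z)"
      using c by (intro sum_mono) (auto split: split_indicator)
    also have "\<dots> = (c * indicator S z) * (\<Sum>k<Suc n. indicator (slab n k) z)"
      by (rule sum_distrib_left[symmetric])
    also have "\<dots> \<le> c * indicator S z"
      unfolding sum_indicator_slab[OF z] using c(2) by (simp split: split_indicator)
    finally show "?q n z \<le> c * indicator S z" .
    show "0 \<le> ?q n z" by (intro sum_nonneg mult_nonneg_nonneg) auto
  qed
  have "(\<lambda>n. LINT z|\<mu>. ?q n z) \<longlonglongrightarrow> (LINT z|\<mu>. 0)"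
  proof (rule integral_dominated_convergence[where w="\<lambda>z. measure \<mu> S * indicator S z"])
    show "integrable \<mu> (\<lambda>z. measure \<mu> S * indicator S z)" by (intro integrable_mult_right iS) auto
    show "AE z in \<mu>. norm (?q n z) \<le> measure \<mu> S * indicator S z" for n
    proof (intro AE_I2)
      fix z assume z: "z \<in> space \<mu>"
      have "measure \<mu> (slab n k \<inter> S) \<le> measure \<mu> S" for k
        by (rule measure_mono_fmeasurable[OF _ _ fm]) auto
      from le[OF z this] nn[OF z this] show "norm (?q n z) \<le> measure \<mu> S * indicator S z" by simp
    qed
    show "AE z in \<mu>. (\<lambda>n. ?q n z) \<longlonglongrightarrow> 0"
    proof (intro AE_I2)
      fix z assume z: "z \<in> space \<mu>"
      let ?m = "\<lambda>n. LINT z'|\<mu>. indicator (window n (fst z)) z' * (indicator S z' :: real)"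
      have m: "measure \<mu> (slab n k \<inter> S) \<le> ?m n" if "z \<in> slab n k" for n k
      proof -
        have "measure \<mu> (slab n k \<inter> S) \<le> measure \<mu> (window n (fst z) \<inter> S)"
          using slab_subset_window[OF that]
          by (intro measure_mono_fmeasurable fmeasurableI2[OF fm]) auto
        also have "\<dots> = (LINT z'|\<mu>. indicator (window n (fst z) \<inter> S) z')"
        proof -
          have "window n (fst z) \<inter> S \<inter> space \<mu> = window n (fst z) \<inter> S" by (auto simp: window_def)
          then show ?thesis by simp
        qed
        also have "\<dots> = ?m n" by (intro Bochner_Integration.integral_cong) (auto split: split_indicator)
        finally show ?thesis .
      qed
      have m0: "0 \<le> ?m n" for n by (intro integral_nonneg_AE) auto
      have m_lim: "?m \<longlonglongrightarrow> 0" by (rule window_tendsto_0[OF iS]) auto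
      show "(\<lambda>n. ?q n z) \<longlonglongrightarrow> 0"
      proof (rule tendsto_sandwich[OF _ _ tendsto_const m_lim])
        show "\<forall>\<^sub>F n in sequentially. 0 \<le> ?q n z" using nn[OF z m m0] by simp
        show "\<forall>\<^sub>F n in sequentially. ?q n z \<le> ?m n"
        proof (intro always_eventually allI)
          fix n show "?q n z \<le> ?m n"
            using le[OF z m m0, of n] m0[of n] by (simp split: split_indicator_asm)
        qed
      qed
    qed
  next
    show "?q n \<in> borel_measurable \<mu>" for n by measurable
  qed simp
  then show ?thesis unfolding int by simp
qed

end

section \<open>Limits of the sums over a partition\<close>

context time_poisson_C11
begin

lemma sq_integrable_restrict:
  "sq_integrable \<mu> f \<Longrightarrow> A \<in> sets \<mu> \<Longrightarrow> sq_integrable \<mu> (\<lambda>z. indicator A z *\<^sub>R f z)"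
  by (rule sq_integrable_indicator_scaleR)

lemma sq_int_restrict: "sq_int (\<lambda>z. indicator A z *\<^sub>R f z) = (LINT z|\<mu>. indicator A z * (norm (f z))\<^sup>2)"
  by (intro Bochner_Integration.integral_cong) (auto split: split_indicator)

text \<open>The energies over the slabs add up to at most the total energy, so the approximation
  error is uniform in the number of slabs. The choices are made in the order
  \<open>\<delta>\<close>, simple field \<open>g\<close>, mesh; each takes a third of
  \<open>\<epsilon>\<close>.\<close>

lemma sum_increment_error_tendsto_0:
  assumes f: "sq_integrable \<mu> f"
    and X: "\<And>n k. comp_lim (\<lambda>z. indicator (slab n k) z *\<^sub>R f z) (X n k)"
    and W: "\<And>n k. indep_var borel (W n k) borel (X n k)"
  shows "(\<lambda>n. \<Sum>k<Suc n. \<bar>expectation (\<lambda>\<omega>. \<phi> (W n k \<omega> + X n k \<omega>)) - expectation (\<lambda>\<omega>. \<phi> (W n k \<omega>))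
    - (LINT z|\<mu>. expectation (\<lambda>\<omega>. rho (W n k \<omega>) (indicator (slab n k) z *\<^sub>R f z)))\<bar>) \<longlonglongrightarrow> 0"
    (is "(\<lambda>n. \<Sum>k<Suc n. ?e n k) \<longlonglongrightarrow> 0")
proof (rule LIMSEQ_I)
  fix \<epsilon> :: real assume \<epsilon>: "0 < \<epsilon>"
  let ?f = "sq_int f"
  have f0: "0 \<le> ?f" by simp
  have iF: "integrable \<mu> (\<lambda>z. (norm (f z))\<^sup>2)" by (rule sq_integrable_integrable[OF f])
  \<comment> \<open>With \<open>sq_int g \<le> 2 * sq_int f + 2\<close>, the two energies together
    are at most \<open>3 * sq_int f + 2\<close>; adding 1 keeps \<open>a\<close> positive when
    \<open>C\<close> vanishes.\<close>
  define a where "a = 5 * C * (3 * ?f + 2) + 1"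
  have a: "0 < a" using f0 C_nonneg by (simp add: a_def add_nonneg_pos)
  define \<delta> where "\<delta> = \<epsilon> / (3 * a)"
  have \<delta>: "0 < \<delta>" using \<epsilon> a by (simp add: \<delta>_def)
  obtain gs where gs: "\<And>n. simple_integrable \<mu> (gs n)" "L2_tendsto \<mu> gs f"
    using simple_integrable_dense[OF f] by blast
  \<comment> \<open>The bound 1 controls the energy of \<open>g\<close>; the other bound survives
    division by \<open>\<delta>\<close> as \<open>\<epsilon> / 3\<close>. Here too the summand 1
    guards against \<open>C = 0\<close>.\<close>
  define \<eta> where "\<eta> = min 1 (\<epsilon> * \<delta> / (3 * (5 * C + 1)))"
  have \<eta>: "0 < \<eta>" using \<epsilon> \<delta> C_nonneg by (simp add: \<eta>_def)
  have "eventually (\<lambda>n. sq_norm \<mu> (\<lambda>z. gs n z - f z) < ennreal \<eta>) sequentially"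
    by (rule order_tendstoD(2)[OF L2_tendstoD(3)[OF gs(2)]]) (use \<eta> in simp)
  then obtain m where m: "sq_norm \<mu> (\<lambda>z. gs m z - f z) < ennreal \<eta>"
    by (auto simp: eventually_sequentially)
  define g where "g = gs m"
  have g: "simple_integrable \<mu> g" using gs by (simp add: g_def)
  have sg: "sq_integrable \<mu> g" by (rule simple_integrable_sq_integrable[OF g])
  have sfg: "sq_integrable \<mu> (\<lambda>z. f z - g z)" by (rule sq_integrable_diff[OF f sg])
  have iG: "integrable \<mu> (\<lambda>z. (norm (g z))\<^sup>2)" by (rule sq_integrable_integrable[OF sg])
  have iFG: "integrable \<mu> (\<lambda>z. (norm (f z - g z))\<^sup>2)" by (rule sq_integrable_integrable[OF sfg])
  have fg: "sq_int (\<lambda>z. f z - g z) < \<eta>"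
  proof -
    have "ennreal (sq_int (\<lambda>z. f z - g z)) < ennreal \<eta>"
      using m sq_norm_eq_integral[OF sfg] sq_norm_commute[of \<mu> f g] by (simp add: g_def)
    then show ?thesis by (subst (asm) ennreal_less_iff) simp_all
  qed
  have "sq_int g \<le> (LINT z|\<mu>. 2 * (norm (f z))\<^sup>2 + 2 * (norm (f z - g z))\<^sup>2)"
  proof (rule integral_mono[OF iG])
    show "(norm (g z))\<^sup>2 \<le> 2 * (norm (f z))\<^sup>2 + 2 * (norm (f z - g z))\<^sup>2" for z
      using norm_add_sq_le[of "f z" "g z - f z"] by (simp add: norm_minus_commute)
  qed (use iF iFG in simp)
  also have "\<dots> = 2 * ?f + 2 * sq_int (\<lambda>z. f z - g z)" using iF iFG by simp
  finally have g_le: "sq_int g \<le> 2 * ?f + 2"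
    using fg by (simp add: \<eta>_def)
  obtain c where c: "0 \<le> c" "\<And>z. z \<in> space \<mu> \<Longrightarrow> norm (g z) \<le> c"
    using simple_integrable_bounded[OF g] by blast
  define S where "S = {z\<in>space \<mu>. g z \<noteq> 0}"
  have S: "S \<in> sets \<mu>" "emeasure \<mu> S < \<infinity>"
    using simple_levels(4,5)[OF g] by (simp_all add: S_def)
  let ?s = "\<lambda>n. \<Sum>k<Suc n. (measure \<mu> (slab n k \<inter> S))\<^sup>2"
  have e_le: "?e n k \<le> 5 * C * (\<delta> * ((LINT z|\<mu>. indicator (slab n k) z * (norm (f z))\<^sup>2)
        + (LINT z|\<mu>. indicator (slab n k) z * (norm (g z))\<^sup>2))
        + (LINT z|\<mu>. indicator (slab n k) z * (norm (f z - g z))\<^sup>2) / \<delta>)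
      + 9 * C * c\<^sup>2 * (measure \<mu> (slab n k \<inter> S))\<^sup>2" (is "_ \<le> ?b n k") for n k
  proof (rule increment_estimate[OF X W])
    fix w
    let ?g = "\<lambda>z. indicator (slab n k) z *\<^sub>R g z"
    have diff: "indicator (slab n k) z *\<^sub>R f z - indicator (slab n k) z *\<^sub>R g z = indicator (slab n k) z *\<^sub>R (f z - g z)" for z
      by (simp add: scaleR_diff_right)
    have "\<bar>expectation (\<lambda>\<omega>. rho w (X n k \<omega>)) - (LINT z|\<mu>. rho w (indicator (slab n k) z *\<^sub>R f z))\<bar>
      \<le> 5 * C * (\<delta> * (sq_int (\<lambda>z. indicator (slab n k) z *\<^sub>R f z) + sq_int ?g)
          + sq_int (\<lambda>z. indicator (slab n k) z *\<^sub>R f z - indicator (slab n k) z *\<^sub>R g z) / \<delta>)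
        + 9 * C * c\<^sup>2 * (measure \<mu> (slab n k \<inter> S))\<^sup>2"
    proof (rule rho_estimate[OF X \<delta> _ _ c(1)])
      show "simple_integrable \<mu> ?g" by (rule simple_integrable_indicator[OF g slab_measurable])
      show "norm (?g z) \<le> c" if "z \<in> space \<mu>" for z
        using c(1) c(2)[OF that] by (auto split: split_indicator)
      show "slab n k \<inter> S \<in> sets \<mu>" using S by auto
      show "emeasure \<mu> (slab n k \<inter> S) < \<infinity>"
        by (rule le_less_trans[OF emeasure_mono S(2)]) (use S in auto)
      show "?g z = 0" if "z \<in> space \<mu>" "z \<notin> slab n k \<inter> S" for z
        using that by (auto simp: S_def split: split_indicator)
    qed
    then show "\<bar>expectation (\<lambda>\<omega>. rho w (X n k \<omega>)) - (LINT z|\<mu>. rho w (indicator (slab n k) z *\<^sub>R f z))\<bar> \<le> ?b n k"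
      unfolding diff sq_int_restrict .
  qed
  have sum_le: "(\<Sum>k<Suc n. ?e n k) \<le> 5 * C * (\<delta> * (?f + sq_int g) + sq_int (\<lambda>z. f z - g z) / \<delta>) + 9 * C * c\<^sup>2 * ?s n" for n
  proof -
    have "(\<Sum>k<Suc n. ?e n k) \<le> (\<Sum>k<Suc n. ?b n k)" by (rule sum_mono) (rule e_le)
    also have "\<dots> = 5 * C * (\<delta> * ((\<Sum>k<Suc n. LINT z|\<mu>. indicator (slab n k) z * (norm (f z))\<^sup>2)
        + (\<Sum>k<Suc n. LINT z|\<mu>. indicator (slab n k) z * (norm (g z))\<^sup>2))
        + (\<Sum>k<Suc n. LINT z|\<mu>. indicator (slab n k) z * (norm (f z - g z))\<^sup>2) / \<delta>)
      + 9 * C * c\<^sup>2 * ?s n"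
      by (simp only: sum.distrib sum_distrib_left[symmetric] sum_divide_distrib[symmetric])
    also have "\<dots> \<le> 5 * C * (\<delta> * (?f + sq_int g) + sq_int (\<lambda>z. f z - g z) / \<delta>) + 9 * C * c\<^sup>2 * ?s n"
      using \<delta> C_nonneg iF iG iFG
      by (intro add_mono mult_left_mono divide_right_mono sum_slab_integral_le order_refl) auto
    finally show ?thesis .
  qed
  have small: "5 * C * (\<delta> * (?f + sq_int g) + sq_int (\<lambda>z. f z - g z) / \<delta>) < 2 * \<epsilon> / 3"
  proof -
    have "5 * C * (\<delta> * (?f + sq_int g)) \<le> 5 * C * (\<delta> * (3 * ?f + 2))"
      using g_le \<delta> C_nonneg by (intro mult_left_mono) auto
    also have "\<dots> = \<delta> * (5 * C * (3 * ?f + 2))" by (simp add: algebra_simps)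
    also have "\<dots> < \<delta> * a" using \<delta> by (simp add: a_def)
    also have "\<dots> = \<epsilon> / 3" using a by (simp add: \<delta>_def)
    finally have 1: "5 * C * (\<delta> * (?f + sq_int g)) < \<epsilon> / 3" .
    have "5 * C * (sq_int (\<lambda>z. f z - g z) / \<delta>) \<le> (5 * C + 1) * (\<eta> / \<delta>)"
      using fg \<delta> C_nonneg \<eta> by (intro mult_mono divide_right_mono) auto
    also have "\<dots> \<le> (5 * C + 1) * ((\<epsilon> * \<delta> / (3 * (5 * C + 1))) / \<delta>)"
      using \<delta> C_nonneg by (intro mult_left_mono divide_right_mono) (auto simp: \<eta>_def)
    also have "\<dots> = \<epsilon> / 3"
    proof -
      have "5 * C + 1 \<noteq> 0" using C_nonneg by linarith
      moreover have "b * ((\<epsilon> * \<delta> / (3 * b)) / \<delta>) = \<epsilon> / 3" if "b \<noteq> 0" for b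
        using that \<delta> by simp
      ultimately show ?thesis by blast
    qed
    finally show ?thesis using 1 by (simp add: distrib_left)
  qed
  have "(\<lambda>n. 9 * C * c\<^sup>2 * ?s n) \<longlonglongrightarrow> 9 * C * c\<^sup>2 * 0"
    by (intro tendsto_mult tendsto_const sum_slab_squares_tendsto_0 S)
  then have "eventually (\<lambda>n. 9 * C * c\<^sup>2 * ?s n < \<epsilon> / 3) sequentially"
    by (intro order_tendstoD(2)[of _ "9 * C * c\<^sup>2 * 0"]) (use \<epsilon> in auto)
  then obtain N where N: "\<And>n. N \<le> n \<Longrightarrow> 9 * C * c\<^sup>2 * ?s n < \<epsilon> / 3"
    by (auto simp: eventually_sequentially)
  have "norm ((\<Sum>k<Suc n. ?e n k) - 0) < \<epsilon>" if "N \<le> n" for n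
  proof -
    have "0 \<le> (\<Sum>k<Suc n. ?e n k)" by (rule sum_nonneg) (rule abs_ge_zero)
    moreover have "(\<Sum>k<Suc n. ?e n k) < \<epsilon>"
      using sum_le[of n] small N[OF that] by linarith
    ultimately show ?thesis by (simp only: diff_0_right real_norm_def abs_of_nonneg)
  qed
  then show "\<exists>no. \<forall>n\<ge>no. norm ((\<Sum>k<Suc n. ?e n k) - 0) < \<epsilon>" by blast
qed

text \<open>At a fixed \<open>z\<close> exactly one slab contributes, and its base point differs
  from \<open>V (fst z)\<close> by at most the energy of \<open>H\<close> in a shrinking window. The
  function \<open>R\<close> is a supplied measurable version of the limit, whose measurability in
  \<open>z\<close> is not evident from pointwise knowledge of \<open>V\<close>.\<close>

lemma sum_rho_tendsto:
  assumes f: "sq_integrable \<mu> f" and H: "sq_integrable \<mu> H"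
    and W [measurable]: "\<And>n k. W n k \<in> borel_measurable M" and V [measurable]: "\<And>t. V t \<in> borel_measurable M"
    and close: "\<And>n k z. z \<in> slab n k \<Longrightarrow> sq_integrable M (\<lambda>\<omega>. W n k \<omega> - V (fst z) \<omega>) \<and>
       expectation (\<lambda>\<omega>. (norm (W n k \<omega> - V (fst z) \<omega>))\<^sup>2) \<le> 4 * (LINT z'|\<mu>. indicator (window n (fst z)) z' * (norm (H z'))\<^sup>2)"
    and R: "R \<in> borel_measurable \<mu>" "AE z in \<mu>. R z = expectation (\<lambda>\<omega>. rho (V (fst z) \<omega>) (f z))"
  shows "(\<lambda>n. \<Sum>k<Suc n. LINT z|\<mu>. expectation (\<lambda>\<omega>. rho (W n k \<omega>) (indicator (slab n k) z *\<^sub>R f z)))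
    \<longlonglongrightarrow> (LINT z|\<mu>. R z)"
proof -
  let ?q = "\<lambda>n k z. expectation (\<lambda>\<omega>. rho (W n k \<omega>) (f z))"
  have iq: "integrable \<mu> (?q n k)" for n k by (rule rho_Fubini(3)[OF W f])
  have i: "integrable \<mu> (\<lambda>z. indicator (slab n k) z * ?q n k z)" for n k
    using integrable_mult_indicator[OF slab_measurable iq] by simp
  have eq: "expectation (\<lambda>\<omega>. rho (W n k \<omega>) (indicator (slab n k) z *\<^sub>R f z)) = indicator (slab n k) z * ?q n k z" for n k z
    by (auto split: split_indicator)
  have int: "(\<Sum>k<Suc n. LINT z|\<mu>. expectation (\<lambda>\<omega>. rho (W n k \<omega>) (indicator (slab n k) z *\<^sub>R f z)))
      = (LINT z|\<mu>. (\<Sum>k<Suc n. indicator (slab n k) z * ?q n k z))" for n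
    unfolding eq by (rule Bochner_Integration.integral_sum[symmetric]) (rule i)
  have iH: "integrable \<mu> (\<lambda>z. (norm (H z))\<^sup>2)" by (rule sq_integrable_integrable[OF H])
  have bound: "\<bar>expectation (\<lambda>\<omega>. rho (Y \<omega>) y)\<bar> \<le> C * (norm y)\<^sup>2" if [measurable]: "Y \<in> borel_measurable M" for Y y
  proof -
    have "integrable M (\<lambda>\<omega>. rho (Y \<omega>) y)"
      using rho_bound by (intro integrable_const_bound[of _ "C * (norm y)\<^sup>2"]) auto
    then have "expectation (\<lambda>\<omega>. \<bar>rho (Y \<omega>) y\<bar>) \<le> expectation (\<lambda>\<omega>. C * (norm y)\<^sup>2)"
      by (intro integral_mono rho_bound) auto
    then have "expectation (\<lambda>\<omega>. \<bar>rho (Y \<omega>) y\<bar>) \<le> C * (norm y)\<^sup>2" by (simp add: prob_space)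
    with integral_abs_bound show ?thesis by (rule order_trans)
  qed
  have diff: "\<bar>?q n k z - expectation (\<lambda>\<omega>. rho (V (fst z) \<omega>) (f z))\<bar>
      \<le> (2 * K + C * norm (f z)) * sqrt (4 * (LINT z'|\<mu>. indicator (window n (fst z)) z' * (norm (H z'))\<^sup>2))"
    if z: "z \<in> slab n k" for n k z
  proof -
    let ?d = "\<lambda>\<omega>. W n k \<omega> - V (fst z) \<omega>"
    have sd: "sq_integrable M ?d" and le: "expectation (\<lambda>\<omega>. (norm (?d \<omega>))\<^sup>2) \<le> 4 * (LINT z'|\<mu>. indicator (window n (fst z)) z' * (norm (H z'))\<^sup>2)"
      using close[OF z] by auto
    have r: "integrable M (\<lambda>\<omega>. rho (Y \<omega>) (f z))" if [measurable]: "Y \<in> borel_measurable M" for Y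
      using rho_bound by (intro integrable_const_bound[of _ "C * (norm (f z))\<^sup>2"]) auto
    have nd: "integrable M (\<lambda>\<omega>. norm (?d \<omega>))" by (rule sq_integrable_norm_integrable(1)[OF sd])
    have "\<bar>?q n k z - expectation (\<lambda>\<omega>. rho (V (fst z) \<omega>) (f z))\<bar>
        = \<bar>expectation (\<lambda>\<omega>. rho (W n k \<omega>) (f z) - rho (V (fst z) \<omega>) (f z))\<bar>"
      using r[OF W] r[OF V] by simp
    also have "\<dots> \<le> expectation (\<lambda>\<omega>. \<bar>rho (W n k \<omega>) (f z) - rho (V (fst z) \<omega>) (f z)\<bar>)"
      using integral_abs_bound by blast
    also have "\<dots> \<le> expectation (\<lambda>\<omega>. (2 * K + C * norm (f z)) * norm (?d \<omega>))"
      by (intro integral_mono rho_base integrable_mult_right nd integrable_abs Bochner_Integration.integrable_diff r W V)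
    also have "\<dots> = (2 * K + C * norm (f z)) * expectation (\<lambda>\<omega>. norm (?d \<omega>))"
      by simp
    also have "\<dots> \<le> (2 * K + C * norm (f z)) * sqrt (4 * (LINT z'|\<mu>. indicator (window n (fst z)) z' * (norm (H z'))\<^sup>2))"
    proof (rule mult_left_mono)
      show "expectation (\<lambda>\<omega>. norm (?d \<omega>)) \<le> sqrt (4 * (LINT z'|\<mu>. indicator (window n (fst z)) z' * (norm (H z'))\<^sup>2))"
        using sq_integrable_norm_integrable(2)[OF sd] le by (intro real_le_rsqrt) linarith
    qed (use K_nonneg C_nonneg in simp)
    finally show ?thesis .
  qed
  have "(\<lambda>n. LINT z|\<mu>. (\<Sum>k<Suc n. indicator (slab n k) z * ?q n k z)) \<longlonglongrightarrow> (LINT z|\<mu>. R z)"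
  proof (rule integral_dominated_convergence[where w="\<lambda>z. C * (norm (f z))\<^sup>2"])
    show "integrable \<mu> (\<lambda>z. C * (norm (f z))\<^sup>2)"
      by (intro integrable_mult_right sq_integrable_integrable f)
    show "(\<lambda>z. \<Sum>k<Suc n. indicator (slab n k) z * ?q n k z) \<in> borel_measurable \<mu>" for n
      by (intro borel_measurable_sum borel_measurable_integrable i)
    show "AE z in \<mu>. norm (\<Sum>k<Suc n. indicator (slab n k) z * ?q n k z) \<le> C * (norm (f z))\<^sup>2" for n
    proof (intro AE_I2)
      fix z assume z: "z \<in> space \<mu>"
      have "norm (\<Sum>k<Suc n. indicator (slab n k) z * ?q n k z) \<le> (\<Sum>k<Suc n. indicator (slab n k) z * (C * (norm (f z))\<^sup>2))"
        by (rule order_trans[OF norm_sum sum_mono]) (auto intro: bound split: split_indicator)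
      also have "\<dots> \<le> C * (norm (f z))\<^sup>2"
        unfolding sum_distrib_right[symmetric] sum_indicator_slab[OF z] using C_nonneg by simp
      finally show "norm (\<Sum>k<Suc n. indicator (slab n k) z * ?q n k z) \<le> C * (norm (f z))\<^sup>2" .
    qed
    show "AE z in \<mu>. (\<lambda>n. \<Sum>k<Suc n. indicator (slab n k) z * ?q n k z) \<longlonglongrightarrow> R z"
      using R(2) no_atoms[of 0] AE_space
    proof eventually_elim
      case (elim z)
      have pos: "0 < fst z" using elim time_range by fastforce
      let ?e = "\<lambda>n. (2 * K + C * norm (f z)) * sqrt (4 * (LINT z'|\<mu>. indicator (window n (fst z)) z' * (norm (H z'))\<^sup>2))"
      have e0: "0 \<le> ?e n" for n
        using K_nonneg C_nonneg by (intro mult_nonneg_nonneg real_sqrt_ge_zero integral_nonneg_AE add_nonneg_nonneg) auto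
      have "?e \<longlonglongrightarrow> (2 * K + C * norm (f z)) * sqrt (4 * 0)"
        by (intro tendsto_intros window_tendsto_0 iH)
      then have e_lim: "?e \<longlonglongrightarrow> 0" by simp
      have "(\<lambda>n. (\<Sum>k<Suc n. indicator (slab n k) z * ?q n k z) - R z) \<longlonglongrightarrow> 0"
      proof (rule Lim_null_comparison[OF _ e_lim], intro always_eventually allI)
        fix n
        have "(\<Sum>k<Suc n. indicator (slab n k) z * ?q n k z) - R z = (\<Sum>k<Suc n. indicator (slab n k) z * (?q n k z - R z))"
          unfolding right_diff_distrib sum_subtractf sum_distrib_right[symmetric]
          using sum_indicator_slab[OF elim(3), of n] pos by simp
        also have "norm \<dots> \<le> (\<Sum>k<Suc n. indicator (slab n k) z * ?e n)"
          by (rule order_trans[OF norm_sum sum_mono]) (auto simp: elim(1) intro: diff split: split_indicator)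
        also have "\<dots> = ?e n"
          unfolding sum_distrib_right[symmetric] sum_indicator_slab[OF elim(3)] using pos by simp
        finally show "norm ((\<Sum>k<Suc n. indicator (slab n k) z * ?q n k z) - R z) \<le> ?e n" .
      qed
      then show ?case by (simp add: LIM_zero_iff)
    qed
  qed (rule R(1))
  then show ?thesis unfolding int .
qed

end

section \<open>Expansion along an integrand that switches from one field to the other\<close>

context time_poisson_C11
begin

definition switch :: "(real \<times> 'y \<Rightarrow> 'h) \<Rightarrow> (real \<times> 'y \<Rightarrow> 'h) \<Rightarrow> real \<Rightarrow> real \<times> 'y \<Rightarrow> 'h" where
  "switch F G t z = (if fst z \<le> t then G z else F z)"

lemma sq_integrable_norm_sum:
  assumes "sq_integrable \<mu> F" "sq_integrable \<mu> G"
  shows "sq_integrable \<mu> (\<lambda>z. norm (F z) + norm (G z))"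
proof -
  have [measurable]: "F \<in> borel_measurable \<mu>" "G \<in> borel_measurable \<mu>" using assms by auto
  show ?thesis
    by (intro sq_integrable_add sq_integrable_mono[OF assms(1)] sq_integrable_mono[OF assms(2)]) auto
qed

lemma sq_integrable_le_sum:
  assumes "sq_integrable \<mu> F" "sq_integrable \<mu> G" "f \<in> borel_measurable \<mu>"
    and "\<And>z. z \<in> space \<mu> \<Longrightarrow> norm (f z) \<le> norm (F z) + norm (G z)"
  shows "sq_integrable \<mu> f"
  by (rule sq_integrable_mono[OF sq_integrable_norm_sum[OF assms(1,2)] assms(3)]) (use assms(4) in auto)

lemma sq_integrable_switch:
  assumes "sq_integrable \<mu> F" "sq_integrable \<mu> G"
  shows "sq_integrable \<mu> (switch F G t)"
proof (rule sq_integrable_le_sum[OF assms])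
  have [measurable]: "F \<in> borel_measurable \<mu>" "G \<in> borel_measurable \<mu>" using assms by auto
  show "switch F G t \<in> borel_measurable \<mu>" unfolding switch_def[abs_def] by measurable
qed (auto simp: switch_def)

text \<open>Telescoping over the partition: the \<open>k\<close>-th increment replaces \<open>F\<close> by \<open>G\<close> on one slab, and
  both versions are compared with the integral that omits the slab.\<close>

theorem expansion:
  assumes F: "sq_integrable \<mu> F" and G: "sq_integrable \<mu> G"
    and V: "\<And>t \<omega>. V t \<omega> = x + comp_integral M \<mu> \<pi> (switch F G t) \<omega>"
    and RF: "RF \<in> borel_measurable \<mu>" "AE z in \<mu>. RF z = expectation (\<lambda>\<omega>. rho (V (fst z) \<omega>) (F z))"
    and RG: "RG \<in> borel_measurable \<mu>" "AE z in \<mu>. RG z = expectation (\<lambda>\<omega>. rho (V (fst z) \<omega>) (G z))"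
  shows "expectation (\<lambda>\<omega>. \<phi> (V T \<omega>)) - expectation (\<lambda>\<omega>. \<phi> (V 0 \<omega>)) = (LINT z|\<mu>. RG z) - (LINT z|\<mu>. RF z)"
proof -
  have [measurable]: "F \<in> borel_measurable \<mu>" "G \<in> borel_measurable \<mu>" using F G by auto
  let ?I = "comp_integral M \<mu> \<pi>"
  define rest where "rest n k z = (if fst z \<le> grid n k then G z else if fst z \<le> grid n (Suc k) then 0 else F z)" for n k z
  have rest_sq: "sq_integrable \<mu> (rest n k)" for n k
  proof (rule sq_integrable_le_sum[OF F G])
    show "rest n k \<in> borel_measurable \<mu>" unfolding rest_def[abs_def] by measurable
  qed (auto simp: rest_def)
  let ?on = "\<lambda>f n k z. indicator (slab n k) z *\<^sub>R f z"
  have cl: "comp_lim f (?I f)" if "sq_integrable \<mu> f" for f :: "real \<times> 'y \<Rightarrow> 'h"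
    by (rule comp_lim_comp_integral[OF that])
  note cl_switch = cl[OF sq_integrable_switch[OF F G]] and cl_rest = cl[OF rest_sq]
    and cl_F = cl[OF sq_integrable_restrict[OF F slab_measurable]]
    and cl_G = cl[OF sq_integrable_restrict[OF G slab_measurable]]
  define W where "W n k \<omega> = x + ?I (rest n k) \<omega>" for n k \<omega>
  have meas: "?I f \<in> borel_measurable M" if "sq_integrable \<mu> f" for f :: "real \<times> 'y \<Rightarrow> 'h"
    using comp_lim_sq_integrable(2)[OF cl[OF that]] by auto
  have W_meas [measurable]: "W n k \<in> borel_measurable M" for n k
    unfolding W_def[abs_def] using meas[OF rest_sq] by measurable
  have V_meas [measurable]: "V t \<in> borel_measurable M" for t
    unfolding V[abs_def] using meas[OF sq_integrable_switch[OF F G]] by measurable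
  have indep: "indep_var borel (W n k) borel (?I (?on f n k))" if "sq_integrable \<mu> f" for f n k
  proof -
    have on: "comp_lim (?on f n k) (?I (?on f n k))"
      by (rule cl[OF sq_integrable_restrict[OF that slab_measurable]])
    have "indep_var borel (?I (rest n k)) borel (?I (?on f n k))"
    proof (rule comp_lim_indep[OF cl_rest[of n k] on, of "space \<mu> - slab n k"])
      show "rest n k z = 0" if "z \<in> space \<mu>" "z \<notin> space \<mu> - slab n k" for z
        using that by (simp add: rest_def slab_def)
      show "?on f n k z = 0" if "z \<in> space \<mu> - slab n k" for z
        using that by simp
    qed (rule sets.compl_sets[OF slab_measurable])
    then have "indep_var borel ((\<lambda>w. x + w) \<circ> ?I (rest n k)) borel ((\<lambda>w. w) \<circ> ?I (?on f n k))"
      by (rule indep_var_compose) measurable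
    moreover have "(\<lambda>w. x + w) \<circ> ?I (rest n k) = W n k" by (simp add: fun_eq_iff W_def)
    ultimately show ?thesis by (simp only: comp_def)
  qed
  have up: "AE \<omega> in M. V (grid n (Suc k)) \<omega> = W n k \<omega> + ?I (?on G n k) \<omega>" for n k
  proof -
    have "AE \<omega> in M. ?I (switch F G (grid n (Suc k))) \<omega> = ?I (rest n k) \<omega> + ?I (?on G n k) \<omega>"
    proof (rule comp_lim_unique[OF cl_switch comp_lim_add[OF cl_rest cl_G]], intro AE_I2)
      fix z assume "z \<in> space \<mu>"
      then show "switch F G (grid n (Suc k)) z = rest n k z + ?on G n k z"
        using grid_less[of n k] by (auto simp: switch_def rest_def slab_def split: split_indicator)
    qed
    then show ?thesis by eventually_elim (simp add: V W_def)
  qed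
  have down: "AE \<omega> in M. V (grid n k) \<omega> = W n k \<omega> + ?I (?on F n k) \<omega>" for n k
  proof -
    have "AE \<omega> in M. ?I (switch F G (grid n k)) \<omega> = ?I (rest n k) \<omega> + ?I (?on F n k) \<omega>"
    proof (rule comp_lim_unique[OF cl_switch comp_lim_add[OF cl_rest cl_F]], intro AE_I2)
      fix z assume "z \<in> space \<mu>"
      then show "switch F G (grid n k) z = rest n k z + ?on F n k z"
        using grid_less[of n k] by (auto simp: switch_def rest_def slab_def split: split_indicator)
    qed
    then show ?thesis by eventually_elim (simp add: V W_def)
  qed
  have E_cong: "expectation (\<lambda>\<omega>. \<phi> (X \<omega>)) = expectation (\<lambda>\<omega>. \<phi> (Y \<omega>))"
    if "AE \<omega> in M. X \<omega> = Y \<omega>" and [measurable]: "X \<in> borel_measurable M" "Y \<in> borel_measurable M" for X Y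
    by (rule Bochner_Integration.integral_cong_AE) (use that in \<open>auto elim: eventually_mono\<close>)
  let ?P = "\<lambda>f n k. expectation (\<lambda>\<omega>. \<phi> (W n k \<omega> + ?I (?on f n k) \<omega>))"
  let ?A = "\<lambda>f n k. LINT z|\<mu>. expectation (\<lambda>\<omega>. rho (W n k \<omega>) (?on f n k z))"
  let ?e = "\<lambda>f n. \<Sum>k<Suc n. \<bar>?P f n k - expectation (\<lambda>\<omega>. \<phi> (W n k \<omega>)) - ?A f n k\<bar>"
  define u where "u t = expectation (\<lambda>\<omega>. \<phi> (V t \<omega>))" for t
  have step: "u (grid n (Suc k)) - u (grid n k) = ?P G n k - ?P F n k" for n k
  proof -
    have [measurable]: "?I (?on G n k) \<in> borel_measurable M" "?I (?on F n k) \<in> borel_measurable M"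
      by (intro meas sq_integrable_restrict F G slab_measurable)+
    show ?thesis
      unfolding u_def using E_cong[OF up] E_cong[OF down] by simp
  qed
  have est: "\<bar>(u T - u 0) - ((\<Sum>k<Suc n. ?A G n k) - (\<Sum>k<Suc n. ?A F n k))\<bar> \<le> ?e G n + ?e F n" for n
  proof -
    have "u T - u 0 = (\<Sum>k<Suc n. u (grid n (Suc k)) - u (grid n k))"
      by (simp only: sum_lessThan_telescope[of "\<lambda>k. u (grid n k)"] grid_0 grid_end)
    \<comment> \<open>The expectation of \<open>\<phi> (W n k)\<close> is common to both versions of
      the increment and cancels, leaving only the two remainders.\<close>
    then have eq: "(u T - u 0) - ((\<Sum>k<Suc n. ?A G n k) - (\<Sum>k<Suc n. ?A F n k))
        = (\<Sum>k<Suc n. (?P G n k - expectation (\<lambda>\<omega>. \<phi> (W n k \<omega>)) - ?A G n k)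
            - (?P F n k - expectation (\<lambda>\<omega>. \<phi> (W n k \<omega>)) - ?A F n k))"
      unfolding step by (simp only: sum_subtractf)
    show ?thesis
      unfolding eq sum.distrib[symmetric]
      by (rule order_trans[OF sum_abs sum_mono]) (rule abs_triangle_ineq4)
  qed
  have e0: "(\<lambda>n. ?e f n) \<longlonglongrightarrow> 0" if f: "sq_integrable \<mu> f" for f
    by (rule sum_increment_error_tendsto_0[where X="\<lambda>n k. ?I (?on f n k)" and W=W, OF f])
      (rule cl[OF sq_integrable_restrict[OF f slab_measurable]], rule indep[OF f])
  let ?H = "\<lambda>z. norm (F z) + norm (G z)"
  have H: "sq_integrable \<mu> ?H" by (rule sq_integrable_norm_sum[OF F G])
  \<comment> \<open>For a time inside the slab, \<open>rest\<close> and \<open>switch\<close> agree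
    off the slab; on it \<open>rest\<close> is 0 and \<open>switch\<close> is \<open>F\<close> or
    \<open>G\<close>. Hence the window energy of \<open>?H\<close> bounds the distance.\<close>
  have close: "sq_integrable M (\<lambda>\<omega>. W n k \<omega> - V (fst z) \<omega>) \<and>
       expectation (\<lambda>\<omega>. (norm (W n k \<omega> - V (fst z) \<omega>))\<^sup>2) \<le> 4 * (LINT z'|\<mu>. indicator (window n (fst z)) z' * (norm (?H z'))\<^sup>2)"
    if z: "z \<in> slab n k" for n k z
  proof -
    note d = comp_lim_diff[OF cl_rest[of n k] cl_switch[of "fst z"]]
    have eq: "W n k \<omega> - V (fst z) \<omega> = ?I (rest n k) \<omega> - ?I (switch F G (fst z)) \<omega>" for \<omega>
      by (simp add: W_def V)
    have "expectation (\<lambda>\<omega>. (norm (W n k \<omega> - V (fst z) \<omega>))\<^sup>2)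
        \<le> 4 * sq_int (\<lambda>z'. rest n k z' - switch F G (fst z) z')"
      unfolding eq by (rule comp_lim_sq_norm_real[OF d])
    also have "sq_int (\<lambda>z'. rest n k z' - switch F G (fst z) z')
        \<le> (LINT z'|\<mu>. indicator (window n (fst z)) z' * (norm (?H z'))\<^sup>2)"
    proof (rule integral_mono)
      show "integrable \<mu> (\<lambda>z'. (norm (rest n k z' - switch F G (fst z) z'))\<^sup>2)"
        by (rule sq_integrable_integrable[OF comp_lim_sq_integrable(1)[OF d]])
      show "integrable \<mu> (\<lambda>z'. indicator (window n (fst z)) z' * (norm (?H z'))\<^sup>2)"
        using integrable_mult_indicator[OF window_measurable sq_integrable_integrable[OF H]] by simp
      fix z' assume z': "z' \<in> space \<mu>"
      show "(norm (rest n k z' - switch F G (fst z) z'))\<^sup>2 \<le> indicator (window n (fst z)) z' * (norm (?H z'))\<^sup>2"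
      proof (cases "z' \<in> slab n k")
        case True
        then have "z' \<in> window n (fst z)" using slab_subset_window[OF z] by blast
        moreover have "norm (rest n k z' - switch F G (fst z) z') \<le> norm (?H z')"
          using True by (auto simp: rest_def switch_def slab_def)
        ultimately show ?thesis by (simp add: power_mono)
      next
        case False
        then have "rest n k z' = switch F G (fst z) z'"
          using z z' by (auto simp: rest_def switch_def slab_def)
        then show ?thesis by simp
      qed
    qed
    finally show ?thesis
      unfolding eq using comp_lim_sq_integrable(2)[OF d] by simp
  qed
  have A_lim: "(\<lambda>n. \<Sum>k<Suc n. ?A f n k) \<longlonglongrightarrow> (LINT z|\<mu>. R z)"
    if "sq_integrable \<mu> f" "R \<in> borel_measurable \<mu>" "AE z in \<mu>. R z = expectation (\<lambda>\<omega>. rho (V (fst z) \<omega>) (f z))" for f R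
    by (rule sum_rho_tendsto[where W=W and V=V, OF that(1) H W_meas V_meas close that(2,3)])
  have "(\<lambda>n. (\<Sum>k<Suc n. ?A G n k) - (\<Sum>k<Suc n. ?A F n k)) \<longlonglongrightarrow> u T - u 0"
  proof (rule LIM_zero_cancel, rule Lim_null_comparison)
    show "(\<lambda>n. ?e G n + ?e F n) \<longlonglongrightarrow> 0"
      by (rule tendsto_add_zero[OF e0[OF G] e0[OF F]])
    show "\<forall>\<^sub>F n in sequentially. norm ((\<Sum>k<Suc n. ?A G n k) - (\<Sum>k<Suc n. ?A F n k) - (u T - u 0)) \<le> ?e G n + ?e F n"
      unfolding real_norm_def
      by (intro always_eventually allI, subst abs_minus_commute) (rule est)
  qed
  moreover have "(\<lambda>n. (\<Sum>k<Suc n. ?A G n k) - (\<Sum>k<Suc n. ?A F n k)) \<longlonglongrightarrow> (LINT z|\<mu>. RG z) - (LINT z|\<mu>. RF z)"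
    by (intro tendsto_diff A_lim F G RF RG)
  ultimately show ?thesis unfolding u_def by (rule LIMSEQ_unique)
qed

end

section \<open>Gradients and almost sure limits\<close>

lemma GDERIV_unique:
  assumes "GDERIV f x :> a" "GDERIV f x :> b"
  shows "a = b"
proof -
  have "(\<lambda>h. h \<bullet> a) = (\<lambda>h. h \<bullet> b)"
    using assms by (auto simp: gderiv_def intro: has_derivative_unique)
  from fun_cong[OF this, of "a - b"] have "(a - b) \<bullet> (a - b) = 0"
    by (simp only: inner_diff_right[of "a - b" a b] right_minus_eq)
  then show ?thesis by simp
qed

lemma grad_eqI: "GDERIV f x :> a \<Longrightarrow> grad f x = a"
  unfolding grad_def by (rule the_equality) (auto intro: GDERIV_unique)

text \<open>Yields the gradient of an expectation by integrating the remainder estimate, so no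
  derivative has to be exchanged with an integral.\<close>

lemma GDERIV_quadratic_remainder:
  fixes f :: "'h::real_inner \<Rightarrow> real"
  assumes "\<And>h. \<bar>f (x + h) - f x - a \<bullet> h\<bar> \<le> C * (norm h)\<^sup>2"
  shows "GDERIV f x :> a"
  unfolding gderiv_def has_derivative_at
proof (intro conjI)
  show "bounded_linear (\<lambda>h. h \<bullet> a)" by (rule bounded_linear_inner_left)
  show "(\<lambda>h. norm (f (x + h) - f x - h \<bullet> a) / norm h) \<midarrow>0\<rightarrow> 0"
  proof (rule Lim_null_comparison)
    show "((\<lambda>h. C * norm h) \<longlongrightarrow> 0) (at (0::'h))"
      using tendsto_mult[OF tendsto_const[of C] tendsto_norm_zero[OF tendsto_ident_at[of "0::'h" UNIV]]] by simp
    show "\<forall>\<^sub>F h in at 0. norm (norm (f (x + h) - f x - h \<bullet> a) / norm h) \<le> C * norm h"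
    proof (intro always_eventually allI)
      fix h show "norm (norm (f (x + h) - f x - h \<bullet> a) / norm h) \<le> C * norm h"
        using assms[of h] by (cases "h = 0") (simp_all add: divide_le_eq power2_eq_square inner_commute)
    qed
  qed
qed

text \<open>Fatou's lemma for the squared distances to \<open>X\<close>; the two modes of
  convergence must share their limit without passing to a subsequence.\<close>

lemma L2_AE_limit_eq:
  fixes X :: "'a \<Rightarrow> 'b::{banach,second_countable_topology}"
  assumes X: "L2_tendsto M Xn X" and Z: "AE x in M. (\<lambda>n. Xn n x) \<longlonglongrightarrow> Z x"
  shows "AE x in M. Z x = X x"
proof -
  note [measurable] = L2_tendstoD(1,2)[OF X]
  let ?l = "\<lambda>x. liminf (\<lambda>n. ennreal ((norm (Xn n x - X x))\<^sup>2))"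
  have "(\<integral>\<^sup>+x. ?l x \<partial>M) \<le> liminf (\<lambda>n. sq_norm M (\<lambda>x. Xn n x - X x))"
    unfolding sq_norm_def by (intro nn_integral_liminf) measurable
  also have "\<dots> = 0"
    by (rule lim_imp_Liminf[OF sequentially_bot L2_tendstoD(3)[OF X]])
  finally have "AE x in M. ?l x = 0"
    by (subst (asm) le_zero_eq, subst (asm) nn_integral_0_iff_AE) auto
  with Z show ?thesis
  proof eventually_elim
    case (elim x)
    have "(\<lambda>n. ennreal ((norm (Xn n x - X x))\<^sup>2)) \<longlonglongrightarrow> ennreal ((norm (Z x - X x))\<^sup>2)"
      by (intro tendsto_intros elim)
    from lim_imp_Liminf[OF sequentially_bot this] elim(2)
    have "ennreal ((norm (Z x - X x))\<^sup>2) = 0" by simp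
    then show ?case by (simp add: ennreal_eq_0_iff)
  qed
qed

section \<open>Continuity in time of the integrals\<close>

context time_poisson_C11
begin

abbreviation before :: "(real \<times> 'y \<Rightarrow> 'h) \<Rightarrow> real \<Rightarrow> real \<times> 'y \<Rightarrow> 'h" where
  "before f t \<equiv> \<lambda>z. indicator {0<..t} (fst z) *\<^sub>R f z"

abbreviation after :: "(real \<times> 'y \<Rightarrow> 'h) \<Rightarrow> real \<Rightarrow> real \<times> 'y \<Rightarrow> 'h" where
  "after f t \<equiv> \<lambda>z. indicator {t<..T} (fst z) *\<^sub>R f z"

text \<open>As the end point moves to \<open>t\<close>, the indicators converge except at time
  exactly \<open>t\<close>, which is negligible.\<close>

lemma cumulative_continuous:
  fixes f :: "real \<times> 'y \<Rightarrow> real"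
  assumes f: "integrable \<mu> f"
  shows "continuous_on UNIV (\<lambda>t. LINT z|\<mu>. indicator {..t} (fst z) * f z)"
  unfolding continuous_on_sequentially
proof (intro allI ballI impI)
  fix s :: "nat \<Rightarrow> real" and t assume "(\<forall>n. s n \<in> UNIV) \<and> s \<longlonglongrightarrow> t"
  then have s: "s \<longlonglongrightarrow> t" by simp
  have [measurable]: "f \<in> borel_measurable \<mu>" using f by auto
  have "(\<lambda>n. LINT z|\<mu>. indicator {..s n} (fst z) * f z) \<longlonglongrightarrow> (LINT z|\<mu>. indicator {..t} (fst z) * f z)"
  proof (rule integral_dominated_convergence[where w="\<lambda>z. norm (f z)"])
    show "AE z in \<mu>. (\<lambda>n. indicator {..s n} (fst z) * f z) \<longlonglongrightarrow> indicator {..t} (fst z) * f z"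
      using no_atoms[of t]
    proof eventually_elim
      case (elim z)
      have "eventually (\<lambda>n. indicator {..s n} (fst z) = (indicator {..t} (fst z) :: real)) sequentially"
      proof (cases "fst z < t")
        case True
        then have "eventually (\<lambda>n. fst z < s n) sequentially" by (rule order_tendstoD(1)[OF s])
        then show ?thesis by eventually_elim (use True in simp)
      next
        case False
        then have "eventually (\<lambda>n. s n < fst z) sequentially"
          using elim by (intro order_tendstoD(2)[OF s]) simp
        then show ?thesis by eventually_elim (use False elim in simp)
      qed
      then show ?case by (intro tendsto_eventually) (auto elim: eventually_mono)
    qed
  qed (use f in \<open>auto split: split_indicator\<close>)
  then show "((\<lambda>t. LINT z|\<mu>. indicator {..t} (fst z) * f z) \<circ> s) \<longlonglongrightarrow> (LINT z|\<mu>. indicator {..t} (fst z) * f z)"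
    by (simp add: o_def)
qed

text \<open>The hypothesis on \<open>A\<close> and \<open>A'\<close> covers fields up to a time and
  fields after a time at once: either way the two sets differ, within (0, T], exactly by the
  interval between \<open>s\<close> and \<open>t\<close>.\<close>

lemma comp_lim_indicator_diff:
  fixes F :: "real \<times> 'y \<Rightarrow> 'h"
  assumes F: "sq_integrable \<mu> F" and X: "comp_lim (\<lambda>z. indicator A (fst z) *\<^sub>R F z) X"
    and Y: "comp_lim (\<lambda>z. indicator A' (fst z) *\<^sub>R F z) Y"
    and AA': "\<And>r. 0 < r \<Longrightarrow> r \<le> T \<Longrightarrow> \<bar>indicator A r - indicator A' r\<bar> = \<bar>indicator {..t} r - (indicator {..s} r :: real)\<bar>"
  shows "expectation (\<lambda>\<omega>. (norm (X \<omega> - Y \<omega>))\<^sup>2)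
    \<le> 4 * \<bar>(LINT z|\<mu>. indicator {..t} (fst z) * (norm (F z))\<^sup>2) - (LINT z|\<mu>. indicator {..s} (fst z) * (norm (F z))\<^sup>2)\<bar>"
proof -
  note d = comp_lim_diff[OF X Y]
  have i: "integrable \<mu> (\<lambda>z. (norm (F z))\<^sup>2)" by (rule sq_integrable_integrable[OF F])
  have i': "integrable \<mu> (\<lambda>z. indicator {..r} (fst z) * (norm (F z))\<^sup>2)" for r
  proof -
    have "{z\<in>space \<mu>. fst z \<le> r} \<in> sets \<mu>" by measurable
    from integrable_mult_indicator[OF this i]
    show ?thesis
      by (rule Bochner_Integration.integrable_cong[THEN iffD1, rotated 2]) (auto split: split_indicator)
  qed
  have main: "sq_int (\<lambda>z. indicator A (fst z) *\<^sub>R F z - indicator A' (fst z) *\<^sub>R F z)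
      = \<bar>(LINT z|\<mu>. indicator {..t} (fst z) * (norm (F z))\<^sup>2) - (LINT z|\<mu>. indicator {..s} (fst z) * (norm (F z))\<^sup>2)\<bar>"
  proof -
    have "sq_int (\<lambda>z. indicator A (fst z) *\<^sub>R F z - indicator A' (fst z) *\<^sub>R F z)
        = (LINT z|\<mu>. \<bar>indicator {..t} (fst z) - indicator {..s} (fst z)\<bar> * (norm (F z))\<^sup>2)"
    proof (rule Bochner_Integration.integral_cong_AE)
      show "(\<lambda>z. (norm (indicator A (fst z) *\<^sub>R F z - indicator A' (fst z) *\<^sub>R F z))\<^sup>2) \<in> borel_measurable \<mu>"
        using sq_integrable_integrable[OF comp_lim_sq_integrable(1)[OF d]] by auto
      have [measurable]: "F \<in> borel_measurable \<mu>" using F by auto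
      show "(\<lambda>z. \<bar>indicator {..t} (fst z) - indicator {..s} (fst z)\<bar> * (norm (F z))\<^sup>2) \<in> borel_measurable \<mu>" by measurable
      show "AE z in \<mu>. (norm (indicator A (fst z) *\<^sub>R F z - indicator A' (fst z) *\<^sub>R F z))\<^sup>2
          = \<bar>indicator {..t} (fst z) - indicator {..s} (fst z)\<bar> * (norm (F z))\<^sup>2"
        using no_atoms[of 0] AE_space
      proof eventually_elim
        case (elim z)
        then have r: "0 < fst z" "fst z \<le> T" using time_range[of z] by auto
        have "(norm (indicator A (fst z) *\<^sub>R F z - indicator A' (fst z) *\<^sub>R F z))\<^sup>2
            = \<bar>indicator A (fst z) - indicator A' (fst z)\<bar>\<^sup>2 * (norm (F z))\<^sup>2"
          by (simp add: scaleR_diff_left[symmetric] power_mult_distrib)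
        also have "\<bar>indicator A (fst z) - indicator A' (fst z) :: real\<bar>\<^sup>2 = \<bar>indicator {..t} (fst z) - indicator {..s} (fst z)\<bar>"
          unfolding AA'[OF r] by (auto split: split_indicator)
        finally show ?case .
      qed
    qed
    also have "\<dots> = \<bar>(LINT z|\<mu>. indicator {..t} (fst z) * (norm (F z))\<^sup>2) - (LINT z|\<mu>. indicator {..s} (fst z) * (norm (F z))\<^sup>2)\<bar>"
    proof -
      have *: "(LINT z|\<mu>. \<bar>indicator {..b} (fst z) - indicator {..a} (fst z)\<bar> * (norm (F z))\<^sup>2)
          = (LINT z|\<mu>. indicator {..b} (fst z) * (norm (F z))\<^sup>2) - (LINT z|\<mu>. indicator {..a} (fst z) * (norm (F z))\<^sup>2)"
        if "a \<le> b" for a b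
      proof -
        have "(LINT z|\<mu>. \<bar>indicator {..b} (fst z) - indicator {..a} (fst z)\<bar> * (norm (F z))\<^sup>2)
            = (LINT z|\<mu>. indicator {..b} (fst z) * (norm (F z))\<^sup>2 - indicator {..a} (fst z) * (norm (F z))\<^sup>2)"
          using that by (intro Bochner_Integration.integral_cong) (auto split: split_indicator)
        then show ?thesis using i' by simp
      qed
      have **: "0 \<le> (LINT z|\<mu>. \<bar>indicator {..b} (fst z) - indicator {..a} (fst z)\<bar> * (norm (F z))\<^sup>2)" for a b :: real
        by (intro integral_nonneg_AE) auto
      show ?thesis
      proof (cases "s \<le> t")
        case True
        then show ?thesis using *[OF True] **[of t s] by simp
      next
        case False
        then have "t \<le> s" by simp
        then show ?thesis using *[OF \<open>t \<le> s\<close>] **[of s t] by (simp add: abs_minus_commute)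
      qed
    qed
    finally show ?thesis .
  qed
  show ?thesis using comp_lim_sq_norm_real[OF d] unfolding main .
qed

end

text \<open>The integrals \<open>J\<close> and \<open>X\<close> are known almost surely at each
  fixed time only. Pathwise regularity is asked of \<open>Y\<close> alone, and only through its left
  limits.\<close>

locale error_setting = time_poisson_C11 M \<mu> \<pi> \<phi> D B K C T
  for M :: "'w measure" and \<mu> :: "(real \<times> 'y) measure" and \<pi> :: "'w \<Rightarrow> (real \<times> 'y) measure"
    and \<phi> :: "'h::{real_inner,banach,second_countable_topology} \<Rightarrow> real" and D B K C and T +
  fixes F G :: "real \<times> 'y \<Rightarrow> 'h" and J X Y :: "real \<Rightarrow> 'w \<Rightarrow> 'h" and x :: 'h
  assumes complete: "complete_measure M"
    and F: "sq_integrable \<mu> F" and G: "sq_integrable \<mu> G"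
    and J: "\<And>t. 0 \<le> t \<Longrightarrow> t \<le> T \<Longrightarrow> comp_lim (after F t) (J t)"
    and X: "\<And>t. 0 \<le> t \<Longrightarrow> t \<le> T \<Longrightarrow> comp_lim (before G t) (X t)"
    and Y: "\<And>t. 0 \<le> t \<Longrightarrow> t \<le> T \<Longrightarrow> AE \<omega> in M. Y t \<omega> = x + X t \<omega>"
    and Y_left: "AE \<omega> in M. \<forall>t\<in>{0<..T}. \<exists>l. ((\<lambda>s. Y s \<omega>) \<longlongrightarrow> l) (at_left t)"
begin

text \<open>Extends functions of time in [0, T] to the whole line, so that continuity and
  measurability can be stated without restricting spaces.\<close>

definition clip :: "real \<Rightarrow> real" where "clip t = max 0 (min T t)"

lemma clip [simp]: "0 \<le> clip t" "clip t \<le> T" "0 \<le> t \<Longrightarrow> t \<le> T \<Longrightarrow> clip t = t"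
  using T_pos by (auto simp: clip_def)

text \<open>Indexed by the current time: this is the value function of the theorem at the remaining
  time \<open>T - t\<close>.\<close>

definition v :: "real \<Rightarrow> 'h \<Rightarrow> real" where "v t y = expectation (\<lambda>\<omega>. \<phi> (y + J t \<omega>))"

definition Dv :: "real \<Rightarrow> 'h \<Rightarrow> 'h" where "Dv t y = expectation (\<lambda>\<omega>. D (y + J t \<omega>))"

text \<open>The energy of \<open>F\<close> spent up to time \<open>t\<close>. It is continuous, and
  its increments bound those of \<open>J\<close> in mean square.\<close>

definition cum :: "real \<Rightarrow> real" where "cum t = (LINT z|\<mu>. indicator {..t} (fst z) * (norm (F z))\<^sup>2)"

lemma J_measurable: "0 \<le> t \<Longrightarrow> t \<le> T \<Longrightarrow> J t \<in> borel_measurable M"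
  using comp_lim_sq_integrable(2)[OF J] by auto

lemma X_measurable: "0 \<le> t \<Longrightarrow> t \<le> T \<Longrightarrow> X t \<in> borel_measurable M"
  using comp_lim_sq_integrable(2)[OF X] by auto

lemma J_diff:
  assumes "0 \<le> t" "t \<le> T" "0 \<le> s" "s \<le> T"
  shows "integrable M (\<lambda>\<omega>. norm (J t \<omega> - J s \<omega>))"
    and "expectation (\<lambda>\<omega>. norm (J t \<omega> - J s \<omega>)) \<le> sqrt (4 * \<bar>cum t - cum s\<bar>)"
proof -
  have sq: "sq_integrable M (\<lambda>\<omega>. J t \<omega> - J s \<omega>)"
    by (rule comp_lim_sq_integrable(2)[OF comp_lim_diff[OF J J]]) (use assms in auto)
  show "integrable M (\<lambda>\<omega>. norm (J t \<omega> - J s \<omega>))" by (rule sq_integrable_norm_integrable(1)[OF sq])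
  have "expectation (\<lambda>\<omega>. (norm (J t \<omega> - J s \<omega>))\<^sup>2) \<le> 4 * \<bar>cum t - cum s\<bar>"
    unfolding cum_def
    by (rule comp_lim_indicator_diff[OF F J J]) (use assms in \<open>auto split: split_indicator\<close>)
  then show "expectation (\<lambda>\<omega>. norm (J t \<omega> - J s \<omega>)) \<le> sqrt (4 * \<bar>cum t - cum s\<bar>)"
    using sq_integrable_norm_integrable(2)[OF sq] by (intro real_le_rsqrt) linarith
qed

lemma expectation_Lipschitz_le:
  fixes f :: "'h \<Rightarrow> 'b::{banach,second_countable_topology}"
  assumes t: "0 \<le> t" "t \<le> T" and s: "0 \<le> s" "s \<le> T"
    and f: "\<And>a b. norm (f a - f b) \<le> L * norm (a - b)" "\<And>a. norm (f a) \<le> c" "f \<in> borel_measurable borel" and L: "0 \<le> L"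
  shows "norm (expectation (\<lambda>\<omega>. f (y + J t \<omega>)) - expectation (\<lambda>\<omega>. f (y' + J s \<omega>)))
    \<le> L * (norm (y - y') + sqrt (4 * \<bar>cum t - cum s\<bar>))"
proof -
  note [measurable] = J_measurable[OF t] J_measurable[OF s] f(3)
  have i: "integrable M (\<lambda>\<omega>. f (y + J t \<omega>))" "integrable M (\<lambda>\<omega>. f (y' + J s \<omega>))"
    using f(2) by (auto intro!: integrable_const_bound[of _ c])
  note d = J_diff[OF t s]
  have "norm (expectation (\<lambda>\<omega>. f (y + J t \<omega>)) - expectation (\<lambda>\<omega>. f (y' + J s \<omega>)))
      = norm (expectation (\<lambda>\<omega>. f (y + J t \<omega>) - f (y' + J s \<omega>)))"
    using i by simp
  also have "\<dots> \<le> expectation (\<lambda>\<omega>. norm (f (y + J t \<omega>) - f (y' + J s \<omega>)))" by (rule integral_norm_bound)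
  also have "\<dots> \<le> expectation (\<lambda>\<omega>. L * (norm (y - y') + norm (J t \<omega> - J s \<omega>)))"
  proof (rule integral_mono)
    show "norm (f (y + J t \<omega>) - f (y' + J s \<omega>)) \<le> L * (norm (y - y') + norm (J t \<omega> - J s \<omega>))" for \<omega>
    proof (rule order_trans[OF f(1)], rule mult_left_mono[OF _ L])
      show "norm (y + J t \<omega> - (y' + J s \<omega>)) \<le> norm (y - y') + norm (J t \<omega> - J s \<omega>)"
        using norm_triangle_ineq[of "y - y'" "J t \<omega> - J s \<omega>"] by (simp add: algebra_simps)
    qed
  qed (use i d in auto)
  also have "\<dots> = L * (norm (y - y') + expectation (\<lambda>\<omega>. norm (J t \<omega> - J s \<omega>)))"
    using d(1) by (simp add: prob_space)
  also have "\<dots> \<le> L * (norm (y - y') + sqrt (4 * \<bar>cum t - cum s\<bar>))"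
    using d(2) L by (intro mult_left_mono) auto
  finally show ?thesis .
qed

text \<open>Joint continuity in time and state is the route to joint measurability of
  \<open>v\<close> and \<open>Dv\<close>, which are then composed with random states.\<close>

lemma expectation_continuous:
  fixes f :: "'h \<Rightarrow> 'b::{banach,second_countable_topology}"
  assumes f: "\<And>a b. norm (f a - f b) \<le> L * norm (a - b)" "\<And>a. norm (f a) \<le> c" "f \<in> borel_measurable borel" and L: "0 \<le> L"
  shows "continuous_on UNIV (\<lambda>p. expectation (\<lambda>\<omega>. f (snd p + J (clip (fst p)) \<omega>)))"
  unfolding continuous_on_def
proof
  fix q :: "real \<times> 'h"
  let ?h = "\<lambda>p. L * (norm (snd p - snd q) + sqrt (4 * \<bar>cum (clip (fst p)) - cum (clip (fst q))\<bar>))"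
  have "continuous_on UNIV cum"
    unfolding cum_def[abs_def] by (rule cumulative_continuous[OF sq_integrable_integrable[OF F]])
  then have "continuous_on UNIV (\<lambda>p::real \<times> 'h. cum (clip (fst p)))"
    by (rule continuous_on_compose2) (auto simp: clip_def intro!: continuous_intros)
  then have c: "((\<lambda>p::real \<times> 'h. cum (clip (fst p))) \<longlongrightarrow> cum (clip (fst q))) (at q)"
    unfolding continuous_on_def by blast
  have "(?h \<longlongrightarrow> L * (norm (snd q - snd q) + sqrt (4 * \<bar>cum (clip (fst q)) - cum (clip (fst q))\<bar>))) (at q)"
    by (intro tendsto_intros c)
  then have h: "(?h \<longlongrightarrow> 0) (at q)" by simp
  show "((\<lambda>p. expectation (\<lambda>\<omega>. f (snd p + J (clip (fst p)) \<omega>))) \<longlongrightarrow> expectation (\<lambda>\<omega>. f (snd q + J (clip (fst q)) \<omega>))) (at q within UNIV)"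
  proof (rule LIM_zero_cancel, rule Lim_null_comparison[OF _ h], intro always_eventually allI)
    fix p
    show "norm (expectation (\<lambda>\<omega>. f (snd p + J (clip (fst p)) \<omega>)) - expectation (\<lambda>\<omega>. f (snd q + J (clip (fst q)) \<omega>))) \<le> ?h p"
      by (rule expectation_Lipschitz_le[OF _ _ _ _ f L]) auto
  qed
qed

lemma v_measurable [measurable (raw)]:
  assumes [measurable]: "a \<in> borel_measurable N" "b \<in> borel_measurable N"
  shows "(\<lambda>i. v (clip (a i)) (b i)) \<in> borel_measurable N"
proof -
  have "(\<lambda>p. v (clip (fst p)) (snd p)) \<in> borel_measurable borel"
    unfolding v_def using bounded Lipschitz K_nonneg
    by (intro borel_measurable_continuous_onI[OF expectation_continuous[of \<phi> K B]]) auto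
  then have [measurable]: "(\<lambda>p. v (clip (fst p)) (snd p)) \<in> borel_measurable (borel \<Otimes>\<^sub>M borel)"
    by (simp add: borel_prod)
  have "(\<lambda>i. (\<lambda>p. v (clip (fst p)) (snd p)) (a i, b i)) \<in> borel_measurable N" by measurable
  then show ?thesis by simp
qed

lemma Dv_measurable [measurable (raw)]:
  assumes [measurable]: "a \<in> borel_measurable N" "b \<in> borel_measurable N"
  shows "(\<lambda>i. Dv (clip (a i)) (b i)) \<in> borel_measurable N"
proof -
  have "(\<lambda>p. Dv (clip (fst p)) (snd p)) \<in> borel_measurable borel"
    unfolding Dv_def using grad_bounded grad_Lipschitz C_nonneg
    by (intro borel_measurable_continuous_onI[OF expectation_continuous[of D C K]]) auto
  then have [measurable]: "(\<lambda>p. Dv (clip (fst p)) (snd p)) \<in> borel_measurable (borel \<Otimes>\<^sub>M borel)"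
    by (simp add: borel_prod)
  have "(\<lambda>i. (\<lambda>p. Dv (clip (fst p)) (snd p)) (a i, b i)) \<in> borel_measurable N" by measurable
  then show ?thesis by simp
qed

lemma v_remainder:
  assumes t: "0 \<le> t" "t \<le> T"
  shows "v t (y + g) - v t y - Dv t y \<bullet> g = expectation (\<lambda>\<omega>. rho (y + J t \<omega>) g)"
    and "\<bar>v t (y + g) - v t y - Dv t y \<bullet> g\<bar> \<le> C * (norm g)\<^sup>2"
proof -
  note [measurable] = J_measurable[OF t]
  have i: "integrable M (\<lambda>\<omega>. \<phi> (a + J t \<omega>))" "integrable M (\<lambda>\<omega>. D (a + J t \<omega>))" for a
    by (auto intro!: phi_integrable D_integrable)
  have "expectation (\<lambda>\<omega>. rho (y + J t \<omega>) g)
      = expectation (\<lambda>\<omega>. \<phi> ((y + g) + J t \<omega>) - \<phi> (y + J t \<omega>) - D (y + J t \<omega>) \<bullet> g)"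
    unfolding rho_def by (intro Bochner_Integration.integral_cong refl) (simp add: algebra_simps)
  also have "\<dots> = v t (y + g) - v t y - Dv t y \<bullet> g"
    unfolding v_def Dv_def using i by simp
  finally show eq: "v t (y + g) - v t y - Dv t y \<bullet> g = expectation (\<lambda>\<omega>. rho (y + J t \<omega>) g)" by simp
  have r: "integrable M (\<lambda>\<omega>. rho (y + J t \<omega>) g)"
    using rho_bound by (intro integrable_const_bound[of _ "C * (norm g)\<^sup>2"]) auto
  have "\<bar>expectation (\<lambda>\<omega>. rho (y + J t \<omega>) g)\<bar> \<le> expectation (\<lambda>\<omega>. \<bar>rho (y + J t \<omega>) g\<bar>)"
    using integral_abs_bound by blast
  also have "\<dots> \<le> expectation (\<lambda>\<omega>. C * (norm g)\<^sup>2)"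
    by (rule integral_mono) (use r rho_bound in auto)
  finally show "\<bar>v t (y + g) - v t y - Dv t y \<bullet> g\<bar> \<le> C * (norm g)\<^sup>2"
    unfolding eq by (simp add: prob_space)
qed

lemma grad_v: "0 \<le> t \<Longrightarrow> t \<le> T \<Longrightarrow> grad (v t) y = Dv t y"
  by (rule grad_eqI, rule GDERIV_quadratic_remainder, rule v_remainder(2))

subsection \<open>The left limit process\<close>

text \<open>The last grid point strictly before \<open>t\<close>: the ceiling minus one excludes
  \<open>t\<close> even when it lies on the grid, as an approach from the left requires.\<close>

definition grid_index :: "nat \<Rightarrow> real \<Rightarrow> nat" where
  "grid_index n t = nat \<lceil>t * real (Suc n) / T\<rceil> - 1"

lemma grid_index:
  assumes "0 < t" "t \<le> T"
  shows "grid_index n t \<le> Suc n" "grid n (grid_index n t) < t" "t \<le> grid n (grid_index n t) + T / real (Suc n)"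
proof -
  let ?c = "\<lceil>t * real (Suc n) / T\<rceil>"
  have pos: "0 < t * real (Suc n) / T" using assms T_pos by simp
  then have c: "1 \<le> ?c" by linarith
  then have k: "real (grid_index n t) = real_of_int ?c - 1"
  proof -
    from c obtain m where m: "?c = int m" using nonneg_int_cases[of ?c] by auto
    then show ?thesis using c unfolding grid_index_def m by (simp add: of_nat_diff)
  qed
  have lt: "real (grid_index n t) < t * real (Suc n) / T" unfolding k by linarith
  then show "grid n (grid_index n t) < t"
    using T_pos by (simp add: grid_def field_simps del: of_nat_Suc)
  have "t * real (Suc n) / T \<le> real (Suc n)"
    using assms T_pos by (simp add: divide_le_eq mult_right_mono del: of_nat_Suc)
  with lt show "grid_index n t \<le> Suc n" by linarith
  have "t * real (Suc n) / T \<le> real (grid_index n t) + 1" unfolding k by linarith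
  then have "t \<le> T * (real (grid_index n t) + 1) / real (Suc n)"
    using T_pos by (simp add: field_simps del: of_nat_Suc)
  then show "t \<le> grid n (grid_index n t) + T / real (Suc n)"
    by (simp add: grid_def distrib_left add_divide_distrib del: of_nat_Suc)
qed

lemma grid_tendsto:
  assumes "0 < t" "t \<le> T"
  shows "(\<lambda>n. grid n (grid_index n t)) \<longlonglongrightarrow> t"
proof (rule tendsto_sandwich)
  have "(\<lambda>n. T / real (Suc n)) \<longlonglongrightarrow> 0"
    using tendsto_mult[OF tendsto_const[of T] LIMSEQ_inverse_real_of_nat] by (simp add: divide_inverse)
  from tendsto_diff[OF tendsto_const[of t] this] show "(\<lambda>n. t - T / real (Suc n)) \<longlonglongrightarrow> t" by simp
  show "\<forall>\<^sub>F n in sequentially. t - T / real (Suc n) \<le> grid n (grid_index n t)"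
  proof (intro always_eventually allI)
    fix n show "t - T / real (Suc n) \<le> grid n (grid_index n t)"
      using grid_index(3)[OF assms, of n] by linarith
  qed
  show "\<forall>\<^sub>F n in sequentially. grid n (grid_index n t) \<le> t"
    using grid_index(2)[OF assms] by (intro always_eventually allI less_imp_le)
qed (rule tendsto_const)

text \<open>Only values of \<open>X\<close> at countably many deterministic times enter, so this
  process is jointly measurable in time and \<open>\<omega>\<close>; \<open>lim\<close> takes some
  value even off the set of convergence.\<close>

definition left_version :: "real \<Rightarrow> 'w \<Rightarrow> 'h" where
  "left_version t \<omega> = (if t \<le> 0 then x + X 0 \<omega> else lim (\<lambda>n. x + X (clip (grid n (grid_index n t))) \<omega>))"

lemma left_version_measurable [measurable (raw)]:
  assumes [measurable]: "a \<in> borel_measurable N" "b \<in> measurable N M"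
  shows "(\<lambda>i. left_version (a i) (b i)) \<in> borel_measurable N"
proof -
  have X0 [measurable]: "X 0 \<in> borel_measurable M" using X_measurable T_pos by simp
  have [measurable]: "(\<lambda>i. x + X (clip (grid n (grid_index n (a i)))) (b i)) \<in> borel_measurable N" for n
  proof (rule measurable_compose_countable[where f="\<lambda>k i. x + X (clip (grid n k)) (b i)"])
    show "(\<lambda>i. x + X (clip (grid n k)) (b i)) \<in> borel_measurable N" for k
      using measurable_compose[OF assms(2) X_measurable[OF clip(1,2)]] by measurable
    show "(\<lambda>i. grid_index n (a i)) \<in> measurable N (count_space UNIV)"
      unfolding grid_index_def by measurable
  qed
  show ?thesis unfolding left_version_def by measurable
qed

text \<open>The equality of \<open>Y\<close> and \<open>x + X\<close> is used at grid points alone,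
  so one null set serves all times simultaneously; existence of left limits does the rest along the
  grid.\<close>

lemma good_AE:
  "AE \<omega> in M. (\<forall>t\<in>{0<..T}. (\<lambda>n. x + X (clip (grid n (grid_index n t))) \<omega>) \<longlonglongrightarrow> left_limit Y t \<omega>)
     \<and> (\<forall>t\<in>{0..T}. left_version t \<omega> = left_limit Y t \<omega>)"
proof -
  have "AE \<omega> in M. \<forall>n k. Y (clip (grid n k)) \<omega> = x + X (clip (grid n k)) \<omega>"
    unfolding AE_all_countable using Y by simp
  with Y_left show ?thesis
  proof eventually_elim
    case (elim \<omega>)
    have lim: "(\<lambda>n. x + X (clip (grid n (grid_index n t))) \<omega>) \<longlonglongrightarrow> left_limit Y t \<omega>" if t: "0 < t" "t \<le> T" for t
    proof -
      have "t \<in> {0<..T}" using t by simp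
      with elim(1) obtain l where l: "((\<lambda>s. Y s \<omega>) \<longlongrightarrow> l) (at_left t)" by blast
      have "left_limit Y t \<omega> = l"
        unfolding left_limit_def using t tendsto_Lim[OF _ l] by (simp add: trivial_limit_at_left_real)
      have "filterlim (\<lambda>n. grid n (grid_index n t)) (at_left t) sequentially"
        unfolding filterlim_at using grid_tendsto[OF t] grid_index(2)[OF t]
        by (auto intro!: always_eventually simp: less_imp_neq)
      from filterlim_compose[OF l this]
      have "(\<lambda>n. Y (grid n (grid_index n t)) \<omega>) \<longlonglongrightarrow> l" .
      moreover have "Y (grid n (grid_index n t)) \<omega> = x + X (clip (grid n (grid_index n t))) \<omega>" for n
        using elim(2) grid_range[OF grid_index(1)[OF t, of n]] by (metis clip(3))
      ultimately show ?thesis using \<open>left_limit Y t \<omega> = l\<close> by simp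
    qed
    have "left_version t \<omega> = left_limit Y t \<omega>" if "0 \<le> t" "t \<le> T" for t
    proof (cases "t = 0")
      case True
      have "Y (clip (grid 0 0)) \<omega> = x + X (clip (grid 0 0)) \<omega>" using elim(2) by blast
      then show ?thesis using True T_pos by (simp add: left_version_def left_limit_def clip_def)
    next
      case False
      then have t: "0 < t" "t \<le> T" using that by auto
      show ?thesis
        using limI[OF lim[OF t]] t by (simp add: left_version_def)
    qed
    then show ?case using lim by auto
  qed
qed

text \<open>No fixed time carries a jump: along the grid \<open>X\<close> converges to
  \<open>X t\<close> in mean square because time has no atoms, and almost surely to the left limit,
  so both limits coincide.\<close>

lemma left_version_AE:
  assumes t: "0 < t" "t \<le> T"
  shows "AE \<omega> in M. left_version t \<omega> = x + X t \<omega>"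
proof -
  let ?s = "\<lambda>n. clip (grid n (grid_index n t))"
  have s: "?s n = grid n (grid_index n t)" for n
    using grid_range[OF grid_index(1)[OF t]] by (metis clip(3))
  let ?c = "\<lambda>t. LINT z|\<mu>. indicator {..t} (fst z) * (norm (G z))\<^sup>2"
  have "continuous_on UNIV ?c" by (rule cumulative_continuous[OF sq_integrable_integrable[OF G]])
  then have "(\<lambda>n. ?c (?s n)) \<longlonglongrightarrow> ?c t"
    unfolding s continuous_on_sequentially using grid_tendsto[OF t] by (auto simp: o_def)
  then have "(\<lambda>n. 4 * \<bar>?c (?s n) - ?c t\<bar>) \<longlonglongrightarrow> 4 * \<bar>?c t - ?c t\<bar>" by (intro tendsto_intros)
  then have "(\<lambda>n. ennreal (4 * \<bar>?c (?s n) - ?c t\<bar>)) \<longlonglongrightarrow> ennreal (4 * \<bar>?c t - ?c t\<bar>)"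
    by (rule tendsto_ennrealI)
  then have lim: "(\<lambda>n. ennreal (4 * \<bar>?c (?s n) - ?c t\<bar>)) \<longlonglongrightarrow> 0" by simp
  have Xt: "comp_lim (before G t) (X t)" and Xs: "comp_lim (before G (?s n)) (X (?s n))" for n
    using X t by auto
  have "(\<lambda>n. sq_norm M (\<lambda>\<omega>. X (?s n) \<omega> - X t \<omega>)) \<longlonglongrightarrow> 0"
  proof (rule ennreal_tendsto_0_le[OF _ lim])
    fix n
    have "expectation (\<lambda>\<omega>. (norm (X (?s n) \<omega> - X t \<omega>))\<^sup>2) \<le> 4 * \<bar>?c (?s n) - ?c t\<bar>"
      by (rule comp_lim_indicator_diff[OF G Xs Xt]) (use t in \<open>auto split: split_indicator\<close>)
    then show "sq_norm M (\<lambda>\<omega>. X (?s n) \<omega> - X t \<omega>) \<le> ennreal (4 * \<bar>?c (?s n) - ?c t\<bar>)"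
      using sq_norm_eq_integral[OF comp_lim_sq_integrable(2)[OF comp_lim_diff[OF Xs Xt]], of n] by (simp add: ennreal_leI)
  qed
  then have "L2_tendsto M (\<lambda>n. X (?s n)) (X t)"
    using X_measurable t by (auto simp: L2_tendsto_iff)
  moreover have "AE \<omega> in M. (\<lambda>n. X (?s n) \<omega>) \<longlonglongrightarrow> left_version t \<omega> - x"
    using good_AE
  proof eventually_elim
    case (elim \<omega>)
    then have "(\<lambda>n. x + X (?s n) \<omega>) \<longlonglongrightarrow> left_version t \<omega>" using t by auto
    from tendsto_diff[OF this tendsto_const[of x]] show ?case by simp
  qed
  ultimately have "AE \<omega> in M. left_version t \<omega> - x = X t \<omega>" by (rule L2_AE_limit_eq)
  then show ?thesis by eventually_elim (metis add.commute diff_add_cancel)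
qed

end

section \<open>The error expansion for left limits\<close>

context error_setting
begin

text \<open>The analogue of \<open>rho\<close> for the value function, taken at the measurable
  version of the left limit so that Fubini can be applied.\<close>

definition remainder :: "(real \<times> 'y \<Rightarrow> 'h) \<Rightarrow> 'w \<Rightarrow> real \<times> 'y \<Rightarrow> real" where
  "remainder H \<omega> z = v (clip (fst z)) (left_version (fst z) \<omega> + H z)
     - v (clip (fst z)) (left_version (fst z) \<omega>) - Dv (clip (fst z)) (left_version (fst z) \<omega>) \<bullet> H z"

lemma remainder_measurable:
  assumes [measurable]: "H \<in> borel_measurable \<mu>"
  shows "(\<lambda>p. remainder H (fst p) (snd p)) \<in> borel_measurable (M \<Otimes>\<^sub>M \<mu>)"
proof -
  have [measurable]: "(\<lambda>p. fst (snd p)) \<in> borel_measurable (M \<Otimes>\<^sub>M \<mu>)"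
    by (rule measurable_compose[OF measurable_snd time_measurable])
  show ?thesis unfolding remainder_def by measurable
qed

lemma remainder_bound: "\<bar>remainder H \<omega> z\<bar> \<le> C * (norm (H z))\<^sup>2"
  unfolding remainder_def by (rule v_remainder(2)) auto

lemma remainder_integrable:
  assumes H: "sq_integrable \<mu> H"
  shows "integrable (M \<Otimes>\<^sub>M \<mu>) (\<lambda>(\<omega>, z). remainder H \<omega> z)"
proof (rule Bochner_Integration.integrable_bound)
  have [measurable]: "H \<in> borel_measurable \<mu>" using H by auto
  show "integrable (M \<Otimes>\<^sub>M \<mu>) (\<lambda>(\<omega>, z). C * (norm (H z))\<^sup>2)"
  proof (rule M_mu.Fubini_integrable)
    show "integrable M (\<lambda>\<omega>. LINT z|\<mu>. norm (case (\<omega>, z) of (\<omega>, z) \<Rightarrow> C * (norm (H z))\<^sup>2))"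
      by simp
    show "AE \<omega> in M. integrable \<mu> (\<lambda>z. case (\<omega>, z) of (\<omega>, z) \<Rightarrow> C * (norm (H z))\<^sup>2)"
      using sq_integrable_integrable[OF H] by simp
  qed measurable
  show "(\<lambda>(\<omega>, z). remainder H \<omega> z) \<in> borel_measurable (M \<Otimes>\<^sub>M \<mu>)"
    using remainder_measurable[of H] H by (auto simp: case_prod_beta')
  show "AE p in M \<Otimes>\<^sub>M \<mu>. norm (case p of (\<omega>, z) \<Rightarrow> remainder H \<omega> z) \<le> norm (case p of (\<omega>, z) \<Rightarrow> C * (norm (H z))\<^sup>2)"
    using remainder_bound C_nonneg by (auto simp: case_prod_beta')
qed

definition V :: "real \<Rightarrow> 'w \<Rightarrow> 'h" where
  "V t \<omega> = x + comp_integral M \<mu> \<pi> (switch F G t) \<omega>"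

lemma X_plus_J:
  assumes t: "0 \<le> t" "t \<le> T"
  shows "AE \<omega> in M. X t \<omega> + J t \<omega> = comp_integral M \<mu> \<pi> (switch F G t) \<omega>"
proof (rule comp_lim_unique[OF comp_lim_add[OF X[OF t] J[OF t]] comp_lim_comp_integral[OF sq_integrable_switch[OF F G]]])
  show "AE z in \<mu>. before G t z + after F t z = switch F G t z"
    using no_atoms[of 0] AE_space
  proof eventually_elim
    case (elim z)
    then have "0 < fst z" "fst z \<le> T" using time_range[of z] by auto
    then show ?case by (simp add: switch_def)
  qed
qed

lemma X_indep_J:
  assumes t: "0 \<le> t" "t \<le> T"
  shows "indep_var borel (X t) borel (J t)"
proof (rule comp_lim_indep[OF X[OF t] J[OF t], of "{z\<in>space \<mu>. fst z \<le> t}"])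
  show "{z\<in>space \<mu>. fst z \<le> t} \<in> sets \<mu>" by measurable
qed auto

text \<open>At a fixed time the left limit is \<open>x + X t\<close> almost surely, and averaging
  over the independent \<open>J t\<close> turns the remainder of \<open>\<phi>\<close> into that of
  the value function.\<close>

lemma expectation_remainder:
  assumes H: "sq_integrable \<mu> H"
  shows "AE z in \<mu>. expectation (\<lambda>\<omega>. remainder H \<omega> z) = expectation (\<lambda>\<omega>. rho (V (fst z) \<omega>) (H z))"
  using no_atoms[of 0] AE_space
proof eventually_elim
  case (elim z)
  then have t: "0 < fst z" "fst z \<le> T" using time_range[of z] by auto
  let ?t = "fst z"
  have t': "0 \<le> ?t" "?t \<le> T" using t by auto
  note [measurable] = X_measurable[OF t'] J_measurable[OF t']
  have V_meas: "V ?t \<in> borel_measurable M"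
    unfolding V_def[abs_def]
    using comp_lim_sq_integrable(2)[OF comp_lim_comp_integral[OF sq_integrable_switch[OF F G]]]
    by (auto intro!: borel_measurable_add)
  have sec: "(\<lambda>\<omega>. remainder H \<omega> z) \<in> borel_measurable M"
  proof -
    have "(\<lambda>\<omega>. (\<lambda>p. remainder H (fst p) (snd p)) (\<omega>, z)) \<in> borel_measurable M"
      by (rule measurable_compose[OF measurable_Pair2' remainder_measurable]) (use elim H in auto)
    then show ?thesis by simp
  qed
  let ?k = "\<lambda>a b. rho (x + a + b) (H z)"
  have int: "integrable M (\<lambda>\<omega>. ?k (X ?t \<omega>) (J ?t \<omega>))"
    using rho_bound by (intro integrable_const_bound[of _ "C * (norm (H z))\<^sup>2"]) auto
  have km: "case_prod ?k \<in> borel_measurable (borel \<Otimes>\<^sub>M borel)" by measurable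
  note iter = indep_var_iterated_expectation[OF X_indep_J[OF t'] km int]
  have "expectation (\<lambda>\<omega>. remainder H \<omega> z) = expectation (\<lambda>\<omega>. expectation (\<lambda>\<omega>'. ?k (X ?t \<omega>) (J ?t \<omega>')))"
  proof (rule Bochner_Integration.integral_cong_AE[OF sec])
    show "(\<lambda>\<omega>. expectation (\<lambda>\<omega>'. ?k (X ?t \<omega>) (J ?t \<omega>'))) \<in> borel_measurable M"
      using iter(2) by auto
    show "AE \<omega> in M. remainder H \<omega> z = expectation (\<lambda>\<omega>'. ?k (X ?t \<omega>) (J ?t \<omega>'))"
      using left_version_AE[OF t]
    proof eventually_elim
      case (elim \<omega>)
      then show ?case
        unfolding remainder_def clip(3)[OF t'] by (simp only: v_remainder(1)[OF t'])
    qed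
  qed
  also have "\<dots> = expectation (\<lambda>\<omega>. ?k (X ?t \<omega>) (J ?t \<omega>))" by (rule iter(1)[symmetric])
  also have "\<dots> = expectation (\<lambda>\<omega>. rho (V ?t \<omega>) (H z))"
  proof (rule Bochner_Integration.integral_cong_AE)
    show "AE \<omega> in M. ?k (X ?t \<omega>) (J ?t \<omega>) = rho (V ?t \<omega>) (H z)"
      using X_plus_J[OF t'] by eventually_elim (simp add: V_def add.assoc)
    show "(\<lambda>\<omega>. rho (V ?t \<omega>) (H z)) \<in> borel_measurable M" using V_meas by measurable
  qed measurable
  finally show ?case .
qed

definition integrand :: "'w \<Rightarrow> real \<times> 'y \<Rightarrow> real" where
  "integrand \<omega> z = v (fst z) (left_limit Y (fst z) \<omega> + G z) - v (fst z) (left_limit Y (fst z) \<omega> + F z)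
     + grad (v (fst z)) (left_limit Y (fst z) \<omega>) \<bullet> (F z - G z)"

text \<open>The values at the left limit cancel and the gradient terms merge. The exceptional null
  set is the same for all \<open>z\<close>, so the identity can be integrated over
  \<open>z\<close>.\<close>

lemma integrand_eq:
  "AE \<omega> in M. \<forall>z\<in>space \<mu>. integrand \<omega> z = remainder G \<omega> z - remainder F \<omega> z"
  using good_AE
proof eventually_elim
  case (elim \<omega>)
  show ?case
  proof
    fix z assume "z \<in> space \<mu>"
    then have t: "0 \<le> fst z" "fst z \<le> T" using time_range by auto
    then have "left_version (fst z) \<omega> = left_limit Y (fst z) \<omega>" using elim by simp
    then show "integrand \<omega> z = remainder G \<omega> z - remainder F \<omega> z"
      unfolding integrand_def remainder_def grad_v[OF t] clip(3)[OF t]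
      by (simp add: inner_diff_right)
  qed
qed

theorem error_expansion:
  shows "AE \<omega> in M. integrable \<mu> (integrand \<omega>)"
    and "integrable M (\<lambda>\<omega>. LINT z|\<mu>. integrand \<omega> z)"
    and "expectation (\<lambda>\<omega>. \<phi> (x + X T \<omega>)) - v 0 x = expectation (\<lambda>\<omega>. LINT z|\<mu>. integrand \<omega> z)"
proof -
  let ?d = "\<lambda>\<omega> z. remainder G \<omega> z - remainder F \<omega> z"
  note iG = remainder_integrable[OF G] and iF = remainder_integrable[OF F]
  have i: "integrable (M \<Otimes>\<^sub>M \<mu>) (\<lambda>(\<omega>, z). ?d \<omega> z)"
    using Bochner_Integration.integrable_diff[OF iG iF] by (simp add: case_prod_beta')
  have ae: "AE \<omega> in M. integrable \<mu> (?d \<omega>)"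
    using M_mu.AE_integrable_fst[OF i] by simp
  show "AE \<omega> in M. integrable \<mu> (integrand \<omega>)"
    using ae integrand_eq
  proof eventually_elim
    case (elim \<omega>)
    then show ?case using Bochner_Integration.integrable_cong[OF refl, of \<mu> "integrand \<omega>" "?d \<omega>"] by simp
  qed
  have int: "integrable M (\<lambda>\<omega>. LINT z|\<mu>. ?d \<omega> z)" by (rule M_mu.integrable_fst[OF i])
  have eq: "AE \<omega> in M. (LINT z|\<mu>. integrand \<omega> z) = (LINT z|\<mu>. ?d \<omega> z)"
    using integrand_eq by eventually_elim (rule Bochner_Integration.integral_cong, auto)
  \<comment> \<open>\<open>left_limit Y\<close> itself is not known to be jointly measurable, so
    Fubini gives measurability for the remainders, and completeness transfers it.\<close>
  have meas: "(\<lambda>\<omega>. LINT z|\<mu>. integrand \<omega> z) \<in> borel_measurable M"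
    by (rule measurable_AE_eq_complete[OF complete _ eq]) (use int in auto)
  show "integrable M (\<lambda>\<omega>. LINT z|\<mu>. integrand \<omega> z)"
    by (rule integrable_cong_AE_imp[OF int meas]) (use eq in \<open>auto elim: eventually_mono\<close>)
  have "expectation (\<lambda>\<omega>. LINT z|\<mu>. integrand \<omega> z) = expectation (\<lambda>\<omega>. LINT z|\<mu>. ?d \<omega> z)"
    by (rule Bochner_Integration.integral_cong_AE[OF meas _ eq]) (use int in auto)
  also have "\<dots> = (LINT z|\<mu>. expectation (\<lambda>\<omega>. ?d \<omega> z))"
    by (rule M_mu.Fubini_integral[OF i, symmetric])
  also have "\<dots> = (LINT z|\<mu>. expectation (\<lambda>\<omega>. remainder G \<omega> z) - expectation (\<lambda>\<omega>. remainder F \<omega> z))"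
  proof (rule Bochner_Integration.integral_cong_AE)
    note m = borel_measurable_integrable[OF M_mu.integrable_snd[OF iG]] borel_measurable_integrable[OF M_mu.integrable_snd[OF iF]]
    show "(\<lambda>z. expectation (\<lambda>\<omega>. remainder G \<omega> z) - expectation (\<lambda>\<omega>. remainder F \<omega> z)) \<in> borel_measurable \<mu>"
      using m by measurable
    show "(\<lambda>z. expectation (\<lambda>\<omega>. ?d \<omega> z)) \<in> borel_measurable \<mu>"
      by (rule borel_measurable_integrable[OF M_mu.integrable_snd[OF i]])
    show "AE z in \<mu>. expectation (\<lambda>\<omega>. ?d \<omega> z) = expectation (\<lambda>\<omega>. remainder G \<omega> z) - expectation (\<lambda>\<omega>. remainder F \<omega> z)"
      using M_mu.AE_integrable_snd[OF iG] M_mu.AE_integrable_snd[OF iF]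
      by eventually_elim (rule Bochner_Integration.integral_diff, auto)
  qed
  also have "\<dots> = (LINT z|\<mu>. expectation (\<lambda>\<omega>. remainder G \<omega> z)) - (LINT z|\<mu>. expectation (\<lambda>\<omega>. remainder F \<omega> z))"
    by (rule Bochner_Integration.integral_diff[OF M_mu.integrable_snd[OF iG] M_mu.integrable_snd[OF iF]])
  also have "\<dots> = expectation (\<lambda>\<omega>. \<phi> (V T \<omega>)) - expectation (\<lambda>\<omega>. \<phi> (V 0 \<omega>))"
    by (rule expansion[OF F G V_def, symmetric])
      (auto intro!: expectation_remainder F G borel_measurable_integrable M_mu.integrable_snd[OF iG] M_mu.integrable_snd[OF iF])
  also have "expectation (\<lambda>\<omega>. \<phi> (V T \<omega>)) = expectation (\<lambda>\<omega>. \<phi> (x + X T \<omega>))"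
  proof (rule Bochner_Integration.integral_cong_AE)
    have T: "0 \<le> T" "T \<le> T" using T_pos by auto
    have z: "AE \<omega> in M. J T \<omega> = 0"
      by (rule comp_lim_unique[OF J[OF T] comp_lim_zero]) simp
    show "AE \<omega> in M. \<phi> (V T \<omega>) = \<phi> (x + X T \<omega>)"
      using X_plus_J[OF T] z by eventually_elim (simp add: V_def)
    show "(\<lambda>\<omega>. \<phi> (x + X T \<omega>)) \<in> borel_measurable M" using X_measurable[OF T] by measurable
    show "(\<lambda>\<omega>. \<phi> (V T \<omega>)) \<in> borel_measurable M"
      unfolding V_def using comp_lim_sq_integrable(2)[OF comp_lim_comp_integral[OF sq_integrable_switch[OF F G]]]
      by (auto intro!: measurable_compose[OF _ phi_measurable] borel_measurable_add)
  qed
  also have "expectation (\<lambda>\<omega>. \<phi> (V 0 \<omega>)) = v 0 x"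
    unfolding v_def
  proof (rule Bochner_Integration.integral_cong_AE)
    have T: "0 \<le> (0::real)" "0 \<le> T" using T_pos by auto
    have z: "AE \<omega> in M. X 0 \<omega> = 0"
      by (rule comp_lim_unique[OF X[OF T] comp_lim_zero]) simp
    show "AE \<omega> in M. \<phi> (V 0 \<omega>) = \<phi> (x + J 0 \<omega>)"
      using X_plus_J[OF T] z by eventually_elim (simp add: V_def)
    show "(\<lambda>\<omega>. \<phi> (x + J 0 \<omega>)) \<in> borel_measurable M" using J_measurable[OF T] by measurable
    show "(\<lambda>\<omega>. \<phi> (V 0 \<omega>)) \<in> borel_measurable M"
      unfolding V_def using comp_lim_sq_integrable(2)[OF comp_lim_comp_integral[OF sq_integrable_switch[OF F G]]]
      by (auto intro!: measurable_compose[OF _ phi_measurable] borel_measurable_add)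
  qed
  finally show "expectation (\<lambda>\<omega>. \<phi> (x + X T \<omega>)) - v 0 x = expectation (\<lambda>\<omega>. LINT z|\<mu>. integrand \<omega> z)" by simp
qed

end

section \<open>Step functions\<close>

abbreviation interval_measure_on :: "real \<Rightarrow> real \<Rightarrow> real measure" where
  "interval_measure_on a b \<equiv> restrict_space lborel {a..b}"

text \<open>Left continuity fits step functions on intervals \<open>(c, d]\<close> sampled at left
  end points. Both kinds of integrand have it: reversed semigroup orbits, and the indicators in the
  integrand of the scheme.\<close>

definition left_continuous_on :: "real \<Rightarrow> real \<Rightarrow> (real \<Rightarrow> 'b::topological_space) \<Rightarrow> bool" where
  "left_continuous_on a b f \<longleftrightarrow> (\<forall>s\<in>{a<..b}. (f \<longlongrightarrow> f s) (at_left s))"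

definition step_list :: "real \<Rightarrow> real \<Rightarrow> (real \<Rightarrow> 'b::real_vector) \<Rightarrow> nat \<Rightarrow> (real \<times> real \<times> 'b) list" where
  "step_list a b f n = map (\<lambda>k. (a + (b - a) * real k / real (Suc n), a + (b - a) * real (Suc k) / real (Suc n),
     f (a + (b - a) * real k / real (Suc n)))) [0..<Suc n]"

context
  fixes a b :: real
  assumes ab: "a < b"
begin

private definition node :: "nat \<Rightarrow> nat \<Rightarrow> real" where
  "node n k = a + (b - a) * real k / real (Suc n)"

private lemma node_simps [simp]: "node n 0 = a" "node n (Suc n) = b"
  by (auto simp: node_def)

private lemma node_Suc: "node n (Suc k) = node n k + (b - a) / real (Suc n)"
  unfolding node_def of_nat_Suc[of k] distrib_left add_divide_distrib by simp

private lemma node_less: "node n k < node n (Suc k)"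
  using ab by (simp add: node_Suc)

private lemma node_mono: "k \<le> l \<Longrightarrow> node n k \<le> node n l"
  by (rule lift_Suc_mono_le) (auto intro: less_imp_le node_less)

private lemma step_fun_step_list:
  "step_fun (step_list a b f n) s = (\<Sum>k<Suc n. indicator {node n k<..node n (Suc k)} s *\<^sub>R f (node n k))"
  unfolding step_fun_def step_list_def node_def
  by (simp add: interv_sum_list_conv_sum_set_nat atLeast0LessThan o_def del: upt_Suc sum.lessThan_Suc)

lemma step_list_range:
  "\<forall>(c, d, x)\<in>set (step_list a b f n). a \<le> c \<and> c \<le> d \<and> d \<le> b"
proof -
  have "a \<le> node n k \<and> node n k \<le> node n (Suc k) \<and> node n (Suc k) \<le> b" if "k < Suc n" for k
    using node_mono[of 0 k n] node_mono[of "Suc k" "Suc n" n] node_less[of n k] that by auto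
  then show ?thesis unfolding step_list_def node_def by (auto simp del: upt_Suc)
qed

private lemma sum_indicator_node:
  "(\<Sum>k<Suc n. indicator {node n k<..node n (Suc k)} s) = (indicator {a<..b} s :: real)"
proof -
  have "(indicator {node n k<..node n (Suc k)} s :: real) = (\<lambda>k. of_bool (s \<le> node n k)) (Suc k) - (\<lambda>k. of_bool (s \<le> node n k)) k" for k
    using node_less[of n k] by (auto simp: indicator_def of_bool_def)
  then have "(\<Sum>k<Suc n. indicator {node n k<..node n (Suc k)} s) = of_bool (s \<le> node n (Suc n)) - (of_bool (s \<le> node n 0) :: real)"
    by (simp only: sum_lessThan_telescope[of "\<lambda>k. of_bool (s \<le> node n k) :: real"])
  then show ?thesis using ab by (auto simp: indicator_def)
qed

text \<open>The sampling point of the cell that contains \<open>s\<close> lies strictly below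
  \<open>s\<close> and within one mesh width of it.\<close>

lemma step_list_tendsto:
  fixes f :: "real \<Rightarrow> 'b::real_normed_vector"
  assumes f: "left_continuous_on a b f" and s: "s \<in> {a<..b}"
  shows "(\<lambda>n. step_fun (step_list a b f n) s) \<longlonglongrightarrow> f s"
proof (rule LIMSEQ_I)
  fix \<epsilon> :: real assume \<epsilon>: "0 < \<epsilon>"
  have "(f \<longlongrightarrow> f s) (at_left s)" using f s by (auto simp: left_continuous_on_def)
  then have "eventually (\<lambda>r. dist (f r) (f s) < \<epsilon> / 2) (at_left s)"
    using \<epsilon> by (intro tendstoD) auto
  then obtain l where l: "l < s" "\<And>r. l < r \<Longrightarrow> r < s \<Longrightarrow> dist (f r) (f s) < \<epsilon> / 2"
    unfolding eventually_at_left_field by blast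
  have "(\<lambda>n. (b - a) / real (Suc n)) \<longlonglongrightarrow> 0"
    using tendsto_mult[OF tendsto_const[of "b - a"] LIMSEQ_inverse_real_of_nat] by (simp add: divide_inverse)
  then have "eventually (\<lambda>n. (b - a) / real (Suc n) < s - l) sequentially"
    by (rule order_tendstoD) (use l in simp)
  then obtain N where N: "\<And>n. N \<le> n \<Longrightarrow> (b - a) / real (Suc n) < s - l"
    by (auto simp: eventually_sequentially)
  have "norm (step_fun (step_list a b f n) s - f s) < \<epsilon>" if n: "N \<le> n" for n
  proof -
    let ?i = "\<lambda>k. indicator {node n k<..node n (Suc k)} s :: real"
    have one: "(\<Sum>k<Suc n. ?i k) = 1" unfolding sum_indicator_node using s by simp
    have "f s = (\<Sum>k<Suc n. ?i k *\<^sub>R f s)" unfolding scaleR_left.sum[symmetric] one by simp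
    then have "step_fun (step_list a b f n) s - f s = (\<Sum>k<Suc n. ?i k *\<^sub>R f (node n k)) - (\<Sum>k<Suc n. ?i k *\<^sub>R f s)"
      unfolding step_fun_step_list by (simp only:)
    also have "\<dots> = (\<Sum>k<Suc n. ?i k *\<^sub>R (f (node n k) - f s))"
      by (simp only: sum_subtractf scaleR_diff_right)
    finally have "norm (step_fun (step_list a b f n) s - f s) \<le> (\<Sum>k<Suc n. norm (?i k *\<^sub>R (f (node n k) - f s)))"
      by (simp only: norm_sum)
    also have "\<dots> \<le> (\<Sum>k<Suc n. ?i k * (\<epsilon> / 2))"
    proof (rule sum_mono)
      fix k
      show "norm (?i k *\<^sub>R (f (node n k) - f s)) \<le> ?i k * (\<epsilon> / 2)"
      proof (cases "s \<in> {node n k<..node n (Suc k)}")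
        case True
        then have "node n k < s" "l < node n k" using N[OF n] by (auto simp: node_Suc)
        from l(2)[OF this(2,1)] show ?thesis using True by (simp add: dist_norm)
      qed simp
    qed
    also have "\<dots> = \<epsilon> / 2" unfolding sum_distrib_right[symmetric] one by simp
    finally show ?thesis using \<epsilon> by simp
  qed
  then show "\<exists>no. \<forall>n\<ge>no. norm (step_fun (step_list a b f n) s - f s) < \<epsilon>" by blast
qed

lemma norm_step_list_le:
  assumes "\<And>r. norm (f r) \<le> c"
  shows "norm (step_fun (step_list a b f n) s) \<le> c"
proof -
  have c: "0 \<le> c" using assms[of 0] norm_ge_zero order_trans by blast
  have "norm (step_fun (step_list a b f n) s) \<le> (\<Sum>k<Suc n. indicator {node n k<..node n (Suc k)} s * c)"
    unfolding step_fun_step_list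
    by (rule order_trans[OF norm_sum sum_mono]) (use assms in \<open>auto split: split_indicator\<close>)
  also have "\<dots> \<le> c"
    unfolding sum_distrib_right[symmetric] sum_indicator_node using c by (simp split: split_indicator)
  finally show ?thesis .
qed

end

lemma step_fun_measurable [measurable]:
  fixes xs :: "(real \<times> real \<times> 'b::{real_normed_vector,second_countable_topology}) list"
  shows "step_fun xs \<in> borel_measurable borel"
proof (induction xs)
  case Nil then show ?case by (simp add: step_fun_def[abs_def])
next
  case (Cons p xs)
  obtain c d x where p: "p = (c, d, x)" by (cases p)
  have "step_fun (p # xs) = (\<lambda>s. indicator {c<..d} s *\<^sub>R x + step_fun xs s)"
    by (auto simp: step_fun_def p)
  moreover have "(\<lambda>s. indicator {c<..d} s *\<^sub>R x + step_fun xs s) \<in> borel_measurable borel"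
    using Cons by measurable
  ultimately show ?case by simp
qed

lemma left_continuous_on_measurable:
  fixes f :: "real \<Rightarrow> 'b::{real_normed_vector,second_countable_topology}"
  assumes f: "left_continuous_on a b f"
  shows "f \<in> borel_measurable (interval_measure_on a b)"
proof (cases "a < b")
  case True
  \<comment> \<open>Step functions vanish at the left end point, so the value there is inserted
    separately.\<close>
  have "(\<lambda>s. if s = a then f a else f s) \<in> borel_measurable (interval_measure_on a b)"
  proof (rule borel_measurable_LIMSEQ_metric)
    show "(\<lambda>s. if s = a then f a else step_fun (step_list a b f n) s) \<in> borel_measurable (interval_measure_on a b)" for n
      by (rule measurable_restrict_space1) measurable
    show "(\<lambda>n. if s = a then f a else step_fun (step_list a b f n) s) \<longlonglongrightarrow> (if s = a then f a else f s)"
      if "s \<in> space (interval_measure_on a b)" for s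
      using step_list_tendsto[OF True f, of s] that by (auto simp: space_restrict_space)
  qed
  then show ?thesis by (rule measurable_cong[THEN iffD1, rotated]) auto
next
  case False
  have "(\<lambda>s::real. f a) \<in> borel_measurable (interval_measure_on a b)" by simp
  then show ?thesis
    by (rule measurable_cong[THEN iffD1, rotated]) (use False in \<open>auto simp: space_restrict_space intro!: arg_cong[where f=f]\<close>)
qed

lemma AE_interval_measure_on:
  "AE s in interval_measure_on a b. s \<in> {a<..b}"
proof -
  have "AE s in lborel. s \<noteq> a" by (rule AE_lborel_singleton)
  then show ?thesis by (subst AE_restrict_space_iff) auto
qed

lemma finite_interval_measure_on: "finite_measure (interval_measure_on a b)"
  by (rule finite_measureI) (auto simp: emeasure_restrict_space space_restrict_space emeasure_lborel_Icc_eq)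

text \<open>A left-continuous square integrable function is first truncated radially, which preserves left
  continuity; the step functions sampled at left end points then converge boundedly.\<close>

lemma left_continuous_step_approx:
  fixes f :: "real \<Rightarrow> 'b::{banach,second_countable_topology}"
  assumes f: "left_continuous_on a b f" and sq: "sq_norm (interval_measure_on a b) f < \<infinity>" and ab: "a \<le> b"
  shows "\<exists>xs. (\<forall>n. \<forall>(c, d, x)\<in>set (xs n). a \<le> c \<and> c \<le> d \<and> d \<le> b) \<and>
    L2_tendsto (interval_measure_on a b) (\<lambda>n. step_fun (xs n)) f"
proof -
  let ?I = "interval_measure_on a b"
  interpret I: finite_measure ?I by (rule finite_interval_measure_on)
  have fm [measurable]: "f \<in> borel_measurable ?I" by (rule left_continuous_on_measurable[OF f])
  have sm [measurable]: "step_fun xs \<in> borel_measurable ?I" for xs :: "(real \<times> real \<times> 'b) list"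
    by (rule measurable_restrict_space1) simp
  have fsq: "sq_integrable ?I f" using fm sq by (simp add: sq_integrable_def)
  have "\<exists>xs. (\<forall>(c, d, x)\<in>set xs. a \<le> c \<and> c \<le> d \<and> d \<le> b) \<and> sq_norm ?I (\<lambda>s. step_fun xs s - f s) < ennreal (1 / Suc j)" for j
  proof (cases "a < b")
    case False
    have "AE s in ?I. step_fun [] s - f s = 0"
      using AE_interval_measure_on[of a b] by eventually_elim (use False in auto)
    then have "sq_norm ?I (\<lambda>s. step_fun [] s - f s) = 0"
      by (subst sq_norm_eq_0_iff) auto
    then show ?thesis by (intro exI[of _ "[]"]) simp
  next
    case True
    define trunc where "trunc m r = (1 / max 1 (norm (f r) / real (Suc m))) *\<^sub>R f r" for m r
    have trunc_le: "norm (trunc m r) \<le> real (Suc m)" for m r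
    proof (cases "norm (f r) \<le> real (Suc m)")
      case True then show ?thesis by (simp add: trunc_def max_def divide_le_eq del: of_nat_Suc)
    next
      case False then show ?thesis by (simp add: trunc_def max_def divide_le_eq del: of_nat_Suc)
    qed
    have trunc_le': "norm (trunc m r) \<le> norm (f r)" for m r
      by (simp add: trunc_def divide_le_eq mult_le_cancel_left1 del: of_nat_Suc)
    have trunc_eq: "trunc m r = f r" if "norm (f r) \<le> real (Suc m)" for m r
      using that by (simp add: trunc_def max_def divide_le_eq del: of_nat_Suc)
    have trunc_cont: "left_continuous_on a b (trunc m)" for m
      unfolding left_continuous_on_def
    proof
      fix s assume "s \<in> {a<..b}"
      then have c: "(f \<longlongrightarrow> f s) (at_left s)" using f by (auto simp: left_continuous_on_def)
      show "(trunc m \<longlongrightarrow> trunc m s) (at_left s)"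
        unfolding trunc_def[abs_def] by (intro tendsto_intros c) auto
    qed
    have tm [measurable]: "trunc m \<in> borel_measurable ?I" for m
      by (rule left_continuous_on_measurable[OF trunc_cont])
    have lim1: "(\<lambda>m. sq_norm ?I (\<lambda>s. trunc m s - f s)) \<longlonglongrightarrow> (\<integral>\<^sup>+s. 0 \<partial>?I)"
      unfolding sq_norm_def
    proof (rule nn_integral_dominated_convergence[where w="\<lambda>s. ennreal ((norm (2 *\<^sub>R f s))\<^sup>2)"])
      show "AE s in ?I. ennreal ((norm (trunc m s - f s))\<^sup>2) \<le> ennreal ((norm (2 *\<^sub>R f s))\<^sup>2)" for m
      proof (intro AE_I2 ennreal_leI power_mono)
        fix s show "norm (trunc m s - f s) \<le> norm (2 *\<^sub>R f s)"
          using trunc_le'[of m s] norm_triangle_ineq4[of "trunc m s" "f s"] by simp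
      qed simp
      show "(\<integral>\<^sup>+s. ennreal ((norm (2 *\<^sub>R f s))\<^sup>2) \<partial>?I) < \<infinity>"
        using sq_integrableD(2)[OF sq_integrable_scaleR[OF fsq, of 2]] by (simp add: sq_norm_def)
      show "AE s in ?I. (\<lambda>m. ennreal ((norm (trunc m s - f s))\<^sup>2)) \<longlonglongrightarrow> 0"
      proof (intro AE_I2 tendsto_eventually)
        fix s
        obtain N where N: "norm (f s) \<le> real N" using real_arch_simple by blast
        have "\<forall>\<^sub>F m in sequentially. trunc m s = f s"
          using eventually_ge_at_top[of N] by eventually_elim (use N in \<open>auto intro!: trunc_eq\<close>)
        then show "\<forall>\<^sub>F m in sequentially. ennreal ((norm (trunc m s - f s))\<^sup>2) = 0"
          by eventually_elim simp
      qed
    qed measurable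
    have "\<forall>\<^sub>F m in sequentially. sq_norm ?I (\<lambda>s. trunc m s - f s) < ennreal (1 / (4 * real (Suc j)))"
      using lim1 by (intro order_tendstoD(2)[where y=0]) auto
    then obtain m where m: "sq_norm ?I (\<lambda>s. trunc m s - f s) < ennreal (1 / (4 * real (Suc j)))"
      by (auto simp: eventually_sequentially)
    let ?st = "\<lambda>n. step_fun (step_list a b (trunc m) n)"
    have lim2: "(\<lambda>n. sq_norm ?I (\<lambda>s. ?st n s - trunc m s)) \<longlonglongrightarrow> (\<integral>\<^sup>+s. 0 \<partial>?I)"
      unfolding sq_norm_def
    proof (rule nn_integral_dominated_convergence[where w="\<lambda>s. ennreal ((2 * real (Suc m))\<^sup>2)"])
      show "AE s in ?I. ennreal ((norm (?st n s - trunc m s))\<^sup>2) \<le> ennreal ((2 * real (Suc m))\<^sup>2)" for n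
      proof (intro AE_I2 ennreal_leI power_mono)
        fix s
        have "norm (?st n s) \<le> real (Suc m)" by (rule norm_step_list_le[OF True]) (rule trunc_le)
        from order_trans[OF norm_triangle_ineq4 add_mono[OF this trunc_le[of m s]]]
        show "norm (?st n s - trunc m s) \<le> 2 * real (Suc m)" by (simp only: mult_2)
      qed simp
      show "(\<integral>\<^sup>+s. ennreal ((2 * real (Suc m))\<^sup>2) \<partial>?I) < \<infinity>"
        by (simp add: ennreal_mult_less_top emeasure_restrict_space emeasure_lborel_Icc_eq)
      show "AE s in ?I. (\<lambda>n. ennreal ((norm (?st n s - trunc m s))\<^sup>2)) \<longlonglongrightarrow> 0"
        using AE_interval_measure_on[of a b]
      proof eventually_elim
        case (elim s)
        have "(\<lambda>n. ennreal ((norm (?st n s - trunc m s))\<^sup>2)) \<longlonglongrightarrow> ennreal ((norm (trunc m s - trunc m s))\<^sup>2)"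
          by (intro tendsto_intros step_list_tendsto[OF True trunc_cont elim])
        then show ?case by simp
      qed
    qed measurable
    have "\<forall>\<^sub>F n in sequentially. sq_norm ?I (\<lambda>s. ?st n s - trunc m s) < ennreal (1 / (4 * real (Suc j)))"
      using lim2 by (intro order_tendstoD(2)[where y=0]) auto
    then obtain n where n: "sq_norm ?I (\<lambda>s. ?st n s - trunc m s) < ennreal (1 / (4 * real (Suc j)))"
      by (auto simp: eventually_sequentially)
    have "sq_norm ?I (\<lambda>s. ?st n s - f s) \<le> 2 * sq_norm ?I (\<lambda>s. ?st n s - trunc m s) + 2 * sq_norm ?I (\<lambda>s. trunc m s - f s)"
      by (rule sq_norm_diff_triangle) measurable
    also have "\<dots> < 2 * ennreal (1 / (4 * real (Suc j))) + 2 * ennreal (1 / (4 * real (Suc j)))"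
      using n m by (intro add_strict_mono ennreal_mult_strict_left_mono) auto
    also have "\<dots> = ennreal (1 / real (Suc j))"
    proof -
      have "2 * ennreal (1 / (4 * real (Suc j))) = ennreal (1 / (2 * real (Suc j)))"
        using ennreal_mult[of 2 "1 / (4 * real (Suc j))"] by (simp del: of_nat_Suc)
      then show ?thesis by (simp add: ennreal_plus[symmetric] field_simps del: ennreal_plus of_nat_Suc)
    qed
    finally show ?thesis using step_list_range[OF True, of "trunc m" n] by blast
  qed
  then have "\<exists>xs. \<forall>j. (\<forall>(c, d, x)\<in>set (xs j). a \<le> c \<and> c \<le> d \<and> d \<le> b)
      \<and> sq_norm ?I (\<lambda>s. step_fun (xs j) s - f s) < ennreal (1 / Suc j)"
    by (intro choice allI)
  then obtain xs where xs: "\<And>j. \<forall>(c, d, x)\<in>set (xs j). a \<le> c \<and> c \<le> d \<and> d \<le> b"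
    "\<And>j. sq_norm ?I (\<lambda>s. step_fun (xs j) s - f s) < ennreal (1 / Suc j)"
    by blast
  have "(\<lambda>j. ennreal (1 / Suc j)) \<longlonglongrightarrow> ennreal 0"
    using LIMSEQ_inverse_real_of_nat by (intro tendsto_ennrealI) (simp add: inverse_eq_divide)
  then have "(\<lambda>j. sq_norm ?I (\<lambda>s. step_fun (xs j) s - f s)) \<longlonglongrightarrow> 0"
    by (intro ennreal_tendsto_0_le[OF less_imp_le[OF xs(2)]]) simp
  then show ?thesis using xs(1) by (intro exI[of _ xs]) (auto simp: L2_tendsto_iff)
qed

section \<open>The impulsive cylindrical process\<close>

locale impulsive_noise = poisson_measure M "intensity T \<O> \<nu>" \<pi>
  for M :: "'w measure" and T :: real and \<O> :: "'d::euclidean_space set" and \<nu> :: "real measure"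
    and \<pi> :: "'w \<Rightarrow> (real \<times> 'd \<times> real) measure" +
  fixes rep :: "'h::{real_inner,banach,second_countable_topology} \<Rightarrow> 'd \<Rightarrow> real" and e :: "nat \<Rightarrow> 'h"
  assumes T_pos: "0 < T" and O_open: "open \<O>" and L2: "is_L2 \<O> rep" and basis: "orthonormal_basis e"
    and sets_nu [measurable_cong]: "sets \<nu> = sets borel" and sigma_finite_nu: "sigma_finite_measure \<nu>"
    and second_moment: "integrable \<nu> (\<lambda>\<sigma>. \<sigma>\<^sup>2)"
begin

abbreviation \<mu> :: "(real \<times> 'd \<times> real) measure" where "\<mu> \<equiv> intensity T \<O> \<nu>"
abbreviation time :: "real measure" where "time \<equiv> interval_measure_on 0 T"
abbreviation lam :: "'d measure" where "lam \<equiv> restrict_space lborel \<O>"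
abbreviation Z :: "nat \<Rightarrow> real \<Rightarrow> 'w \<Rightarrow> real" where "Z \<equiv> coord_process M \<mu> \<pi> rep e"

definition m2 :: real where "m2 = (LINT \<sigma>|\<nu>. \<sigma>\<^sup>2)"

lemma m2: "(\<integral>\<^sup>+\<sigma>. ennreal (\<sigma>\<^sup>2) \<partial>\<nu>) = ennreal m2"
  unfolding m2_def by (rule nn_integral_eq_integral[OF second_moment]) simp

lemma rep_measurable [measurable]: "rep x \<in> borel_measurable lam"
  and rep_sq: "integrable lam (\<lambda>\<xi>. (rep x \<xi>)\<^sup>2)"
  and inner_rep: "x \<bullet> y = (LINT \<xi>|lam. rep x \<xi> * rep y \<xi>)"
  using L2 by (auto simp: is_L2_def Let_def)

lemma inner_basis: "e i \<bullet> e j = (if i = j then 1 else 0)"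
  using basis by (simp add: orthonormal_basis_def)

sublocale lam: sigma_finite_measure lam
  by (rule sigma_finite_measure_restrict_space[OF lborel.sigma_finite_measure_axioms]) (use O_open in auto)

sublocale nu: sigma_finite_measure \<nu> by (rule sigma_finite_nu)

sublocale time: finite_measure time by (rule finite_interval_measure_on)

sublocale mark: pair_sigma_finite lam \<nu> ..

sublocale mark: sigma_finite_measure "lam \<Otimes>\<^sub>M \<nu>" by (rule sigma_finite_pair_measure[OF lam.sigma_finite_measure_axioms nu.sigma_finite_measure_axioms])

sublocale all: pair_sigma_finite time "lam \<Otimes>\<^sub>M \<nu>" ..

sublocale mu: sigma_finite_measure \<mu>
  unfolding intensity_def
  by (rule sigma_finite_pair_measure[OF time.sigma_finite_measure_axioms mark.sigma_finite_measure_axioms])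

lemma space_mu: "space \<mu> = {0..T} \<times> \<O> \<times> UNIV"
proof -
  have "space \<nu> = UNIV" using sets_eq_imp_space_eq[OF sets_nu] by simp
  then show ?thesis by (simp add: intensity_def space_pair_measure space_restrict_space)
qed

lemma sets_mu [measurable_cong]: "sets \<mu> = sets (time \<Otimes>\<^sub>M (lam \<Otimes>\<^sub>M \<nu>))"
  by (simp add: intensity_def)

lemma ident_measurable_time: "(\<lambda>s. s) \<in> borel_measurable time"
  by (rule measurable_restrict_space1) simp

lemma fst_measurable: "fst \<in> borel_measurable \<mu>"
  unfolding measurable_cong_sets[OF sets_mu refl]
  using measurable_compose[OF measurable_fst[of time "lam \<Otimes>\<^sub>M \<nu>"] ident_measurable_time] by simp

lemma time_AE_mu:
  assumes "AE s in time. P s"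
  shows "AE z in \<mu>. P (fst z)"
proof -
  obtain N where N: "N \<in> null_sets time" "\<And>s. s \<in> space time \<Longrightarrow> s \<notin> N \<Longrightarrow> P s"
    using assms by (auto elim!: AE_E3)
  then have N': "\<And>s. s \<in> space time \<Longrightarrow> \<not> P s \<Longrightarrow> s \<in> N" by blast
  have "N \<times> space (lam \<Otimes>\<^sub>M \<nu>) \<in> null_sets \<mu>"
    unfolding intensity_def using N(1)
    by (auto simp: null_sets_def mark.emeasure_pair_measure_Times)
  then show ?thesis
    by (rule AE_I') (auto simp: intensity_def space_pair_measure simp del: space_restrict_space2 intro: N')
qed

lemma no_atoms_mu: "AE z in \<mu>. fst z \<noteq> t"
proof (rule time_AE_mu)
  have "AE s in lborel. s \<noteq> t" by (rule AE_lborel_singleton)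
  then show "AE s in time. s \<noteq> t" by (subst AE_restrict_space_iff) auto
qed

subsection \<open>The integrands of the coordinate processes\<close>

text \<open>An arbitrary index set lets single coordinates, partial sums and tails of the jump
  kernel share one isometry.\<close>

definition kernel :: "nat set \<Rightarrow> (nat \<Rightarrow> real \<Rightarrow> 'b::real_vector) \<Rightarrow> real \<times> 'd \<times> real \<Rightarrow> 'b" where
  "kernel K f z = (\<Sum>k\<in>K. (rep (e k) (fst (snd z)) * snd (snd z)) *\<^sub>R f k (fst z))"

lemma kernel_measurable:
  fixes f :: "nat \<Rightarrow> real \<Rightarrow> 'b::{real_normed_vector,second_countable_topology}"
  assumes [measurable]: "\<And>k. k \<in> K \<Longrightarrow> f k \<in> borel_measurable time"
  shows "kernel K f \<in> borel_measurable \<mu>"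
proof -
  have [measurable]: "(\<lambda>\<sigma>::real. \<sigma>) \<in> borel_measurable \<nu>" by measurable
  have "(\<lambda>z. (rep (e k) (fst (snd z)) * snd (snd z)) *\<^sub>R f k (fst z)) \<in> borel_measurable (time \<Otimes>\<^sub>M (lam \<Otimes>\<^sub>M \<nu>))"
    if k [measurable]: "k \<in> K" for k
  proof -
    have 1: "(\<lambda>z. rep (e k) (fst (snd z))) \<in> borel_measurable (time \<Otimes>\<^sub>M (lam \<Otimes>\<^sub>M \<nu>))" by measurable
    have 2: "(\<lambda>z. snd (snd z)) \<in> borel_measurable (time \<Otimes>\<^sub>M (lam \<Otimes>\<^sub>M \<nu>))" by measurable
    have 3: "(\<lambda>z. f k (fst z)) \<in> borel_measurable (time \<Otimes>\<^sub>M (lam \<Otimes>\<^sub>M \<nu>))"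
      by (rule measurable_compose[OF measurable_fst assms[OF k]])
    show ?thesis by (intro borel_measurable_scaleR borel_measurable_times 1 2 3)
  qed
  then show ?thesis
    unfolding kernel_def[abs_def] measurable_cong_sets[OF sets_mu refl]
    by (intro borel_measurable_sum) auto
qed

text \<open>Pythagoras for vector valued coefficients: the mixed terms integrate to the inner
  products of basis vectors.\<close>

lemma rep_orthogonal:
  fixes y :: "nat \<Rightarrow> 'b::real_inner"
  assumes K: "finite K"
  shows "(\<integral>\<^sup>+\<xi>. ennreal ((norm (\<Sum>k\<in>K. rep (e k) \<xi> *\<^sub>R y k))\<^sup>2) \<partial>lam) = ennreal (\<Sum>k\<in>K. (norm (y k))\<^sup>2)"
proof -
  have prod_int: "integrable lam (\<lambda>\<xi>. rep a \<xi> * rep b \<xi>)" for a b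
  proof (rule Bochner_Integration.integrable_bound)
    show "integrable lam (\<lambda>\<xi>. (rep a \<xi>)\<^sup>2 + (rep b \<xi>)\<^sup>2)" using rep_sq by simp
    show "AE \<xi> in lam. norm (rep a \<xi> * rep b \<xi>) \<le> norm ((rep a \<xi>)\<^sup>2 + (rep b \<xi>)\<^sup>2)"
    proof (intro AE_I2)
      fix \<xi>
      have "2 * (\<bar>rep a \<xi>\<bar> * \<bar>rep b \<xi>\<bar>) \<le> (rep a \<xi>)\<^sup>2 + (rep b \<xi>)\<^sup>2"
        using sum_squares_bound[of "\<bar>rep a \<xi>\<bar>" "\<bar>rep b \<xi>\<bar>"] by (simp add: mult.assoc)
      moreover have "0 \<le> \<bar>rep a \<xi>\<bar> * \<bar>rep b \<xi>\<bar>" by simp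
      ultimately have "\<bar>rep a \<xi>\<bar> * \<bar>rep b \<xi>\<bar> \<le> (rep a \<xi>)\<^sup>2 + (rep b \<xi>)\<^sup>2" by linarith
      then show "norm (rep a \<xi> * rep b \<xi>) \<le> norm ((rep a \<xi>)\<^sup>2 + (rep b \<xi>)\<^sup>2)"
        by (simp add: abs_mult)
    qed
  qed measurable
  have eq: "(norm (\<Sum>k\<in>K. rep (e k) \<xi> *\<^sub>R y k))\<^sup>2 = (\<Sum>k\<in>K. \<Sum>l\<in>K. (y k \<bullet> y l) * (rep (e k) \<xi> * rep (e l) \<xi>))" for \<xi>
    unfolding power2_norm_eq_inner inner_sum_left inner_sum_right
    by (intro sum.cong refl) (simp add: inner_commute)
  have int: "integrable lam (\<lambda>\<xi>. (norm (\<Sum>k\<in>K. rep (e k) \<xi> *\<^sub>R y k))\<^sup>2)"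
    unfolding eq by (intro Bochner_Integration.integrable_sum integrable_mult_right prod_int)
  have "(LINT \<xi>|lam. (norm (\<Sum>k\<in>K. rep (e k) \<xi> *\<^sub>R y k))\<^sup>2) = (\<Sum>k\<in>K. LINT \<xi>|lam. (\<Sum>l\<in>K. (y k \<bullet> y l) * (rep (e k) \<xi> * rep (e l) \<xi>)))"
    unfolding eq by (rule Bochner_Integration.integral_sum) (intro Bochner_Integration.integrable_sum integrable_mult_right prod_int)
  also have "\<dots> = (\<Sum>k\<in>K. \<Sum>l\<in>K. (y k \<bullet> y l) * (LINT \<xi>|lam. rep (e k) \<xi> * rep (e l) \<xi>))"
  proof (rule sum.cong[OF refl])
    fix k
    have "(LINT \<xi>|lam. (\<Sum>l\<in>K. (y k \<bullet> y l) * (rep (e k) \<xi> * rep (e l) \<xi>))) = (\<Sum>l\<in>K. LINT \<xi>|lam. (y k \<bullet> y l) * (rep (e k) \<xi> * rep (e l) \<xi>))"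
      by (rule Bochner_Integration.integral_sum) (intro integrable_mult_right prod_int)
    then show "(LINT \<xi>|lam. (\<Sum>l\<in>K. (y k \<bullet> y l) * (rep (e k) \<xi> * rep (e l) \<xi>))) = (\<Sum>l\<in>K. (y k \<bullet> y l) * (LINT \<xi>|lam. rep (e k) \<xi> * rep (e l) \<xi>))"
      by (simp only: integral_mult_right_zero)
  qed
  also have "\<dots> = (\<Sum>k\<in>K. \<Sum>l\<in>K. if k = l then (norm (y k))\<^sup>2 else 0)"
    unfolding inner_rep[symmetric] inner_basis by (intro sum.cong refl) (simp add: power2_norm_eq_inner)
  also have "\<dots> = (\<Sum>k\<in>K. (norm (y k))\<^sup>2)" using K by simp
  finally show ?thesis using nn_integral_eq_integral[OF int] by simp
qed

text \<open>By Tonelli the jump size contributes the second moment \<open>m2\<close>, the space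
  variable contributes orthogonality, and the time integral of the coefficients remains.\<close>

lemma sq_norm_kernel:
  fixes f :: "nat \<Rightarrow> real \<Rightarrow> 'b::{real_inner,second_countable_topology}"
  assumes K: "finite K" and f: "\<And>k. k \<in> K \<Longrightarrow> f k \<in> borel_measurable time"
  shows "sq_norm \<mu> (kernel K f) = ennreal m2 * (\<Sum>k\<in>K. sq_norm time (f k))"
proof -
  have km: "kernel K f \<in> borel_measurable (time \<Otimes>\<^sub>M (lam \<Otimes>\<^sub>M \<nu>))"
    using kernel_measurable[of K f, OF f] by (simp add: measurable_cong_sets[OF sets_mu refl])
  let ?A = "\<lambda>s \<xi>. \<Sum>k\<in>K. rep (e k) \<xi> *\<^sub>R f k s"
  have ker: "kernel K f (s, \<xi>, \<sigma>) = \<sigma> *\<^sub>R ?A s \<xi>" for s \<xi> \<sigma>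
    by (simp add: kernel_def scaleR_sum_right mult.commute)
  have inner: "(\<integral>\<^sup>+\<xi>. \<integral>\<^sup>+\<sigma>. ennreal ((norm (kernel K f (s, \<xi>, \<sigma>)))\<^sup>2) \<partial>\<nu> \<partial>lam) = ennreal m2 * ennreal (\<Sum>k\<in>K. (norm (f k s))\<^sup>2)" for s
  proof -
    have "(\<integral>\<^sup>+\<sigma>. ennreal ((norm (kernel K f (s, \<xi>, \<sigma>)))\<^sup>2) \<partial>\<nu>) = ennreal m2 * ennreal ((norm (?A s \<xi>))\<^sup>2)" for \<xi>
    proof -
      have "(\<integral>\<^sup>+\<sigma>. ennreal ((norm (kernel K f (s, \<xi>, \<sigma>)))\<^sup>2) \<partial>\<nu>) = (\<integral>\<^sup>+\<sigma>. ennreal (\<sigma>\<^sup>2) * ennreal ((norm (?A s \<xi>))\<^sup>2) \<partial>\<nu>)"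
        unfolding ker by (intro nn_integral_cong) (simp add: power_mult_distrib ennreal_mult)
      also have "\<dots> = (\<integral>\<^sup>+\<sigma>. ennreal (\<sigma>\<^sup>2) \<partial>\<nu>) * ennreal ((norm (?A s \<xi>))\<^sup>2)"
        by (rule nn_integral_multc) measurable
      finally show ?thesis unfolding m2 .
    qed
    then have "(\<integral>\<^sup>+\<xi>. \<integral>\<^sup>+\<sigma>. ennreal ((norm (kernel K f (s, \<xi>, \<sigma>)))\<^sup>2) \<partial>\<nu> \<partial>lam) = (\<integral>\<^sup>+\<xi>. ennreal m2 * ennreal ((norm (?A s \<xi>))\<^sup>2) \<partial>lam)"
      by simp
    also have "\<dots> = ennreal m2 * (\<integral>\<^sup>+\<xi>. ennreal ((norm (?A s \<xi>))\<^sup>2) \<partial>lam)"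
      by (rule nn_integral_cmult) measurable
    finally show ?thesis unfolding rep_orthogonal[OF K] .
  qed
  have "sq_norm \<mu> (kernel K f) = (\<integral>\<^sup>+z. ennreal ((norm (kernel K f z))\<^sup>2) \<partial>(time \<Otimes>\<^sub>M (lam \<Otimes>\<^sub>M \<nu>)))"
    by (simp add: sq_norm_def intensity_def)
  also have "\<dots> = (\<integral>\<^sup>+s. \<integral>\<^sup>+p. ennreal ((norm (kernel K f (s, p)))\<^sup>2) \<partial>(lam \<Otimes>\<^sub>M \<nu>) \<partial>time)"
  proof (rule mark.nn_integral_fst[symmetric])
    show "(\<lambda>z. ennreal ((norm (kernel K f z))\<^sup>2)) \<in> borel_measurable (time \<Otimes>\<^sub>M (lam \<Otimes>\<^sub>M \<nu>))"
      by (rule measurable_compose[OF km]) measurable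
  qed
  also have "\<dots> = (\<integral>\<^sup>+s. ennreal m2 * ennreal (\<Sum>k\<in>K. (norm (f k s))\<^sup>2) \<partial>time)"
  proof (rule nn_integral_cong)
    fix s assume s: "s \<in> space time"
    have "(\<lambda>p. ennreal ((norm (kernel K f (s, p)))\<^sup>2)) \<in> borel_measurable (lam \<Otimes>\<^sub>M \<nu>)"
      using measurable_compose[OF measurable_Pair1'[OF s] km] by measurable
    from nu.nn_integral_fst[OF this]
    show "(\<integral>\<^sup>+p. ennreal ((norm (kernel K f (s, p)))\<^sup>2) \<partial>(lam \<Otimes>\<^sub>M \<nu>)) = ennreal m2 * ennreal (\<Sum>k\<in>K. (norm (f k s))\<^sup>2)"
      unfolding inner by simp
  qed
  also have "\<dots> = (\<integral>\<^sup>+s. ennreal m2 * (\<Sum>k\<in>K. ennreal ((norm (f k s))\<^sup>2)) \<partial>time)"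
    by (intro nn_integral_cong) (simp add: sum_ennreal)
  also have "\<dots> = ennreal m2 * (\<integral>\<^sup>+s. (\<Sum>k\<in>K. ennreal ((norm (f k s))\<^sup>2)) \<partial>time)"
    using f by (intro nn_integral_cmult borel_measurable_sum) auto
  also have "(\<integral>\<^sup>+s. (\<Sum>k\<in>K. ennreal ((norm (f k s))\<^sup>2)) \<partial>time) = (\<Sum>k\<in>K. sq_norm time (f k))"
    unfolding sq_norm_def using f by (intro nn_integral_sum) auto
  finally show ?thesis .
qed

end

lemma L2_tendsto_indicator:
  assumes X: "L2_tendsto M Xn X" and A: "{x\<in>space M. g x \<in> A} \<in> sets M"
  shows "L2_tendsto M (\<lambda>n x. indicator A (g x) *\<^sub>R Xn n x) (\<lambda>x. indicator A (g x) *\<^sub>R X x)"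
proof -
  note [measurable] = L2_tendstoD(1,2)[OF X]
  have m: "(\<lambda>x. indicator A (g x) *\<^sub>R Y x) \<in> borel_measurable M" if [measurable]: "Y \<in> borel_measurable M" for Y :: "_ \<Rightarrow> 'b"
  proof -
    have "(\<lambda>x. indicator {x\<in>space M. g x \<in> A} x *\<^sub>R Y x) \<in> borel_measurable M" using A by measurable
    then show ?thesis
      by (rule measurable_cong[THEN iffD1, rotated]) (auto split: split_indicator)
  qed
  have "(\<lambda>n. sq_norm M (\<lambda>x. indicator A (g x) *\<^sub>R Xn n x - indicator A (g x) *\<^sub>R X x)) \<longlonglongrightarrow> 0"
    by (rule ennreal_tendsto_0_le[OF sq_norm_mono L2_tendstoD(3)[OF X]]) (auto split: split_indicator)
  then show ?thesis using m by (auto simp: L2_tendsto_iff)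
qed

lemma indicator_interval_measurable:
  fixes f :: "real \<Rightarrow> 'b::{banach,second_countable_topology}"
  assumes f: "f \<in> borel_measurable (interval_measure_on a b)"
  shows "(\<lambda>s. indicator {a<..b} s *\<^sub>R f s) \<in> borel_measurable borel"
proof -
  have "(\<lambda>s. indicator {a..b} s *\<^sub>R f s) \<in> borel_measurable lborel"
    using f by (subst (asm) borel_measurable_restrict_space_iff) auto
  then have [measurable]: "(\<lambda>s. indicator {a..b} s *\<^sub>R f s) \<in> borel_measurable borel" by simp
  have "(\<lambda>s. indicator {a<..b} s *\<^sub>R (indicator {a..b} s *\<^sub>R f s)) \<in> borel_measurable borel" by measurable
  also have "(\<lambda>s. indicator {a<..b} s *\<^sub>R (indicator {a..b} s *\<^sub>R f s)) = (\<lambda>s. indicator {a<..b} s *\<^sub>R f s)"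
    by (auto simp: fun_eq_iff split: split_indicator)
  finally show ?thesis .
qed

lemma left_continuous_on_subset:
  "left_continuous_on a b f \<Longrightarrow> a \<le> c \<Longrightarrow> d \<le> b \<Longrightarrow> left_continuous_on c d f"
  by (auto simp: left_continuous_on_def)

lemma sq_norm_interval_mono:
  assumes "a \<le> c" "d \<le> b"
  shows "sq_norm (interval_measure_on c d) f \<le> sq_norm (interval_measure_on a b) f"
  unfolding sq_norm_def
  by (subst (1 2) nn_integral_restrict_space) (use assms in \<open>auto intro!: nn_integral_mono split: split_indicator\<close>)

section \<open>Coordinate and stochastic integrals as compensated integrals\<close>

context impulsive_noise
begin

lemma restrict_borel_measurable: "f \<in> borel_measurable borel \<Longrightarrow> f \<in> borel_measurable time"
  by (rule measurable_restrict_space1) simp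

lemma kernel_sq_integrable:
  fixes f :: "nat \<Rightarrow> real \<Rightarrow> 'b::{real_inner,banach,second_countable_topology}"
  assumes "finite K" "\<And>k. k \<in> K \<Longrightarrow> sq_integrable time (f k)"
  shows "sq_integrable \<mu> (kernel K f)"
proof -
  have m: "f k \<in> borel_measurable time" if "k \<in> K" for k using assms(2)[OF that] by auto
  have "(\<Sum>k\<in>K. sq_norm time (f k)) < \<infinity>"
    using assms sq_integrableD(2) by (auto simp: less_top)
  then show ?thesis
    using kernel_measurable[of K f, OF m] sq_norm_kernel[OF assms(1) m]
    by (simp add: sq_integrable_def ennreal_mult_less_top)
qed

lemma kernel_singleton: "kernel {k} f z = (rep (e k) (fst (snd z)) * snd (snd z)) *\<^sub>R f k (fst z)"
  by (simp add: kernel_def)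

lemma kernel_diff: "kernel K f z - kernel K g z = kernel K (\<lambda>k s. f k s - g k s) z"
  by (simp add: kernel_def sum_subtractf scaleR_diff_right)

lemma sq_integrable_bounded_time:
  fixes f :: "real \<Rightarrow> 'b::{banach,second_countable_topology}"
  assumes "f \<in> borel_measurable borel" "\<And>s. norm (f s) \<le> c"
  shows "sq_integrable time f"
proof -
  have "(\<integral>\<^sup>+s. ennreal ((norm (f s))\<^sup>2) \<partial>time) \<le> (\<integral>\<^sup>+s. ennreal (c\<^sup>2) \<partial>time)"
    using assms(2) by (intro nn_integral_mono ennreal_leI power_mono) auto
  also have "\<dots> < \<infinity>"
    by (simp add: ennreal_mult_less_top emeasure_restrict_space emeasure_lborel_Icc_eq)
  finally show ?thesis
    using restrict_borel_measurable[OF assms(1)] by (simp add: sq_integrable_def sq_norm_def)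
qed

lemma coord_process_comp_lim:
  "comp_lim (kernel {k} (\<lambda>_. indicator {0..t} :: real \<Rightarrow> real)) (Z k t)"
proof -
  have eq: "(\<lambda>(s, \<xi>, \<sigma>). indicator {0..t} s * (rep (e k) \<xi> * \<sigma>)) = kernel {k} (\<lambda>_. indicator {0..t} :: real \<Rightarrow> real)"
    by (auto simp: kernel_singleton fun_eq_iff)
  have "sq_integrable \<mu> (kernel {k} (\<lambda>_. indicator {0..t} :: real \<Rightarrow> real))"
    by (rule kernel_sq_integrable) (auto intro!: sq_integrable_bounded_time[where c=1])
  then show ?thesis
    unfolding coord_process_def eq by (rule comp_lim_comp_integral)
qed

lemma step_integral_comp_lim:
  fixes xs :: "(real \<times> real \<times> 'h) list"
  assumes "\<forall>(c, d, x)\<in>set xs. 0 \<le> c \<and> c \<le> d"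
  shows "comp_lim (kernel {k} (\<lambda>_. step_fun xs)) (step_integral (Z k) xs)"
  using assms
proof (induction xs)
  case Nil
  have "kernel {k} (\<lambda>_. step_fun []) = (\<lambda>_. 0 :: 'h)" by (simp add: kernel_def step_fun_def fun_eq_iff)
  moreover have "step_integral (Z k) [] = (\<lambda>_. 0 :: 'h)" by (simp add: step_integral_def fun_eq_iff)
  ultimately show ?case using comp_lim_zero by simp
next
  case (Cons p xs)
  obtain c d x where p: "p = (c, d, x)" by (cases p)
  have cd: "0 \<le> c" "c \<le> d" using Cons(2) p by auto
  have bl: "bounded_linear (\<lambda>r::real. r *\<^sub>R x)" by (rule bounded_linear_scaleR_left)
  have "comp_lim (kernel {k} (\<lambda>_. step_fun xs)) (step_integral (Z k) xs)" using Cons by auto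
  note l = comp_lim_add[OF comp_lim_bounded_linear[OF bl comp_lim_diff[OF coord_process_comp_lim[of k d] coord_process_comp_lim[of k c]]] this]
  have "step_integral (Z k) (p # xs) = (\<lambda>\<omega>. (Z k d \<omega> - Z k c \<omega>) *\<^sub>R x + step_integral (Z k) xs \<omega>)"
    by (simp add: step_integral_def p fun_eq_iff)
  moreover have "comp_lim (kernel {k} (\<lambda>_. step_fun (p # xs))) (\<lambda>\<omega>. (Z k d \<omega> - Z k c \<omega>) *\<^sub>R x + step_integral (Z k) xs \<omega>)"
  proof (rule comp_lim_cong[OF l])
    show "AE z in \<mu>. (kernel {k} (\<lambda>_. indicator {0..d}) z - kernel {k} (\<lambda>_. indicator {0..c}) z) *\<^sub>R x + kernel {k} (\<lambda>_. step_fun xs) z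
        = kernel {k} (\<lambda>_. step_fun (p # xs)) z"
    proof (intro AE_I2)
      fix z assume "z \<in> space \<mu>"
      then have "0 \<le> fst z" by (auto simp: space_mu)
      \<comment> \<open>The coordinate process integrates over closed intervals from 0; differences
        of these are the half open intervals of step functions.\<close>
      then have "indicator {0..d} (fst z) - indicator {0..c} (fst z) = (indicator {c<..d} (fst z) :: real)"
        using cd by (auto split: split_indicator)
      then show "(kernel {k} (\<lambda>_. indicator {0..d}) z - kernel {k} (\<lambda>_. indicator {0..c}) z) *\<^sub>R x + kernel {k} (\<lambda>_. step_fun xs) z
        = kernel {k} (\<lambda>_. step_fun (p # xs)) z"
        by (simp only: kernel_singleton) (simp add: step_fun_def p scaleR_add_right right_diff_distrib[symmetric])
    qed
    show "kernel {k} (\<lambda>_. step_fun (p # xs)) \<in> borel_measurable \<mu>"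
      by (intro kernel_measurable restrict_borel_measurable step_fun_measurable)
    show "(\<lambda>\<omega>. (Z k d \<omega> - Z k c \<omega>) *\<^sub>R x + step_integral (Z k) xs \<omega>) \<in> borel_measurable M"
      using comp_lim_sq_integrable(2)[OF l] by auto
  qed simp
  ultimately show ?case by simp
qed

text \<open>The steps vanish outside \<open>(a, b]\<close>, so passing from \<open>[a, b]\<close> to
  the full time interval adds no error once \<open>f\<close> is cut off accordingly.\<close>

lemma kernel_step_tendsto:
  fixes f :: "real \<Rightarrow> 'h"
  assumes ab: "0 \<le> a" "b \<le> T" and xs: "\<And>n. \<forall>(c, d, x)\<in>set (xs n). a \<le> c \<and> c \<le> d \<and> d \<le> b"
    and lim: "L2_tendsto (interval_measure_on a b) (\<lambda>n. step_fun (xs n)) f"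
  shows "L2_tendsto \<mu> (\<lambda>n. kernel {k} (\<lambda>_. step_fun (xs n))) (kernel {k} (\<lambda>_ s. indicator {a<..b} s *\<^sub>R f s))"
proof -
  let ?f = "\<lambda>s. indicator {a<..b} s *\<^sub>R f s"
  have fm: "?f \<in> borel_measurable borel"
    by (rule indicator_interval_measurable[OF L2_tendstoD(2)[OF lim]])
  have zero: "step_fun ys s = 0" if "\<forall>(c, d, x)\<in>set ys. a \<le> c \<and> c \<le> d \<and> d \<le> b" "s \<notin> {a<..b}"
    for ys :: "(real \<times> real \<times> 'h) list" and s
    using that by (induction ys) (auto simp: step_fun_def split: split_indicator)
  have le: "sq_norm time (\<lambda>s. step_fun (xs n) s - ?f s) \<le> sq_norm (interval_measure_on a b) (\<lambda>s. step_fun (xs n) s - f s)" for n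
    unfolding sq_norm_def
  proof (subst (1 2) nn_integral_restrict_space)
    show "(\<integral>\<^sup>+s. ennreal ((norm (step_fun (xs n) s - ?f s))\<^sup>2) * indicator {0..T} s \<partial>lborel)
      \<le> (\<integral>\<^sup>+s. ennreal ((norm (step_fun (xs n) s - f s))\<^sup>2) * indicator {a..b} s \<partial>lborel)"
    proof (rule nn_integral_mono)
      fix s
      show "ennreal ((norm (step_fun (xs n) s - ?f s))\<^sup>2) * indicator {0..T} s
          \<le> ennreal ((norm (step_fun (xs n) s - f s))\<^sup>2) * indicator {a..b} s"
        using zero[OF xs[of n], of s] by (cases "s \<in> {a<..b}") (auto split: split_indicator)
    qed
  qed auto
  have "(\<lambda>n. sq_norm \<mu> (\<lambda>z. kernel {k} (\<lambda>_. step_fun (xs n)) z - kernel {k} (\<lambda>_. ?f) z)) \<longlonglongrightarrow> 0"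
  proof (rule ennreal_tendsto_0_le[OF _ tendsto_0_cmult_ennreal[OF L2_tendstoD(3)[OF lim], of "ennreal m2"]])
    fix n
    have "(\<lambda>s. step_fun (xs n) s - ?f s) \<in> borel_measurable time"
      by (intro restrict_borel_measurable borel_measurable_diff fm step_fun_measurable)
    then show "sq_norm \<mu> (\<lambda>z. kernel {k} (\<lambda>_. step_fun (xs n)) z - kernel {k} (\<lambda>_. ?f) z)
        \<le> ennreal m2 * sq_norm (interval_measure_on a b) (\<lambda>s. step_fun (xs n) s - f s)"
      unfolding kernel_diff using sq_norm_kernel[of "{k}" "\<lambda>_ s. step_fun (xs n) s - ?f s"] le[of n]
      by (simp add: mult_left_mono)
  qed simp
  moreover have "kernel {k} (\<lambda>_. step_fun (xs n)) \<in> borel_measurable \<mu>" for n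
    by (intro kernel_measurable restrict_borel_measurable step_fun_measurable)
  moreover have "kernel {k} (\<lambda>_. ?f) \<in> borel_measurable \<mu>"
    by (intro kernel_measurable restrict_borel_measurable fm)
  ultimately show ?thesis by (auto simp: L2_tendsto_iff)
qed

text \<open>Approximation by steps supplies a witness for the \<open>SOME\<close>. The chosen value
  then comes with its own approximating steps \<open>ys\<close>, from which
  \<open>comp_lim_closed\<close> identifies it.\<close>

lemma process_integral_comp_lim:
  fixes f :: "real \<Rightarrow> 'h"
  assumes ab: "0 \<le> a" "a \<le> b" "b \<le> T" and f: "left_continuous_on a b f"
    and sq: "sq_norm (interval_measure_on a b) f < \<infinity>"
  shows "comp_lim (kernel {k} (\<lambda>_ s. indicator {a<..b} s *\<^sub>R f s)) (process_integral M (Z k) a b f)"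
proof -
  let ?P = "\<lambda>X. \<exists>xs. (\<forall>n. \<forall>(c, d, x)\<in>set (xs n). a \<le> c \<and> c \<le> d \<and> d \<le> b) \<and>
      L2_tendsto (interval_measure_on a b) (\<lambda>n. step_fun (xs n)) f \<and>
      L2_tendsto M (\<lambda>n. step_integral (Z k) (xs n)) X"
  let ?f = "kernel {k} (\<lambda>_ s. indicator {a<..b} s *\<^sub>R f s)"
  have steps: "comp_lim (kernel {k} (\<lambda>_. step_fun (xs n))) (step_integral (Z k) (xs n))"
    if "\<forall>n. \<forall>(c, d, x)\<in>set (xs n). a \<le> c \<and> c \<le> d \<and> d \<le> b" for xs :: "nat \<Rightarrow> (real \<times> real \<times> 'h) list" and n
  proof (rule step_integral_comp_lim, clarify)
    fix c d x assume "(c, d, x) \<in> set (xs n)"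
    then have "a \<le> c \<and> c \<le> d" using that by blast
    then show "0 \<le> c \<and> c \<le> d" using ab by linarith
  qed
  obtain xs where xs: "\<forall>n. \<forall>(c, d, x)\<in>set (xs n). a \<le> c \<and> c \<le> d \<and> d \<le> b"
    "L2_tendsto (interval_measure_on a b) (\<lambda>n. step_fun (xs n)) f"
    using left_continuous_step_approx[OF f sq ab(2)] by blast
  have lim: "L2_tendsto \<mu> (\<lambda>n. kernel {k} (\<lambda>_. step_fun (xs n))) ?f"
    by (rule kernel_step_tendsto[OF ab(1,3) _ xs(2)]) (use xs(1) in blast)
  have "sq_integrable \<mu> ?f"
    by (rule L2_tendsto_sq_integrable[OF lim comp_lim_sq_integrable(1)[OF steps[OF xs(1)]]])
  then obtain X where X: "comp_lim ?f X" using comp_lim_exists by blast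
  have "L2_tendsto M (\<lambda>n. step_integral (Z k) (xs n)) X"
    by (rule comp_lim_L2_tendsto[OF steps[OF xs(1)] lim X])
  then have "?P X" using xs by blast
  then have "?P (process_integral M (Z k) a b f)"
    unfolding process_integral_def by (rule someI[where P="?P"])
  then obtain ys where ys: "\<forall>n. \<forall>(c, d, x)\<in>set (ys n). a \<le> c \<and> c \<le> d \<and> d \<le> b"
    "L2_tendsto (interval_measure_on a b) (\<lambda>n. step_fun (ys n)) f"
    "L2_tendsto M (\<lambda>n. step_integral (Z k) (ys n)) (process_integral M (Z k) a b f)"
    by blast
  have "L2_tendsto \<mu> (\<lambda>n. kernel {k} (\<lambda>_. step_fun (ys n))) ?f"
    by (rule kernel_step_tendsto[OF ab(1,3) _ ys(2)]) (use ys(1) in blast)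
  from comp_lim_closed[OF steps[OF ys(1)] this ys(3)] show ?thesis .
qed

subsection \<open>Operator valued integrands\<close>

text \<open>The squared Hilbert-Schmidt norm appears as a series in ennreal, so no convergence at
  individual times has to be known. Left continuity along basis vectors provides measurability and
  approximating steps.\<close>

definition admissible :: "(real \<Rightarrow> 'h \<Rightarrow> 'h) \<Rightarrow> bool" where
  "admissible \<Psi> \<longleftrightarrow> (\<forall>k. left_continuous_on 0 T (\<lambda>s. \<Psi> s (e k))) \<and>
     (\<integral>\<^sup>+s. (\<Sum>k. ennreal ((norm (\<Psi> s (e k)))\<^sup>2)) \<partial>time) < \<infinity>"

lemma admissible_measurable: "admissible \<Psi> \<Longrightarrow> (\<lambda>s. \<Psi> s (e k)) \<in> borel_measurable time"
  by (auto simp: admissible_def intro: left_continuous_on_measurable)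

lemma admissible_summable:
  assumes "admissible \<Psi>"
  shows "(\<Sum>k. sq_norm time (\<lambda>s. \<Psi> s (e k))) < \<infinity>" "sq_integrable time (\<lambda>s. \<Psi> s (e k))"
proof -
  note [measurable] = admissible_measurable[OF assms]
  have "(\<integral>\<^sup>+s. (\<Sum>k. ennreal ((norm (\<Psi> s (e k)))\<^sup>2)) \<partial>time) = (\<Sum>k. sq_norm time (\<lambda>s. \<Psi> s (e k)))"
    unfolding sq_norm_def by (rule nn_integral_suminf) measurable
  then show sum: "(\<Sum>k. sq_norm time (\<lambda>s. \<Psi> s (e k))) < \<infinity>"
    using assms by (simp add: admissible_def)
  have "sq_norm time (\<lambda>s. \<Psi> s (e k)) \<le> (\<Sum>k. sq_norm time (\<lambda>s. \<Psi> s (e k)))"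
    using sum_le_suminf[of "\<lambda>k. sq_norm time (\<lambda>s. \<Psi> s (e k))" "{k}"] by auto
  with sum show "sq_integrable time (\<lambda>s. \<Psi> s (e k))"
    by (auto simp: sq_integrable_def intro: le_less_trans)
qed

text \<open>The isometry turns tails of the kernel series into tails of a convergent numerical
  series, so completeness provides the limit that \<open>L2_lim\<close> selects.\<close>

lemma jump_kernel_tendsto:
  assumes \<Psi>: "admissible \<Psi>"
  shows "L2_tendsto \<mu> (\<lambda>n. kernel {..<n} (\<lambda>k s. \<Psi> s (e k))) (jump_kernel \<mu> rep e \<Psi>)"
proof -
  let ?k = "\<lambda>n. kernel {..<n} (\<lambda>k s. \<Psi> s (e k))"
  have eq: "(\<lambda>n (s, \<xi>, \<sigma>). \<Sum>k<n. (rep (e k) \<xi> * \<sigma>) *\<^sub>R \<Psi> s (e k)) = ?k"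
    by (auto simp: kernel_def fun_eq_iff)
  have m: "?k n \<in> borel_measurable \<mu>" for n
    by (intro kernel_measurable admissible_measurable[OF \<Psi>])
  let ?c = "\<lambda>k. sq_norm time (\<lambda>s. \<Psi> s (e k))"
  define r where "r k = enn2real (?c k)" for k
  have c: "?c k = ennreal (r k)" for k
    unfolding r_def using admissible_summable(2)[OF \<Psi>, of k] by (auto simp: sq_integrable_def)
  have r0: "0 \<le> r k" for k by (simp add: r_def)
  have "(\<Sum>k. ennreal (r k)) \<noteq> \<top>"
    using admissible_summable(1)[OF \<Psi>] unfolding c by auto
  then have r_sum: "summable r" by (rule summable_suminf_not_top[OF r0])
  have tail: "sq_norm \<mu> (\<lambda>z. ?k n z - ?k m z) = ennreal (m2 * sum r {m..<n})" if "m \<le> n" for m n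
  proof -
    have "?k n z - ?k m z = kernel {m..<n} (\<lambda>k s. \<Psi> s (e k)) z" for z
      unfolding kernel_def lessThan_atLeast0 by (rule sum_diff_nat_ivl) (use that in auto)
    then have "sq_norm \<mu> (\<lambda>z. ?k n z - ?k m z) = ennreal m2 * (\<Sum>k\<in>{m..<n}. ennreal (r k))"
      using sq_norm_kernel[of "{m..<n}" "\<lambda>k s. \<Psi> s (e k)"] admissible_measurable[OF \<Psi>] by (simp add: c)
    also have "\<dots> = ennreal (m2 * sum r {m..<n})"
    proof -
      have "0 \<le> m2" unfolding m2_def by simp
      then show ?thesis using r0 by (simp add: sum_ennreal ennreal_mult sum_nonneg)
    qed
    finally show ?thesis .
  qed
  have m20: "0 \<le> m2" unfolding m2_def by simp
  have "\<exists>X. L2_tendsto \<mu> ?k X"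
  proof (rule L2_complete[OF m])
    fix \<epsilon> :: real assume \<epsilon>: "0 < \<epsilon>"
    \<comment> \<open>The denominator \<open>m2 + 1\<close> remains positive when the second moment
      vanishes.\<close>
    obtain N where N: "\<And>m n. N \<le> m \<Longrightarrow> norm (sum r {m..<n}) < \<epsilon> / (m2 + 1)"
    proof -
      have "0 < \<epsilon> / (m2 + 1)" using \<epsilon> m20 by simp
      from r_sum[unfolded summable_Cauchy, rule_format, OF this] show ?thesis using that by blast
    qed
    have *: "sq_norm \<mu> (\<lambda>z. ?k n z - ?k m z) \<le> ennreal \<epsilon>" if "N \<le> m" "m \<le> n" for m n
    proof -
      have "sum r {m..<n} \<le> \<epsilon> / (m2 + 1)" using N[OF that(1), of n] by simp
      then have "m2 * sum r {m..<n} \<le> (m2 + 1) * (\<epsilon> / (m2 + 1))"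
        using m20 \<epsilon> r0 by (intro mult_mono) (auto intro: sum_nonneg)
      also have "\<dots> = \<epsilon>" using m20 by simp
      finally show ?thesis unfolding tail[OF that(2)] by (rule ennreal_leI)
    qed
    have "sq_norm \<mu> (\<lambda>z. ?k m z - ?k n z) \<le> ennreal \<epsilon>" if "N \<le> m" "N \<le> n" for m n
      using *[OF that(1), of n] *[OF that(2), of m] sq_norm_commute[of \<mu> "?k m" "?k n"]
      by (cases "m \<le> n") auto
    then show "\<exists>N. \<forall>m\<ge>N. \<forall>n\<ge>N. sq_norm \<mu> (\<lambda>z. ?k m z - ?k n z) \<le> ennreal \<epsilon>" by blast
  qed
  then obtain X where "L2_tendsto \<mu> ?k X" by blast
  then show ?thesis unfolding jump_kernel_def eq by (rule L2_lim_tendsto)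
qed

lemma jump_kernel_sq_integrable:
  assumes "admissible \<Psi>"
  shows "sq_integrable \<mu> (jump_kernel \<mu> rep e \<Psi>)"
  by (rule L2_tendsto_sq_integrable[OF jump_kernel_tendsto[OF assms]])
    (intro kernel_sq_integrable admissible_summable(2)[OF assms], simp)

lemma fst_in_sets: "A \<in> sets borel \<Longrightarrow> {z\<in>space \<mu>. fst z \<in> A} \<in> sets \<mu>"
  using measurable_sets[OF fst_measurable, of A] by (simp add: vimage_def Int_def conj_commute)

lemma indicator_kernel:
  "indicator A (fst z) *\<^sub>R kernel K f z = kernel K (\<lambda>k s. indicator A s *\<^sub>R f k s) z"
  by (simp add: kernel_def scaleR_sum_right mult.commute)

text \<open>Serves both the stochastic integral and the noise increments of the scheme, whose
  definitions are limits of partial sums of the same shape.\<close>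

lemma L2_lim_sum_comp_lim:
  fixes f :: "nat \<Rightarrow> real \<times> 'd \<times> real \<Rightarrow> 'h"
  assumes X: "\<And>k. comp_lim (f k) (X k)" and lim: "L2_tendsto \<mu> (\<lambda>n z. \<Sum>k<n. f k z) F"
  shows "comp_lim F (L2_lim M (\<lambda>n \<omega>. \<Sum>k<n. X k \<omega>))"
proof -
  have s: "comp_lim (\<lambda>z. \<Sum>k<n. f k z) (\<lambda>\<omega>. \<Sum>k<n. X k \<omega>)" for n
    by (rule comp_lim_sum[OF X])
  obtain Y where Y: "comp_lim F Y"
    using comp_lim_exists[OF L2_tendsto_sq_integrable[OF lim comp_lim_sq_integrable(1)[OF s]]] by blast
  have "L2_tendsto M (\<lambda>n \<omega>. \<Sum>k<n. X k \<omega>) Y" by (rule comp_lim_L2_tendsto[OF s lim Y])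
  from comp_lim_closed[OF s lim L2_lim_tendsto[OF this]] show ?thesis .
qed

lemma restricted_jump_kernel_tendsto:
  assumes \<Psi>: "admissible \<Psi>"
  shows "L2_tendsto \<mu> (\<lambda>n z. \<Sum>k<n. kernel {k} (\<lambda>_ s. indicator {a<..b} s *\<^sub>R \<Psi> s (e k)) z)
    (\<lambda>z. indicator {a<..b} (fst z) *\<^sub>R jump_kernel \<mu> rep e \<Psi> z)"
proof -
  have "L2_tendsto \<mu> (\<lambda>n z. indicator {a<..b} (fst z) *\<^sub>R kernel {..<n} (\<lambda>k s. \<Psi> s (e k)) z)
      (\<lambda>z. indicator {a<..b} (fst z) *\<^sub>R jump_kernel \<mu> rep e \<Psi> z)"
    by (rule L2_tendsto_indicator[OF jump_kernel_tendsto[OF \<Psi>] fst_in_sets]) simp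
  moreover have "indicator {a<..b} (fst z) *\<^sub>R kernel {..<n} (\<lambda>k s. \<Psi> s (e k)) z
      = (\<Sum>k<n. kernel {k} (\<lambda>_ s. indicator {a<..b} s *\<^sub>R \<Psi> s (e k)) z)" for n z
    unfolding indicator_kernel by (simp add: kernel_def)
  ultimately show ?thesis by simp
qed

lemma stoch_integral_comp_lim:
  assumes \<Psi>: "admissible \<Psi>" and ab: "0 \<le> a" "a \<le> b" "b \<le> T"
  shows "comp_lim (\<lambda>z. indicator {a<..b} (fst z) *\<^sub>R jump_kernel \<mu> rep e \<Psi> z) (stoch_integral M Z e a b \<Psi>)"
  unfolding stoch_integral_def
proof (rule L2_lim_sum_comp_lim[OF _ restricted_jump_kernel_tendsto[OF \<Psi>]])
  fix k
  show "comp_lim (kernel {k} (\<lambda>_ s. indicator {a<..b} s *\<^sub>R \<Psi> s (e k))) (process_integral M (Z k) a b (\<lambda>s. \<Psi> s (e k)))"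
  proof (rule process_integral_comp_lim[OF ab])
    show "left_continuous_on a b (\<lambda>s. \<Psi> s (e k))"
      using \<Psi> ab by (auto simp: admissible_def intro: left_continuous_on_subset)
    show "sq_norm (interval_measure_on a b) (\<lambda>s. \<Psi> s (e k)) < \<infinity>"
      using sq_norm_interval_mono[OF ab(1,3)] sq_integrableD(2)[OF admissible_summable(2)[OF \<Psi>]]
      by (rule le_less_trans)
  qed
qed

lemma increment_comp_lim:
  assumes L: "admissible (\<lambda>_. L)" and cd: "0 \<le> c" "c \<le> d"
  shows "comp_lim (\<lambda>z. indicator {c<..d} (fst z) *\<^sub>R jump_kernel \<mu> rep e (\<lambda>_. L) z)
    (L2_lim M (\<lambda>m \<omega>. \<Sum>j<m. (Z j d \<omega> - Z j c \<omega>) *\<^sub>R L (e j)))"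
proof (rule L2_lim_sum_comp_lim[OF _ restricted_jump_kernel_tendsto[OF L]])
  fix j
  have "comp_lim (kernel {j} (\<lambda>_. step_fun [(c, d, L (e j))])) (step_integral (Z j) [(c, d, L (e j))])"
    by (rule step_integral_comp_lim) (use cd in auto)
  then show "comp_lim (kernel {j} (\<lambda>_ s. indicator {c<..d} s *\<^sub>R L (e j))) (\<lambda>\<omega>. (Z j d \<omega> - Z j c \<omega>) *\<^sub>R L (e j))"
    unfolding step_fun_def[abs_def] step_integral_def[abs_def] by simp
qed

text \<open>Bounded operators and time indicators commute with the mean square limit that defines
  the kernel. A piecewise constant integrand thus acts on one fixed kernel, that of
  \<open>L\<close>, which links the scheme to a stochastic integral.\<close>

lemma jump_kernel_step:
  fixes Lk :: "nat \<Rightarrow> 'h \<Rightarrow> 'h"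
  assumes L: "admissible (\<lambda>_. L)" and Lk: "\<And>k. k < N \<Longrightarrow> bounded_linear (Lk k)"
    and \<Gamma>: "admissible \<Gamma>" and eq: "\<And>s j. \<Gamma> s (e j) = (\<Sum>k<N. indicator (A k) s *\<^sub>R Lk k (L (e j)))"
    and A: "\<And>k. A k \<in> sets borel"
  shows "AE z in \<mu>. jump_kernel \<mu> rep e \<Gamma> z = (\<Sum>k<N. indicator (A k) (fst z) *\<^sub>R Lk k (jump_kernel \<mu> rep e (\<lambda>_. L) z))"
proof (rule L2_tendsto_unique[OF jump_kernel_tendsto[OF \<Gamma>]])
  have "L2_tendsto \<mu> (\<lambda>n z. \<Sum>k<N. indicator (A k) (fst z) *\<^sub>R Lk k (kernel {..<n} (\<lambda>j s. L (e j)) z))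
      (\<lambda>z. \<Sum>k<N. indicator (A k) (fst z) *\<^sub>R Lk k (jump_kernel \<mu> rep e (\<lambda>_. L) z))"
  proof (rule L2_tendsto_sum[where Xn="\<lambda>n k z. indicator (A k) (fst z) *\<^sub>R Lk k (kernel {..<n} (\<lambda>j s. L (e j)) z)"])
    fix k assume "k \<in> {..<N}"
    then have "L2_tendsto \<mu> (\<lambda>n z. Lk k (kernel {..<n} (\<lambda>j s. L (e j)) z)) (\<lambda>z. Lk k (jump_kernel \<mu> rep e (\<lambda>_. L) z))"
      by (intro L2_tendsto_bounded_linear[OF Lk jump_kernel_tendsto[OF L]]) simp
    then show "L2_tendsto \<mu> (\<lambda>n z. indicator (A k) (fst z) *\<^sub>R Lk k (kernel {..<n} (\<lambda>j s. L (e j)) z))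
        (\<lambda>z. indicator (A k) (fst z) *\<^sub>R Lk k (jump_kernel \<mu> rep e (\<lambda>_. L) z))"
      by (rule L2_tendsto_indicator[OF _ fst_in_sets[OF A]])
  qed
  moreover have "(\<Sum>k<N. indicator (A k) (fst z) *\<^sub>R Lk k (kernel {..<n} (\<lambda>j s. L (e j)) z)) = kernel {..<n} (\<lambda>j s. \<Gamma> s (e j)) z" for n z
  proof -
    have "Lk k (kernel {..<n} (\<lambda>j s. L (e j)) z) = (\<Sum>j<n. (rep (e j) (fst (snd z)) * snd (snd z)) *\<^sub>R Lk k (L (e j)))" if "k < N" for k
    proof -
      interpret bounded_linear "Lk k" by (rule Lk[OF that])
      show ?thesis by (simp add: kernel_def sum scaleR)
    qed
    then have "(\<Sum>k<N. indicator (A k) (fst z) *\<^sub>R Lk k (kernel {..<n} (\<lambda>j s. L (e j)) z))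
        = (\<Sum>k<N. \<Sum>j<n. (rep (e j) (fst (snd z)) * snd (snd z)) *\<^sub>R (indicator (A k) (fst z) *\<^sub>R Lk k (L (e j))))"
      by (intro sum.cong refl) (simp add: scaleR_sum_right mult.commute)
    also have "\<dots> = (\<Sum>j<n. \<Sum>k<N. (rep (e j) (fst (snd z)) * snd (snd z)) *\<^sub>R (indicator (A k) (fst z) *\<^sub>R Lk k (L (e j))))"
      by (rule sum.swap)
    also have "\<dots> = kernel {..<n} (\<lambda>j s. \<Gamma> s (e j)) z"
      unfolding kernel_def eq by (simp only: scaleR_sum_right)
    finally show ?thesis .
  qed
  ultimately show "L2_tendsto \<mu> (\<lambda>n. kernel {..<n} (\<lambda>j s. \<Gamma> s (e j))) (\<lambda>z. \<Sum>k<N. indicator (A k) (fst z) *\<^sub>R Lk k (jump_kernel \<mu> rep e (\<lambda>_. L) z))"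
    by simp
qed

end

section \<open>Finite dimensional subspaces\<close>

text \<open>Operators on a subspace are total functions with arbitrary values outside it, so
  linearity makes sense only within \<open>V\<close>.\<close>

definition linear_within :: "'h::real_vector set \<Rightarrow> ('h \<Rightarrow> 'h) \<Rightarrow> bool" where
  "linear_within V f \<longleftrightarrow> f ` V \<subseteq> V \<and> (\<forall>x\<in>V. \<forall>y\<in>V. f (x + y) = f x + f y) \<and> (\<forall>c. \<forall>x\<in>V. f (c *\<^sub>R x) = c *\<^sub>R f x)"

lemma linear_withinD:
  assumes "linear_within V f"
  shows "x \<in> V \<Longrightarrow> f x \<in> V" "x \<in> V \<Longrightarrow> y \<in> V \<Longrightarrow> f (x + y) = f x + f y" "x \<in> V \<Longrightarrow> f (c *\<^sub>R x) = c *\<^sub>R f x"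
  using assms by (auto simp: linear_within_def)

lemma linear_within_comp:
  assumes "linear_within V f" "linear_within V g"
  shows "linear_within V (\<lambda>x. f (g x))"
  using assms by (auto simp: linear_within_def image_subset_iff)

lemma linear_within_power:
  assumes "linear_within V f"
  shows "linear_within V (f ^^ n)"
proof (induction n)
  case 0 then show ?case by (simp add: linear_within_def)
next
  case (Suc n) then show ?case using linear_within_comp[OF assms Suc] by (simp add: o_def)
qed

lemma linear_within_sum:
  assumes f: "linear_within V f" and V: "subspace V" and "finite I" "\<And>i. i \<in> I \<Longrightarrow> x i \<in> V"
  shows "f (\<Sum>i\<in>I. c i *\<^sub>R x i) = (\<Sum>i\<in>I. c i *\<^sub>R f (x i))"
  using assms(3,4)
proof (induction I rule: finite_induct)
  case empty
  have "f (0 *\<^sub>R 0) = 0 *\<^sub>R f 0" by (rule linear_withinD(3)[OF f subspace_0[OF V]])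
  then show ?case by simp
next
  case (insert i I)
  have "f (c i *\<^sub>R x i + (\<Sum>i\<in>I. c i *\<^sub>R x i)) = f (c i *\<^sub>R x i) + f (\<Sum>i\<in>I. c i *\<^sub>R x i)"
    using insert V by (intro linear_withinD(2)[OF f] subspace_sum subspace_scale) auto
  then show ?case using insert linear_withinD(3)[OF f] by simp
qed

locale orthonormal_span =
  fixes V C :: "'h::real_inner set"
  assumes fin: "finite C" and span_C: "span C = V"
    and orthonormal: "c \<in> C \<Longrightarrow> c' \<in> C \<Longrightarrow> c \<bullet> c' = (if c = c' then 1 else 0)"
begin

lemma subspace_V: "subspace V" using span_C subspace_span by metis

lemma C_subset: "C \<subseteq> V" using span_C span_superset by blast

definition proj :: "'h \<Rightarrow> 'h" where "proj x = (\<Sum>c\<in>C. (x \<bullet> c) *\<^sub>R c)"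

lemma proj_in: "proj x \<in> V"
  unfolding proj_def by (intro subspace_sum[OF subspace_V] subspace_scale[OF subspace_V]) (use C_subset in auto)

lemma coeff_inner: "c' \<in> C \<Longrightarrow> (\<Sum>c\<in>C. a c *\<^sub>R c) \<bullet> c' = a c'"
proof -
  assume c': "c' \<in> C"
  have "(\<Sum>c\<in>C. a c *\<^sub>R c) \<bullet> c' = (\<Sum>c\<in>C. if c = c' then a c else 0)"
    unfolding inner_sum_left using orthonormal c' by (intro sum.cong) auto
  then show ?thesis using c' fin by simp
qed

lemma orthogonal_on_V:
  assumes "\<And>c. c \<in> C \<Longrightarrow> x \<bullet> c = 0" "w \<in> V"
  shows "x \<bullet> w = 0"
proof -
  have "w \<in> span C" using assms(2) span_C by simp
  then show ?thesis
  proof (rule span_induct)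
    show "subspace {w. x \<bullet> w = 0}" by (auto simp: subspace_def inner_add_right)
  qed (rule assms(1))
qed

lemma proj_orthogonal: "w \<in> V \<Longrightarrow> (x - proj x) \<bullet> w = 0"
  by (rule orthogonal_on_V) (simp_all add: inner_diff_left proj_def coeff_inner)

lemma V_eqI: "v \<in> V \<Longrightarrow> v' \<in> V \<Longrightarrow> (\<And>w. w \<in> V \<Longrightarrow> v \<bullet> w = v' \<bullet> w) \<Longrightarrow> v = v'"
proof -
  assume v: "v \<in> V" "v' \<in> V" "\<And>w. w \<in> V \<Longrightarrow> v \<bullet> w = v' \<bullet> w"
  have "v - v' \<in> V" using v subspace_diff[OF subspace_V] by blast
  then have "(v - v') \<bullet> (v - v') = 0" using v(3)[of "v - v'"] by (simp only: inner_diff_left right_minus_eq)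
  then show ?thesis by simp
qed

lemma orth_proj_eq: "orth_proj V x = proj x"
  unfolding orth_proj_def
proof (rule the_equality)
  show "proj x \<in> V \<and> (\<forall>w\<in>V. (x - proj x) \<bullet> w = 0)" using proj_in proj_orthogonal by blast
  fix v assume v: "v \<in> V \<and> (\<forall>w\<in>V. (x - v) \<bullet> w = 0)"
  show "v = proj x"
  proof (rule V_eqI)
    fix w assume "w \<in> V"
    then have "(x - v) \<bullet> w = 0" "(x - proj x) \<bullet> w = 0" using v proj_orthogonal by auto
    then show "v \<bullet> w = proj x \<bullet> w" by (simp add: inner_diff_left)
  qed (use v proj_in in auto)
qed

lemma proj_id: "x \<in> V \<Longrightarrow> proj x = x"
  by (rule V_eqI[OF proj_in]) (use proj_orthogonal[of _ x] in \<open>auto simp: inner_diff_left\<close>)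

text \<open>Precomposition with the projection extends an operator on \<open>V\<close> to the whole
  space. In coordinates it is a finite sum of bounded functionals times vectors, hence
  bounded.\<close>

lemma bounded_linear_within_proj:
  assumes "linear_within V f"
  shows "bounded_linear (\<lambda>x. f (proj x))"
proof -
  have "f (proj x) = (\<Sum>c\<in>C. (x \<bullet> c) *\<^sub>R f c)" for x
    unfolding proj_def by (rule linear_within_sum[OF assms subspace_V fin]) (use C_subset in auto)
  then show ?thesis
    by (simp only: ) (intro bounded_linear_sum bounded_linear_scaleR_const bounded_linear_inner_left)
qed

lemma norm_proj_sq: "(norm (proj x))\<^sup>2 = (\<Sum>c\<in>C. (x \<bullet> c)\<^sup>2)"
proof -
  have "proj x \<bullet> proj x = (\<Sum>c\<in>C. proj x \<bullet> ((x \<bullet> c) *\<^sub>R c))"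
    by (subst (2) proj_def) (simp add: inner_sum_right)
  also have "\<dots> = (\<Sum>c\<in>C. (x \<bullet> c)\<^sup>2)"
    by (intro sum.cong refl) (simp add: proj_def coeff_inner power2_eq_square)
  finally show ?thesis by (simp add: power2_norm_eq_inner)
qed

text \<open>The image of an orthonormal basis under an injective endomorphism is independent of the same
  cardinality, hence spans.\<close>

lemma linear_within_inj_surj:
  assumes f: "linear_within V f" and inj: "inj_on f V"
  shows "f ` V = V"
proof
  show "f ` V \<subseteq> V" using f by (auto simp: linear_within_def)
  define g where "g x = f (proj x)" for x
  have lin: "linear g"
    unfolding g_def[abs_def] by (rule bounded_linear.linear[OF bounded_linear_within_proj[OF f]])
  have gf: "g x = f x" if "x \<in> V" for x using proj_id[OF that] by (simp add: g_def)
  have "0 \<notin> C"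
  proof
    assume "0 \<in> C" from orthonormal[OF this this] show False by simp
  qed
  then have indC: "independent C"
    by (intro pairwise_orthogonal_independent) (auto simp: pairwise_def orthogonal_def orthonormal)
  have injg: "inj_on g (span C)"
    unfolding span_C by (rule inj_onI) (use inj gf in \<open>simp add: inj_on_eq_iff\<close>)
  have ind: "independent (g ` C)"
    by (rule linear_independent_injective_image[OF lin indC injg])
  have card: "card (g ` C) = card C"
    by (rule card_image[OF inj_on_subset[OF injg span_superset]])
  have gC: "g ` C \<subseteq> V" by (intro image_subsetI) (simp add: g_def linear_withinD(1)[OF f proj_in])
  show "V \<subseteq> f ` V"
  proof
    fix y assume y: "y \<in> V"
    have "y \<in> span (g ` C)"
    proof (rule ccontr)
      assume n: "y \<notin> span (g ` C)"
      then have "independent (insert y (g ` C))" using ind by (rule independent_insertI)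
      from independent_span_bound[OF fin this] have "card (insert y (g ` C)) \<le> card C"
        unfolding span_C using y gC by blast
      moreover have "y \<notin> g ` C" using n span_base[of y "g ` C"] by (rule contrapos_nn)
      then have "card (insert y (g ` C)) = Suc (card (g ` C))"
        by (rule card_insert_disjoint[OF finite_imageI[OF fin]])
      ultimately show False unfolding card by linarith
    qed
    then obtain x where "x \<in> V" "y = g x" unfolding linear_span_image[OF lin] span_C by blast
    then show "y \<in> f ` V" using gf[of x] by blast
  qed
qed

lemma linear_within_inv_into:
  assumes f: "linear_within V f" and inj: "inj_on f V"
  shows "linear_within V (inv_into V f)"
proof -
  note surj = linear_within_inj_surj[OF assms]
  let ?g = "inv_into V f"
  have g: "?g y \<in> V" "f (?g y) = y" if "y \<in> V" for y
    using inv_into_into[of y f V] f_inv_into_f[of y f V] that unfolding surj by blast+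
  have gI: "?g y = x" if "x \<in> V" "f x = y" for x y
    using inv_into_f_f[OF inj that(1)] that(2) by simp
  show ?thesis
    unfolding linear_within_def
  proof (intro conjI ballI allI)
    show "?g ` V \<subseteq> V" using g(1) by blast
    fix x assume x: "x \<in> V"
    show "?g (c *\<^sub>R x) = c *\<^sub>R ?g x" for c
      using linear_withinD(3)[OF f g(1)[OF x], of c]
      by (intro gI subspace_scale[OF subspace_V] g x) (simp add: g(2)[OF x])
    fix y assume y: "y \<in> V"
    show "?g (x + y) = ?g x + ?g y"
      using linear_withinD(2)[OF f g(1)[OF x] g(1)[OF y]]
      by (intro gI subspace_add[OF subspace_V] g x y) (simp add: g(2)[OF x] g(2)[OF y])
  qed
qed

lemma discrete_op:
  assumes R: "\<And>x y. x \<in> V \<Longrightarrow> y \<in> V \<Longrightarrow> R (x + y) = R x + R y" "\<And>c x. x \<in> V \<Longrightarrow> R (c *\<^sub>R x) = c *\<^sub>R R x"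
  shows "linear_within V (discrete_op R V)" "u \<in> V \<Longrightarrow> w \<in> V \<Longrightarrow> discrete_op R V u \<bullet> w = R u \<bullet> R w"
proof -
  have spec: "discrete_op R V u \<in> V \<and> (\<forall>w\<in>V. discrete_op R V u \<bullet> w = R u \<bullet> R w)" for u
    unfolding discrete_op_def
  proof (rule theI')
    \<comment> \<open>The Riesz representative of the form
      \<open>w \<mapsto> R u \<bullet> R w\<close>, written in orthonormal coordinates.\<close>
    let ?y = "\<Sum>c\<in>C. (R u \<bullet> R c) *\<^sub>R c"
    have yV: "?y \<in> V"
      by (intro subspace_sum[OF subspace_V] subspace_scale[OF subspace_V]) (use C_subset in auto)
    have yw: "?y \<bullet> w = R u \<bullet> R w" if "w \<in> V" for w
    proof -
      have "w \<in> span C" using that span_C by simp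
      then have "w \<in> V \<and> ?y \<bullet> w = R u \<bullet> R w"
      proof (rule span_induct_alt)
        have "R (0 *\<^sub>R 0) = 0 *\<^sub>R R 0" by (rule R(2)[OF subspace_0[OF subspace_V]])
        then show "0 \<in> V \<and> ?y \<bullet> 0 = R u \<bullet> R 0" using subspace_0[OF subspace_V] by simp
        fix a x y assume x: "x \<in> C" and y: "y \<in> V \<and> ?y \<bullet> y = R u \<bullet> R y"
        have xV: "x \<in> V" "a *\<^sub>R x \<in> V" using x C_subset subspace_scale[OF subspace_V] by auto
        have "?y \<bullet> (a *\<^sub>R x + y) = a * (R u \<bullet> R x) + R u \<bullet> R y"
          using coeff_inner[OF x, of "\<lambda>c. R u \<bullet> R c"] y by (simp add: inner_add_right)
        also have "\<dots> = R u \<bullet> R (a *\<^sub>R x + y)"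
          using R(1)[OF xV(2), of y] R(2)[OF xV(1), of a] y by (simp add: inner_add_right)
        finally show "a *\<^sub>R x + y \<in> V \<and> ?y \<bullet> (a *\<^sub>R x + y) = R u \<bullet> R (a *\<^sub>R x + y)"
          using xV y subspace_add[OF subspace_V] by blast
      qed
      then show ?thesis by blast
    qed
    show "\<exists>!y. y \<in> V \<and> (\<forall>w\<in>V. y \<bullet> w = R u \<bullet> R w)"
    proof (rule ex1I[of _ ?y])
      show "?y \<in> V \<and> (\<forall>w\<in>V. ?y \<bullet> w = R u \<bullet> R w)" using yV yw by blast
      show "y = ?y" if "y \<in> V \<and> (\<forall>w\<in>V. y \<bullet> w = R u \<bullet> R w)" for y
        by (rule V_eqI) (use that yV yw in auto)
    qed
  qed
  then have spec': "discrete_op R V u \<bullet> w = R u \<bullet> R w" if "w \<in> V" for u w using that by blast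
  then show "u \<in> V \<Longrightarrow> w \<in> V \<Longrightarrow> discrete_op R V u \<bullet> w = R u \<bullet> R w" .
  show "linear_within V (discrete_op R V)"
    unfolding linear_within_def
  proof (intro conjI ballI allI)
    show "discrete_op R V ` V \<subseteq> V" using spec by auto
    fix x assume x: "x \<in> V"
    show "discrete_op R V (c *\<^sub>R x) = c *\<^sub>R discrete_op R V x" for c
    proof (rule V_eqI)
      show "discrete_op R V (c *\<^sub>R x) \<in> V" "c *\<^sub>R discrete_op R V x \<in> V"
        using spec subspace_scale[OF subspace_V] by blast+
      fix w assume w: "w \<in> V"
      show "discrete_op R V (c *\<^sub>R x) \<bullet> w = (c *\<^sub>R discrete_op R V x) \<bullet> w"
        unfolding inner_scaleR_left spec'[OF w] R(2)[OF x] ..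
    qed
    fix y assume y: "y \<in> V"
    show "discrete_op R V (x + y) = discrete_op R V x + discrete_op R V y"
    proof (rule V_eqI)
      show "discrete_op R V (x + y) \<in> V" "discrete_op R V x + discrete_op R V y \<in> V"
        using spec subspace_add[OF subspace_V] by blast+
      fix w assume w: "w \<in> V"
      show "discrete_op R V (x + y) \<bullet> w = (discrete_op R V x + discrete_op R V y) \<bullet> w"
        unfolding inner_add_left spec'[OF w] R(1)[OF x y] ..
    qed
  qed
qed

text \<open>Injectivity of \<open>I + \<theta> * \<tau> * A\<close> comes from positivity: pairing
  its value at \<open>d\<close> with \<open>d\<close> gives the squared norm of \<open>d\<close>
  plus a nonnegative term. Finite dimension turns injectivity into invertibility.\<close>

lemma theta_scheme:
  assumes R: "\<And>x y. x \<in> V \<Longrightarrow> y \<in> V \<Longrightarrow> R (x + y) = R x + R y" "\<And>c x. x \<in> V \<Longrightarrow> R (c *\<^sub>R x) = c *\<^sub>R R x"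
    and pos: "0 \<le> \<theta> * \<tau>"
  shows "linear_within V (theta_T (discrete_op R V) V \<theta> \<tau>)" "linear_within V (theta_S (discrete_op R V) V \<theta> \<tau>)"
proof -
  let ?A = "discrete_op R V"
  have A1: "linear_within V ?A" by (rule discrete_op(1)) (fact R)+
  have A2: "?A u \<bullet> w = R u \<bullet> R w" if "u \<in> V" "w \<in> V" for u w
    by (rule discrete_op(2)) (fact R that)+
  note A = A1 A2
  have shift: "linear_within V (\<lambda>u. u + a *\<^sub>R ?A u)" for a
    unfolding linear_within_def
  proof (intro conjI ballI allI image_subsetI)
    fix x assume x: "x \<in> V"
    show "x + a *\<^sub>R ?A x \<in> V"
      by (intro subspace_add[OF subspace_V] subspace_scale[OF subspace_V] x linear_withinD(1)[OF A(1)])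
    show "c *\<^sub>R x + a *\<^sub>R ?A (c *\<^sub>R x) = c *\<^sub>R (x + a *\<^sub>R ?A x)" for c
      unfolding linear_withinD(3)[OF A(1) x] scaleR_add_right by (simp only: scaleR_scaleR mult.commute)
    fix y assume y: "y \<in> V"
    show "x + y + a *\<^sub>R ?A (x + y) = x + a *\<^sub>R ?A x + (y + a *\<^sub>R ?A y)"
      unfolding linear_withinD(2)[OF A(1) x y] scaleR_add_right by (simp only: ac_simps)
  qed
  have inj: "inj_on (\<lambda>u. u + (\<theta> * \<tau>) *\<^sub>R ?A u) V"
  proof (rule inj_onI)
    fix x y assume xy: "x \<in> V" "y \<in> V" and eq: "x + (\<theta> * \<tau>) *\<^sub>R ?A x = y + (\<theta> * \<tau>) *\<^sub>R ?A y"
    \<comment> \<open>The difference is written with addition and scaling because these are the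
      operations for which \<open>linear_within\<close> gives rules.\<close>
    let ?d = "x + (-1) *\<^sub>R y"
    have d: "?d \<in> V" using xy subspace_add[OF subspace_V] subspace_scale[OF subspace_V] by blast
    have "?A ?d = ?A x + ?A ((-1) *\<^sub>R y)"
      by (rule linear_withinD(2)[OF A(1) xy(1) subspace_scale[OF subspace_V xy(2)]])
    then have Ad: "?A ?d = ?A x - ?A y"
      using linear_withinD(3)[OF A(1) xy(2), of "-1"] by simp
    have "?d + (\<theta> * \<tau>) *\<^sub>R ?A ?d = (x + (\<theta> * \<tau>) *\<^sub>R ?A x) - (y + (\<theta> * \<tau>) *\<^sub>R ?A y)"
      unfolding Ad scaleR_diff_right by simp
    also have "\<dots> = 0" unfolding eq by (rule diff_self)
    finally have "?d + (\<theta> * \<tau>) *\<^sub>R ?A ?d = 0" .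
    then have "(?d + (\<theta> * \<tau>) *\<^sub>R ?A ?d) \<bullet> ?d = 0" by simp
    then have "?d \<bullet> ?d + (\<theta> * \<tau>) * (R ?d \<bullet> R ?d) = 0"
      unfolding inner_add_left inner_scaleR_left A(2)[OF d d] .
    moreover have "0 \<le> (\<theta> * \<tau>) * (R ?d \<bullet> R ?d)" by (rule mult_nonneg_nonneg[OF pos inner_ge_zero])
    ultimately have "?d \<bullet> ?d \<le> 0" by linarith
    with inner_ge_zero[of ?d] have "?d \<bullet> ?d = 0" by (rule antisym[rotated])
    then have "?d = 0" by (simp only: inner_eq_zero_iff)
    then have "x - y = 0" by simp
    then show "x = y" by (simp only: right_minus_eq)
  qed
  show T: "linear_within V (theta_T ?A V \<theta> \<tau>)"
    unfolding theta_T_def by (rule linear_within_inv_into[OF shift[of "\<theta> * \<tau>"] inj])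
  have "linear_within V (\<lambda>u. u - ((1 - \<theta>) * \<tau>) *\<^sub>R ?A u)"
    using shift[of "- ((1 - \<theta>) * \<tau>)"] unfolding scaleR_minus_left add_uminus_conv_diff .
  from linear_within_comp[OF T this] show "linear_within V (theta_S ?A V \<theta> \<tau>)"
    unfolding theta_S_def[abs_def] .
qed

end

text \<open>Gram-Schmidt, with the zero vector removed before normalizing.\<close>

lemma finite_dim_orthonormal_span:
  fixes V :: "'h::real_inner set"
  assumes "finite_dim_subspace V"
  shows "\<exists>C. orthonormal_span V C"
proof -
  obtain B where B: "finite B" "V = span B" using assms by (auto simp: finite_dim_subspace_def)
  obtain C where C: "finite C" "span C = span B" "pairwise orthogonal C"
    using basis_orthogonal[OF B(1)] by blast
  let ?D = "(\<lambda>x. x /\<^sub>R norm x) ` (C - {0})"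
  have "span ?D = span (C - {0})"
    by (rule span_image_scale) (use C in auto)
  then have "span ?D = V" using C(2) B(2) by (simp add: span_delete_0)
  moreover have "c \<bullet> c' = (if c = c' then 1 else 0)" if "c \<in> ?D" "c' \<in> ?D" for c c'
  proof -
    obtain x y where xy: "x \<in> C" "x \<noteq> 0" "c = x /\<^sub>R norm x" "y \<in> C" "y \<noteq> 0" "c' = y /\<^sub>R norm y"
      using \<open>c \<in> ?D\<close> \<open>c' \<in> ?D\<close> by auto
    show ?thesis
    proof (cases "x = y")
      case True
      then have "c \<bullet> c' = 1"
        using xy by (simp add: power2_norm_eq_inner[symmetric] power2_eq_square field_simps)
      then show ?thesis using True xy by simp
    next
      case False
      then have "x \<bullet> y = 0" using C(3) xy by (auto simp: pairwise_def orthogonal_def)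
      then have "c \<bullet> c' = 0" using xy by simp
      moreover have "c \<noteq> c'"
      proof
        assume "c = c'"
        then have "c \<bullet> c = 0" using \<open>c \<bullet> c' = 0\<close> by simp
        then show False using xy by simp
      qed
      ultimately show ?thesis by simp
    qed
  qed
  ultimately have "orthonormal_span V ?D" using C(1) by unfold_locales auto
  then show ?thesis by blast
qed

section \<open>Strongly continuous semigroups\<close>

lemma C0_semigroup_onD:
  assumes "C0_semigroup_on V S"
  shows C0_semigroup_linear: "0 \<le> t \<Longrightarrow> linear_within V (S t)"
    and C0_semigroup_bounded: "0 \<le> t \<Longrightarrow> \<exists>C. \<forall>x\<in>V. norm (S t x) \<le> C * norm x"
    and C0_semigroup_0: "x \<in> V \<Longrightarrow> S 0 x = x"
    and C0_semigroup_add: "0 \<le> s \<Longrightarrow> 0 \<le> t \<Longrightarrow> x \<in> V \<Longrightarrow> S (s + t) x = S s (S t x)"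
    and C0_semigroup_tendsto: "x \<in> V \<Longrightarrow> ((\<lambda>t. S t x) \<longlongrightarrow> x) (at_right 0)"
  using assms by (simp_all add: C0_semigroup_on_def linear_within_def)

text \<open>For \<open>r < s\<close> the orbit factors as \<open>S (T - s) (S (s - r) y)\<close>.
  Boundedness of the single operator \<open>S (T - s)\<close> and right continuity at 0 therefore
  suffice, without a bound uniform in time.\<close>

lemma semigroup_left_continuous:
  assumes S: "C0_semigroup_on V S" and V: "subspace V" and y: "y \<in> V"
  shows "left_continuous_on 0 T (\<lambda>s. S (T - s) y)"
  unfolding left_continuous_on_def
proof
  fix s assume s: "s \<in> {0<..T}"
  have t: "0 \<le> T - s" using s by simp
  have lin: "S (T - s) (a + b) = S (T - s) a + S (T - s) b" "S (T - s) (c *\<^sub>R a) = c *\<^sub>R S (T - s) a" if "a \<in> V" "b \<in> V" for a b c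
    using linear_withinD(2,3)[OF C0_semigroup_linear[OF S t]] that by simp_all
  obtain K where K: "\<And>x. x \<in> V \<Longrightarrow> norm (S (T - s) x) \<le> K * norm x"
    using C0_semigroup_bounded[OF S t] by blast
  note lim = C0_semigroup_tendsto[OF S y]
  have "filterlim (\<lambda>r. s - r) (at_right 0) (at_left s)"
    unfolding filterlim_at
  proof
    show "\<forall>\<^sub>F r in at_left s. s - r \<in> {0<..} \<and> s - r \<noteq> 0"
      unfolding eventually_at_left_field by (intro exI[of _ "s - 1"]) auto
    have "((\<lambda>r. s - r) \<longlongrightarrow> s - s) (at_left s)" by (intro tendsto_intros)
    then show "((\<lambda>r. s - r) \<longlongrightarrow> 0) (at_left s)" by simp
  qed
  from filterlim_compose[OF lim this] have lim': "((\<lambda>r. S (s - r) y) \<longlongrightarrow> y) (at_left s)" .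
  have "((\<lambda>r. S (T - r) y - S (T - s) y) \<longlongrightarrow> 0) (at_left s)"
  proof (rule Lim_null_comparison)
    have "((\<lambda>r. K * norm (S (s - r) y - y)) \<longlongrightarrow> K * norm (y - y)) (at_left s)" by (intro tendsto_intros lim')
    then show "((\<lambda>r. K * norm (S (s - r) y - y)) \<longlongrightarrow> 0) (at_left s)" by simp
    have "\<forall>\<^sub>F r in at_left s. r < s" by (simp add: eventually_at_filter)
    then show "\<forall>\<^sub>F r in at_left s. norm (S (T - r) y - S (T - s) y) \<le> K * norm (S (s - r) y - y)"
    proof eventually_elim
      case (elim r)
      have sr: "0 \<le> s - r" using elim by simp
      have z: "S (s - r) y \<in> V" by (rule linear_withinD(1)[OF C0_semigroup_linear[OF S sr] y])
      have "S (T - r) y = S ((T - s) + (s - r)) y" by simp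
      also have "\<dots> = S (T - s) (S (s - r) y)"
        by (rule C0_semigroup_add[OF S t sr y])
      finally have "S (T - r) y - S (T - s) y = S (T - s) (S (s - r) y + (-1) *\<^sub>R y)"
        using lin(1)[OF z subspace_scale[OF V y, of "-1"]] lin(2)[OF y y, of "-1"] by simp
      also have "norm \<dots> \<le> K * norm (S (s - r) y + (-1) *\<^sub>R y)"
        by (intro K subspace_add[OF V z] subspace_scale[OF V y])
      finally show ?case by simp
    qed
  qed
  then show "((\<lambda>s. S (T - s) y) \<longlongrightarrow> S (T - s) y) (at_left s)" by (rule LIM_zero_cancel)
qed

context orthonormal_span
begin

text \<open>Finite dimension replaces the uniform boundedness principle: continuity at 0 bounds
  finitely many basis vectors on a short interval, and the semigroup law propagates the
  bound.\<close>

lemma semigroup_bounded: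
  assumes S: "C0_semigroup_on V S"
  shows "\<exists>K\<ge>0. \<forall>t\<in>{0..T}. \<forall>x\<in>V. norm (S t x) \<le> K * norm x"
proof -
  note lin = C0_semigroup_linear[OF S]
  have "\<exists>\<delta>>0. \<forall>t. 0 < t \<and> t < \<delta> \<longrightarrow> (\<forall>c\<in>C. norm (S t c) \<le> 2)"
  proof -
    have "\<forall>\<^sub>F t in at_right 0. norm (S t c) \<le> 2" if c: "c \<in> C" for c
    proof -
      have "((\<lambda>t. norm (S t c)) \<longlongrightarrow> norm c) (at_right 0)"
        using C_subset c by (intro tendsto_norm C0_semigroup_tendsto[OF S]) auto
      moreover have "norm c < 2" using orthonormal[OF c c] by (simp add: norm_eq_sqrt_inner)
      ultimately have "\<forall>\<^sub>F t in at_right 0. norm (S t c) < 2" by (rule order_tendstoD)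
      then show ?thesis by eventually_elim simp
    qed
    then have "\<forall>\<^sub>F t in at_right 0. \<forall>c\<in>C. norm (S t c) \<le> 2"
      using fin by (simp add: eventually_ball_finite)
    then show ?thesis unfolding eventually_at_right_field by auto
  qed
  then obtain \<delta> where \<delta>: "0 < \<delta>" "\<And>t c. 0 < t \<Longrightarrow> t < \<delta> \<Longrightarrow> c \<in> C \<Longrightarrow> norm (S t c) \<le> 2" by blast
  \<comment> \<open>Each of the basis vectors contributes at most 2 on the short interval; the
    maximum with 1 covers \<open>t = 0\<close> and makes the powers of \<open>K0\<close>
    increase.\<close>
  define K0 where "K0 = max 1 (2 * real (card C))"
  have K0: "1 \<le> K0" by (simp add: K0_def)
  have short: "norm (S t x) \<le> K0 * norm x" if t: "0 \<le> t" "t < \<delta>" and x: "x \<in> V" for t x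
  proof (cases "t = 0")
    case True
    then have "S t x = x" using C0_semigroup_0[OF S x] by simp
    then show ?thesis using mult_right_mono[OF K0, of "norm x"] by simp
  next
    case False
    have "x = (\<Sum>c\<in>C. (x \<bullet> c) *\<^sub>R c)" using proj_id[OF x] by (simp add: proj_def)
    then have "S t x = (\<Sum>c\<in>C. (x \<bullet> c) *\<^sub>R S t c)"
      using linear_within_sum[OF lin[OF t(1)] subspace_V fin, of "\<lambda>c. c" "\<lambda>c. x \<bullet> c"] C_subset by auto
    then have "norm (S t x) \<le> (\<Sum>c\<in>C. norm ((x \<bullet> c) *\<^sub>R S t c))" by (simp only: norm_sum)
    also have "\<dots> \<le> (\<Sum>c\<in>C. norm x * 2)"
    proof (rule sum_mono)
      fix c assume c: "c \<in> C"
      have "\<bar>x \<bullet> c\<bar> \<le> norm x * norm c" by (rule Cauchy_Schwarz_ineq2)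
      also have "norm c = 1" using orthonormal[OF c c] by (simp add: norm_eq_sqrt_inner)
      finally show "norm ((x \<bullet> c) *\<^sub>R S t c) \<le> norm x * 2"
        using \<delta>(2)[of t c] t False c by (simp add: mult_mono)
    qed
    also have "\<dots> = (2 * real (card C)) * norm x" by simp
    also have "\<dots> \<le> K0 * norm x" by (intro mult_right_mono) (simp_all add: K0_def)
    finally show ?thesis .
  qed
  \<comment> \<open>Steps of length \<open>\<delta> / 2\<close> stay strictly inside the interval on
    which \<open>short\<close> holds.\<close>
  have long: "norm (S t x) \<le> K0 ^ Suc n * norm x" if "0 \<le> t" "t \<le> real n * (\<delta> / 2)" "x \<in> V" for t x n
    using that
  proof (induction n arbitrary: t)
    case 0
    then show ?case using short[of t x] \<delta>(1) by simp
  next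
    case (Suc n)
    show ?case
    proof (cases "t \<le> \<delta> / 2")
      case True
      have "norm (S t x) \<le> K0 * norm x" using Suc True \<delta>(1) by (intro short) auto
      also have "\<dots> \<le> K0 ^ Suc (Suc n) * norm x"
        using K0 power_increasing[of 1 "Suc (Suc n)" K0] by (intro mult_right_mono) auto
      finally show ?thesis .
    next
      case False
      let ?t = "t - \<delta> / 2"
      have t: "0 \<le> ?t" "?t \<le> real n * (\<delta> / 2)" using False Suc by (auto simp: algebra_simps)
      have z: "S ?t x \<in> V" using linear_withinD(1)[OF lin[OF t(1)] Suc(4)] .
      have "S t x = S (\<delta> / 2 + ?t) x" by simp
      also have "\<dots> = S (\<delta> / 2) (S ?t x)"
        by (rule C0_semigroup_add[OF S _ t(1) Suc(4)]) (use \<delta>(1) in simp)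
      finally have "norm (S t x) = norm (S (\<delta> / 2) (S ?t x))" by simp
      also have "\<dots> \<le> K0 * norm (S ?t x)" using \<delta>(1) z by (intro short) auto
      also have "\<dots> \<le> K0 * (K0 ^ Suc n * norm x)"
        using K0 Suc.IH[OF t Suc(4)] by (intro mult_left_mono) auto
      finally show ?thesis by (simp add: mult.assoc)
    qed
  qed
  have "0 < \<delta> / 2" using \<delta>(1) by simp
  then obtain n where "T < real n * (\<delta> / 2)" using reals_Archimedean3 by blast
  then have n: "t \<le> real n * (\<delta> / 2)" if "t \<le> T" for t using that by linarith
  have "\<forall>t\<in>{0..T}. \<forall>x\<in>V. norm (S t x) \<le> K0 ^ Suc n * norm x"
  proof (intro ballI)
    fix t x assume "t \<in> {0..T}" "x \<in> V"
    then show "norm (S t x) \<le> K0 ^ Suc n * norm x" using long[OF _ n, of t x] by simp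
  qed
  moreover have "0 \<le> K0 ^ Suc n" using K0 by (intro zero_le_power) linarith
  ultimately show ?thesis by blast
qed

end

text \<open>By the mean value inequality, a bound on the Hessian in operator norm is a Lipschitz
  constant of the gradient.\<close>

lemma C2_b_C11_function:
  fixes \<phi> :: "'h::{real_inner,banach,second_countable_topology} \<Rightarrow> real"
  assumes "C2_b \<phi>"
  obtains B K C where "C11_function \<phi> (grad \<phi>) B K C"
proof -
  have g: "GDERIV \<phi> x :> grad \<phi> x" and d: "(grad \<phi> has_derivative hess \<phi> x) (at x)" for x
    using assms unfolding C2_b_def hess_def by (simp_all flip: frechet_derivative_works)
  obtain B where B: "\<And>x. norm (\<phi> x) \<le> B"
    using assms unfolding C2_b_def bounded_iff by auto
  obtain K where K: "\<And>x. norm (grad \<phi> x) \<le> K"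
    using assms unfolding C2_b_def bounded_iff by auto
  obtain C where C: "\<And>x. norm (Blinfun (hess \<phi> x)) \<le> C"
    using assms unfolding C2_b_def bounded_iff by auto
  have on: "onorm (hess \<phi> x) \<le> C" for x
    using C[of x] has_derivative_bounded_linear[OF d[of x]]
    by (simp add: norm_blinfun.rep_eq bounded_linear_Blinfun_apply)
  have "C11_function \<phi> (grad \<phi>) B K C"
  proof
    show "norm (grad \<phi> x - grad \<phi> y) \<le> C * norm (x - y)" for x y
      by (rule differentiable_bound[of UNIV, OF convex_UNIV d on]) auto
    show "0 \<le> C" using C[of 0] norm_ge_zero order_trans by blast
  qed (use B K g in auto)
  then show ?thesis by (rule that)
qed

lemma (in orthonormal_span) norm_proj_le: "norm (proj x) \<le> norm x"
proof -
  have "(x - proj x) \<bullet> proj x = 0" by (rule proj_orthogonal[OF proj_in])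
  then have "norm (proj x) * norm (proj x) = x \<bullet> proj x"
    by (simp add: inner_diff_left power2_norm_eq_inner flip: power2_eq_square)
  also have "\<dots> \<le> norm x * norm (proj x)" by (rule norm_cauchy_schwarz)
  finally show ?thesis by (cases "proj x = 0") auto
qed

lemma left_continuous_on_indicator:
  fixes c d :: real
  shows "left_continuous_on a b (\<lambda>s. indicator {c<..d} s :: real)"
  unfolding left_continuous_on_def
proof
  fix s :: real
  have "\<forall>\<^sub>F r in at_left s. indicator {c<..d} r = (indicator {c<..d} s :: real)"
  proof (cases "s \<in> {c<..d}")
    case True
    have "\<forall>\<^sub>F r in at_left s. r \<in> {c<..<s}" by (rule eventually_at_leftI[of c]) (use True in auto)
    then show ?thesis by eventually_elim (use True in auto)
  next
    case False
    show ?thesis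
    proof (cases "s \<le> c")
      case True
      have "\<forall>\<^sub>F r in at_left s. r \<in> {s - 1<..<s}" by (rule eventually_at_leftI[of "s - 1"]) auto
      then show ?thesis by eventually_elim (use True in auto)
    next
      case False
      then have "d < s" using \<open>s \<notin> {c<..d}\<close> by auto
      then have "\<forall>\<^sub>F r in at_left s. r \<in> {d<..<s}" by (intro eventually_at_leftI[of d]) auto
      then show ?thesis by eventually_elim (use \<open>d < s\<close> in auto)
    qed
  qed
  then show "((\<lambda>s. indicator {c<..d} s :: real) \<longlongrightarrow> indicator {c<..d} s) (at_left s)"
    by (rule tendsto_eventually)
qed

section \<open>Admissibility of the semigroup integrands\<close>

context impulsive_noise
begin

text \<open>Each partial sum is the squared norm of the projection onto the span of finitely many
  basis vectors, which cannot exceed that of \<open>y\<close>.\<close>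

lemma bessel: "(\<Sum>k. ennreal ((e k \<bullet> y)\<^sup>2)) \<le> ennreal ((norm y)\<^sup>2)"
  unfolding suminf_eq_SUP
proof (rule SUP_least)
  fix n :: nat
  have inj: "inj_on e {..<n}"
  proof (rule inj_onI)
    fix i j assume "e i = e j"
    then have "e i \<bullet> e i = e i \<bullet> e j" by simp
    then show "i = j" unfolding inner_basis by (simp split: if_splits)
  qed
  interpret orthonormal_span "span (e ` {..<n})" "e ` {..<n}"
    by unfold_locales (auto simp: inner_basis)
  have "(\<Sum>k<n. (e k \<bullet> y)\<^sup>2) = (norm (proj y))\<^sup>2"
    unfolding norm_proj_sq sum.reindex[OF inj] by (simp add: inner_commute)
  also have "\<dots> \<le> (norm y)\<^sup>2" by (intro power_mono norm_proj_le) simp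
  finally show "(\<Sum>k<n. ennreal ((e k \<bullet> y)\<^sup>2)) \<le> ennreal ((norm y)\<^sup>2)"
    by (simp add: sum_ennreal ennreal_leI)
qed

text \<open>A symmetric operator followed by a projection of finite rank is Hilbert-Schmidt: by symmetry
  the sum over the basis is a finite sum of the expressions in Bessel's inequality.\<close>

lemma proj_summable:
  assumes "orthonormal_span V C" and R: "\<And>x y. R x \<bullet> y = x \<bullet> R y"
  shows "(\<Sum>k. ennreal ((norm (orth_proj V (R (e k))))\<^sup>2)) < \<infinity>"
proof -
  interpret orthonormal_span V C by fact
  have "(\<Sum>k. ennreal ((norm (orth_proj V (R (e k))))\<^sup>2)) = (\<Sum>k. \<Sum>c\<in>C. ennreal ((e k \<bullet> R c)\<^sup>2))"
    unfolding orth_proj_eq norm_proj_sq R by (simp add: sum_ennreal)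
  also have "\<dots> = (\<Sum>c\<in>C. \<Sum>k. ennreal ((e k \<bullet> R c)\<^sup>2))"
    by (rule suminf_sum) auto
  also have "\<dots> \<le> (\<Sum>c\<in>C. ennreal ((norm (R c))\<^sup>2))"
    by (rule sum_mono) (rule bessel)
  also have "\<dots> < \<infinity>" by (simp add: sum_ennreal)
  finally show ?thesis .
qed

lemma admissible_bounded:
  assumes "\<And>k. left_continuous_on 0 T (\<lambda>s. \<Psi> s (e k))"
    and le: "\<And>s k. s \<in> {0..T} \<Longrightarrow> norm (\<Psi> s (e k)) \<le> K * norm (L (e k))"
    and L: "(\<Sum>k. ennreal ((norm (L (e k)))\<^sup>2)) < \<infinity>"
  shows "admissible \<Psi>"
proof -
  let ?c = "\<Sum>k. ennreal ((norm (L (e k)))\<^sup>2)"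
  have "(\<integral>\<^sup>+s. (\<Sum>k. ennreal ((norm (\<Psi> s (e k)))\<^sup>2)) \<partial>time) \<le> (\<integral>\<^sup>+s. ennreal (K\<^sup>2) * ?c \<partial>time)"
  proof (rule nn_integral_mono)
    fix s assume "s \<in> space time"
    then have s: "s \<in> {0..T}" by simp
    have "(\<Sum>k. ennreal ((norm (\<Psi> s (e k)))\<^sup>2)) \<le> (\<Sum>k. ennreal (K\<^sup>2) * ennreal ((norm (L (e k)))\<^sup>2))"
    proof (rule suminf_le)
      fix k
      have "(norm (\<Psi> s (e k)))\<^sup>2 \<le> (K * norm (L (e k)))\<^sup>2" using le[OF s] by (rule power_mono) simp
      then have "ennreal ((norm (\<Psi> s (e k)))\<^sup>2) \<le> ennreal ((K * norm (L (e k)))\<^sup>2)" by (rule ennreal_leI)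
      also have "\<dots> = ennreal (K\<^sup>2) * ennreal ((norm (L (e k)))\<^sup>2)"
        unfolding power_mult_distrib by (rule ennreal_mult) simp_all
      finally show "ennreal ((norm (\<Psi> s (e k)))\<^sup>2) \<le> ennreal (K\<^sup>2) * ennreal ((norm (L (e k)))\<^sup>2)" .
    qed (rule summableI)+
    then show "(\<Sum>k. ennreal ((norm (\<Psi> s (e k)))\<^sup>2)) \<le> ennreal (K\<^sup>2) * ?c"
      unfolding ennreal_suminf_cmult .
  qed
  also have "\<dots> < \<infinity>"
  proof -
    have mult: "x * y < \<infinity>" if "x < \<infinity>" "y < \<infinity>" for x y :: ennreal
      using that by (simp add: ennreal_mult_less_top)
    have fin: "emeasure time (space time) < \<infinity>"
      using time.emeasure_finite[of "space time"] unfolding infinity_ennreal_def less_top .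
    show ?thesis unfolding nn_integral_const by (intro mult L fin) simp
  qed
  finally show ?thesis using assms(1) by (simp add: admissible_def)
qed

text \<open>The hypothesis runs forward in time and the integrand backward; reflecting Lebesgue
  measure on [0, T] matches the two. Measurability of the series, required for the reflection, comes
  from left continuity.\<close>

lemma semigroup_admissible:
  assumes S: "C0_semigroup_on UNIV S" and hs: "AE t in time. hilbert_schmidt e (S t \<circ> R)"
    and int: "integrable time (\<lambda>t. (hs_norm e (S t \<circ> R))\<^sup>2)"
  shows "admissible (\<lambda>s x. S (T - s) (R x))"
proof -
  have lc: "left_continuous_on 0 T (\<lambda>s. S (T - s) (R (e k)))" for k
    by (rule semigroup_left_continuous[OF S]) auto
  let ?f = "\<lambda>s. \<Sum>k. ennreal ((norm (S (T - s) (R (e k))))\<^sup>2)"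
  let ?g = "\<lambda>t. \<Sum>k. ennreal ((norm (S t (R (e k))))\<^sup>2)"
  note [measurable] = left_continuous_on_measurable[OF lc]
  have "?f \<in> borel_measurable time" by measurable
  then have fm: "(\<lambda>s. ?f s * indicator {0..T} s) \<in> borel_measurable borel"
    by (subst (asm) borel_measurable_restrict_space_iff_ennreal) auto
  have "(\<integral>\<^sup>+s. ?f s \<partial>time) = (\<integral>\<^sup>+s. ?f s * indicator {0..T} s \<partial>lborel)"
    by (rule nn_integral_restrict_space) simp
  also have "\<dots> = (\<integral>\<^sup>+t. ?f (T + (-1) * t) * indicator {0..T} (T + (-1) * t) \<partial>lborel)"
  proof -
    have "(\<integral>\<^sup>+s. ?f s * indicator {0..T} s \<partial>lborel)
        = ennreal \<bar>-1\<bar> * (\<integral>\<^sup>+t. ?f (T + (-1) * t) * indicator {0..T} (T + (-1) * t) \<partial>lborel)"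
      by (rule nn_integral_real_affine[OF fm]) simp
    then show ?thesis unfolding abs_minus_cancel abs_one ennreal_1 mult_1_left .
  qed
  also have "\<dots> = (\<integral>\<^sup>+t. ?g t * indicator {0..T} t \<partial>lborel)"
  proof (rule nn_integral_cong)
    fix t :: real
    have "T - (T + (-1) * t) = t" "(indicator {0..T} (T + (-1) * t) :: ennreal) = indicator {0..T} t"
      by (auto simp: indicator_def)
    then show "?f (T + (-1) * t) * indicator {0..T} (T + (-1) * t) = ?g t * indicator {0..T} t"
      by (simp only:)
  qed
  also have "\<dots> = (\<integral>\<^sup>+t. ?g t \<partial>time)"
    by (rule nn_integral_restrict_space[symmetric]) simp
  also have "\<dots> = (\<integral>\<^sup>+t. ennreal (norm ((hs_norm e (S t \<circ> R))\<^sup>2)) \<partial>time)"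
  proof (rule nn_integral_cong_AE)
    show "AE t in time. ?g t = ennreal (norm ((hs_norm e (S t \<circ> R))\<^sup>2))"
      using hs
    proof eventually_elim
      case (elim t)
      then have sum: "summable (\<lambda>k. (norm (S t (R (e k))))\<^sup>2)" by (simp add: hilbert_schmidt_def)
      have "?g t = ennreal (\<Sum>k. (norm (S t (R (e k))))\<^sup>2)"
        by (rule suminf_ennreal2[OF _ sum]) simp
      also have "(\<Sum>k. (norm (S t (R (e k))))\<^sup>2) = norm ((hs_norm e (S t \<circ> R))\<^sup>2)"
        using suminf_nonneg[OF sum] by (simp add: hs_norm_def)
      finally show ?case .
    qed
  qed
  also have "\<dots> < \<infinity>" using int by (simp add: integrable_iff_bounded)
  finally show ?thesis using lc by (simp add: admissible_def)
qed

end

section \<open>The discretizations as stochastic integrals\<close>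

context impulsive_noise
begin

text \<open>\<open>\<Psi>\<close> drives the value function and \<open>\<Theta>\<close> the process
  measured against it. The first expansion takes the space and the space-time integrand in these
  roles, the second the exact and the space integrand.\<close>

lemma error_expansion_integrals:
  assumes "C2_b \<phi>" and complete: "complete_measure M" and \<Psi>: "admissible \<Psi>" and \<Theta>: "admissible \<Theta>"
    and Y: "cadlag_version M T (\<lambda>t \<omega>. x + stoch_integral M Z e 0 t \<Theta> \<omega>) Y"
  defines "v \<equiv> value_fun M Z e T \<phi> \<Psi>"
    and "F \<equiv> jump_kernel \<mu> rep e \<Psi>" and "G \<equiv> jump_kernel \<mu> rep e \<Theta>"
  defines "I \<equiv> (\<lambda>\<omega> (t, \<xi>, \<sigma>). v (T - t) (left_limit Y t \<omega> + G (t, \<xi>, \<sigma>)) - v (T - t) (left_limit Y t \<omega> + F (t, \<xi>, \<sigma>))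
      + inner (grad (v (T - t)) (left_limit Y t \<omega>)) (F (t, \<xi>, \<sigma>) - G (t, \<xi>, \<sigma>)))"
  shows "AE \<omega> in M. integrable \<mu> (I \<omega>)" "integrable M (\<lambda>\<omega>. LINT z|\<mu>. I \<omega> z)"
    "(LINT \<omega>|M. \<phi> (x + stoch_integral M Z e 0 T \<Theta> \<omega>)) = v T x + (LINT \<omega>|M. LINT z|\<mu>. I \<omega> z)"
proof -
  obtain B K C where phi: "C11_function \<phi> (grad \<phi>) B K C"
    using C2_b_C11_function[OF \<open>C2_b \<phi>\<close>] .
  interpret complete_measure M by (rule complete)
  interpret C11_function \<phi> "grad \<phi>" B K C by (rule phi)
  interpret error: error_setting M \<mu> \<pi> \<phi> "grad \<phi>" B K C T F G
    "\<lambda>t. stoch_integral M Z e t T \<Psi>" "\<lambda>t. stoch_integral M Z e 0 t \<Theta>" Y x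
  proof unfold_locales
    show "0 < T" by (rule T_pos)
    show "fst \<in> borel_measurable \<mu>" by (rule fst_measurable)
    show "0 \<le> fst z \<and> fst z \<le> T" if "z \<in> space \<mu>" for z using that by (auto simp: space_mu)
    show "AE z in \<mu>. fst z \<noteq> t" for t by (rule no_atoms_mu)
    show "sq_integrable \<mu> F" "sq_integrable \<mu> G"
      unfolding F_def G_def by (intro jump_kernel_sq_integrable \<Psi> \<Theta>)+
    show "comp_lim (\<lambda>z. indicator {t<..T} (fst z) *\<^sub>R F z) (stoch_integral M Z e t T \<Psi>)" if "0 \<le> t" "t \<le> T" for t
      unfolding F_def by (rule stoch_integral_comp_lim[OF \<Psi> that order_refl])
    show "comp_lim (\<lambda>z. indicator {0<..t} (fst z) *\<^sub>R G z) (stoch_integral M Z e 0 t \<Theta>)" if "0 \<le> t" "t \<le> T" for t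
      unfolding G_def by (rule stoch_integral_comp_lim[OF \<Theta> order_refl that])
    show "AE \<omega> in M. Y t \<omega> = x + stoch_integral M Z e 0 t \<Theta> \<omega>" if "0 \<le> t" "t \<le> T" for t
      using Y that by (simp add: cadlag_version_def)
    show "AE \<omega> in M. \<forall>t\<in>{0<..T}. \<exists>l. ((\<lambda>s. Y s \<omega>) \<longlongrightarrow> l) (at_left t)"
      using Y by (auto simp: cadlag_version_def)
  qed
  have v: "v (T - t) = error.v t" for t
    by (simp add: v_def value_fun_def error.v_def fun_eq_iff)
  have I: "I = error.integrand"
    by (auto simp: I_def error.integrand_def v fun_eq_iff)
  show "AE \<omega> in M. integrable \<mu> (I \<omega>)" "integrable M (\<lambda>\<omega>. LINT z|\<mu>. I \<omega> z)"
    unfolding I by (rule error.error_expansion)+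
  show "(LINT \<omega>|M. \<phi> (x + stoch_integral M Z e 0 T \<Theta> \<omega>)) = v T x + (LINT \<omega>|M. LINT z|\<mu>. I \<omega> z)"
    using error.error_expansion(3) v[of 0] unfolding I by simp
qed

text \<open>\<open>X\<close> is prescribed only almost surely; completeness makes it measurable, so
  that the two expectations may be compared.\<close>

lemma expectation_cong_complete:
  assumes "C2_b \<phi>" "complete_measure M" and \<Psi>: "admissible \<Psi>"
    and ae: "AE \<omega> in M. X \<omega> = x + stoch_integral M Z e 0 T \<Psi> \<omega>"
  shows "(LINT \<omega>|M. \<phi> (X \<omega>)) = (LINT \<omega>|M. \<phi> (x + stoch_integral M Z e 0 T \<Psi> \<omega>))"
proof (rule integral_cong_AE)
  have "isCont \<phi> y" for y
    using \<open>C2_b \<phi>\<close> by (auto simp: C2_b_def gderiv_def intro: has_derivative_continuous)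
  then have phi: "\<phi> \<in> borel_measurable borel"
    by (intro borel_measurable_continuous_onI) (simp add: continuous_at_imp_continuous_on)
  have "stoch_integral M Z e 0 T \<Psi> \<in> borel_measurable M"
    using comp_lim_sq_integrable(2)[OF stoch_integral_comp_lim[OF \<Psi> order_refl less_imp_le[OF T_pos] order_refl]] by auto
  then have m: "(\<lambda>\<omega>. x + stoch_integral M Z e 0 T \<Psi> \<omega>) \<in> borel_measurable M" by simp
  show "(\<lambda>\<omega>. \<phi> (x + stoch_integral M Z e 0 T \<Psi> \<omega>)) \<in> borel_measurable M"
    by (rule measurable_compose[OF m phi])
  have "X \<in> borel_measurable M"
    by (rule measurable_AE_eq_complete[OF \<open>complete_measure M\<close> m ae]) simp
  then show "(\<lambda>\<omega>. \<phi> (X \<omega>)) \<in> borel_measurable M" by (rule measurable_compose[OF _ phi])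
  show "AE \<omega> in M. \<phi> (X \<omega>) = \<phi> (x + stoch_integral M Z e 0 T \<Psi> \<omega>)"
    using ae by eventually_elim simp
qed

text \<open>The operators of the scheme are linear only within \<open>V\<close>, so the noise
  increments must be seen to lie there. Each partial sum does, and the projection, being bounded,
  fixes the limit almost surely.\<close>

lemma projection_increment:
  assumes V: "orthonormal_span V C" and L: "admissible (\<lambda>_. L)" and LV: "\<And>j. L (e j) \<in> V"
    and X: "comp_lim (\<lambda>z. indicator A (fst z) *\<^sub>R jump_kernel \<mu> rep e (\<lambda>_. L) z) X"
  shows "AE \<omega> in M. orthonormal_span.proj C (X \<omega>) = X \<omega>"
proof -
  interpret orthonormal_span V C by (rule V)
  have "linear_within V (\<lambda>x. x)" by (simp add: linear_within_def)
  from bounded_linear_within_proj[OF this] have bl: "bounded_linear proj" .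
  have "AE z in \<mu>. jump_kernel \<mu> rep e (\<lambda>_. L) z
      = (\<Sum>k<1::nat. indicator UNIV (fst z) *\<^sub>R proj (jump_kernel \<mu> rep e (\<lambda>_. L) z))"
    by (rule jump_kernel_step[where N=1 and L=L and \<Gamma>="\<lambda>_. L" and Lk="\<lambda>_. proj" and A="\<lambda>_. UNIV", OF L bl L])
      (simp_all add: proj_id LV)
  then have ae: "AE z in \<mu>. proj (indicator A (fst z) *\<^sub>R jump_kernel \<mu> rep e (\<lambda>_. L) z)
      = indicator A (fst z) *\<^sub>R jump_kernel \<mu> rep e (\<lambda>_. L) z"
    by eventually_elim (simp add: linear_scale[OF bounded_linear.linear[OF bl]])
  show ?thesis by (rule comp_lim_unique[OF comp_lim_bounded_linear[OF bl X] X ae])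
qed

lemma step_admissible:
  assumes V: "orthonormal_span V C" and R: "\<And>x y. R x \<bullet> y = x \<bullet> R y"
    and B: "\<And>k. k < N \<Longrightarrow> linear_within V (B k)"
  shows "admissible (\<lambda>s x. \<Sum>k<N. indicator {c k<..d k} s *\<^sub>R B k (orth_proj V (R x)))" (is "admissible ?\<Gamma>")
proof -
  interpret orthonormal_span V C by (rule V)
  have bl: "bounded_linear (\<lambda>x. B k (proj x))" if "k < N" for k
    by (rule bounded_linear_within_proj[OF B[OF that]])
  show ?thesis
  proof (rule admissible_bounded)
    show "left_continuous_on 0 T (\<lambda>s. ?\<Gamma> s (e j))" for j
      using left_continuous_on_indicator unfolding left_continuous_on_def
      by (intro ballI tendsto_sum tendsto_scaleR tendsto_const) blast
    show "norm (?\<Gamma> s (e j)) \<le> (\<Sum>k<N. onorm (\<lambda>x. B k (proj x))) * norm (orth_proj V (R (e j)))" for s j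
    proof -
      have "norm (?\<Gamma> s (e j)) \<le> (\<Sum>k<N. norm (indicator {c k<..d k} s *\<^sub>R B k (orth_proj V (R (e j)))))"
        by (rule norm_sum)
      also have "\<dots> \<le> (\<Sum>k<N. onorm (\<lambda>x. B k (proj x)) * norm (orth_proj V (R (e j))))"
      proof (rule sum_mono)
        fix k assume "k \<in> {..<N}"
        then have "norm (B k (proj (proj (R (e j))))) \<le> onorm (\<lambda>x. B k (proj x)) * norm (proj (R (e j)))"
          using onorm[OF bl] by simp
        moreover have "norm (indicator {c k<..d k} s *\<^sub>R B k (proj (R (e j)))) \<le> norm (B k (proj (R (e j))))"
          by (simp split: split_indicator)
        ultimately show "norm (indicator {c k<..d k} s *\<^sub>R B k (orth_proj V (R (e j))))
            \<le> onorm (\<lambda>x. B k (proj x)) * norm (orth_proj V (R (e j)))"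
          by (simp add: orth_proj_eq proj_id[OF proj_in])
      qed
      finally show ?thesis by (simp add: sum_distrib_right)
    qed
    show "(\<Sum>k. ennreal ((norm (orth_proj V (R (e k))))\<^sup>2)) < \<infinity>" by (rule proj_summable[OF V R])
  qed
qed

lemma const_admissible:
  assumes "orthonormal_span V C" and R: "\<And>x y. R x \<bullet> y = x \<bullet> R y"
  shows "admissible (\<lambda>_ x. orth_proj V (R x))"
  by (rule admissible_bounded[where K=1, OF _ _ proj_summable[OF assms(1) R]])
    (simp_all add: left_continuous_on_def)

lemma projected_semigroup_admissible:
  assumes V: "orthonormal_span V C" and R: "\<And>x y. R x \<bullet> y = x \<bullet> R y" and S: "C0_semigroup_on V S"
  shows "admissible (\<lambda>s x. S (T - s) (orth_proj V (R x)))"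
proof -
  interpret orthonormal_span V C by (rule V)
  obtain K where K: "\<And>t x. t \<in> {0..T} \<Longrightarrow> x \<in> V \<Longrightarrow> norm (S t x) \<le> K * norm x"
    using semigroup_bounded[OF S, of T] by blast
  show ?thesis
  proof (rule admissible_bounded)
    show "left_continuous_on 0 T (\<lambda>s. S (T - s) (orth_proj V (R (e k))))" for k
      unfolding orth_proj_eq by (rule semigroup_left_continuous[OF S subspace_V proj_in])
    show "norm (S (T - s) (orth_proj V (R (e k)))) \<le> K * norm (orth_proj V (R (e k)))" if "s \<in> {0..T}" for s k
      unfolding orth_proj_eq by (rule K) (use that proj_in in auto)
    show "(\<Sum>k. ennreal ((norm (orth_proj V (R (e k))))\<^sup>2)) < \<infinity>" by (rule proj_summable[OF V R])
  qed
qed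

text \<open>The scheme applies its operators to increments that are already limits, whereas
  \<open>\<Gamma>\<close> applies them under the integral. Both sides have the same jump field
  almost everywhere, and uniqueness of compensated integrals identifies them.\<close>

lemma full_discretization_eq:
  fixes N :: nat and R Sd Td :: "'h \<Rightarrow> 'h"
  assumes V: "orthonormal_span V C" and R: "\<And>x y. R x \<bullet> y = x \<bullet> R y"
    and Sd: "linear_within V Sd" and Td: "linear_within V Td" and N: "1 \<le> N"
  defines "\<tau> \<equiv> T / real N"
  defines "\<Gamma> \<equiv> (\<lambda>s x. \<Sum>k<N. indicator {real k * \<tau><..real (k + 1) * \<tau>} s *\<^sub>R (Sd ^^ (N - k - 1)) (Td (orth_proj V (R x))))"
  shows "admissible \<Gamma>"
    and "AE \<omega> in M. full_discretization M Z e \<tau> Sd Td (orth_proj V) R x0 N \<omega>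
      = (Sd ^^ N) (orth_proj V x0) + stoch_integral M Z e 0 T \<Gamma> \<omega>"
proof -
  interpret orthonormal_span V C by (rule V)
  let ?L = "\<lambda>x. orth_proj V (R x)"
  let ?A = "\<lambda>k. {real k * \<tau><..real (k + 1) * \<tau>}"
  define B where "B k x = (Sd ^^ (N - k - 1)) (Td x)" for k x
  have B: "linear_within V (B k)" for k
    unfolding B_def[abs_def] by (rule linear_within_comp[OF linear_within_power[OF Sd] Td])
  have bl: "bounded_linear (\<lambda>x. B k (proj x))" for k by (rule bounded_linear_within_proj[OF B])
  have \<Gamma>: "\<Gamma> = (\<lambda>s x. \<Sum>k<N. indicator (?A k) s *\<^sub>R B k (orth_proj V (R x)))"
    by (simp add: \<Gamma>_def B_def)
  show adm: "admissible \<Gamma>" unfolding \<Gamma> by (rule step_admissible[OF V R B])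
  have L: "admissible (\<lambda>_. ?L)" by (rule const_admissible[OF V R])
  have \<tau>: "0 \<le> \<tau>" using T_pos by (simp add: \<tau>_def)
  define X where "X k = L2_lim M (\<lambda>m \<omega>. \<Sum>j<m. (Z j (real (k + 1) * \<tau>) \<omega> - Z j (real k * \<tau>) \<omega>) *\<^sub>R ?L (e j))" for k
  let ?J = "jump_kernel \<mu> rep e (\<lambda>_. ?L)"
  have X: "comp_lim (\<lambda>z. indicator (?A k) (fst z) *\<^sub>R ?J z) (X k)" for k
    unfolding X_def by (rule increment_comp_lim[OF L]) (use \<tau> in \<open>auto intro: mult_right_mono\<close>)
  have PX: "AE \<omega> in M. proj (X k \<omega>) = X k \<omega>" for k
    by (rule projection_increment[OF V L _ X]) (simp add: orth_proj_eq proj_in)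
  have sum: "comp_lim (\<lambda>z. \<Sum>k<N. B k (proj (indicator (?A k) (fst z) *\<^sub>R ?J z))) (\<lambda>\<omega>. \<Sum>k<N. B k (proj (X k \<omega>)))"
    by (rule comp_lim_sum, rule comp_lim_bounded_linear[OF bl X])
  have "AE z in \<mu>. jump_kernel \<mu> rep e \<Gamma> z = (\<Sum>k<N. indicator (?A k) (fst z) *\<^sub>R B k (proj (?J z)))"
    by (rule jump_kernel_step[where L="?L" and Lk="\<lambda>k x. B k (proj x)" and A="?A", OF L bl adm])
      (simp_all add: \<Gamma> orth_proj_eq proj_id[OF proj_in])
  \<comment> \<open>Almost every time lies in \<open>(0, T]\<close>, where the cut-off of the
    stochastic integral equals 1.\<close>
  with no_atoms_mu[of 0] AE_space
  have ae: "AE z in \<mu>. (\<Sum>k<N. B k (proj (indicator (?A k) (fst z) *\<^sub>R ?J z)))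
      = indicator {0<..T} (fst z) *\<^sub>R jump_kernel \<mu> rep e \<Gamma> z"
  proof eventually_elim
    case (elim z)
    then have "fst z \<in> {0<..T}" by (auto simp: space_mu)
    moreover have "B k (proj (indicator (?A k) (fst z) *\<^sub>R ?J z)) = indicator (?A k) (fst z) *\<^sub>R B k (proj (?J z))" for k
      by (rule linear_scale[OF bounded_linear.linear[OF bl]])
    ultimately show ?case using elim by simp
  qed
  have eq: "AE \<omega> in M. (\<Sum>k<N. B k (proj (X k \<omega>))) = stoch_integral M Z e 0 T \<Gamma> \<omega>"
    by (rule comp_lim_unique[OF sum stoch_integral_comp_lim[OF adm order_refl less_imp_le[OF T_pos] order_refl] ae])
  have "AE \<omega> in M. \<forall>k. proj (X k \<omega>) = X k \<omega>" using PX by (simp add: AE_all_countable)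
  with eq show "AE \<omega> in M. full_discretization M Z e \<tau> Sd Td (orth_proj V) R x0 N \<omega>
      = (Sd ^^ N) (orth_proj V x0) + stoch_integral M Z e 0 T \<Gamma> \<omega>"
  proof eventually_elim
    case (elim \<omega>)
    then have "(\<Sum>k<N. B k (X k \<omega>)) = stoch_integral M Z e 0 T \<Gamma> \<omega>" by simp
    then show ?case unfolding full_discretization_def B_def X_def by simp
  qed
qed

end

section \<open>The two error expansions\<close>

theorem theorem5:
  fixes \<O> :: "'d::euclidean_space set" and T \<theta> h :: real and N :: nat
    and rep :: "'h::{real_inner,banach,second_countable_topology} \<Rightarrow> 'd \<Rightarrow> real"
    and e :: "nat \<Rightarrow> 'h"
    and Q Q12 A A12 :: "'h \<Rightarrow> 'h" and DA DA12 :: "'h set"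
    and S :: "real \<Rightarrow> 'h \<Rightarrow> 'h"
    and \<nu> :: "real measure" and M :: "'w measure" and F :: "real \<Rightarrow> 'w measure"
    and \<pi> :: "'w \<Rightarrow> (real \<times> 'd \<times> real) measure"
    and V :: "real \<Rightarrow> 'h set" and Sh :: "real \<Rightarrow> real \<Rightarrow> 'h \<Rightarrow> 'h"
    and \<phi> :: "'h \<Rightarrow> real" and x0 :: 'h
    and X Y Ybar :: "real \<Rightarrow> 'w \<Rightarrow> 'h"
  \<comment> \<open>spaces and operators\<close>
  assumes "open \<O>" and "bounded \<O>" and "is_L2 \<O> rep" and "orthonormal_basis e"
    and "nonneg_symmetric Q" and "nonneg_symmetric Q12" and "Q12 \<circ> Q12 = Q"
    and "self_adjoint DA A" and "strictly_positive DA A" and "compactly_embedded_domain DA A"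
    and "is_sqrt_operator DA A DA12 A12"
    and "generates_on UNIV DA (\<lambda>x. - A x) S"
  \<comment> \<open>noise\<close>
    and "levy_measure \<nu>" and "sigma_finite_measure \<nu>" and "usual_filtration M T F"
  defines "\<mu> \<equiv> intensity T \<O> \<nu>"
  assumes "poisson_random_measure M \<mu> \<pi>" and "sum_of_point_masses M \<mu> \<pi>"
    and "adapted_independent_increments M T F (restrict_space lborel \<O> \<Otimes>\<^sub>M \<nu>) \<pi>"
  defines "Z \<equiv> coord_process M \<mu> \<pi> rep e"
  \<comment> \<open>discretization\<close>
  assumes "\<And>h. 0 < h \<Longrightarrow> finite_dim_subspace (V h) \<and> V h \<subseteq> DA12"
    and "\<And>h. 0 < h \<Longrightarrow> generates_on (V h) (V h) (\<lambda>u. - discrete_op A12 (V h) u) (Sh h)"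
    and "1/2 < \<theta>" and "\<theta> \<le> 1" and "0 < h" and "1 \<le> N"
  defines "P \<equiv> orth_proj (V h)" and "\<Delta>t \<equiv> T / real N"
  defines "Sd \<equiv> theta_S (discrete_op A12 (V h)) (V h) \<theta> \<Delta>t"
    and "Td \<equiv> theta_T (discrete_op A12 (V h)) (V h) \<theta> \<Delta>t"
  defines "XhN \<equiv> full_discretization M Z e \<Delta>t Sd Td P Q12 x0"
    and "Xh \<equiv> space_discretization M Z e (Sh h) P Q12 x0"
  \<comment> \<open>hypotheses of the theorem\<close>
  assumes "integrable \<nu> (\<lambda>\<sigma>. \<sigma>\<^sup>2)"
    and "AE t in restrict_space lborel {0..T}. hilbert_schmidt e (S t \<circ> Q12)"
    and "integrable (restrict_space lborel {0..T}) (\<lambda>t. (hs_norm e (S t \<circ> Q12))\<^sup>2)"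
    and "C2_b \<phi>" and "\<And>x. hilbert_schmidt e (hess \<phi> x)"
    and "\<And>B \<epsilon>. bounded B \<Longrightarrow> 0 < \<epsilon> \<Longrightarrow>
           \<exists>\<delta>>0. \<forall>x\<in>B. \<forall>y\<in>B. dist x y < \<delta> \<longrightarrow> hs_norm e (\<lambda>u. hess \<phi> x u - hess \<phi> y u) < \<epsilon>"
    and "1 \<le> T"
    and "mild_solution M Z e T S Q12 x0 X"
  \<comment> \<open>auxiliary objects\<close>
  defines "\<Psi> \<equiv> (\<lambda>s x. S (T - s) (Q12 x))"
    and "\<Phi> \<equiv> (\<lambda>s x. Sh h (T - s) (P (Q12 x)))"
    and "\<Gamma> \<equiv> (\<lambda>s x. \<Sum>k<N. indicator {real k * \<Delta>t<..real (k + 1) * \<Delta>t} s *\<^sub>R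
                        (Sd ^^ (N - k - 1)) (Td (P (Q12 x))))"
  assumes "cadlag_version M T
             (\<lambda>t \<omega>. Sh h T (P x0) + stoch_integral M Z e 0 t \<Phi> \<omega>) Y"
    and "cadlag_version M T
             (\<lambda>t \<omega>. (Sd ^^ N) (P x0) + stoch_integral M Z e 0 t \<Gamma> \<omega>) Ybar"
  defines "E \<equiv> jump_kernel \<mu> rep e \<Psi>" and "F' \<equiv> jump_kernel \<mu> rep e \<Phi>"
    and "G \<equiv> jump_kernel \<mu> rep e \<Gamma>"
    and "v \<equiv> value_fun M Z e T \<phi> \<Psi>" and "vh \<equiv> value_fun M Z e T \<phi> \<Phi>"
  defines "I1 \<equiv> (\<lambda>\<omega> (t, \<xi>, \<sigma>).
        vh (T - t) (left_limit Ybar t \<omega> + G (t, \<xi>, \<sigma>))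
      - vh (T - t) (left_limit Ybar t \<omega> + F' (t, \<xi>, \<sigma>))
      + inner (grad (vh (T - t)) (left_limit Ybar t \<omega>)) (F' (t, \<xi>, \<sigma>) - G (t, \<xi>, \<sigma>)))"
    and "I2 \<equiv> (\<lambda>\<omega> (t, \<xi>, \<sigma>).
        v (T - t) (left_limit Y t \<omega> + F' (t, \<xi>, \<sigma>))
      - v (T - t) (left_limit Y t \<omega> + E (t, \<xi>, \<sigma>))
      + inner (grad (v (T - t)) (left_limit Y t \<omega>)) (E (t, \<xi>, \<sigma>) - F' (t, \<xi>, \<sigma>)))"
  shows "((AE \<omega> in M. integrable \<mu> (I1 \<omega>)) \<and> integrable M (\<lambda>\<omega>. LINT z|\<mu>. I1 \<omega> z) \<and>
          (LINT \<omega>|M. \<phi> (XhN N \<omega>)) - (LINT \<omega>|M. \<phi> (Xh T \<omega>))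
            = (vh T ((Sd ^^ N) (P x0)) - vh T (Sh h T (P x0)))
              + (LINT \<omega>|M. LINT z|\<mu>. I1 \<omega> z)) \<and>
         ((AE \<omega> in M. integrable \<mu> (I2 \<omega>)) \<and> integrable M (\<lambda>\<omega>. LINT z|\<mu>. I2 \<omega> z) \<and>
          (LINT \<omega>|M. \<phi> (Xh T \<omega>)) - (LINT \<omega>|M. \<phi> (X T \<omega>))
            = (v T (Sh h T (P x0)) - v T (S T x0))
              + (LINT \<omega>|M. LINT z|\<mu>. I2 \<omega> z))"
proof -
  have prob: "prob_space M" and complete: "complete_measure M"
    using \<open>usual_filtration M T F\<close> by (simp_all add: usual_filtration_def)
  have T: "0 < T" using \<open>1 \<le> T\<close> by simp
  interpret noise: impulsive_noise M T \<O> \<nu> \<pi> rep e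
  proof (intro impulsive_noise.intro poisson_measure.intro poisson_measure_axioms.intro impulsive_noise_axioms.intro)
    show "poisson_random_measure M (intensity T \<O> \<nu>) \<pi>"
      using \<open>poisson_random_measure M \<mu> \<pi>\<close> unfolding \<mu>_def .
    show "sets \<nu> = sets borel" using \<open>levy_measure \<nu>\<close> by (simp add: levy_measure_def)
  qed fact+
  have fin: "finite_dim_subspace (V h)" and sub: "V h \<subseteq> DA12"
    using assms(21)[OF \<open>0 < h\<close>] by auto
  obtain C where V: "orthonormal_span (V h) C"
    using finite_dim_orthonormal_span[OF fin] by blast
  have R: "Q12 x \<bullet> y = x \<bullet> Q12 y" for x y
    using \<open>nonneg_symmetric Q12\<close> by (simp add: nonneg_symmetric_def)
  have Sh: "C0_semigroup_on (V h) (Sh h)"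
    using assms(22)[OF \<open>0 < h\<close>] by (simp add: generates_on_def)
  have S: "C0_semigroup_on UNIV S"
    using \<open>generates_on UNIV DA (\<lambda>x. - A x) S\<close> by (simp add: generates_on_def)
  have sa: "self_adjoint DA12 A12"
    using \<open>is_sqrt_operator DA A DA12 A12\<close> by (simp add: is_sqrt_operator_def)
  have lin: "\<forall>x\<in>DA12. \<forall>y\<in>DA12. A12 (x + y) = A12 x + A12 y" "\<forall>c. \<forall>x\<in>DA12. A12 (c *\<^sub>R x) = c *\<^sub>R A12 x"
    using sa by (simp_all add: self_adjoint_def)
  have add: "A12 (x + y) = A12 x + A12 y" if "x \<in> V h" "y \<in> V h" for x y
    using lin(1) subsetD[OF sub] that by blast
  have scale: "A12 (c *\<^sub>R x) = c *\<^sub>R A12 x" if "x \<in> V h" for x c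
    using lin(2) subsetD[OF sub] that by blast
  have \<theta>: "0 \<le> \<theta> * \<Delta>t" using \<open>1/2 < \<theta>\<close> T by (simp add: \<Delta>t_def)
  have Td: "linear_within (V h) Td" and Sd: "linear_within (V h) Sd"
    unfolding Td_def Sd_def by (rule orthonormal_span.theta_scheme[OF V]; fact add scale \<theta>)+
  have \<Psi>: "noise.admissible \<Psi>"
    unfolding \<Psi>_def by (rule noise.semigroup_admissible[OF S]) fact+
  have \<Phi>: "noise.admissible \<Phi>"
    unfolding \<Phi>_def P_def by (rule noise.projected_semigroup_admissible[OF V R Sh])
  have \<Gamma>: "noise.admissible \<Gamma>"
    unfolding \<Gamma>_def P_def \<Delta>t_def by (rule noise.full_discretization_eq(1)[OF V R Sd Td \<open>1 \<le> N\<close>])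
  have XhN: "AE \<omega> in M. XhN N \<omega> = (Sd ^^ N) (P x0) + stoch_integral M Z e 0 T \<Gamma> \<omega>"
    unfolding XhN_def \<Gamma>_def P_def \<Delta>t_def Z_def \<mu>_def
    by (rule noise.full_discretization_eq(2)[OF V R Sd Td \<open>1 \<le> N\<close>])
  have X: "AE \<omega> in M. X T \<omega> = S T x0 + stoch_integral M Z e 0 T \<Psi> \<omega>"
    using \<open>mild_solution M Z e T S Q12 x0 X\<close> T by (simp add: mild_solution_def \<Psi>_def)
  note expansion = noise.error_expansion_integrals[OF \<open>C2_b \<phi>\<close> complete, folded \<mu>_def, folded Z_def]
  note cong = noise.expectation_cong_complete[OF \<open>C2_b \<phi>\<close> complete, folded \<mu>_def, folded Z_def]
  have I1: "AE \<omega> in M. integrable \<mu> (I1 \<omega>)" "integrable M (\<lambda>\<omega>. LINT z|\<mu>. I1 \<omega> z)"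
    "(LINT \<omega>|M. \<phi> ((Sd ^^ N) (P x0) + stoch_integral M Z e 0 T \<Gamma> \<omega>))
      = vh T ((Sd ^^ N) (P x0)) + (LINT \<omega>|M. LINT z|\<mu>. I1 \<omega> z)"
    unfolding I1_def vh_def F'_def G_def
    by (rule expansion[OF \<Phi> \<Gamma> \<open>cadlag_version M T (\<lambda>t \<omega>. (Sd ^^ N) (P x0) + stoch_integral M Z e 0 t \<Gamma> \<omega>) Ybar\<close>])+
  have I2: "AE \<omega> in M. integrable \<mu> (I2 \<omega>)" "integrable M (\<lambda>\<omega>. LINT z|\<mu>. I2 \<omega> z)"
    "(LINT \<omega>|M. \<phi> (Sh h T (P x0) + stoch_integral M Z e 0 T \<Phi> \<omega>))
      = v T (Sh h T (P x0)) + (LINT \<omega>|M. LINT z|\<mu>. I2 \<omega> z)"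
    unfolding I2_def v_def F'_def E_def
    by (rule expansion[OF \<Psi> \<Phi> \<open>cadlag_version M T (\<lambda>t \<omega>. Sh h T (P x0) + stoch_integral M Z e 0 t \<Phi> \<omega>) Y\<close>])+
  have v: "(LINT \<omega>|M. \<phi> (X T \<omega>)) = v T (S T x0)"
    unfolding cong[OF \<Psi> X] by (simp add: v_def value_fun_def)
  have Xh: "(LINT \<omega>|M. \<phi> (Xh T \<omega>)) = (LINT \<omega>|M. \<phi> (Sh h T (P x0) + stoch_integral M Z e 0 T \<Phi> \<omega>))"
    by (simp add: Xh_def space_discretization_def \<Phi>_def)
  \<comment> \<open>The space discretization plays two roles: its expectation is the starting value
    of \<open>vh\<close> in the first expansion, and the terminal expectation in the second.\<close>
  have vh: "(LINT \<omega>|M. \<phi> (Xh T \<omega>)) = vh T (Sh h T (P x0))"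
    unfolding Xh by (simp add: vh_def value_fun_def)
  have "(LINT \<omega>|M. \<phi> (XhN N \<omega>)) - (LINT \<omega>|M. \<phi> (Xh T \<omega>))
      = (vh T ((Sd ^^ N) (P x0)) - vh T (Sh h T (P x0))) + (LINT \<omega>|M. LINT z|\<mu>. I1 \<omega> z)"
    unfolding cong[OF \<Gamma> XhN] I1(3) vh by linarith
  moreover have "(LINT \<omega>|M. \<phi> (Xh T \<omega>)) - (LINT \<omega>|M. \<phi> (X T \<omega>))
      = (v T (Sh h T (P x0)) - v T (S T x0)) + (LINT \<omega>|M. LINT z|\<mu>. I2 \<omega> z)"
    unfolding Xh I2(3) v by linarith
  ultimately show ?thesis using I1(1,2) I2(1,2) by (intro conjI)
qed

end
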